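(* Let $\alpha\in(0,1)$ and consider the incomplete matched pairs model with data $\boldsymbol X=(\boldsymbol X^{(c)},\boldsymbol X^{(i)})$, the weighted statistic $T=T(\boldsymbol X^{(c)},\boldsymbol X^{(i)})$ and its permutation version $T_p=T(\boldsymbol X^{(c)}_\tau,\boldsymbol X^{(i)}_\pi)$, all as defined in the context. Suppose that $\min(n_1,n_2,n_3)\to\infty$ in such a way that $n_2/(n_2+n_3)\to\kappa$ for some $\kappa\in(0,1)$. (1) One has $$\sup_{x\in\mathbb R}\bigl|P(T_p\le x\mid \boldsymbol X)-\Phi(x)\bigr|\longrightarrow 0\quad\text{in probability},$$ where $\Phi$ is the distribution function of $N(0,1)$. (No assumption $\mu_1=\mu_2$ is made here.) (2) Let $c_p(\alpha)$ be the $(1-\alpha)$-quantile of the conditional distribution of $T_p$ given $\boldsymbol X$, and let $$\varphi_p=\mathbf 1\{T>c_p(\alpha)\}+\gamma_p\,\mathbf 1\{T=c_p(\alpha)\}.$$ Then $\varphi_p$ is of asymptotic level $\alpha$ for testing $H_0:\mu_1=\mu_2$ against the one-sided alternative $\mu_1>\mu_2$, i.e. $E(\varphi_p)\to\alpha$ if $\mu_1=\mu_2$, and it is consistent, i.e. $E(\varphi_p)\to 1$ if $\mu_1>\mu_2$. (3) In the special case that $D_1=X^{(c)}_{11}-X^{(c)}_{21}$ is $0$-symmetric (that is, $D_1$ and $-D_1$ have the same distribution) and $X^{(i)}_{11}$ has the same distribution as $X^{(i)}_{21}$, the test is finitely exact, i.e. $E(\varphi_p)=\alpha$ for all finite sample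 sizes $n_1,n_2,n_3\ge 2$.
   Context: Model. For sample sizes $n_1,n_2,n_3\ge 2$, with $n=n_1+n_2+n_3$, one observes independent random objects: complete pairs $\boldsymbol X^{(c)}=\bigl((X^{(c)}_{11},X^{(c)}_{21})',\dots,(X^{(c)}_{1n_1},X^{(c)}_{2n_1})'\bigr)$ and incomplete observations $\boldsymbol X^{(i)}=(X^{(i)}_{11},\dots,X^{(i)}_{1n_2},X^{(i)}_{21},\dots,X^{(i)}_{2n_3})$ (the superscript $(i)$ stands for "incomplete" and is not an index). The complete pairs are i.i.d. with mean vector $(\mu_1,\mu_2)'\in\mathbb R^2$ and arbitrary positive definite covariance matrix $\boldsymbol\Sigma$. All first components $X^{(c)}_{1j},X^{(i)}_{1k}$ ($1\le j\le n_1$, $1\le k\le n_2$) are i.i.d. with mean $\mu_1$ and variance $\sigma_1^2\in(0,\infty)$. All second components $X^{(c)}_{2j},X^{(i)}_{2\ell}$ ($1\le j\le n_1$, $1\le\ell\le n_3$) are i.i.d. with mean $\mu_2$ and variance $\sigma_2^2\in(0,\infty)$. The complete pairs and all the incomplete observations are mutually independent. The underlying distributions do not depend on the sample sizes. Statistics. Let $D_j=X^{(c)}_{1j}-X^{(c)}_{2j}$, $\overline D_\cdot=n_1^{-1}\sum_{j=1}^{n_1}D_j$, $\widehat\sigma^2=(n_1-1)^{-1}\sum_{j=1}^{n_1}(D_j-\overline D_\cdot)^2$, and $$T_1(\boldsymbol X^{(c)})=\frac{\overline D_\cdot}{\sqrt{\widehat\sigma^2/n_1}}.$$ Let $\overline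 X^{(i)}_{1\cdot}=n_2^{-1}\sum_{k=1}^{n_2}X^{(i)}_{1k}$, $\overline X^{(i)}_{2\cdot}=n_3^{-1}\sum_{\ell=1}^{n_3}X^{(i)}_{2\ell}$, $\widehat\sigma_1^2=(n_2-1)^{-1}\sum_{k=1}^{n_2}(X^{(i)}_{1k}-\overline X^{(i)}_{1\cdot})^2$, $\widehat\sigma_2^2=(n_3-1)^{-1}\sum_{\ell=1}^{n_3}(X^{(i)}_{2\ell}-\overline X^{(i)}_{2\cdot})^2$, and $$T_2(\boldsymbol X^{(i)})=\frac{\overline X^{(i)}_{1\cdot}-\overline X^{(i)}_{2\cdot}}{\sqrt{\widehat\sigma_1^2/n_2+\widehat\sigma_2^2/n_3}}.$$ A fraction with zero denominator is assigned the value $0$. The weighted statistic is $$T=T(\boldsymbol X^{(c)},\boldsymbol X^{(i)})=\sqrt a\,T_1(\boldsymbol X^{(c)})+\sqrt{1-a}\,T_2(\boldsymbol X^{(i)}),$$ where $a\in[0,1]$ is a deterministic weight that may depend on the sample sizes (e.g. $a=2n_1/(n+n_1)$ or $a=n_1/n$). Permutation version. Let $\tau_1,\dots,\tau_{n_1}$ be random permutations uniformly distributed on the symmetric group $\mathcal S_2$ and let $\pi$ be uniformly distributed on $\mathcal S_{n_2+n_3}$; $\tau_1,\dots,\tau_{n_1},\pi,\boldsymbol X$ are mutually independent. Let $\boldsymbol X^{(c)}_\tau$ consist of the pairs $(X^{(c)}_{\tau_j(1)j},X^{(c)}_{\tau_j(2)j})'$, $j=1,\dots,n_1$ (components within each complete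 pair are randomly permuted). Write the pooled incomplete sample as $(Z_1,\dots,Z_{n_2+n_3})=(X^{(i)}_{11},\dots,X^{(i)}_{1n_2},X^{(i)}_{21},\dots,X^{(i)}_{2n_3})$ and set $\boldsymbol X^{(i)}_\pi=(Z_{\pi(1)},\dots,Z_{\pi(n_2+n_3)})$, where the first $n_2$ entries play the role of the first sample and the last $n_3$ entries that of the second sample. Then $$T_p=T(\boldsymbol X^{(c)}_\tau,\boldsymbol X^{(i)}_\pi)=\sqrt a\,T_1(\boldsymbol X^{(c)}_\tau)+\sqrt{1-a}\,T_2(\boldsymbol X^{(i)}_\pi).$$ Randomization constant. $\gamma_p=\gamma_p(\boldsymbol X)\in[0,1]$ is the usual randomization constant chosen such that $P(T_p>c_p(\alpha)\mid\boldsymbol X)+\gamma_p\,P(T_p=c_p(\alpha)\mid\boldsymbol X)=\alpha$. *)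

theory Defs
  imports "HOL-Probability.Probability"
begin

section \<open>Statistics\<close>

text \<open>All samples are indexed from 1. Division by zero gives 0 in HOL, which is the convention
  adopted here for the studentised statistics.\<close>

definition sample_mean :: "nat \<Rightarrow> (nat \<Rightarrow> real) \<Rightarrow> real" where
  "sample_mean n x = (\<Sum>j=1..n. x j) / real n"

definition sample_var :: "nat \<Rightarrow> (nat \<Rightarrow> real) \<Rightarrow> real" where
  "sample_var n x = (\<Sum>j=1..n. (x j - sample_mean n x)\<^sup>2) / (real n - 1)"

definition T1 :: "nat \<Rightarrow> (nat \<Rightarrow> real^2) \<Rightarrow> real" where
  "T1 n1 xc = (let D = (\<lambda>j. xc j $ 1 - xc j $ 2)
     in sample_mean n1 D / sqrt (sample_var n1 D / real n1))"

text \<open>The incomplete observations are stored as one pooled vector: entries 1 to n2 form the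
  first sample, entries n2 + 1 to n2 + n3 the second one.\<close>

definition T2 :: "nat \<Rightarrow> nat \<Rightarrow> (nat \<Rightarrow> real) \<Rightarrow> real" where
  "T2 n2 n3 z = (let z' = (\<lambda>l. z (n2 + l))
     in (sample_mean n2 z - sample_mean n3 z') /
        sqrt (sample_var n2 z / real n2 + sample_var n3 z' / real n3))"

definition weighted_T ::
  "real \<Rightarrow> nat \<Rightarrow> nat \<Rightarrow> nat \<Rightarrow> (nat \<Rightarrow> real^2) \<times> (nat \<Rightarrow> real) \<Rightarrow> real" where
  "weighted_T a n1 n2 n3 = (\<lambda>(xc, z). sqrt a * T1 n1 xc + sqrt (1 - a) * T2 n2 n3 z)"

definition permute_data ::
  "(nat \<Rightarrow> 2 \<Rightarrow> 2) \<Rightarrow> (nat \<Rightarrow> nat) \<Rightarrow> (nat \<Rightarrow> real^2) \<times> (nat \<Rightarrow> real) \<Rightarrow>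
   (nat \<Rightarrow> real^2) \<times> (nat \<Rightarrow> real)" where
  "permute_data s p = (\<lambda>(xc, z). ((\<lambda>j. \<chi> i. xc j $ s j i), (\<lambda>m. z (p m))))"

section \<open>The incomplete matched pairs model\<close>

text \<open>One experiment with fixed sample sizes: \<open>XC j\<close> is the j-th complete pair, \<open>XI i k\<close> is the
  k-th incomplete observation of component i, and \<open>\<tau> j\<close>, \<open>\<pi>\<close> are the random permutations.\<close>

record 'a pairs_experiment =
  pspace :: "'a measure"
  n\<^sub>1 :: nat
  n\<^sub>2 :: nat
  n\<^sub>3 :: nat
  XC :: "nat \<Rightarrow> 'a \<Rightarrow> real^2"
  XI :: "2 \<Rightarrow> nat \<Rightarrow> 'a \<Rightarrow> real"
  \<tau> :: "nat \<Rightarrow> 'a \<Rightarrow> 2 \<Rightarrow> 2"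
  \<pi> :: "'a \<Rightarrow> nat \<Rightarrow> nat"

text \<open>\<open>P\<close> is the law of a complete pair, with mean vector \<open>\<mu>\<close> and positive definite covariance
  matrix \<open>\<Sigma>\<close>. The variances of the two components are the diagonal entries of \<open>\<Sigma>\<close>: they are
  finite by square integrability and positive by definiteness.\<close>

definition pair_law :: "(real^2) measure \<Rightarrow> real^2 \<Rightarrow> real^2^2 \<Rightarrow> bool" where
  "pair_law P \<mu> \<Sigma> \<longleftrightarrow>
     prob_space P \<and> sets P = sets borel \<and>
     (\<forall>i. integrable P (\<lambda>x. (x $ i)\<^sup>2)) \<and>
     (\<forall>i. \<mu> $ i = (LINT x|P. x $ i)) \<and>
     (\<forall>i j. \<Sigma> $ i $ j = (LINT x|P. (x $ i - \<mu> $ i) * (x $ j - \<mu> $ j))) \<and>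
     (\<forall>v. v \<noteq> 0 \<longrightarrow> 0 < v \<bullet> (\<Sigma> *v v))"

datatype source = Pair_src nat | Inc_src 2 nat | Swap_src nat | Perm_src

definition S2 :: "(2 \<Rightarrow> 2) set" where
  "S2 = {s. s permutes UNIV}"

definition Sn :: "nat \<Rightarrow> (nat \<Rightarrow> nat) set" where
  "Sn n = {p. p permutes {1..n}}"

definition source_events :: "'a pairs_experiment \<Rightarrow> source \<Rightarrow> 'a set set" where
  "source_events E src = (case src of
     Pair_src j \<Rightarrow> sets (vimage_algebra (space (pspace E)) (XC E j) borel)
   | Inc_src i k \<Rightarrow> sets (vimage_algebra (space (pspace E)) (XI E i k) borel)
   | Swap_src j \<Rightarrow> sets (vimage_algebra (space (pspace E)) (\<tau> E j) (count_space S2))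
   | Perm_src \<Rightarrow> sets (vimage_algebra (space (pspace E)) (\<pi> E) (count_space (Sn (n\<^sub>2 E + n\<^sub>3 E)))))"

definition sources :: "'a pairs_experiment \<Rightarrow> source set" where
  "sources E = Pair_src ` {1..n\<^sub>1 E} \<union> Inc_src 1 ` {1..n\<^sub>2 E} \<union> Inc_src 2 ` {1..n\<^sub>3 E} \<union>
     Swap_src ` {1..n\<^sub>1 E} \<union> {Perm_src}"

text \<open>The last clause is joint independence of all complete pairs, all incomplete observations and
  all random permutations; only the two components within a complete pair may depend on each other.
  The law \<open>P\<close> is a parameter because it must not change with the sample sizes.\<close>

definition incomplete_pairs_model :: "(real^2) measure \<Rightarrow> 'a pairs_experiment \<Rightarrow> bool" where
  "incomplete_pairs_model P E \<longleftrightarrow>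
     prob_space (pspace E) \<and> 2 \<le> n\<^sub>1 E \<and> 2 \<le> n\<^sub>2 E \<and> 2 \<le> n\<^sub>3 E \<and>
     (\<forall>j\<in>{1..n\<^sub>1 E}. XC E j \<in> borel_measurable (pspace E) \<and> distr (pspace E) borel (XC E j) = P) \<and>
     (\<forall>k\<in>{1..n\<^sub>2 E}. XI E 1 k \<in> borel_measurable (pspace E) \<and>
        distr (pspace E) borel (XI E 1 k) = distr P borel (\<lambda>x. x $ 1)) \<and>
     (\<forall>l\<in>{1..n\<^sub>3 E}. XI E 2 l \<in> borel_measurable (pspace E) \<and>
        distr (pspace E) borel (XI E 2 l) = distr P borel (\<lambda>x. x $ 2)) \<and>
     (\<forall>j\<in>{1..n\<^sub>1 E}. \<tau> E j \<in> pspace E \<rightarrow>\<^sub>M count_space S2 \<and>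
        distr (pspace E) (count_space S2) (\<tau> E j) = uniform_count_measure S2) \<and>
     \<pi> E \<in> pspace E \<rightarrow>\<^sub>M count_space (Sn (n\<^sub>2 E + n\<^sub>3 E)) \<and>
     distr (pspace E) (count_space (Sn (n\<^sub>2 E + n\<^sub>3 E))) (\<pi> E) =
       uniform_count_measure (Sn (n\<^sub>2 E + n\<^sub>3 E)) \<and>
     prob_space.indep_sets (pspace E) (source_events E) (sources E)"

definition data :: "'a pairs_experiment \<Rightarrow> 'a \<Rightarrow> (nat \<Rightarrow> real^2) \<times> (nat \<Rightarrow> real)" where
  "data E \<omega> =
     ((\<lambda>j\<in>{1..n\<^sub>1 E}. XC E j \<omega>),
      (\<lambda>m\<in>{1..n\<^sub>2 E + n\<^sub>3 E}. if m \<le> n\<^sub>2 E then XI E 1 m \<omega> else XI E 2 (m - n\<^sub>2 E) \<omega>))"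

definition data_algebra :: "'a pairs_experiment \<Rightarrow> 'a measure" where
  "data_algebra E = vimage_algebra (space (pspace E)) (data E)
     ((\<Pi>\<^sub>M j\<in>{1..n\<^sub>1 E}. borel) \<Otimes>\<^sub>M (\<Pi>\<^sub>M m\<in>{1..n\<^sub>2 E + n\<^sub>3 E}. borel))"

text \<open>The deterministic weight \<open>a\<close> is a function of the three sample sizes.\<close>

definition T_obs :: "(nat \<Rightarrow> nat \<Rightarrow> nat \<Rightarrow> real) \<Rightarrow> 'a pairs_experiment \<Rightarrow> 'a \<Rightarrow> real" where
  "T_obs a E \<omega> = weighted_T (a (n\<^sub>1 E) (n\<^sub>2 E) (n\<^sub>3 E)) (n\<^sub>1 E) (n\<^sub>2 E) (n\<^sub>3 E) (data E \<omega>)"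

definition T_perm :: "(nat \<Rightarrow> nat \<Rightarrow> nat \<Rightarrow> real) \<Rightarrow> 'a pairs_experiment \<Rightarrow> 'a \<Rightarrow> real" where
  "T_perm a E \<omega> = weighted_T (a (n\<^sub>1 E) (n\<^sub>2 E) (n\<^sub>3 E)) (n\<^sub>1 E) (n\<^sub>2 E) (n\<^sub>3 E)
     (permute_data (\<lambda>j. \<tau> E j \<omega>) (\<pi> E \<omega>) (data E \<omega>))"

section \<open>Conditional distribution and the randomised test\<close>

text \<open>\<open>K\<close> is a regular conditional distribution of \<open>Y\<close> given the sub-sigma-algebra \<open>F\<close>:
  a probability kernel, measurable with respect to \<open>F\<close>, such that \<open>K \<omega> B\<close> is a version of the
  conditional probability of \<open>Y \<in> B\<close> given \<open>F\<close> for every Borel set \<open>B\<close>.\<close>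

definition regular_cond_distr ::
  "'a measure \<Rightarrow> 'a measure \<Rightarrow> ('a \<Rightarrow> real) \<Rightarrow> ('a \<Rightarrow> real measure) \<Rightarrow> bool" where
  "regular_cond_distr M F Y K \<longleftrightarrow>
     K \<in> F \<rightarrow>\<^sub>M prob_algebra borel \<and>
     (\<forall>B\<in>sets borel. AE \<omega> in M.
        measure (K \<omega>) B = real_cond_exp M F (indicator (Y -` B \<inter> space M)) \<omega>)"

definition cond_law_T_perm ::
  "(nat \<Rightarrow> nat \<Rightarrow> nat \<Rightarrow> real) \<Rightarrow> 'a pairs_experiment \<Rightarrow> ('a \<Rightarrow> real measure) \<Rightarrow> bool" where
  "cond_law_T_perm a E K \<longleftrightarrow> regular_cond_distr (pspace E) (data_algebra E) (T_perm a E) K"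

definition quantile :: "real measure \<Rightarrow> real \<Rightarrow> real" where
  "quantile N p = Inf {x. p \<le> cdf N x}"

definition randomization_constant ::
  "real \<Rightarrow> 'a pairs_experiment \<Rightarrow> ('a \<Rightarrow> real measure) \<Rightarrow> ('a \<Rightarrow> real) \<Rightarrow> bool" where
  "randomization_constant \<alpha> E K \<gamma> \<longleftrightarrow>
     \<gamma> \<in> borel_measurable (data_algebra E) \<and>
     (\<forall>\<omega>\<in>space (pspace E). \<gamma> \<omega> \<in> {0..1} \<and>
        (let c = quantile (K \<omega>) (1 - \<alpha>)
         in measure (K \<omega>) {c<..} + \<gamma> \<omega> * measure (K \<omega>) {c} = \<alpha>))"

definition perm_test ::
  "real \<Rightarrow> (nat \<Rightarrow> nat \<Rightarrow> nat \<Rightarrow> real) \<Rightarrow> 'a pairs_experiment \<Rightarrow> ('a \<Rightarrow> real measure) \<Rightarrow> ('a \<Rightarrow> real) \<Rightarrow>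
   'a \<Rightarrow> real" where
  "perm_test \<alpha> a E K \<gamma> \<omega> =
     (let c = quantile (K \<omega>) (1 - \<alpha>)
      in of_bool (T_obs a E \<omega> > c) + \<gamma> \<omega> * of_bool (T_obs a E \<omega> = c))"

section \<open>Asymptotics\<close>

definition asymptotic_regime :: "(nat \<Rightarrow> 'a pairs_experiment) \<Rightarrow> real \<Rightarrow> bool" where
  "asymptotic_regime E \<kappa> \<longleftrightarrow>
     filterlim (\<lambda>r. min (n\<^sub>1 (E r)) (min (n\<^sub>2 (E r)) (n\<^sub>3 (E r)))) at_top sequentially \<and>
     (\<lambda>r. real (n\<^sub>2 (E r)) / real (n\<^sub>2 (E r) + n\<^sub>3 (E r))) \<longlonglongrightarrow> \<kappa>"

text \<open>Measurability is part of the definition since \<open>measure\<close> is 0 on non-measurable sets. The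
  underlying probability space may change along the sequence.\<close>

definition tendsto_in_prob :: "(nat \<Rightarrow> 'a measure) \<Rightarrow> (nat \<Rightarrow> 'a \<Rightarrow> real) \<Rightarrow> real \<Rightarrow> bool" where
  "tendsto_in_prob M Y l \<longleftrightarrow>
     (\<forall>r. Y r \<in> borel_measurable (M r)) \<and>
     (\<forall>\<epsilon>>0. (\<lambda>r. measure (M r) {\<omega>\<in>space (M r). \<bar>Y r \<omega> - l\<bar> > \<epsilon>}) \<longlonglongrightarrow> 0)"

end

theory Submission imports Defs begin

text \<open>Conditionally on the data the permutation statistic is a function of a uniformly random pattern of
  \<open>n\<^sub>1\<close> signs and one permutation: swapping the components of a complete pair flips the sign of its
  difference, and the statistic sees a complete pair through its difference only. Its conditional law
  is therefore almost surely the image of the uniform distribution on patterns (\<open>cond_law_eq_perm_law\<close>),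
  and everything about it can be studied for deterministic data.

  For deterministic data the law is close to normal as soon as no observation dominates the sums of
  squares (\<open>perm_law_uniform_limit\<close>). After normalisation the paired part is a Rademacher sum, whose
  characteristic function is a product of cosines, and the two-sample part is the sum of the first
  block of a randomly permuted vector. The characteristic function of the latter almost solves the
  differential equation of a Gaussian one, by an exchangeable pair in the sense of Stein: exchange an
  entry of the first block with one of the second. Signs and permutation are independent, so the two
  functions multiply. The studentising denominators converge to constants, because the signs do not
  affect the squares and because the share of the squares that falls into the first block
  concentrates. An argument by contradiction makes the limit theorem uniform in the data
  (\<open>perm_law_uniformly_close\<close>), and Polya's theorem makes it uniform in the argument. For i.i.d. data with
  finite nonzero variances the event that some observation dominates has vanishing probability, by
  the law of large numbers and since the maximum of \<open>n\<close> squares is \<open>o(n)\<close>. This gives the first claim.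

  For the second claim the conditional quantile is caught between two normal quantiles with
  probability tending to 1 (\<open>quantile_between\<close>). If the means agree then the statistic is itself
  asymptotically normal (\<open>T_stat_asymp_normal\<close>), by the central limit theorem with bounded coefficients
  and Slutsky's lemma: whatever the weight \<open>a\<close> is, the squared coefficients of the three independent
  samples add up to 1. If \<open>\<mu>\<^sub>1 > \<mu>\<^sub>2\<close> the statistic tends to infinity in probability
  (\<open>T_stat_diverges\<close>) while the critical value stays bounded.

  The third claim is an orbit argument. Patterns act on data, the permutation law is constant on
  orbits, and so the test averages to exactly \<open>\<alpha>\<close> over every orbit (\<open>test_fun_orbit_average\<close>). Under the
  symmetry assumptions the action preserves the law of the data (\<open>expectation_invariant\<close>), so the
  expectation of the test equals the expectation of its orbit average.\<close>

section \<open>Convergence in probability along varying spaces\<close>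

lemma tendsto_in_prob_measurable:
  "tendsto_in_prob M X c \<Longrightarrow> X r \<in> borel_measurable (M r)"
  by (simp add: tendsto_in_prob_def)

lemma tendsto_in_probD:
  "tendsto_in_prob M X c \<Longrightarrow> \<epsilon> > 0 \<Longrightarrow> (\<lambda>r. measure (M r) {\<omega>\<in>space (M r). \<bar>X r \<omega> - c\<bar> > \<epsilon>}) \<longlonglongrightarrow> 0"
  by (simp add: tendsto_in_prob_def)

lemma tendsto_in_probI_bound:
  assumes "\<And>r. X r \<in> borel_measurable (M r)"
    and "\<And>\<epsilon>. \<epsilon> > 0 \<Longrightarrow> \<exists>b. b \<longlonglongrightarrow> 0 \<and> (\<forall>r. measure (M r) {\<omega>\<in>space (M r). \<bar>X r \<omega> - c\<bar> > \<epsilon>} \<le> b r)"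
  shows "tendsto_in_prob M X c"
  unfolding tendsto_in_prob_def
proof (intro conjI allI impI)
  fix \<epsilon> :: real assume "\<epsilon> > 0"
  then obtain b where b: "b \<longlonglongrightarrow> 0"
    "\<And>r. measure (M r) {\<omega>\<in>space (M r). \<bar>X r \<omega> - c\<bar> > \<epsilon>} \<le> b r" using assms(2) by blast
  show "(\<lambda>r. measure (M r) {\<omega>\<in>space (M r). \<bar>X r \<omega> - c\<bar> > \<epsilon>}) \<longlonglongrightarrow> 0"
    by (rule tendsto_sandwich[OF _ _ tendsto_const b(1)]) (auto simp: b(2))
qed (use assms in auto)

lemma tendsto_in_prob_continuous2:
  fixes f :: "real \<Rightarrow> real \<Rightarrow> real"
  assumes M: "\<And>r. prob_space (M r)"
    and X: "tendsto_in_prob M X c" and Y: "tendsto_in_prob M Y d"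
    and cont: "isCont (\<lambda>p. f (fst p) (snd p)) (c, d)"
    and meas: "(\<lambda>p. f (fst p) (snd p)) \<in> borel_measurable (borel \<Otimes>\<^sub>M borel)"
  shows "tendsto_in_prob M (\<lambda>r \<omega>. f (X r \<omega>) (Y r \<omega>)) (f c d)"
proof (rule tendsto_in_probI_bound)
  note [measurable] = tendsto_in_prob_measurable[OF X] tendsto_in_prob_measurable[OF Y]
  have m: "(\<lambda>\<omega>. (X r \<omega>, Y r \<omega>)) \<in> M r \<rightarrow>\<^sub>M borel \<Otimes>\<^sub>M borel" for r by measurable
  show "(\<lambda>\<omega>. f (X r \<omega>) (Y r \<omega>)) \<in> borel_measurable (M r)" for r
    using measurable_compose[OF m meas] by simp
  fix \<epsilon> :: real assume "\<epsilon> > 0"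
  then obtain \<delta> where \<delta>: "\<delta> > 0" "\<And>p. dist p (c, d) < \<delta> \<Longrightarrow> dist (f (fst p) (snd p)) (f c d) < \<epsilon>"
    using cont unfolding continuous_at_eps_delta by fastforce
  let ?b = "\<lambda>r. measure (M r) {\<omega>\<in>space (M r). \<bar>X r \<omega> - c\<bar> > \<delta>/3}
     + measure (M r) {\<omega>\<in>space (M r). \<bar>Y r \<omega> - d\<bar> > \<delta>/3}"
  have "?b \<longlonglongrightarrow> 0"
    using tendsto_add[OF tendsto_in_probD[OF X, of "\<delta>/3"] tendsto_in_probD[OF Y, of "\<delta>/3"]] \<delta>(1) by simp
  moreover have "measure (M r) {\<omega>\<in>space (M r). \<bar>f (X r \<omega>) (Y r \<omega>) - f c d\<bar> > \<epsilon>} \<le> ?b r" for r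
  proof -
    interpret prob_space "M r" by (rule M)
    have "{\<omega>\<in>space (M r). \<bar>f (X r \<omega>) (Y r \<omega>) - f c d\<bar> > \<epsilon>} \<subseteq>
       {\<omega>\<in>space (M r). \<bar>X r \<omega> - c\<bar> > \<delta>/3} \<union> {\<omega>\<in>space (M r). \<bar>Y r \<omega> - d\<bar> > \<delta>/3}"
    proof (rule subsetI, rule ccontr)
      fix \<omega> assume w: "\<omega> \<in> {\<omega>\<in>space (M r). \<bar>f (X r \<omega>) (Y r \<omega>) - f c d\<bar> > \<epsilon>}"
        "\<omega> \<notin> {\<omega>\<in>space (M r). \<bar>X r \<omega> - c\<bar> > \<delta>/3} \<union> {\<omega>\<in>space (M r). \<bar>Y r \<omega> - d\<bar> > \<delta>/3}"
      have "dist (X r \<omega>, Y r \<omega>) (c, d) \<le> dist (X r \<omega>) c + dist (Y r \<omega>) d"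
        unfolding dist_Pair_Pair by (rule sqrt_sum_squares_le_sum) auto
      also have "\<dots> < \<delta>" using w \<delta>(1) by (auto simp: dist_real_def)
      finally show False using \<delta>(2)[of "(X r \<omega>, Y r \<omega>)"] w by (auto simp: dist_real_def)
    qed
    then show ?thesis
      by (intro order.trans[OF finite_measure_mono measure_Un_le]) auto
  qed
  ultimately show "\<exists>b. b \<longlonglongrightarrow> 0 \<and> (\<forall>r. measure (M r) {\<omega>\<in>space (M r). \<bar>f (X r \<omega>) (Y r \<omega>) - f c d\<bar> > \<epsilon>} \<le> b r)"
    by blast
qed

lemma tendsto_in_prob_continuous:
  fixes f :: "real \<Rightarrow> real"
  assumes "\<And>r. prob_space (M r)" "tendsto_in_prob M X c" "isCont f c" "f \<in> borel_measurable borel"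
  shows "tendsto_in_prob M (\<lambda>r \<omega>. f (X r \<omega>)) (f c)"
proof (rule tendsto_in_prob_continuous2[OF assms(1,2,2), where f="\<lambda>x y. f x"])
  show "isCont (\<lambda>p. f (fst p)) (c, c)" using assms(3) by (intro isCont_o2[OF isCont_fst]) auto
  show "(\<lambda>p. f (fst p)) \<in> borel_measurable (borel \<Otimes>\<^sub>M borel)" using assms(4) by measurable
qed

lemma tendsto_in_prob_add:
  assumes "\<And>r. prob_space (M r)" "tendsto_in_prob M X c" "tendsto_in_prob M Y d"
  shows "tendsto_in_prob M (\<lambda>r \<omega>. X r \<omega> + Y r \<omega>) (c + d)"
  by (rule tendsto_in_prob_continuous2[OF assms]) (auto intro!: continuous_intros)

lemma tendsto_in_prob_diff:
  assumes "\<And>r. prob_space (M r)" "tendsto_in_prob M X c" "tendsto_in_prob M Y d"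
  shows "tendsto_in_prob M (\<lambda>r \<omega>. X r \<omega> - Y r \<omega>) (c - d)"
  by (rule tendsto_in_prob_continuous2[OF assms]) (auto intro!: continuous_intros)

lemma tendsto_in_prob_mult:
  assumes "\<And>r. prob_space (M r)" "tendsto_in_prob M X c" "tendsto_in_prob M Y d"
  shows "tendsto_in_prob M (\<lambda>r \<omega>. X r \<omega> * Y r \<omega>) (c * d)"
  by (rule tendsto_in_prob_continuous2[OF assms]) (auto intro!: continuous_intros)

lemma tendsto_in_prob_cong:
  assumes "tendsto_in_prob M X c" "\<And>r \<omega>. \<omega> \<in> space (M r) \<Longrightarrow> X r \<omega> = Y r \<omega>"
  shows "tendsto_in_prob M Y c"
proof -
  have "{\<omega>\<in>space (M r). \<bar>Y r \<omega> - c\<bar> > \<epsilon>} = {\<omega>\<in>space (M r). \<bar>X r \<omega> - c\<bar> > \<epsilon>}" for r \<epsilon>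
    using assms(2) by auto
  moreover have "Y r \<in> borel_measurable (M r)" for r
    using tendsto_in_prob_measurable[OF assms(1), of r] assms(2)[of _ r]
    by (subst measurable_cong[where g="X r"]) auto
  ultimately show ?thesis using assms(1) by (simp add: tendsto_in_prob_def)
qed

lemma tendsto_in_prob_dominated:
  assumes M: "\<And>r. prob_space (M r)" and X: "tendsto_in_prob M X 0"
    and Y: "\<And>r. Y r \<in> borel_measurable (M r)"
    and le: "\<And>r \<omega>. \<omega> \<in> space (M r) \<Longrightarrow> \<bar>Y r \<omega> - l\<bar> \<le> X r \<omega>"
  shows "tendsto_in_prob M Y l"
proof (rule tendsto_in_probI_bound[OF Y])
  fix \<epsilon> :: real assume e: "\<epsilon> > 0"
  note [measurable] = tendsto_in_prob_measurable[OF X]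
  have "measure (M r) {\<omega>\<in>space (M r). \<bar>Y r \<omega> - l\<bar> > \<epsilon>} \<le> measure (M r) {\<omega>\<in>space (M r). \<bar>X r \<omega> - 0\<bar> > \<epsilon>}" for r
  proof -
    interpret prob_space "M r" by (rule M)
    show ?thesis using le[of _ r] by (intro finite_measure_mono) force+
  qed
  then show "\<exists>b. b \<longlonglongrightarrow> 0 \<and> (\<forall>r. measure (M r) {\<omega>\<in>space (M r). \<bar>Y r \<omega> - l\<bar> > \<epsilon>} \<le> b r)"
    using tendsto_in_probD[OF X e] by blast
qed

lemma tendsto_in_prob_const:
  assumes "c \<longlonglongrightarrow> l"
  shows "tendsto_in_prob M (\<lambda>r \<omega>. c r) l"
  unfolding tendsto_in_prob_def
proof (intro conjI allI impI)
  fix \<epsilon> :: real assume "\<epsilon> > 0"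
  then have "\<forall>\<^sub>F r in sequentially. dist (c r) l < \<epsilon>" using assms by (simp add: tendstoD)
  then have "\<forall>\<^sub>F r in sequentially. 0 = measure (M r) {\<omega>\<in>space (M r). \<bar>c r - l\<bar> > \<epsilon>}"
    by eventually_elim (auto simp: dist_real_def)
  then show "(\<lambda>r. measure (M r) {\<omega>\<in>space (M r). \<bar>c r - l\<bar> > \<epsilon>}) \<longlonglongrightarrow> 0"
    by (rule Lim_transform_eventually[OF tendsto_const])
qed simp

lemma prob_abs_gt_le:
  assumes "prob_space M" "integrable M X" "c > (0::real)"
  shows "measure M {\<omega>\<in>space M. \<bar>X \<omega>\<bar> > c} \<le> (LINT \<omega>|M. \<bar>X \<omega>\<bar>) / c"
proof -
  interpret prob_space M by fact
  note [measurable] = borel_measurable_integrable[OF assms(2)]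
  have "measure M {\<omega>\<in>space M. \<bar>X \<omega>\<bar> > c} \<le> measure M {\<omega>\<in>space M. \<bar>X \<omega>\<bar> \<ge> c}"
    by (intro finite_measure_mono) auto
  also have "\<dots> \<le> (LINT \<omega>|M. \<bar>X \<omega>\<bar>) / c"
    by (rule integral_Markov_inequality_measure[where A="{}"]) (use assms in auto)
  finally show ?thesis .
qed

lemma prob_abs_gt_le_second_moment:
  assumes "prob_space M" and [measurable]: "X \<in> borel_measurable M"
    and "integrable M (\<lambda>\<omega>. (X \<omega>)\<^sup>2)" "c > (0::real)"
  shows "measure M {\<omega>\<in>space M. \<bar>X \<omega>\<bar> > c} \<le> (LINT \<omega>|M. (X \<omega>)\<^sup>2) / c\<^sup>2"
proof -
  have "{\<omega>\<in>space M. \<bar>X \<omega>\<bar> > c} = {\<omega>\<in>space M. \<bar>(X \<omega>)\<^sup>2\<bar> > c\<^sup>2}"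
    using assms(4) by (auto simp: abs_square_less_1 power2_less_imp_less
        simp flip: abs_le_square_iff linorder_not_le)
  then show ?thesis using prob_abs_gt_le[OF assms(1,3), of "c\<^sup>2"] assms(4) by simp
qed

lemma tendsto_in_prob_L1:
  assumes "\<And>r. prob_space (M r)" and int: "\<And>r. integrable (M r) (\<lambda>\<omega>. X r \<omega> - l)"
    and [measurable]: "\<And>r. X r \<in> borel_measurable (M r)"
    and lim: "(\<lambda>r. LINT \<omega>|M r. \<bar>X r \<omega> - l\<bar>) \<longlonglongrightarrow> 0"
  shows "tendsto_in_prob M X l"
proof (rule tendsto_in_probI_bound)
  fix \<epsilon> :: real assume e: "\<epsilon> > 0"
  show "\<exists>b. b \<longlonglongrightarrow> 0 \<and> (\<forall>r. measure (M r) {\<omega>\<in>space (M r). \<bar>X r \<omega> - l\<bar> > \<epsilon>} \<le> b r)"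
    using tendsto_divide_zero[OF lim, of \<epsilon>] prob_abs_gt_le[OF assms(1) int e] by blast
qed fact

lemma tendsto_in_prob_L2:
  assumes "\<And>r. prob_space (M r)" and int: "\<And>r. integrable (M r) (\<lambda>\<omega>. (X r \<omega> - l)\<^sup>2)"
    and [measurable]: "\<And>r. X r \<in> borel_measurable (M r)"
    and lim: "(\<lambda>r. LINT \<omega>|M r. (X r \<omega> - l)\<^sup>2) \<longlonglongrightarrow> 0"
  shows "tendsto_in_prob M X l"
proof (rule tendsto_in_probI_bound)
  fix \<epsilon> :: real assume e: "\<epsilon> > 0"
  show "\<exists>b. b \<longlonglongrightarrow> 0 \<and> (\<forall>r. measure (M r) {\<omega>\<in>space (M r). \<bar>X r \<omega> - l\<bar> > \<epsilon>} \<le> b r)"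
    using tendsto_divide_zero[OF lim, of "\<epsilon>\<^sup>2"]
      prob_abs_gt_le_second_moment[OF assms(1) _ int e] by fastforce
qed fact

text \<open>A bounded second moment makes a sequence stochastically bounded, so that its product with a
  sequence vanishing in probability vanishes too.\<close>

lemma tendsto_in_prob_bounded_mult:
  assumes M: "\<And>r. prob_space (M r)"
    and U: "\<And>r. U r \<in> borel_measurable (M r)" "\<And>r. integrable (M r) (\<lambda>\<omega>. (U r \<omega>)\<^sup>2)"
      "\<And>r. (LINT \<omega>|M r. (U r \<omega>)\<^sup>2) \<le> C"
    and Z: "tendsto_in_prob M Z 0"
  shows "tendsto_in_prob M (\<lambda>r \<omega>. U r \<omega> * Z r \<omega>) 0"
  unfolding tendsto_in_prob_def
proof (intro conjI allI impI)
  note [measurable] = tendsto_in_prob_measurable[OF Z] U(1)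
  show "(\<lambda>\<omega>. U r \<omega> * Z r \<omega>) \<in> borel_measurable (M r)" for r by measurable
  fix \<epsilon> :: real assume e: "\<epsilon> > 0"
  have C: "C \<ge> 0" using order.trans[OF Bochner_Integration.integral_nonneg U(3)[of 0]] by simp
  show "(\<lambda>r. measure (M r) {\<omega>\<in>space (M r). \<bar>U r \<omega> * Z r \<omega> - 0\<bar> > \<epsilon>}) \<longlonglongrightarrow> 0"
  proof (rule LIMSEQ_I)
    fix h :: real assume h: "h > 0"
    \<comment> \<open>By Chebyshev the factor \<open>U\<close> exceeds \<open>B\<close> with probability less than \<open>h / 2\<close>.\<close>
    define B where "B = sqrt (2 * (C + 1) / h)"
    have B: "B > 0" "C / B\<^sup>2 < h / 2" using h C by (auto simp: B_def field_simps)
    obtain r0 where r0: "\<And>r. r \<ge> r0 \<Longrightarrow> norm (measure (M r) {\<omega>\<in>space (M r). \<bar>Z r \<omega> - 0\<bar> > \<epsilon> / B} - 0) < h / 2"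
      using LIMSEQ_D[OF tendsto_in_probD[OF Z, of "\<epsilon> / B"], of "h / 2"] h e B(1) by auto
    have "norm (measure (M r) {\<omega>\<in>space (M r). \<bar>U r \<omega> * Z r \<omega> - 0\<bar> > \<epsilon>} - 0) < h" if r: "r \<ge> r0" for r
    proof -
      interpret prob_space "M r" by (rule M)
      have "{\<omega>\<in>space (M r). \<bar>U r \<omega> * Z r \<omega> - 0\<bar> > \<epsilon>} \<subseteq>
        {\<omega>\<in>space (M r). \<bar>U r \<omega>\<bar> > B} \<union> {\<omega>\<in>space (M r). \<bar>Z r \<omega> - 0\<bar> > \<epsilon> / B}"
      proof (rule subsetI, rule ccontr)
        fix \<omega> assume w: "\<omega> \<in> {\<omega>\<in>space (M r). \<bar>U r \<omega> * Z r \<omega> - 0\<bar> > \<epsilon>}"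
          "\<omega> \<notin> {\<omega>\<in>space (M r). \<bar>U r \<omega>\<bar> > B} \<union> {\<omega>\<in>space (M r). \<bar>Z r \<omega> - 0\<bar> > \<epsilon> / B}"
        have "\<bar>U r \<omega>\<bar> * \<bar>Z r \<omega>\<bar> \<le> B * (\<epsilon> / B)" using w B by (intro mult_mono) auto
        then show False using w B by (auto simp: abs_mult)
      qed
      then have "prob {\<omega>\<in>space (M r). \<bar>U r \<omega> * Z r \<omega> - 0\<bar> > \<epsilon>} \<le>
         prob {\<omega>\<in>space (M r). \<bar>U r \<omega>\<bar> > B} + prob {\<omega>\<in>space (M r). \<bar>Z r \<omega> - 0\<bar> > \<epsilon> / B}"
        by (intro order.trans[OF finite_measure_mono measure_Un_le]) auto
      moreover have "prob {\<omega>\<in>space (M r). \<bar>U r \<omega>\<bar> > B} \<le> C / B\<^sup>2"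
        using prob_abs_gt_le_second_moment[OF M U(1,2) B(1), of r] U(3)[of r] B(1)
        by (elim order.trans) (intro divide_right_mono, auto)
      moreover have "prob {\<omega>\<in>space (M r). \<bar>Z r \<omega> - 0\<bar> > \<epsilon> / B} < h / 2"
        using r0[OF r] by simp
      ultimately have "prob {\<omega>\<in>space (M r). \<bar>U r \<omega> * Z r \<omega> - 0\<bar> > \<epsilon>} < h" using B(2) by linarith
      then show ?thesis by simp
    qed
    then show "\<exists>no. \<forall>r\<ge>no. norm (measure (M r) {\<omega>\<in>space (M r). \<bar>U r \<omega> * Z r \<omega> - 0\<bar> > \<epsilon>} - 0) < h"
      by blast
  qed
qed

section \<open>Asymptotic normality\<close>

text \<open>Convergence in law to the standard normal distribution, in the form of characteristic functions
  (Levy's theorem): products of independent factors and small perturbations are easy to treat this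
  way. Measurability is included because the image measure is meaningless without it.\<close>

definition asymp_normal :: "(nat \<Rightarrow> 'a measure) \<Rightarrow> (nat \<Rightarrow> 'a \<Rightarrow> real) \<Rightarrow> bool" where
  "asymp_normal M X \<longleftrightarrow> (\<forall>r. X r \<in> borel_measurable (M r)) \<and>
     (\<forall>t. (\<lambda>r. char (distr (M r) borel (X r)) t) \<longlonglongrightarrow> complex_of_real (exp (- (t\<^sup>2) / 2)))"

lemma isCont_cdf_std_normal: "isCont (cdf std_normal_distribution) x"
proof -
  interpret N: real_distribution std_normal_distribution by (rule real_dist_normal_dist)
  have "emeasure std_normal_distribution {x} = 0"
    by (subst emeasure_density) (auto simp: nn_integral_null_set)
  then show ?thesis by (simp add: N.isCont_cdf measure_def)
qed

lemma asymp_normal_cdf: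
  assumes M: "\<And>r. prob_space (M r)" and X: "asymp_normal M X"
  shows "(\<lambda>r. cdf (distr (M r) borel (X r)) x) \<longlonglongrightarrow> cdf std_normal_distribution x"
proof -
  have "weak_conv_m (\<lambda>r. distr (M r) borel (X r)) std_normal_distribution"
  proof (rule levy_continuity)
    show "real_distribution (distr (M r) borel (X r))" for r
      using X by (intro prob_space.real_distribution_distr M) (auto simp: asymp_normal_def)
  qed (use X in \<open>auto simp: asymp_normal_def char_std_normal_distribution real_dist_normal_dist\<close>)
  then show ?thesis using isCont_cdf_std_normal by (simp add: weak_conv_m_def weak_conv_def)
qed

lemma norm_iexp_diff_le: "cmod (iexp x - iexp y) \<le> \<bar>x - y\<bar>"
proof -
  have "iexp y * iexp (x - y) = iexp x" by (simp add: algebra_simps flip: exp_add)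
  then have "iexp x - iexp y = iexp y * (iexp (x - y) - 1)" by (simp add: right_diff_distrib)
  then have "cmod (iexp x - iexp y) = cmod (iexp (x - y) - 1)" by (simp add: norm_mult)
  also have "\<dots> \<le> \<bar>x - y\<bar>" using iexp_approx1[of "x - y" 0] by simp
  finally show ?thesis .
qed

lemma char_distr_eq:
  assumes "X \<in> borel_measurable M"
  shows "char (distr M borel X) t = (CLINT \<omega>|M. iexp (t * X \<omega>))"
  unfolding char_def by (subst integral_distr) (use assms in auto)

text \<open>Slutsky's lemma: \<open>\<bar>e\<^sup>i\<^sup>t\<^sup>x - e\<^sup>i\<^sup>t\<^sup>y\<bar>\<close> is at most \<open>\<bar>t\<bar> \<bar>x - y\<bar>\<close> and at most 2; the
  first bound serves where \<open>X\<close> and \<open>Y\<close> are close, the second elsewhere.\<close>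

lemma asymp_normal_slutsky:
  assumes M: "\<And>r. prob_space (M r)" and Y: "asymp_normal M Y"
    and XY: "tendsto_in_prob M (\<lambda>r \<omega>. X r \<omega> - Y r \<omega>) 0"
    and Xm: "\<And>r. X r \<in> borel_measurable (M r)"
  shows "asymp_normal M X"
  unfolding asymp_normal_def
proof (intro conjI allI)
  fix t
  have Ym: "Y r \<in> borel_measurable (M r)" for r using Y by (simp add: asymp_normal_def)
  note [measurable] = Xm Ym
  have "(\<lambda>r. char (distr (M r) borel (X r)) t - char (distr (M r) borel (Y r)) t) \<longlonglongrightarrow> 0"
  proof (rule LIMSEQ_I)
    fix h :: real assume h: "h > 0"
    define \<epsilon> where "\<epsilon> = h / (2 * (\<bar>t\<bar> + 1))"
    have e: "\<epsilon> > 0" "\<bar>t\<bar> * \<epsilon> \<le> h / 2" using h by (auto simp: \<epsilon>_def field_simps)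
    obtain r0 where r0: "\<And>r. r \<ge> r0 \<Longrightarrow> norm (measure (M r) {\<omega>\<in>space (M r). \<bar>X r \<omega> - Y r \<omega> - 0\<bar> > \<epsilon>} - 0) < h / 4"
      using LIMSEQ_D[OF tendsto_in_probD[OF XY e(1)], of "h / 4"] h by auto
    have "norm (char (distr (M r) borel (X r)) t - char (distr (M r) borel (Y r)) t - 0) < h" if r: "r \<ge> r0" for r
    proof -
      interpret prob_space "M r" by (rule M)
      let ?A = "{\<omega>\<in>space (M r). \<bar>X r \<omega> - Y r \<omega> - 0\<bar> > \<epsilon>}"
      have int: "integrable (M r) (\<lambda>\<omega>. iexp (t * X r \<omega>))" "integrable (M r) (\<lambda>\<omega>. iexp (t * Y r \<omega>))"
        by (auto intro!: integrable_iexp)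
      have "norm (char (distr (M r) borel (X r)) t - char (distr (M r) borel (Y r)) t)
         = norm (CLINT \<omega>|M r. iexp (t * X r \<omega>) - iexp (t * Y r \<omega>))"
        using int by (simp add: char_distr_eq)
      also have "\<dots> \<le> (LINT \<omega>|M r. norm (iexp (t * X r \<omega>) - iexp (t * Y r \<omega>)))"
        by (rule integral_norm_bound)
      also have "\<dots> \<le> (LINT \<omega>|M r. \<bar>t\<bar> * \<epsilon> + 2 * indicator ?A \<omega>)"
      proof (rule integral_mono)
        show "integrable (M r) (\<lambda>\<omega>. norm (iexp (t * X r \<omega>) - iexp (t * Y r \<omega>)))" using int by auto
        show "integrable (M r) (\<lambda>\<omega>. \<bar>t\<bar> * \<epsilon> + 2 * indicator ?A \<omega>)"
          by (intro Bochner_Integration.integrable_add integrable_mult_right integrable_const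
              integrable_real_indicator) (auto simp: emeasure_eq_measure)
        fix \<omega> assume w: "\<omega> \<in> space (M r)"
        show "norm (iexp (t * X r \<omega>) - iexp (t * Y r \<omega>)) \<le> \<bar>t\<bar> * \<epsilon> + 2 * indicator ?A \<omega>"
        proof (cases "\<omega> \<in> ?A")
          case True
          have "norm (iexp (t * X r \<omega>) - iexp (t * Y r \<omega>)) \<le> 2"
            using norm_triangle_ineq4[of "iexp (t * X r \<omega>)" "iexp (t * Y r \<omega>)"] by simp
          then show ?thesis using True e by (simp add: add_increasing)
        next
          case False
          have "norm (iexp (t * X r \<omega>) - iexp (t * Y r \<omega>)) \<le> \<bar>t\<bar> * \<bar>X r \<omega> - Y r \<omega>\<bar>"
            using norm_iexp_diff_le[of "t * X r \<omega>" "t * Y r \<omega>"] by (simp add: abs_mult flip: right_diff_distrib)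
          also have "\<dots> \<le> \<bar>t\<bar> * \<epsilon>" using False w by (intro mult_left_mono) auto
          finally show ?thesis using False by simp
        qed
      qed
      also have "\<dots> = \<bar>t\<bar> * \<epsilon> + 2 * prob ?A"
        by (subst Bochner_Integration.integral_add)
          (auto simp: prob_space emeasure_eq_measure intro!: integrable_real_indicator)
      also have "\<dots> < h" using r0[OF r] e by auto
      finally show ?thesis by simp
    qed
    then show "\<exists>no. \<forall>r\<ge>no. norm (char (distr (M r) borel (X r)) t - char (distr (M r) borel (Y r)) t - 0) < h"
      by blast
  qed
  then show "(\<lambda>r. char (distr (M r) borel (X r)) t) \<longlonglongrightarrow> complex_of_real (exp (- (t\<^sup>2) / 2))"
    using Lim_transform[of "\<lambda>r. char (distr (M r) borel (Y r)) t"] Y by (auto simp: asymp_normal_def)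
qed (rule Xm)

text \<open>Both the observed and the permuted statistic have this form: a studentised quantity is a
  standardised one times a ratio of standard deviations that tends to 1. The coefficients are bounded,
  so replacing both ratios by 1 costs a term that vanishes in probability, wherever the weight moves.\<close>

lemma asymp_normal_weighted_ratio:
  assumes M: "\<And>r. prob_space (M r)"
    and w: "\<And>r. a r \<in> {0..1::real}"
    and U1: "\<And>r. U1 r \<in> borel_measurable (M r)" "\<And>r. integrable (M r) (\<lambda>\<omega>. (U1 r \<omega>)\<^sup>2)"
      "\<And>r. (LINT \<omega>|M r. (U1 r \<omega>)\<^sup>2) \<le> C"
    and U2: "\<And>r. U2 r \<in> borel_measurable (M r)" "\<And>r. integrable (M r) (\<lambda>\<omega>. (U2 r \<omega>)\<^sup>2)"
      "\<And>r. (LINT \<omega>|M r. (U2 r \<omega>)\<^sup>2) \<le> C"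
    and R1: "tendsto_in_prob M R1 1" and R2: "tendsto_in_prob M R2 1"
    and Y: "asymp_normal M (\<lambda>r \<omega>. sqrt (a r) * U1 r \<omega> + sqrt (1 - a r) * U2 r \<omega>)"
  shows "asymp_normal M (\<lambda>r \<omega>. sqrt (a r) * (U1 r \<omega> * R1 r \<omega>) + sqrt (1 - a r) * (U2 r \<omega> * R2 r \<omega>))"
proof (rule asymp_normal_slutsky[OF M Y])
  note [measurable] = U1(1) U2(1) tendsto_in_prob_measurable[OF R1] tendsto_in_prob_measurable[OF R2]
  show "(\<lambda>\<omega>. sqrt (a r) * (U1 r \<omega> * R1 r \<omega>) + sqrt (1 - a r) * (U2 r \<omega> * R2 r \<omega>)) \<in> borel_measurable (M r)" for r
    by measurable
  have diff: "tendsto_in_prob M (\<lambda>r \<omega>. \<bar>U r \<omega> * (R r \<omega> - 1)\<bar>) 0"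
    if "\<And>r. U r \<in> borel_measurable (M r)" "\<And>r. integrable (M r) (\<lambda>\<omega>. (U r \<omega>)\<^sup>2)"
      "\<And>r. (LINT \<omega>|M r. (U r \<omega>)\<^sup>2) \<le> C" "tendsto_in_prob M R 1" for U R
  proof -
    have "tendsto_in_prob M (\<lambda>r \<omega>. R r \<omega> - 1) (1 - 1)"
      by (rule tendsto_in_prob_diff[OF M that(4) tendsto_in_prob_const]) auto
    from tendsto_in_prob_bounded_mult[OF M that(1-3) this[simplified]]
    show ?thesis by (intro tendsto_in_prob_continuous[where f=abs and c=0, simplified] M) auto
  qed
  have "tendsto_in_prob M (\<lambda>r \<omega>. \<bar>U1 r \<omega> * (R1 r \<omega> - 1)\<bar> + \<bar>U2 r \<omega> * (R2 r \<omega> - 1)\<bar>) (0 + 0)"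
    by (rule tendsto_in_prob_add[OF M diff[OF U1 R1] diff[OF U2 R2]])
  then have lim: "tendsto_in_prob M (\<lambda>r \<omega>. \<bar>U1 r \<omega> * (R1 r \<omega> - 1)\<bar> + \<bar>U2 r \<omega> * (R2 r \<omega> - 1)\<bar>) 0"
    by simp
  show "tendsto_in_prob M (\<lambda>r \<omega>. sqrt (a r) * (U1 r \<omega> * R1 r \<omega>) + sqrt (1 - a r) * (U2 r \<omega> * R2 r \<omega>)
      - (sqrt (a r) * U1 r \<omega> + sqrt (1 - a r) * U2 r \<omega>)) 0"
  proof (rule tendsto_in_prob_dominated[OF M lim])
    fix r \<omega>
    have "sqrt (a r) * (U1 r \<omega> * R1 r \<omega>) + sqrt (1 - a r) * (U2 r \<omega> * R2 r \<omega>)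
      - (sqrt (a r) * U1 r \<omega> + sqrt (1 - a r) * U2 r \<omega>)
      = sqrt (a r) * (U1 r \<omega> * (R1 r \<omega> - 1)) + sqrt (1 - a r) * (U2 r \<omega> * (R2 r \<omega> - 1))"
      by (simp add: algebra_simps)
    also have "\<bar>\<dots>\<bar> \<le> \<bar>sqrt (a r) * (U1 r \<omega> * (R1 r \<omega> - 1))\<bar> + \<bar>sqrt (1 - a r) * (U2 r \<omega> * (R2 r \<omega> - 1))\<bar>"
      by (rule abs_triangle_ineq)
    also have "\<dots> \<le> 1 * \<bar>U1 r \<omega> * (R1 r \<omega> - 1)\<bar> + 1 * \<bar>U2 r \<omega> * (R2 r \<omega> - 1)\<bar>"
      using w[of r] by (intro add_mono) (simp_all add: abs_mult mult_left_le_one_le)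
    finally show "\<bar>sqrt (a r) * (U1 r \<omega> * R1 r \<omega>) + sqrt (1 - a r) * (U2 r \<omega> * R2 r \<omega>)
      - (sqrt (a r) * U1 r \<omega> + sqrt (1 - a r) * U2 r \<omega>) - 0\<bar> \<le> \<bar>U1 r \<omega> * (R1 r \<omega> - 1)\<bar> + \<bar>U2 r \<omega> * (R2 r \<omega> - 1)\<bar>"
      by simp
  qed auto
qed

section \<open>Uniform convergence of distribution functions\<close>

lemma cdf_std_normal_attains:
  assumes "0 < p" "p < 1"
  shows "\<exists>x. cdf std_normal_distribution x = p"
proof -
  interpret N: real_distribution std_normal_distribution by (rule real_dist_normal_dist)
  obtain a where a: "cdf std_normal_distribution a < p"
    using order_tendstoD(2)[OF N.cdf_lim_at_bot, of p] assms by (auto simp: eventually_at_bot_linorder)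
  obtain b where b: "cdf std_normal_distribution b > p"
    using order_tendstoD(1)[OF N.cdf_lim_at_top_prob, of p] assms by (auto simp: eventually_at_top_linorder)
  have "a \<le> b" using N.cdf_nondecreasing[of b a] a b by linarith
  then show ?thesis
    using IVT[of "cdf std_normal_distribution" a p b] a b isCont_cdf_std_normal by auto
qed

lemma cdf_diff_bounded:
  assumes "real_distribution F" "real_distribution G"
  shows "\<bar>cdf F x - cdf G x\<bar> \<le> 1"
proof -
  interpret F: real_distribution F by fact
  interpret G: real_distribution G by fact
  show ?thesis using F.cdf_nonneg[of x] F.cdf_bounded_prob[of x] G.cdf_nonneg[of x] G.cdf_bounded_prob[of x]
    by linarith
qed

lemma bdd_above_cdf_diff:
  assumes "real_distribution F" "real_distribution G"
  shows "bdd_above (range (\<lambda>x. \<bar>cdf F x - cdf G x\<bar>))"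
  using cdf_diff_bounded[OF assms] by (intro bdd_aboveI[of _ 1]) auto

text \<open>Polya's theorem. Between neighbouring points \<open>x\<^sub>i\<close> with \<open>\<Phi> x\<^sub>i = i / k\<close> both distribution functions
  are monotone and \<open>\<Phi>\<close> grows by \<open>1 / k\<close> only, so convergence at these points suffices.\<close>

lemma cdf_tendsto_std_normal_uniform:
  assumes F: "\<And>r. real_distribution (F r)"
    and lim: "\<And>x. (\<lambda>r. cdf (F r) x) \<longlonglongrightarrow> cdf std_normal_distribution x"
  shows "(\<lambda>r. SUP x. \<bar>cdf (F r) x - cdf std_normal_distribution x\<bar>) \<longlonglongrightarrow> 0"
proof (rule LIMSEQ_I)
  let ?P = "cdf std_normal_distribution"
  interpret N: real_distribution std_normal_distribution by (rule real_dist_normal_dist)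
  fix h :: real assume h: "h > 0"
  \<comment> \<open>A grid of mesh \<open>1 / k < h / 4\<close> in the values of \<open>\<Phi>\<close>.\<close>
  define k where "k = nat \<lceil>4 / h\<rceil> + 1"
  have k: "k > 0" "2 / real k < h"
  proof -
    have "4 / h \<le> real (nat \<lceil>4 / h\<rceil>)" by linarith
    then have "4 / h < real k" by (simp add: k_def)
    moreover show "k > 0" by (simp add: k_def)
    ultimately have "4 < h * real k" using h by (simp add: field_simps)
    then show "2 / real k < h" using \<open>k > 0\<close> by (simp add: pos_divide_less_eq)
  qed
  have "\<forall>i\<in>{1..<k}. \<exists>x. ?P x = real i / real k"
    using k by (intro ballI cdf_std_normal_attains) auto
  then obtain x where x: "\<And>i. i \<in> {1..<k} \<Longrightarrow> ?P (x i) = real i / real k" by metis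
  have "\<forall>\<^sub>F r in sequentially. \<bar>cdf (F r) (x i) - ?P (x i)\<bar> < h - 2 / real k" for i
    using tendstoD[OF lim, of "h - 2 / real k" "x i"] k by (simp add: dist_real_def)
  then have "\<forall>\<^sub>F r in sequentially. \<forall>i\<in>{1..<k}. \<bar>cdf (F r) (x i) - ?P (x i)\<bar> < h - 2 / real k"
    by (intro eventually_ball_finite) auto
  then have "\<forall>\<^sub>F r in sequentially. (SUP y. \<bar>cdf (F r) y - ?P y\<bar>) \<le> h - 1 / real k"
  proof eventually_elim
    case (elim r)
    interpret Fr: real_distribution "F r" by (rule F)
    show ?case
    proof (rule cSUP_least)
      fix y
      have py: "0 \<le> ?P y" "?P y \<le> 1" by (rule N.cdf_nonneg, rule N.cdf_bounded_prob)
      have up: "cdf (F r) y - ?P y \<le> h - 1 / real k"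
      proof (cases "nat \<lfloor>real k * ?P y\<rfloor> + 1 < k")
        case True
        \<comment> \<open>The next grid point above \<open>y\<close>.\<close>
        define i where "i = nat \<lfloor>real k * ?P y\<rfloor> + 1"
        have i: "i \<in> {1..<k}" "real k * ?P y < real i" "real i \<le> real k * ?P y + 1"
        proof -
          have "real_of_int \<lfloor>real k * ?P y\<rfloor> = real (nat \<lfloor>real k * ?P y\<rfloor>)" using py by simp
          then show "real k * ?P y < real i" "real i \<le> real k * ?P y + 1" unfolding i_def by linarith+
        qed (use True in \<open>auto simp: i_def\<close>)
        have "?P y < real i / real k" "real i / real k \<le> ?P y + 1 / real k"
          using i(2,3) k(1) by (simp_all add: pos_less_divide_eq pos_divide_le_eq algebra_simps)
        then have le: "?P y < ?P (x i)" "?P (x i) \<le> ?P y + 1 / real k" using x[OF i(1)] by simp_all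
        then have "y \<le> x i" using N.cdf_nondecreasing[of "x i" y] by linarith
        then have "cdf (F r) y \<le> cdf (F r) (x i)" by (rule Fr.cdf_nondecreasing)
        then show ?thesis using elim i(1) le by (smt (verit) add_divide_distrib)
      next
        case False
        have "real k \<le> real k * ?P y + 1"
        proof -
          have "real_of_int \<lfloor>real k * ?P y\<rfloor> = real (nat \<lfloor>real k * ?P y\<rfloor>)" using py by simp
          then show ?thesis using False by linarith
        qed
        then have "1 - 1 / real k \<le> ?P y" using k by (simp add: field_simps)
        moreover have "2 / real k = 1 / real k + 1 / real k" by simp
        ultimately show ?thesis using Fr.cdf_bounded_prob[of y] k by linarith
      qed
      have lo: "?P y - cdf (F r) y \<le> h - 1 / real k"
      proof (cases "\<lceil>real k * ?P y\<rceil> - 1 \<ge> 1")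
        case True
        \<comment> \<open>The last grid point below \<open>y\<close>.\<close>
        define i where "i = nat (\<lceil>real k * ?P y\<rceil> - 1)"
        have ri: "real i = real_of_int \<lceil>real k * ?P y\<rceil> - 1" using True by (simp add: i_def)
        have "real i < real k * ?P y" "real k * ?P y \<le> real i + 1" using ri by linarith+
        moreover have "real k * ?P y \<le> real k" using py k by (simp add: mult_left_le)
        moreover have "i \<ge> 1" using True ri by linarith
        ultimately have i: "i \<in> {1..<k}" "real i < real k * ?P y" "real k * ?P y \<le> real i + 1" by auto
        have "real i / real k < ?P y" "?P y \<le> real i / real k + 1 / real k"
          using i(2,3) k(1) by (simp_all add: pos_le_divide_eq pos_divide_less_eq algebra_simps flip: add_divide_distrib)
        then have le: "?P (x i) < ?P y" "?P y \<le> ?P (x i) + 1 / real k" using x[OF i(1)] by simp_all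
        then have "x i \<le> y" using N.cdf_nondecreasing[of y "x i"] by linarith
        then have "cdf (F r) (x i) \<le> cdf (F r) y" by (rule Fr.cdf_nondecreasing)
        then show ?thesis using elim i(1) le by (smt (verit) add_divide_distrib)
      next
        case False
        then have "real k * ?P y \<le> 1" by linarith
        then have "?P y \<le> 1 / real k" using k by (simp add: field_simps)
        moreover have "2 / real k = 1 / real k + 1 / real k" by simp
        ultimately show ?thesis using Fr.cdf_nonneg[of y] k by linarith
      qed
      show "\<bar>cdf (F r) y - ?P y\<bar> \<le> h - 1 / real k" using up lo by linarith
    qed simp
  qed
  then obtain r0 where r0: "\<And>r. r \<ge> r0 \<Longrightarrow> (SUP y. \<bar>cdf (F r) y - ?P y\<bar>) \<le> h - 1 / real k"
    by (auto simp: eventually_sequentially)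
  have "norm ((SUP y. \<bar>cdf (F r) y - ?P y\<bar>) - 0) < h" if "r \<ge> r0" for r
  proof -
    have "\<bar>cdf (F r) 0 - ?P 0\<bar> \<le> (SUP y. \<bar>cdf (F r) y - ?P y\<bar>)"
      by (rule cSUP_upper[OF _ bdd_above_cdf_diff[OF F real_dist_normal_dist]]) simp
    then have "0 \<le> (SUP y. \<bar>cdf (F r) y - ?P y\<bar>)" by linarith
    moreover have "0 < 1 / real k" using k by simp
    ultimately have "\<bar>SUP y. \<bar>cdf (F r) y - ?P y\<bar>\<bar> < h" using r0[OF that] by linarith
    then show ?thesis by simp
  qed
  then show "\<exists>no. \<forall>r\<ge>no. norm ((SUP y. \<bar>cdf (F r) y - ?P y\<bar>) - 0) < h" by blast
qed

section \<open>Linear statistics of a uniformly random permutation\<close>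

text \<open>The expectation under the uniform distribution on a finite set, as a plain sum: sums over
  permutations can be reindexed by bijections, and the values may be complex.\<close>

definition average :: "'a set \<Rightarrow> ('a \<Rightarrow> 'b) \<Rightarrow> 'b::real_normed_field" where
  "average A f = (\<Sum>x\<in>A. f x) / of_nat (card A)"

lemma average_add: "average A (\<lambda>x. f x + g x) = average A f + average A g"
  by (simp add: average_def sum.distrib add_divide_distrib)

lemma average_diff: "average A (\<lambda>x. f x - g x) = average A f - average A g"
  by (simp add: average_def sum_subtractf diff_divide_distrib)

lemma average_cmult: "average A (\<lambda>x. c * f x) = c * average A f"
  by (simp add: average_def sum_distrib_left)

lemma average_const: "finite A \<Longrightarrow> A \<noteq> {} \<Longrightarrow> average A (\<lambda>x. c) = c"
  by (simp add: average_def)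

lemma average_cong: "(\<And>x. x \<in> A \<Longrightarrow> f x = g x) \<Longrightarrow> average A f = average A g"
  by (simp add: average_def)

lemma average_mono: "(\<And>x. x \<in> A \<Longrightarrow> f x \<le> (g x :: real)) \<Longrightarrow> average A f \<le> average A g"
  unfolding average_def by (intro divide_right_mono sum_mono) auto

lemma norm_average_le: "norm (average A f) \<le> average A (\<lambda>x. norm (f x))"
  unfolding average_def norm_divide norm_of_nat of_nat_id
  by (intro divide_right_mono norm_sum) auto

lemma average_Times:
  assumes "finite A" "finite B"
  shows "average (A \<times> B) (\<lambda>x. f (fst x) * g (snd x)) = average A f * average B g"
  by (simp add: average_def sum_product sum.cartesian_product card_cartesian_product case_prod_beta)

lemma integral_pmf_of_set_average:
  fixes f :: "'a \<Rightarrow> 'b::{banach, second_countable_topology, real_normed_field}"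
  assumes "finite A" "A \<noteq> {}"
  shows "(LINT x|measure_pmf (pmf_of_set A). f x) = average A f"
  using assms by (subst integral_measure_pmf[of A])
    (auto simp: average_def scaleR_conv_of_real sum_divide_distrib field_simps)

lemma finite_Sn: "finite (Sn N)" and Sn_nonempty: "Sn N \<noteq> {}"
  by (auto simp: Sn_def finite_permutations intro!: exI[of _ id] permutes_id)

lemma sum_permutes: "p \<in> Sn N \<Longrightarrow> (\<Sum>m=1..N. f (p m)) = (\<Sum>m=1..N. f m)"
  using sum.permute[of p "{1..N}" f] by (simp add: Sn_def o_def)

lemma Sn_in: "p \<in> Sn N \<Longrightarrow> m \<in> {1..N} \<Longrightarrow> p m \<in> {1..N}"
  by (simp add: Sn_def permutes_in_image del: atLeastAtMost_iff)

text \<open>Swapping an entry of the first block with one of the second block leaves the uniform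
  distribution invariant and exchanges \<open>W\<close> with \<open>W + \<Delta>\<close>. This is an exchangeable pair in the sense
  of Stein; the drift of \<open>W\<close> is linear because the scores are centred.\<close>

lemma stein_identity:
  fixes y :: "nat \<Rightarrow> real" and g :: "real \<Rightarrow> 'b::real_normed_field"
  assumes y0: "(\<Sum>m=1..n2+n3. y m) = 0"
  defines "W \<equiv> \<lambda>p::nat \<Rightarrow> nat. \<Sum>m=1..n2. y (p m)"
  shows "of_nat (n2 + n3) * average (Sn (n2+n3)) (\<lambda>p. of_real (W p) * g (W p)) =
    average (Sn (n2+n3)) (\<lambda>p. \<Sum>i=1..n2. \<Sum>j=n2+1..n2+n3. of_real (y (p j) - y (p i)) *
       (g (W p + (y (p j) - y (p i))) - g (W p))) / 2"
proof -
  let ?N = "n2 + n3"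
  \<comment> \<open>Transposing positions \<open>i\<close> and \<open>j\<close> is an involution of the permutations that negates the summand.\<close>
  have swap: "(\<Sum>p\<in>Sn ?N. of_real (y (p i) - y (p j)) * (g (W p) + g (W p + (y (p j) - y (p i))))) = 0"
    if i: "i \<in> {1..n2}" and j: "j \<in> {n2+1..?N}" for i j
  proof -
    let ?t = "Transposition.transpose i j"
    let ?F = "\<lambda>p. of_real (y (p i) - y (p j)) * (g (W p) + g (W p + (y (p j) - y (p i))))"
    have t: "?t permutes {1..?N}" using i j by (intro permutes_swap_id) auto
    have inv: "p \<circ> ?t \<circ> ?t = p" for p :: "nat \<Rightarrow> nat" by (auto simp: fun_eq_iff transpose_def)
    have W': "W (p \<circ> ?t) = W p + (y (p j) - y (p i))" for p
    proof -
      have "W (p \<circ> ?t) = y (p j) + (\<Sum>m\<in>{1..n2} - {i}. y (p (?t m)))"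
        unfolding W_def using i by (subst sum.remove[of _ i]) auto
      also have "(\<Sum>m\<in>{1..n2} - {i}. y (p (?t m))) = (\<Sum>m\<in>{1..n2} - {i}. y (p m))"
        using i j by (intro sum.cong) (auto simp: transpose_def)
      also have "\<dots> = W p - y (p i)" unfolding W_def using i by (subst sum.remove[of _ i]) auto
      finally show ?thesis by linarith
    qed
    have "(\<Sum>p\<in>Sn ?N. ?F p) = (\<Sum>p\<in>Sn ?N. ?F (p \<circ> ?t))"
      by (rule sum.reindex_bij_witness[of _ "\<lambda>p. p \<circ> ?t" "\<lambda>p. p \<circ> ?t"])
        (use t in \<open>auto simp: Sn_def inv intro: permutes_compose\<close>)
    also have "\<dots> = (\<Sum>p\<in>Sn ?N. - ?F p)"
      by (rule sum.cong) (simp_all add: W' algebra_simps)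
    finally have "(\<Sum>p\<in>Sn ?N. ?F p) + (\<Sum>p\<in>Sn ?N. ?F p) = 0" by (simp add: sum_negf)
    then show ?thesis by (simp flip: mult_2)
  qed
  \<comment> \<open>Centred scores make the second block sum up to \<open>- W\<close>, so the mean increment is linear in \<open>W\<close>.\<close>
  have drift: "(\<Sum>i=1..n2. \<Sum>j=n2+1..?N. y (p i) - y (p j)) = real ?N * W p" if "p \<in> Sn ?N" for p
  proof -
    have "(\<Sum>m=1..n2. y (p m)) + (\<Sum>m=n2+1..?N. y (p m)) = (\<Sum>m=1..?N. y (p m))"
      by (rule sum.ub_add_nat[symmetric]) simp
    also have "\<dots> = 0" using sum_permutes[OF that, of y] y0 by simp
    finally have "(\<Sum>m=n2+1..?N. y (p m)) = - W p" by (simp add: W_def)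
    moreover have "(\<Sum>i=1..n2. \<Sum>j=n2+1..?N. y (p i) - y (p j)) = real n3 * (\<Sum>i=1..n2. y (p i)) - real n2 * (\<Sum>j=n2+1..?N. y (p j))"
      by (simp add: sum_subtractf sum_distrib_left)
    ultimately have "(\<Sum>i=1..n2. \<Sum>j=n2+1..?N. y (p i) - y (p j)) = real n3 * W p + real n2 * W p"
      unfolding W_def by simp
    then show ?thesis by (simp add: algebra_simps)
  qed
  let ?S = "\<Sum>p\<in>Sn ?N. \<Sum>i=1..n2. \<Sum>j=n2+1..?N. of_real (y (p i) - y (p j)) * g (W p)"
  let ?S' = "\<Sum>p\<in>Sn ?N. \<Sum>i=1..n2. \<Sum>j=n2+1..?N. of_real (y (p i) - y (p j)) * g (W p + (y (p j) - y (p i)))"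
  have "?S + ?S' = (\<Sum>i=1..n2. \<Sum>j=n2+1..?N. \<Sum>p\<in>Sn ?N.
      of_real (y (p i) - y (p j)) * (g (W p) + g (W p + (y (p j) - y (p i)))))"
    by (simp add: sum.distrib distrib_left sum.swap[of _ "Sn ?N"])
  also have "\<dots> = 0" using swap by simp
  finally have SS': "?S' = - ?S" by (rule minus_unique[symmetric])
  have "?S = (\<Sum>p\<in>Sn ?N. of_nat ?N * (of_real (W p) * g (W p)))"
  proof (rule sum.cong[OF refl])
    fix p assume p: "p \<in> Sn ?N"
    have "(\<Sum>i=1..n2. \<Sum>j=n2+1..?N. of_real (y (p i) - y (p j)) * g (W p))
       = of_real (\<Sum>i=1..n2. \<Sum>j=n2+1..?N. y (p i) - y (p j)) * g (W p)"
      by (simp add: sum_distrib_right)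
    then show "(\<Sum>i=1..n2. \<Sum>j=n2+1..?N. of_real (y (p i) - y (p j)) * g (W p)) = of_nat ?N * (of_real (W p) * g (W p))"
      unfolding drift[OF p] by simp
  qed
  also have "\<dots> = of_nat ?N * (\<Sum>p\<in>Sn ?N. of_real (W p) * g (W p))" by (simp add: sum_distrib_left)
  finally have S: "?S = of_nat ?N * (\<Sum>p\<in>Sn ?N. of_real (W p) * g (W p))" .
  have "(\<Sum>p\<in>Sn ?N. \<Sum>i=1..n2. \<Sum>j=n2+1..?N. of_real (y (p j) - y (p i)) *
       (g (W p + (y (p j) - y (p i))) - g (W p))) = ?S - ?S'"
    by (simp add: sum_subtractf[symmetric] algebra_simps)
  also have "\<dots> = 2 * (of_nat ?N * (\<Sum>p\<in>Sn ?N. of_real (W p) * g (W p)))" using SS' S by simp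
  finally show ?thesis unfolding average_def by simp
qed

text \<open>The conditional second moment of the increment of the exchangeable pair. It depends on the
  permutation only through the share of the squares in the first block and through \<open>W\<^sup>2\<close>.\<close>

lemma stein_pairs_square:
  fixes y :: "nat \<Rightarrow> real"
  assumes "(\<Sum>m=1..n2+n3. y m) = 0" "p \<in> Sn (n2+n3)"
  shows "(\<Sum>i=1..n2. \<Sum>j=n2+1..n2+n3. (y (p j) - y (p i))\<^sup>2) =
    real n3 * (\<Sum>m=1..n2. (y (p m))\<^sup>2) + real n2 * (\<Sum>m=n2+1..n2+n3. (y (p m))\<^sup>2) + 2 * (\<Sum>m=1..n2. y (p m))\<^sup>2"
proof -
  have "(\<Sum>m=1..n2. y (p m)) + (\<Sum>m=n2+1..n2+n3. y (p m)) = (\<Sum>m=1..n2+n3. y (p m))"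
    by (rule sum.ub_add_nat[symmetric]) simp
  also have "\<dots> = 0" using sum_permutes[OF assms(2), of y] assms by simp
  finally have B: "(\<Sum>m=n2+1..n2+n3. y (p m)) = - (\<Sum>m=1..n2. y (p m))" by simp
  have "(\<Sum>i=1..n2. \<Sum>j=n2+1..n2+n3. (y (p j) - y (p i))\<^sup>2) =
     (\<Sum>i=1..n2. \<Sum>j=n2+1..n2+n3. (y (p j))\<^sup>2 + (y (p i))\<^sup>2 - 2 * (y (p i) * y (p j)))"
    by (intro sum.cong) (auto simp: power2_diff)
  also have "\<dots> = real n2 * (\<Sum>m=n2+1..n2+n3. (y (p m))\<^sup>2) + real n3 * (\<Sum>m=1..n2. (y (p m))\<^sup>2)
     - 2 * ((\<Sum>m=1..n2. y (p m)) * (\<Sum>m=n2+1..n2+n3. y (p m)))"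
    by (simp add: sum.distrib sum_subtractf sum_product flip: sum_distrib_left)
  finally show ?thesis unfolding B by (simp add: power2_eq_square)
qed

text \<open>The identity as test function: the exchangeable pair gives the variance of \<open>W\<close>.\<close>

lemma perm_second_moment_eq:
  fixes y :: "nat \<Rightarrow> real"
  assumes y0: "(\<Sum>m=1..n2+n3. y m) = 0"
  shows "real (n2 + n3) * average (Sn (n2+n3)) (\<lambda>p. (\<Sum>m=1..n2. y (p m))\<^sup>2) =
     average (Sn (n2+n3)) (\<lambda>p. \<Sum>i=1..n2. \<Sum>j=n2+1..n2+n3. (y (p j) - y (p i))\<^sup>2) / 2"
  using stein_identity[OF y0, of "\<lambda>x. x::real"] by (simp add: power2_eq_square)

text \<open>A crude bound for the variance, from \<open>(x - y)\<^sup>2 \<le> 2 x\<^sup>2 + 2 y\<^sup>2\<close>; the true value is smaller by the factor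
  \<open>n2 n3 / (N (N - 1))\<close>.\<close>

lemma perm_second_moment_le:
  fixes y :: "nat \<Rightarrow> real"
  assumes y0: "(\<Sum>m=1..n2+n3. y m) = 0" and n: "2 \<le> n2" "2 \<le> n3"
  shows "average (Sn (n2+n3)) (\<lambda>p. (\<Sum>m=1..n2. y (p m))\<^sup>2) \<le> (\<Sum>m=1..n2+n3. (y m)\<^sup>2)"
proof -
  let ?V = "\<Sum>m=1..n2+n3. (y m)\<^sup>2"
  have "average (Sn (n2+n3)) (\<lambda>p. \<Sum>i=1..n2. \<Sum>j=n2+1..n2+n3. (y (p j) - y (p i))\<^sup>2)
     \<le> average (Sn (n2+n3)) (\<lambda>p. 2 * real (n2 + n3) * ?V)"
  proof (rule average_mono)
    fix p assume p: "p \<in> Sn (n2+n3)"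
    have V: "(\<Sum>m=1..n2. (y (p m))\<^sup>2) + (\<Sum>m=n2+1..n2+n3. (y (p m))\<^sup>2) = ?V"
      using sum_permutes[OF p, of "\<lambda>m. (y m)\<^sup>2"] sum.ub_add_nat[of 1 n2 "\<lambda>m. (y (p m))\<^sup>2" n3] by simp
    have "(\<Sum>i=1..n2. \<Sum>j=n2+1..n2+n3. (y (p j) - y (p i))\<^sup>2)
      \<le> (\<Sum>i=1..n2. \<Sum>j=n2+1..n2+n3. 2 * (y (p i))\<^sup>2 + 2 * (y (p j))\<^sup>2)"
    proof (intro sum_mono)
      fix i j
      have "0 \<le> (y (p i) + y (p j))\<^sup>2" by simp
      then show "(y (p j) - y (p i))\<^sup>2 \<le> 2 * (y (p i))\<^sup>2 + 2 * (y (p j))\<^sup>2"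
        by (simp add: power2_eq_square algebra_simps)
    qed
    also have "\<dots> = 2 * (real n3 * (\<Sum>m=1..n2. (y (p m))\<^sup>2)) + 2 * (real n2 * (\<Sum>m=n2+1..n2+n3. (y (p m))\<^sup>2))"
      by (simp add: sum.distrib flip: sum_distrib_left)
    also have "\<dots> \<le> 2 * (real n3 * ?V) + 2 * (real n2 * ?V)"
      unfolding V[symmetric] by (intro add_mono mult_left_mono) (auto intro!: sum_nonneg)
    finally show "(\<Sum>i=1..n2. \<Sum>j=n2+1..n2+n3. (y (p j) - y (p i))\<^sup>2) \<le> 2 * real (n2 + n3) * ?V"
      by (simp add: algebra_simps)
  qed
  then have "real (n2 + n3) * average (Sn (n2+n3)) (\<lambda>p. (\<Sum>m=1..n2. y (p m))\<^sup>2) \<le> real (n2 + n3) * ?V"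
    unfolding perm_second_moment_eq[OF y0] average_const[OF finite_Sn Sn_nonempty] mult.assoc by linarith
  then show ?thesis using n by (simp add: mult_le_cancel_left_pos)
qed

text \<open>The share of the total sum of squares that falls into the first block concentrates around
  \<open>n2 / N\<close>: it is itself a centred linear permutation statistic, with scores \<open>y\<^sup>2 - 1 / N\<close>.\<close>

lemma perm_square_share:
  fixes y :: "nat \<Rightarrow> real"
  assumes y2: "(\<Sum>m=1..n2+n3. (y m)\<^sup>2) = 1" and n: "2 \<le> n2" "2 \<le> n3"
    and \<delta>: "\<And>m. m \<in> {1..n2+n3} \<Longrightarrow> \<bar>y m\<bar> \<le> \<delta>"
  shows "average (Sn (n2+n3)) (\<lambda>p. ((\<Sum>m=1..n2. (y (p m))\<^sup>2) - real n2 / real (n2 + n3))\<^sup>2) \<le> \<delta>\<^sup>2"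
proof -
  define w where "w m = (y m)\<^sup>2 - 1 / real (n2 + n3)" for m
  have w0: "(\<Sum>m=1..n2+n3. w m) = 0" using y2 n by (simp add: w_def sum_subtractf)
  have eq: "(\<Sum>m=1..n2. w (p m)) = (\<Sum>m=1..n2. (y (p m))\<^sup>2) - real n2 / real (n2 + n3)" for p
    by (simp add: w_def sum_subtractf)
  have "(\<Sum>m=1..n2+n3. (w m)\<^sup>2) \<le> (\<Sum>m=1..n2+n3. \<delta>\<^sup>2 * (y m)\<^sup>2 - 2 / real (n2 + n3) * (y m)\<^sup>2 + (1 / real (n2 + n3))\<^sup>2)"
  proof (rule sum_mono)
    fix m assume "m \<in> {1..n2+n3}"
    then have "(y m)\<^sup>2 \<le> \<delta>\<^sup>2" using \<delta>[of m] by (simp add: abs_le_square_iff[symmetric])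
    then have "(y m)\<^sup>2 * (y m)\<^sup>2 \<le> \<delta>\<^sup>2 * (y m)\<^sup>2" by (intro mult_right_mono) auto
    then show "(w m)\<^sup>2 \<le> \<delta>\<^sup>2 * (y m)\<^sup>2 - 2 / real (n2 + n3) * (y m)\<^sup>2 + (1 / real (n2 + n3))\<^sup>2"
      by (simp add: w_def power2_eq_square algebra_simps)
  qed
  also have "\<dots> = \<delta>\<^sup>2 - 2 / real (n2 + n3) + real (n2 + n3) * (1 / real (n2 + n3))\<^sup>2"
    by (simp only: sum.distrib sum_subtractf y2 flip: sum_distrib_left) simp
  also have "\<dots> \<le> \<delta>\<^sup>2" using n by (simp add: power2_eq_square)
  finally show ?thesis using perm_second_moment_le[OF w0 n] unfolding eq by linarith
qed

text \<open>Taylor expansion of \<open>e\<^sup>i\<^sup>s\<^sup>x\<close> at \<open>w\<close>, multiplied by the increment \<open>d\<close>.\<close>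

lemma iexp_increment_bound: "norm (of_real d * (iexp (s * (w + d)) - iexp (s * w)) - \<i> * of_real s * of_real (d\<^sup>2) * iexp (s * w))
    \<le> s\<^sup>2 * \<bar>d\<bar> * d\<^sup>2 / 2"
proof -
  have "iexp (s * (w + d)) = iexp (s * w) * iexp (s * d)" by (simp add: algebra_simps flip: exp_add)
  then have "of_real d * (iexp (s * (w + d)) - iexp (s * w)) - \<i> * of_real s * of_real (d\<^sup>2) * iexp (s * w)
    = of_real d * iexp (s * w) * (iexp (s * d) - (1 + \<i> * of_real (s * d)))"
    by (simp add: algebra_simps power2_eq_square)
  then have "norm (of_real d * (iexp (s * (w + d)) - iexp (s * w)) - \<i> * of_real s * of_real (d\<^sup>2) * iexp (s * w))
    = \<bar>d\<bar> * norm (iexp (s * d) - (1 + \<i> * of_real (s * d)))"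
    by (simp add: norm_mult)
  also have "\<dots> \<le> \<bar>d\<bar> * (\<bar>s * d\<bar>\<^sup>2 / 2)"
    using iexp_approx1[of "s * d" 1] by (intro mult_left_mono) (auto simp: numeral_2_eq_2)
  also have "\<dots> = s\<^sup>2 * \<bar>d\<bar> * d\<^sup>2 / 2" by (simp add: power_mult_distrib)
  finally show ?thesis .
qed

text \<open>The characteristic function \<open>\<phi>\<close> of \<open>W\<close> almost solves \<open>\<phi>' s = - v s \<phi> s\<close> with \<open>v = n2 n3 / N\<^sup>2\<close>:
  apply the exchangeable pair to \<open>x \<mapsto> e\<^sup>i\<^sup>s\<^sup>x\<close> and expand the increment to second order.\<close>

lemma perm_char_differential_equation:
  fixes y :: "nat \<Rightarrow> real"
  assumes y0: "(\<Sum>m=1..n2+n3. y m) = 0" and y2: "(\<Sum>m=1..n2+n3. (y m)\<^sup>2) = 1"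
    and n: "2 \<le> n2" "2 \<le> n3" and \<delta>0: "\<delta> > 0"
    and \<delta>: "\<And>m. m \<in> {1..n2+n3} \<Longrightarrow> \<bar>y m\<bar> \<le> \<delta>"
  defines "W \<equiv> \<lambda>p::nat \<Rightarrow> nat. \<Sum>m=1..n2. y (p m)"
    and "v \<equiv> real n2 * real n3 / (real (n2 + n3))\<^sup>2"
  shows "norm (average (Sn (n2+n3)) (\<lambda>p. of_real (W p) * iexp (s * W p))
     - \<i> * of_real (s * v) * average (Sn (n2+n3)) (\<lambda>p. iexp (s * W p))) \<le> \<bar>s\<bar> * (\<delta> + 1 / real (n2+n3)) + s\<^sup>2 * \<delta>"
proof -
  let ?N = "n2 + n3"
  let ?av = "average (Sn ?N)" and ?avc = "average (Sn ?N)"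
  have N: "real ?N > 0" using n by simp
  define Q where "Q p = (\<Sum>i=1..n2. \<Sum>j=n2+1..?N. (y (p j) - y (p i))\<^sup>2)" for p
  define a where "a p = (\<Sum>m=1..n2. (y (p m))\<^sup>2) - real n2 / real ?N" for p
  have W2: "?av (\<lambda>p. (W p)\<^sup>2) \<le> 1" unfolding W_def using perm_second_moment_le[OF y0 n] y2 by simp
  have avQ: "?av Q = 2 * real ?N * ?av (\<lambda>p. (W p)\<^sup>2)"
    using perm_second_moment_eq[OF y0] unfolding W_def Q_def[abs_def] mult.assoc by linarith
  \<comment> \<open>\<open>Q / (2 N)\<close> plays the role of the variance \<open>v\<close>; its fluctuation comes from \<open>a\<close>, the deviation of the share of squares, and from \<open>W\<^sup>2\<close>.\<close>
  have Qeq: "Q p / (2 * real ?N) - v = ((real n3 - real n2) * a p + 2 * (W p)\<^sup>2) / (2 * real ?N)"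
    if p: "p \<in> Sn ?N" for p
  proof -
    have "(\<Sum>m=1..n2. (y (p m))\<^sup>2) + (\<Sum>m=n2+1..n2+n3. (y (p m))\<^sup>2) = 1"
      using sum_permutes[OF p, of "\<lambda>m. (y m)\<^sup>2"] sum.ub_add_nat[of 1 n2 "\<lambda>m. (y (p m))\<^sup>2" n3] y2 by simp
    then have B: "(\<Sum>m=n2+1..n2+n3. (y (p m))\<^sup>2) = 1 - (\<Sum>m=1..n2. (y (p m))\<^sup>2)" by simp
    have A: "(\<Sum>m=1..n2. (y (p m))\<^sup>2) = a p + real n2 / real ?N" by (simp add: a_def)
    define x where "x = real n2 / real ?N"
    have "real n2 * (1 - x) = real n3 * x" using N by (simp add: x_def field_simps)
    moreover have "Q p = real n3 * (a p + x) + real n2 * (1 - (a p + x)) + 2 * (W p)\<^sup>2"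
      unfolding Q_def stein_pairs_square[OF y0 p] W_def A B x_def by simp
    moreover have "real n3 * (a p + x) + real n2 * (1 - (a p + x)) = (real n3 - real n2) * a p + real n3 * x + real n2 * (1 - x)"
      by (simp add: algebra_simps)
    ultimately have "Q p = (real n3 - real n2) * a p + 2 * (real n3 * x) + 2 * (W p)\<^sup>2"
      by linarith
    moreover have "real n3 * x / real ?N = v" by (simp add: x_def v_def power2_eq_square)
    ultimately have "Q p / (2 * real ?N) - v = ((real n3 - real n2) * a p + 2 * (real n3 * x) + 2 * (W p)\<^sup>2) / (2 * real ?N)
        - real n3 * x / real ?N" by simp
    moreover have "2 * (real n3 * x) / (2 * real ?N) = real n3 * x / real ?N"
      by (rule mult_divide_mult_cancel_left) simp
    moreover have "l = b + c" if "l = b + d + c - e" "d = e" for l b c d e :: real using that by simp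
    ultimately show ?thesis unfolding add_divide_distrib by blast
  qed
  have a1: "?av (\<lambda>p. \<bar>a p\<bar>) \<le> \<delta>"
  proof -
    have "?av (\<lambda>p. \<bar>a p\<bar>) \<le> ?av (\<lambda>p. (a p)\<^sup>2 / (2 * \<delta>) + \<delta> / 2)"
    proof (rule average_mono)
      fix p
      have "0 \<le> (\<bar>a p\<bar> - \<delta>)\<^sup>2" by simp
      then have "2 * \<bar>a p\<bar> * \<delta> \<le> (a p)\<^sup>2 + \<delta>\<^sup>2" by (simp add: power2_diff)
      then show "\<bar>a p\<bar> \<le> (a p)\<^sup>2 / (2 * \<delta>) + \<delta> / 2" using \<delta>0 by (simp add: field_simps power2_eq_square)
    qed
    also have "\<dots> = ?av (\<lambda>p. (a p)\<^sup>2) / (2 * \<delta>) + \<delta> / 2"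
      using average_cmult[of "Sn ?N" "1 / (2 * \<delta>)" "\<lambda>p. (a p)\<^sup>2"]
      by (simp add: average_add average_const finite_Sn Sn_nonempty)
    also have "\<dots> \<le> \<delta>\<^sup>2 / (2 * \<delta>) + \<delta> / 2"
      using perm_square_share[OF y2 n \<delta>] \<delta>0 by (intro add_mono divide_right_mono) (auto simp: a_def)
    also have "\<dots> = \<delta>" using \<delta>0 by (simp add: power2_eq_square)
    finally show ?thesis .
  qed
  \<comment> \<open>Here \<open>\<bar>n3 - n2\<bar> \<le> 2 N\<close> and the second moment bound for \<open>W\<close> enter.\<close>
  have dev: "?av (\<lambda>p. \<bar>Q p / (2 * real ?N) - v\<bar>) \<le> \<delta> + 1 / real ?N"
  proof -
    have "?av (\<lambda>p. \<bar>Q p / (2 * real ?N) - v\<bar>) \<le> ?av (\<lambda>p. \<bar>a p\<bar> + 1 / real ?N * (W p)\<^sup>2)"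
    proof (rule average_mono)
      fix p assume p: "p \<in> Sn ?N"
      have "\<bar>(real n3 - real n2) * a p + 2 * (W p)\<^sup>2\<bar> \<le> \<bar>real n3 - real n2\<bar> * \<bar>a p\<bar> + 2 * (W p)\<^sup>2"
        by (rule order.trans[OF abs_triangle_ineq]) (simp add: abs_mult)
      also have "\<dots> \<le> (2 * real ?N) * \<bar>a p\<bar> + 2 * (W p)\<^sup>2" by (intro add_mono mult_right_mono) auto
      finally have le: "\<bar>(real n3 - real n2) * a p + 2 * (W p)\<^sup>2\<bar> \<le> (2 * real ?N) * \<bar>a p\<bar> + 2 * (W p)\<^sup>2" .
      have divide: "u / (2 * M) \<le> b + 1 / M * w" if "u \<le> (2 * M) * b + 2 * w" "M > 0" for u M b w :: real
        using that by (simp add: field_simps)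
      have "\<bar>2 * real ?N\<bar> = 2 * real ?N" by simp
      then show "\<bar>Q p / (2 * real ?N) - v\<bar> \<le> \<bar>a p\<bar> + 1 / real ?N * (W p)\<^sup>2"
        unfolding Qeq[OF p] abs_divide by (simp only: divide[OF le N])
    qed
    also have "\<dots> = ?av (\<lambda>p. \<bar>a p\<bar>) + 1 / real ?N * ?av (\<lambda>p. (W p)\<^sup>2)"
      by (simp only: average_add average_cmult)
    also have "\<dots> \<le> \<delta> + 1 / real ?N * 1" using a1 W2 N by (intro add_mono mult_left_mono) auto
    finally show ?thesis by simp
  qed
  define R where "R p = (\<Sum>i=1..n2. \<Sum>j=n2+1..?N. of_real (y (p j) - y (p i)) *
       (iexp (s * (W p + (y (p j) - y (p i)))) - iexp (s * W p)))" for p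
  have R: "norm (R p - \<i> * of_real s * of_real (Q p) * iexp (s * W p)) \<le> s\<^sup>2 * \<delta> * Q p" if p: "p \<in> Sn ?N" for p
  proof -
    have eq: "R p - \<i> * of_real s * of_real (Q p) * iexp (s * W p) = (\<Sum>i=1..n2. \<Sum>j=n2+1..?N. of_real (y (p j) - y (p i)) *
       (iexp (s * (W p + (y (p j) - y (p i)))) - iexp (s * W p)) - \<i> * of_real s * of_real ((y (p j) - y (p i))\<^sup>2) * iexp (s * W p))"
      unfolding R_def Q_def by (simp add: sum_subtractf sum_distrib_left sum_distrib_right mult.assoc)
    have "norm (R p - \<i> * of_real s * of_real (Q p) * iexp (s * W p))
        \<le> (\<Sum>i=1..n2. \<Sum>j=n2+1..?N. s\<^sup>2 * \<delta> * (y (p j) - y (p i))\<^sup>2)"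
      unfolding eq
    proof (intro sum_norm_le)
      fix i j assume ij: "i \<in> {1..n2}" "j \<in> {n2+1..?N}"
      let ?d = "y (p j) - y (p i)"
      have pm: "p i \<in> {1..?N}" "p j \<in> {1..?N}" using Sn_in[OF p, of i] Sn_in[OF p, of j] ij by auto
      have "\<bar>?d\<bar> \<le> 2 * \<delta>" using \<delta>[OF pm(1)] \<delta>[OF pm(2)] by linarith
      then have "s\<^sup>2 * \<bar>?d\<bar> * ?d\<^sup>2 / 2 \<le> s\<^sup>2 * (2 * \<delta>) * ?d\<^sup>2 / 2"
        by (intro divide_right_mono mult_right_mono mult_left_mono) auto
      then show "norm (of_real ?d * (iexp (s * (W p + ?d)) - iexp (s * W p)) - \<i> * of_real s * of_real (?d\<^sup>2) * iexp (s * W p))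
         \<le> s\<^sup>2 * \<delta> * ?d\<^sup>2"
        using iexp_increment_bound[of ?d s "W p"] by simp
    qed
    also have "\<dots> = s\<^sup>2 * \<delta> * Q p" by (simp only: Q_def sum_distrib_left)
    finally show ?thesis .
  qed
  have stein: "of_nat ?N * ?avc (\<lambda>p. of_real (W p) * iexp (s * W p)) = ?avc R / 2"
    using stein_identity[OF y0, of "\<lambda>x. iexp (s * x)"] by (simp add: W_def R_def[abs_def])
  have "norm (?avc R - \<i> * of_real s * ?avc (\<lambda>p. of_real (Q p) * iexp (s * W p))) \<le> s\<^sup>2 * \<delta> * (2 * real ?N)"
  proof -
    have eq: "?avc R - \<i> * of_real s * ?avc (\<lambda>p. of_real (Q p) * iexp (s * W p)) =
      ?avc (\<lambda>p. R p - \<i> * of_real s * of_real (Q p) * iexp (s * W p))"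
      by (simp add: average_diff mult.assoc average_cmult)
    have "norm (?avc R - \<i> * of_real s * ?avc (\<lambda>p. of_real (Q p) * iexp (s * W p)))
        \<le> ?av (\<lambda>p. norm (R p - \<i> * of_real s * of_real (Q p) * iexp (s * W p)))"
      unfolding eq by (rule norm_average_le)
    also have "\<dots> \<le> ?av (\<lambda>p. s\<^sup>2 * \<delta> * Q p)" by (intro average_mono R)
    also have "\<dots> = s\<^sup>2 * \<delta> * (2 * real ?N * ?av (\<lambda>p. (W p)\<^sup>2))" by (simp only: average_cmult avQ)
    also have "\<dots> \<le> s\<^sup>2 * \<delta> * (2 * real ?N * 1)" using W2 \<delta>0 N by (intro mult_left_mono) auto
    finally show ?thesis by simp
  qed
  moreover have "norm (?avc (\<lambda>p. of_real (Q p) * iexp (s * W p)) - of_real (2 * real ?N * v) * ?avc (\<lambda>p. iexp (s * W p)))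
     \<le> 2 * real ?N * (\<delta> + 1 / real ?N)"
  proof -
    have eq: "?avc (\<lambda>p. of_real (Q p) * iexp (s * W p)) - of_real (2 * real ?N * v) * ?avc (\<lambda>p. iexp (s * W p))
       = ?avc (\<lambda>p. of_real (2 * real ?N) * (of_real (Q p / (2 * real ?N) - v) * iexp (s * W p)))"
    proof -
      have scale: "of_real q * E - of_real (c * w) * E = of_real c * (of_real (q / c - w) * E)"
        if "c \<noteq> 0" for c q w :: real and E :: complex
      proof -
        have "c * (q / c - w) = q - c * w" using that by (simp add: right_diff_distrib)
        then show ?thesis by (simp only: mult.assoc[symmetric] of_real_mult[symmetric] of_real_diff[symmetric] left_diff_distrib[symmetric])
      qed
      show ?thesis
        unfolding average_cmult[symmetric] average_diff[symmetric] by (intro average_cong scale) (use N in simp)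
    qed
    have "norm (?avc (\<lambda>p. of_real (Q p) * iexp (s * W p)) - of_real (2 * real ?N * v) * ?avc (\<lambda>p. iexp (s * W p)))
        \<le> ?av (\<lambda>p. 2 * real ?N * \<bar>Q p / (2 * real ?N) - v\<bar>)"
    proof -
      have "\<bar>2 * real ?N\<bar> = 2 * real ?N" by simp
      then show ?thesis
        unfolding eq by (intro order.trans[OF norm_average_le] average_mono)
          (simp only: norm_mult norm_of_real norm_exp_i_times mult_1_right order.refl)
    qed
    also have "\<dots> \<le> 2 * real ?N * (\<delta> + 1 / real ?N)"
      unfolding average_cmult using dev by (intro mult_left_mono) auto
    finally show ?thesis .
  qed
  ultimately have "norm (?avc R - \<i> * of_real s * (of_real (2 * real ?N * v) * ?avc (\<lambda>p. iexp (s * W p))))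
     \<le> s\<^sup>2 * \<delta> * (2 * real ?N) + \<bar>s\<bar> * (2 * real ?N * (\<delta> + 1 / real ?N))" (is "norm (?r - \<i> * of_real s * ?w) \<le> ?b1 + \<bar>s\<bar> * ?b2")
  proof -
    let ?q = "?avc (\<lambda>p. of_real (Q p) * iexp (s * W p))"
    assume h: "norm (?r - \<i> * of_real s * ?q) \<le> ?b1" "norm (?q - ?w) \<le> ?b2"
    have "norm (?r - \<i> * of_real s * ?w) \<le> norm (?r - \<i> * of_real s * ?q) + norm (\<i> * of_real s * (?q - ?w))"
      by (rule order.trans[OF _ norm_triangle_ineq]) (simp add: algebra_simps)
    also have "\<dots> \<le> ?b1 + \<bar>s\<bar> * ?b2" using h by (intro add_mono) (auto simp: norm_mult intro!: mult_left_mono)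
    finally show ?thesis .
  qed
  moreover have "?avc R - \<i> * of_real s * (of_real (2 * real ?N * v) * ?avc (\<lambda>p. iexp (s * W p)))
     = of_real (2 * real ?N) * (?avc (\<lambda>p. of_real (W p) * iexp (s * W p)) - \<i> * of_real (s * v) * ?avc (\<lambda>p. iexp (s * W p)))"
    using stein by (simp add: algebra_simps)
  ultimately have "2 * real ?N * norm (?avc (\<lambda>p. of_real (W p) * iexp (s * W p)) - \<i> * of_real (s * v) * ?avc (\<lambda>p. iexp (s * W p)))
    \<le> 2 * real ?N * (\<bar>s\<bar> * (\<delta> + 1 / real ?N) + s\<^sup>2 * \<delta>)"
    by (simp only: norm_mult norm_of_real) (simp add: algebra_simps)
  from mult_left_le_imp_le[OF this] show ?thesis using N by simp
qed

lemma has_field_derivative_average: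
  assumes "\<And>x. x \<in> A \<Longrightarrow> (f x has_field_derivative f' x) (at z within S)"
  shows "((\<lambda>z. average A (\<lambda>x. f x z)) has_field_derivative average A f') (at z within S)"
  unfolding average_def by (intro DERIV_cdivide DERIV_sum assms)

text \<open>Integrating the approximate differential equation against \<open>e\<^bsup>vs\<^sup>2/2\<^esup>\<close>.\<close>

lemma perm_char_approx:
  fixes y :: "nat \<Rightarrow> real"
  assumes y0: "(\<Sum>m=1..n2+n3. y m) = 0" and y2: "(\<Sum>m=1..n2+n3. (y m)\<^sup>2) = 1"
    and n: "2 \<le> n2" "2 \<le> n3" and \<delta>0: "\<delta> > 0"
    and \<delta>: "\<And>m. m \<in> {1..n2+n3} \<Longrightarrow> \<bar>y m\<bar> \<le> \<delta>"
  defines "v \<equiv> real n2 * real n3 / (real (n2 + n3))\<^sup>2"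
  shows "norm (average (Sn (n2+n3)) (\<lambda>p. iexp (s * (\<Sum>m=1..n2. y (p m)))) - of_real (exp (- (v * s\<^sup>2) / 2)))
     \<le> \<bar>s\<bar> * (\<bar>s\<bar> * (\<delta> + 1 / real (n2+n3)) + s\<^sup>2 * \<delta>)"
proof -
  let ?N = "n2 + n3"
  define W where "W p = (\<Sum>m=1..n2. y (p m))" for p :: "nat \<Rightarrow> nat"
  define \<eta> where "\<eta> = \<bar>s\<bar> * (\<delta> + 1 / real ?N) + s\<^sup>2 * \<delta>"
  have v0: "v \<ge> 0" by (simp add: v_def)
  define \<phi> where "\<phi> z = average (Sn ?N) (\<lambda>p. exp (\<i> * z * of_real (W p)))" for z :: complex
  define \<phi>' where "\<phi>' z = average (Sn ?N) (\<lambda>p. of_real (W p) * exp (\<i> * z * of_real (W p)))" for z :: complex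
  have D\<phi>: "(\<phi> has_field_derivative \<i> * \<phi>' z) (at z within X)" for z X
    unfolding \<phi>_def \<phi>'_def average_cmult[symmetric]
    by (rule has_field_derivative_average) (auto intro!: derivative_eq_intros)
  \<comment> \<open>With the integrating factor the derivative is small, so \<open>F\<close> stays close to \<open>F 0 = 1\<close>.\<close>
  define F where "F z = \<phi> z * exp (of_real v * z\<^sup>2 / 2)" for z
  define F' where "F' z = (\<i> * \<phi>' z + of_real v * z * \<phi> z) * exp (of_real v * z\<^sup>2 / 2)" for z
  have D: "(F has_field_derivative F' z) (at z within X)" for z X
  proof -
    have "((\<lambda>z. exp (of_real v * z\<^sup>2 / 2)) has_field_derivative of_real v * z * exp (of_real v * z\<^sup>2 / 2)) (at z within X)"
      by (auto intro!: derivative_eq_intros)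
    from DERIV_mult[OF D\<phi> this] show ?thesis
      unfolding F_def[abs_def] F'_def by (rule DERIV_cong) (simp add: algebra_simps)
  qed
  have bound: "norm (F' z) \<le> \<eta> * exp (v * s\<^sup>2 / 2)" if z: "z \<in> closed_segment 0 (of_real s)" for z
  proof -
    obtain u where u: "0 \<le> u" "u \<le> 1" "z = of_real (u * s)" using z by (auto simp: in_segment scaleR_conv_of_real)
    define q where "q = u * s"
    have q: "z = of_real q" "\<bar>q\<bar> \<le> \<bar>s\<bar>" using u by (auto simp: q_def abs_mult mult_left_le_one_le)
    then have q2: "q\<^sup>2 \<le> s\<^sup>2" by (simp add: abs_le_square_iff)
    have "\<i> * \<phi>' z + of_real v * z * \<phi> z = \<i> * (\<phi>' z - \<i> * of_real (q * v) * \<phi> z)"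
      by (simp add: q algebra_simps)
    then have "norm (\<i> * \<phi>' z + of_real v * z * \<phi> z) = norm (\<phi>' z - \<i> * of_real (q * v) * \<phi> z)"
      by (simp add: norm_mult)
    also have "\<dots> \<le> \<bar>q\<bar> * (\<delta> + 1 / real ?N) + q\<^sup>2 * \<delta>"
      using perm_char_differential_equation[OF y0 y2 n \<delta>0 \<delta>, of q]
      by (simp add: \<phi>_def \<phi>'_def q v_def W_def mult.assoc)
    also have "\<dots> \<le> \<eta>" unfolding \<eta>_def using q q2 \<delta>0 by (intro add_mono mult_right_mono) auto
    finally have 1: "norm (\<i> * \<phi>' z + of_real v * z * \<phi> z) \<le> \<eta>" .
    have "of_real v * z\<^sup>2 / 2 = complex_of_real (v * q\<^sup>2 / 2)" by (simp add: q)
    then have "norm (exp (of_real v * z\<^sup>2 / 2)) = exp (v * q\<^sup>2 / 2)" by (simp only: norm_exp_eq_Re Re_complex_of_real)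
    also have "\<dots> \<le> exp (v * s\<^sup>2 / 2)" using q2 v0 by (simp add: mult_left_mono)
    finally show ?thesis unfolding F'_def norm_mult
      using 1 order.trans[OF norm_ge_zero 1] by (intro mult_mono) auto
  qed
  have "norm (F (of_real s) - F 0) \<le> \<eta> * exp (v * s\<^sup>2 / 2) * norm (of_real s - 0 :: complex)"
    by (rule field_differentiable_bound[OF convex_closed_segment D bound]) auto
  then have le: "norm (F (of_real s) - 1) \<le> \<eta> * exp (v * s\<^sup>2 / 2) * \<bar>s\<bar>"
    by (simp add: F_def \<phi>_def average_const finite_Sn Sn_nonempty)
  have ex: "F (of_real s) = \<phi> (of_real s) * of_real (exp (v * s\<^sup>2 / 2))"
  proof -
    have "of_real v * (of_real s)\<^sup>2 / 2 = complex_of_real (v * s\<^sup>2 / 2)" by simp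
    then show ?thesis unfolding F_def by (simp only: exp_of_real)
  qed
  have one: "complex_of_real (exp (v * s\<^sup>2 / 2)) * of_real (exp (- (v * s\<^sup>2) / 2)) = 1"
    by (simp flip: of_real_mult exp_add)
  have "\<phi> (of_real s) - of_real (exp (- (v * s\<^sup>2) / 2)) = (F (of_real s) - 1) * of_real (exp (- (v * s\<^sup>2) / 2))"
    unfolding ex left_diff_distrib mult.assoc one by simp
  then have "norm (\<phi> (of_real s) - of_real (exp (- (v * s\<^sup>2) / 2))) = norm (F (of_real s) - 1) * exp (- (v * s\<^sup>2) / 2)"
    by (simp only: norm_mult norm_of_real abs_exp_cancel)
  also have "\<dots> \<le> \<eta> * exp (v * s\<^sup>2 / 2) * \<bar>s\<bar> * exp (- (v * s\<^sup>2) / 2)" using le by (rule mult_right_mono) simp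
  also have "\<dots> = \<bar>s\<bar> * \<eta> * (exp (v * s\<^sup>2 / 2) * exp (- (v * s\<^sup>2) / 2))" by (simp only: ac_simps)
  also have "\<dots> = \<bar>s\<bar> * \<eta>" by (simp flip: exp_add)
  finally show ?thesis by (simp add: \<phi>_def W_def \<eta>_def mult.assoc)
qed

section \<open>Random signs\<close>

text \<open>Extensional functions represent \<open>{-1, 1}\<^sup>n\<close> without repetition, which makes the set finite.\<close>

definition signs :: "nat \<Rightarrow> (nat \<Rightarrow> real) set" where
  "signs n = (\<Pi>\<^sub>E j\<in>{1..n}. {-1, 1})"

lemma finite_signs: "finite (signs n)" and signs_nonempty: "signs n \<noteq> {}"
  and card_signs: "card (signs n) = 2 ^ n"
  unfolding signs_def by (auto simp: card_PiE PiE_eq_empty_iff intro!: finite_PiE simp: numeral_2_eq_2)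

lemma signs_square: "e \<in> signs n \<Longrightarrow> j \<in> {1..n} \<Longrightarrow> (e j)\<^sup>2 = 1"
  using PiE_mem[of e "{1..n}" "\<lambda>_. {-1, 1}" j] by (auto simp: signs_def)

lemma signs_char:
  "average (signs n) (\<lambda>e. iexp (s * (\<Sum>j=1..n. e j * d j))) = of_real (\<Prod>j=1..n. cos (s * d j))"
proof -
  have "(\<Sum>e\<in>signs n. iexp (s * (\<Sum>j=1..n. e j * d j))) = (\<Sum>e\<in>signs n. \<Prod>j=1..n. iexp (s * (e j * d j)))"
    by (intro sum.cong refl) (simp add: sum_distrib_left flip: exp_sum)
  also have "\<dots> = (\<Prod>j=1..n. \<Sum>x\<in>{-1, 1}. iexp (s * (x * d j)))"
    unfolding signs_def by (rule prod_sum_PiE[symmetric]) auto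
  also have "\<dots> = (\<Prod>j=1..n. 2 * of_real (cos (s * d j)))"
    by (intro prod.cong refl) (simp add: complex_eq_iff Re_exp Im_exp)
  finally show ?thesis by (simp add: average_def card_signs prod.distrib)
qed

lemma exp_minus_bound:
  fixes u :: real
  assumes u: "u \<ge> 0"
  shows "\<bar>exp (- u) - (1 - u)\<bar> \<le> u\<^sup>2 / 2"
proof -
  have "exp (- u) \<le> 1 - u + u\<^sup>2 / 2"
  proof -
    have "(1 + u + u\<^sup>2 / 2) * (1 - u + u\<^sup>2 / 2) = 1 + (u\<^sup>2 / 2)\<^sup>2"
      by (simp add: algebra_simps power2_eq_square)
    then have "1 \<le> (1 + u + u\<^sup>2 / 2) * (1 - u + u\<^sup>2 / 2)" by simp
    also have "\<dots> \<le> exp u * (1 - u + u\<^sup>2 / 2)"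
    proof (intro mult_right_mono exp_lower_Taylor_quadratic u)
      have "0 \<le> (1 - u)\<^sup>2" by simp
      then have "0 \<le> 1 - 2 * u + u\<^sup>2" by (simp add: power2_diff)
      then show "0 \<le> 1 - u + u\<^sup>2 / 2" by linarith
    qed
    finally show ?thesis by (simp add: exp_minus field_simps)
  qed
  moreover have "1 - u \<le> exp (- u)" using exp_ge_add_one_self[of "- u"] by simp
  ultimately show ?thesis by (simp add: abs_le_iff)
qed

lemma cos_gauss_diff: "\<bar>cos x - exp (- (x\<^sup>2) / 2)\<bar> \<le> x ^ 4" for x :: real
proof -
  have "Re (iexp x - (\<Sum>k\<le>3. (\<i> * of_real x) ^ k / fact k)) = cos x - (1 - x\<^sup>2 / 2)"
    by (simp add: eval_nat_numeral Re_exp)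
  then have "\<bar>cos x - (1 - x\<^sup>2 / 2)\<bar> \<le> norm (iexp x - (\<Sum>k\<le>3. (\<i> * of_real x) ^ k / fact k))"
    using abs_Re_le_cmod by metis
  also have "\<dots> \<le> \<bar>x\<bar> ^ 4 / 24" using iexp_approx1[of x 3] by (simp add: eval_nat_numeral)
  finally have 1: "\<bar>cos x - (1 - x\<^sup>2 / 2)\<bar> \<le> x ^ 4 / 24" by simp
  have "(x\<^sup>2 / 2)\<^sup>2 / 2 = x ^ 4 / 8" by (simp add: power_divide flip: power_mult)
  then have "\<bar>exp (- (x\<^sup>2) / 2) - (1 - x\<^sup>2 / 2)\<bar> \<le> x ^ 4 / 8" using exp_minus_bound[of "x\<^sup>2 / 2"] by simp
  with 1 zero_le_even_power[of 4 x] show ?thesis by linarith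
qed

text \<open>The cosine factors differ from the Gaussian ones by at most the fourth power of their arguments,
  and a difference of products of numbers in the unit disc is at most the sum of the differences.\<close>

lemma signs_char_approx:
  assumes d2: "(\<Sum>j=1..n. (d j)\<^sup>2) = 1" and \<delta>: "\<And>j. j \<in> {1..n} \<Longrightarrow> (d j)\<^sup>2 \<le> \<delta>"
  shows "norm (average (signs n) (\<lambda>e. iexp (s * (\<Sum>j=1..n. e j * d j))) - of_real (exp (- (s\<^sup>2) / 2))) \<le> s ^ 4 * \<delta>"
proof -
  have "(\<Sum>j=1..n. - ((s * d j)\<^sup>2) / 2) = (\<Sum>j=1..n. - (s\<^sup>2) / 2 * (d j)\<^sup>2)"
    by (simp add: power_mult_distrib)
  also have "\<dots> = - (s\<^sup>2) / 2" by (simp only: d2 mult_1_right flip: sum_distrib_left)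
  finally have "exp (- (s\<^sup>2) / 2) = (\<Prod>j=1..n. exp (- ((s * d j)\<^sup>2) / 2))"
    using exp_sum[of "{1..n}" "\<lambda>j. - ((s * d j)\<^sup>2) / 2"] by simp
  then have "norm (average (signs n) (\<lambda>e. iexp (s * (\<Sum>j=1..n. e j * d j))) - of_real (exp (- (s\<^sup>2) / 2)))
    = norm ((\<Prod>j=1..n. cos (s * d j)) - (\<Prod>j=1..n. exp (- ((s * d j)\<^sup>2) / 2)))"
    unfolding signs_char by (simp only: norm_of_real flip: of_real_diff) simp
  also have "\<dots> \<le> (\<Sum>j=1..n. norm (cos (s * d j) - exp (- ((s * d j)\<^sup>2) / 2)))"
    by (rule norm_prod_diff) auto
  also have "\<dots> \<le> (\<Sum>j=1..n. s ^ 4 * \<delta> * (d j)\<^sup>2)"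
  proof (rule sum_mono)
    fix j assume j: "j \<in> {1..n}"
    have "norm (cos (s * d j) - exp (- ((s * d j)\<^sup>2) / 2)) \<le> (s * d j) ^ 4"
      using cos_gauss_diff[of "s * d j"] by simp
    also have "\<dots> = s ^ 4 * ((d j)\<^sup>2 * (d j)\<^sup>2)" by (simp add: power_mult_distrib flip: power_add)
    also have "\<dots> \<le> s ^ 4 * (\<delta> * (d j)\<^sup>2)" using \<delta>[OF j] by (intro mult_left_mono mult_right_mono) auto
    finally show "norm (cos (s * d j) - exp (- ((s * d j)\<^sup>2) / 2)) \<le> s ^ 4 * \<delta> * (d j)\<^sup>2" by (simp add: mult.assoc)
  qed
  also have "\<dots> = s ^ 4 * \<delta>" using d2 by (simp flip: sum_distrib_left)
  finally show ?thesis .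
qed

lemma signs_second_moment: "average (signs n) (\<lambda>e. (\<Sum>j=1..n. e j * d j)\<^sup>2) = (\<Sum>j=1..n. (d j)\<^sup>2)"
proof -
  have off: "(\<Sum>e\<in>signs n. e i * e j) = 0" if ij: "i \<in> {1..n}" "j \<in> {1..n}" "i \<noteq> j" for i j
  proof -
    let ?f = "\<lambda>k x. if k = i \<or> k = j then x else (1::real)"
    have "(\<Prod>k=1..n. ?f k (e k)) = e i * e j" for e :: "nat \<Rightarrow> real"
    proof -
      have "(\<Prod>k=1..n. ?f k (e k)) = (\<Prod>k\<in>{i,j}. ?f k (e k))"
        by (rule prod.mono_neutral_right) (use ij in auto)
      then show ?thesis using ij by simp
    qed
    then have "(\<Sum>e\<in>signs n. e i * e j) = (\<Sum>e\<in>signs n. \<Prod>k=1..n. ?f k (e k))" by simp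
    also have "\<dots> = (\<Prod>k=1..n. \<Sum>x\<in>{-1,1}. ?f k x)"
      unfolding signs_def by (rule prod_sum_PiE[symmetric]) auto
    also have "\<dots> = 0" by (rule prod_zero) (use ij in auto)
    finally show ?thesis .
  qed
  have "(\<Sum>e\<in>signs n. (\<Sum>j=1..n. e j * d j)\<^sup>2) = (\<Sum>e\<in>signs n. \<Sum>i=1..n. \<Sum>j=1..n. d i * d j * (e i * e j))"
    by (simp add: power2_eq_square sum_product ac_simps)
  also have "\<dots> = (\<Sum>i=1..n. \<Sum>j=1..n. d i * d j * (\<Sum>e\<in>signs n. e i * e j))"
    by (simp add: sum.swap[of _ "signs n"] sum_distrib_left)
  also have "\<dots> = (\<Sum>i=1..n. \<Sum>j=1..n. if j = i then (d i)\<^sup>2 * real (card (signs n)) else 0)"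
  proof (intro sum.cong refl)
    fix i j assume ij: "i \<in> {1..n}" "j \<in> {1..n}"
    show "d i * d j * (\<Sum>e\<in>signs n. e i * e j) = (if j = i then (d i)\<^sup>2 * real (card (signs n)) else 0)"
    proof (cases "j = i")
      case True
      have "(\<Sum>e\<in>signs n. e i * e i) = real (card (signs n))"
        using signs_square[of _ n i] ij by (simp add: power2_eq_square)
      then show ?thesis using True by (simp add: power2_eq_square)
    qed (use off ij in auto)
  qed
  also have "\<dots> = (\<Sum>i=1..n. (d i)\<^sup>2) * real (card (signs n))" by (simp add: sum_distrib_right)
  finally show ?thesis using finite_signs signs_nonempty by (simp add: average_def)
qed

section \<open>The permutation distribution is asymptotically normal\<close>

definition t_stat :: "nat \<Rightarrow> (nat \<Rightarrow> real) \<Rightarrow> real" where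
  "t_stat n d = sample_mean n d / sqrt (sample_var n d / real n)"

text \<open>The whole statistic depends on a complete pair through its difference only.\<close>

definition reduced_T :: "real \<Rightarrow> nat \<Rightarrow> nat \<Rightarrow> nat \<Rightarrow> (nat \<Rightarrow> real) \<Rightarrow> (nat \<Rightarrow> real) \<Rightarrow> real" where
  "reduced_T a n1 n2 n3 d z = sqrt a * t_stat n1 d + sqrt (1 - a) * T2 n2 n3 z"

text \<open>A resampling pattern for \<open>n\<close> pairs and \<open>N\<close> pooled observations: a sign for every pair, as swapping its
  components negates the difference, and a permutation of the pooled sample.\<close>

definition resamples :: "nat \<Rightarrow> nat \<Rightarrow> ((nat \<Rightarrow> real) \<times> (nat \<Rightarrow> nat)) set" where
  "resamples n N = signs n \<times> Sn N"

definition perm_T :: "real \<Rightarrow> nat \<Rightarrow> nat \<Rightarrow> nat \<Rightarrow> (nat \<Rightarrow> real) \<Rightarrow> (nat \<Rightarrow> real) \<Rightarrow> (nat \<Rightarrow> real) \<times> (nat \<Rightarrow> nat) \<Rightarrow> real" where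
  "perm_T a n1 n2 n3 d z g = reduced_T a n1 n2 n3 (\<lambda>j. fst g j * d j) (\<lambda>m. z (snd g m))"

definition perm_law :: "real \<Rightarrow> nat \<Rightarrow> nat \<Rightarrow> nat \<Rightarrow> (nat \<Rightarrow> real) \<Rightarrow> (nat \<Rightarrow> real) \<Rightarrow> real measure" where
  "perm_law a n1 n2 n3 d z =
     distr (measure_pmf (pmf_of_set (resamples n1 (n2 + n3)))) borel (perm_T a n1 n2 n3 d z)"

lemma finite_resamples: "finite (resamples n N)" and resamples_nonempty: "resamples n N \<noteq> {}"
  by (auto simp: resamples_def finite_signs finite_Sn signs_nonempty Sn_nonempty)

lemma real_distribution_perm_law: "real_distribution (perm_law a n1 n2 n3 d z)"
  unfolding perm_law_def by (intro prob_space.real_distribution_distr) (auto intro: measure_pmf.prob_space_axioms)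

lemma sample_mean_cong: "(\<And>j. j \<in> {1..n} \<Longrightarrow> x j = y j) \<Longrightarrow> sample_mean n x = sample_mean n y"
  by (simp add: sample_mean_def)

lemma sample_var_cong: "(\<And>j. j \<in> {1..n} \<Longrightarrow> x j = y j) \<Longrightarrow> sample_var n x = sample_var n y"
  using sample_mean_cong[of n x y] by (simp add: sample_var_def)

lemma t_stat_cong: "(\<And>j. j \<in> {1..n} \<Longrightarrow> x j = y j) \<Longrightarrow> t_stat n x = t_stat n y"
  using sample_mean_cong[of n x y] sample_var_cong[of n x y] by (simp add: t_stat_def)

lemma T2_cong:
  assumes "\<And>m. m \<in> {1..n2+n3} \<Longrightarrow> x m = y m"
  shows "T2 n2 n3 x = T2 n2 n3 y"
proof -
  have 1: "\<And>m. m \<in> {1..n2} \<Longrightarrow> x m = y m" "\<And>m. m \<in> {1..n3} \<Longrightarrow> x (n2 + m) = y (n2 + m)"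
    using assms by auto
  show ?thesis
    using sample_mean_cong[OF 1(1)] sample_var_cong[OF 1(1)] sample_mean_cong[OF 1(2)] sample_var_cong[OF 1(2)]
    by (simp add: T2_def Let_def)
qed

lemma sample_var_eq:
  assumes "n > 0"
  shows "sample_var n x = ((\<Sum>j=1..n. (x j)\<^sup>2) - (\<Sum>j=1..n. x j)\<^sup>2 / real n) / (real n - 1)"
proof -
  let ?m = "sample_mean n x"
  have s: "(\<Sum>j=1..n. x j) = real n * ?m" using assms by (simp add: sample_mean_def)
  have "(\<Sum>j=1..n. (x j - ?m)\<^sup>2) = (\<Sum>j=1..n. (x j)\<^sup>2) - 2 * ?m * (\<Sum>j=1..n. x j) + real n * ?m\<^sup>2"
    by (simp add: power2_diff sum.distrib sum_subtractf sum_distrib_left mult.commute mult.left_commute)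
  also have "\<dots> = (\<Sum>j=1..n. (x j)\<^sup>2) - (\<Sum>j=1..n. x j)\<^sup>2 / real n"
    unfolding s using assms by (simp add: power2_eq_square algebra_simps)
  finally show ?thesis by (simp add: sample_var_def)
qed

lemma sample_var_nonneg: "n > 0 \<Longrightarrow> sample_var n x \<ge> 0"
  unfolding sample_var_def by (intro divide_nonneg_nonneg sum_nonneg) auto

lemma sample_mean_affine: "n > 0 \<Longrightarrow> sample_mean n (\<lambda>j. s * x j + b) = s * sample_mean n x + b"
  by (simp add: sample_mean_def sum.distrib add_divide_distrib flip: sum_distrib_left)

lemma sample_var_affine: "n > 0 \<Longrightarrow> sample_var n (\<lambda>j. s * x j + b) = s\<^sup>2 * sample_var n x"
proof -
  assume n: "n > 0"
  have "(\<Sum>j=1..n. (s * x j + b - (s * sample_mean n x + b))\<^sup>2) = (\<Sum>j=1..n. s\<^sup>2 * (x j - sample_mean n x)\<^sup>2)"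
    by (intro sum.cong) (auto simp: power_mult_distrib simp flip: right_diff_distrib)
  then show ?thesis using n by (simp add: sample_var_def sample_mean_affine flip: sum_distrib_left)
qed

lemma t_stat_scale: "n > 0 \<Longrightarrow> s > 0 \<Longrightarrow> t_stat n (\<lambda>j. s * x j) = t_stat n x"
  using sample_mean_affine[of n s x 0] sample_var_affine[of n s x 0]
  by (simp add: t_stat_def real_sqrt_mult real_sqrt_divide)

lemma T2_affine:
  assumes "n2 > 0" "n3 > 0" "s > 0"
  shows "T2 n2 n3 (\<lambda>m. s * x m + b) = T2 n2 n3 x"
proof -
  have "s\<^sup>2 * u / real n2 + s\<^sup>2 * v / real n3 = s\<^sup>2 * (u / real n2 + v / real n3)" for u v
    by (simp add: distrib_left)
  then show ?thesis using assms
    by (simp add: T2_def Let_def sample_mean_affine sample_var_affine real_sqrt_mult flip: right_diff_distrib)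
qed

text \<open>Random signs leave the sum of squares alone, so the studentised mean is a function of the
  normalised sum.\<close>

lemma t_stat_signs:
  assumes n: "2 \<le> n" and d2: "(\<Sum>j=1..n. (d j)\<^sup>2) = 1" and e: "e \<in> signs n"
  defines "W \<equiv> \<Sum>j=1..n. e j * d j"
  shows "t_stat n (\<lambda>j. e j * d j) = W * sqrt ((real n - 1) / (real n - W\<^sup>2))"
proof -
  have "(\<Sum>j=1..n. (e j * d j)\<^sup>2) = 1"
    unfolding d2[symmetric] by (intro sum.cong refl) (simp add: power_mult_distrib signs_square[OF e])
  then have "sample_var n (\<lambda>j. e j * d j) = (1 - W\<^sup>2 / real n) / (real n - 1)"
    using n by (simp add: sample_var_eq W_def)
  moreover have "1 - W\<^sup>2 / real n = (real n - W\<^sup>2) / real n" using n by (simp add: diff_divide_distrib)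
  ultimately have "sample_var n (\<lambda>j. e j * d j) / real n = ((real n - W\<^sup>2) / (real n - 1)) / (real n)\<^sup>2"
    by (simp add: power2_eq_square)
  moreover have "sample_mean n (\<lambda>j. e j * d j) = W / real n" by (simp add: sample_mean_def W_def)
  ultimately show ?thesis using n by (simp add: t_stat_def real_sqrt_divide real_sqrt_mult)
qed

lemma sum_second_block: "(\<Sum>l=1..n3. f (n2 + l)) = (\<Sum>m=n2+1..n2+n3. f m)" for n2 n3 :: nat and f :: "nat \<Rightarrow> 'b::comm_monoid_add"
  using sum.shift_bounds_cl_nat_ivl[of f 1 n2 n3] by (simp add: add.commute)

lemma sum_split_blocks: "(\<Sum>m=1..n2+n3. f m) = (\<Sum>m=1..n2. f m) + (\<Sum>l=1..n3. f (n2 + l))"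
  for n2 n3 :: nat and f :: "nat \<Rightarrow> 'b::comm_monoid_add"
  using sum.ub_add_nat[of 1 n2 f n3] sum_second_block[where f=f and ?n2.0=n2 and ?n3.0=n3] by simp

lemma prod_split_blocks: "(\<Prod>m=1..n2+n3. f m) = (\<Prod>m=1..n2. f m) * (\<Prod>l=1..n3. f (n2 + l))"
  for n2 n3 :: nat and f :: "nat \<Rightarrow> 'b::comm_monoid_mult"
  using prod.ub_add_nat[of 1 n2 f n3] prod.shift_bounds_cl_nat_ivl[of f 1 n2 n3] by (simp add: add.commute)

text \<open>Permuting keeps the total sum 0 and the total sum of squares 1, so the second block is determined by
  the first one and \<open>T2\<close> becomes a function of the sum \<open>W\<close> and the sum of squares \<open>A\<close> of the first block.\<close>

lemma T2_perm:
  assumes n: "2 \<le> n2" "2 \<le> n3" and y0: "(\<Sum>m=1..n2+n3. y m) = 0" and y2: "(\<Sum>m=1..n2+n3. (y m)\<^sup>2) = 1"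
    and p: "p \<in> Sn (n2+n3)"
  defines "W \<equiv> \<Sum>m=1..n2. y (p m)" and "A \<equiv> \<Sum>m=1..n2. (y (p m))\<^sup>2"
  shows "T2 n2 n3 (\<lambda>m. y (p m)) = (real (n2 + n3) / sqrt (real n2 * real n3) * W) *
    (1 / sqrt (real n3 / (real n2 - 1) * (A - W\<^sup>2 / real n2) + real n2 / (real n3 - 1) * (1 - A - W\<^sup>2 / real n3)))"
proof -
  have "W + (\<Sum>m=n2+1..n2+n3. y (p m)) = 0"
    using sum_permutes[OF p, of y] sum.ub_add_nat[of 1 n2 "\<lambda>m. y (p m)" n3] y0 by (simp add: W_def)
  then have W': "(\<Sum>l=1..n3. y (p (n2 + l))) = - W" using sum_second_block[where f="\<lambda>m. y (p m)"] by simp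
  have "A + (\<Sum>m=n2+1..n2+n3. (y (p m))\<^sup>2) = 1"
    using sum_permutes[OF p, of "\<lambda>m. (y m)\<^sup>2"] sum.ub_add_nat[of 1 n2 "\<lambda>m. (y (p m))\<^sup>2" n3] y2 by (simp add: A_def)
  then have A': "(\<Sum>l=1..n3. (y (p (n2 + l)))\<^sup>2) = 1 - A" using sum_second_block[where f="\<lambda>m. (y (p m))\<^sup>2"] by simp
  have v1: "sample_var n2 (\<lambda>m. y (p m)) = (A - W\<^sup>2 / real n2) / (real n2 - 1)"
    using n by (simp add: sample_var_eq A_def W_def)
  have v2: "sample_var n3 (\<lambda>l. y (p (n2 + l))) = (1 - A - W\<^sup>2 / real n3) / (real n3 - 1)"
    using n unfolding sample_var_eq[of n3, OF order.strict_trans2[OF _ n(2)], simplified] A'[simplified] W'[simplified] by simp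
  define v where "v = real n3 / (real n2 - 1) * (A - W\<^sup>2 / real n2) + real n2 / (real n3 - 1) * (1 - A - W\<^sup>2 / real n3)"
  have den: "sample_var n2 (\<lambda>m. y (p m)) / real n2 + sample_var n3 (\<lambda>l. y (p (n2 + l))) / real n3 = v / (real n2 * real n3)"
  proof -
    have "u / k / real n2 + w / l / real n3 = (real n3 / k * u + real n2 / l * w) / (real n2 * real n3)" for u w k l :: real
      using n by (simp add: add_divide_distrib)
    then show ?thesis unfolding v1 v2 v_def .
  qed
  have num: "sample_mean n2 (\<lambda>m. y (p m)) - sample_mean n3 (\<lambda>l. y (p (n2 + l))) = W * real (n2 + n3) / (real n2 * real n3)"
    unfolding sample_mean_def W' W_def[symmetric] using n by (simp add: field_simps)
  have "T2 n2 n3 (\<lambda>m. y (p m)) = W * real (n2 + n3) / (real n2 * real n3) / (sqrt v / sqrt (real n2 * real n3))"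
    unfolding T2_def Let_def num den real_sqrt_divide ..
  also have "\<dots> = W * real (n2 + n3) / sqrt v * (sqrt (real n2 * real n3) / (real n2 * real n3))" by simp
  also have "sqrt (real n2 * real n3) / (real n2 * real n3) = 1 / sqrt (real n2 * real n3)"
    using n by (simp add: real_div_sqrt field_simps)
  finally show ?thesis by (simp add: v_def ac_simps)
qed

lemma norm_mult_diff_le:
  fixes a b a' b' :: "'a::real_normed_field"
  assumes "norm a \<le> 1" "norm b' \<le> 1"
  shows "norm (a * b - a' * b') \<le> norm (a - a') + norm (b - b')"
proof -
  have "a * b - a' * b' = a * (b - b') + (a - a') * b'" by (simp add: algebra_simps)
  then have "norm (a * b - a' * b') \<le> norm a * norm (b - b') + norm (a - a') * norm b'"
    by (metis norm_triangle_ineq norm_mult)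
  also have "\<dots> \<le> 1 * norm (b - b') + norm (a - a') * 1" using assms by (intro add_mono mult_mono) auto
  finally show ?thesis by simp
qed

lemma average_fst:
  fixes f :: "'a \<Rightarrow> 'c::real_normed_field"
  assumes "finite A" "finite B" "B \<noteq> {}"
  shows "average (A \<times> B) (\<lambda>x. f (fst x)) = average A f"
  using average_Times[OF assms(1,2), of f "\<lambda>_. 1"] average_const[OF assms(2,3), of "1::'c"] by simp

lemma average_snd:
  fixes f :: "'b \<Rightarrow> 'c::real_normed_field"
  assumes "finite A" "finite B" "A \<noteq> {}"
  shows "average (A \<times> B) (\<lambda>x. f (snd x)) = average B f"
  using average_Times[OF assms(1,2), of "\<lambda>_. 1" f] average_const[OF assms(1,3), of "1::'c"] by simp

lemma norm_average_iexp_le: "norm (average A (\<lambda>x. iexp (f x))) \<le> 1"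
  by (rule order.trans[OF norm_average_le]) (simp add: average_def)

text \<open>Noether's condition, in quantitative form.\<close>

definition no_dominant_term :: "real \<Rightarrow> nat \<Rightarrow> (nat \<Rightarrow> real) \<Rightarrow> bool" where
  "no_dominant_term \<delta> n x \<longleftrightarrow> 0 < (\<Sum>j=1..n. (x j)\<^sup>2) \<and> (\<forall>j\<in>{1..n}. (x j)\<^sup>2 \<le> \<delta> * (\<Sum>j=1..n. (x j)\<^sup>2))"

text \<open>The statistic is invariant under rescaling both parts and under shifting the pooled sample, so the
  data may be normalised to sums of squares 1 and pooled mean 0. Signs and permutation are independent,
  so the characteristic function of the linear part is the product of the two functions approximated
  above; both denominators converge to constants in probability.\<close>

theorem perm_law_uniform_limit:
  fixes n1 n2 n3 :: "nat \<Rightarrow> nat" and d z :: "nat \<Rightarrow> nat \<Rightarrow> real" and a \<delta> :: "nat \<Rightarrow> real"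
  assumes a: "\<And>r. a r \<in> {0..1}"
    and n: "\<And>r. 2 \<le> n1 r" "\<And>r. 2 \<le> n2 r" "\<And>r. 2 \<le> n3 r"
    and lim: "(\<lambda>r. 1 / real (n1 r)) \<longlonglongrightarrow> 0" "(\<lambda>r. 1 / real (n2 r)) \<longlonglongrightarrow> 0" "(\<lambda>r. 1 / real (n3 r)) \<longlonglongrightarrow> 0"
    and \<kappa>: "0 < \<kappa>" "\<kappa> < 1" "(\<lambda>r. real (n2 r) / real (n2 r + n3 r)) \<longlonglongrightarrow> \<kappa>"
    and \<delta>: "\<And>r. \<delta> r > 0" "\<delta> \<longlonglongrightarrow> 0"
    and dom_d: "\<And>r. no_dominant_term (\<delta> r) (n1 r) (d r)"
    and dom_z: "\<And>r. no_dominant_term (\<delta> r) (n2 r + n3 r) (\<lambda>m. z r m - sample_mean (n2 r + n3 r) (z r))"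
  shows "(\<lambda>r. SUP x. \<bar>cdf (perm_law (a r) (n1 r) (n2 r) (n3 r) (d r) (z r)) x - cdf std_normal_distribution x\<bar>) \<longlonglongrightarrow> 0"
proof (rule cdf_tendsto_std_normal_uniform[OF real_distribution_perm_law])
  have d: "\<And>r. (\<Sum>j=1..n1 r. (d r j)\<^sup>2) > 0"
      "\<And>r j. j \<in> {1..n1 r} \<Longrightarrow> (d r j)\<^sup>2 \<le> \<delta> r * (\<Sum>j=1..n1 r. (d r j)\<^sup>2)"
    using dom_d unfolding no_dominant_term_def by blast+
  have z: "\<And>r. (\<Sum>m=1..n2 r+n3 r. (z r m - sample_mean (n2 r+n3 r) (z r))\<^sup>2) > 0"
      "\<And>r m. m \<in> {1..n2 r+n3 r} \<Longrightarrow> (z r m - sample_mean (n2 r+n3 r) (z r))\<^sup>2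
         \<le> \<delta> r * (\<Sum>m=1..n2 r+n3 r. (z r m - sample_mean (n2 r+n3 r) (z r))\<^sup>2)"
    using dom_z unfolding no_dominant_term_def by blast+
  define N where "N r = n2 r + n3 r" for r
  define S where "S r = (\<Sum>j=1..n1 r. (d r j)\<^sup>2)" for r
  define V where "V r = (\<Sum>m=1..N r. (z r m - sample_mean (N r) (z r))\<^sup>2)" for r
  define y where "y r m = (z r m - sample_mean (N r) (z r)) / sqrt (V r)" for r m
  define c where "c r j = d r j / sqrt (S r)" for r j
  define b where "b r = real (N r) / sqrt (real (n2 r) * real (n3 r))" for r
  define \<rho> where "\<rho> r = real (n2 r) / real (N r)" for r
  have S: "S r > 0" and V: "V r > 0" for r using d(1) z(1) by (auto simp: S_def V_def N_def)
  have c2: "(\<Sum>j=1..n1 r. (c r j)\<^sup>2) = 1" for r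
  proof -
    have "(\<Sum>j=1..n1 r. (c r j)\<^sup>2) = (\<Sum>j=1..n1 r. (d r j)\<^sup>2) / S r"
      using S[of r] by (simp add: c_def power_divide sum_divide_distrib)
    then show ?thesis using S[of r] by (simp only: flip: S_def) simp
  qed
  have c\<delta>: "(c r j)\<^sup>2 \<le> \<delta> r" if "j \<in> {1..n1 r}" for r j
  proof -
    have "(d r j)\<^sup>2 \<le> \<delta> r * S r" using d(2)[OF that] by (simp only: S_def)
    then show ?thesis using S[of r] by (simp add: c_def power_divide field_simps)
  qed
  have y0: "(\<Sum>m=1..n2 r+n3 r. y r m) = 0" for r
  proof -
    have "(\<Sum>m=1..n2 r+n3 r. z r m) = real (N r) * sample_mean (N r) (z r)"
      using n(2)[of r] by (simp add: sample_mean_def N_def)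
    then have "(\<Sum>m=1..n2 r+n3 r. z r m - sample_mean (N r) (z r)) = 0"
      by (simp add: sum_subtractf N_def)
    then show ?thesis by (simp add: y_def flip: sum_divide_distrib)
  qed
  have y2: "(\<Sum>m=1..n2 r+n3 r. (y r m)\<^sup>2) = 1" for r
  proof -
    have "(\<Sum>m=1..n2 r+n3 r. (y r m)\<^sup>2) = (\<Sum>m=1..N r. (z r m - sample_mean (N r) (z r))\<^sup>2) / V r"
      using V[of r] by (simp add: y_def power_divide sum_divide_distrib N_def)
    then show ?thesis using V[of r] by (simp only: flip: V_def) simp
  qed
  have y\<delta>: "\<bar>y r m\<bar> \<le> sqrt (\<delta> r)" if "m \<in> {1..n2 r+n3 r}" for r m
  proof -
    have "(z r m - sample_mean (N r) (z r))\<^sup>2 \<le> \<delta> r * V r" using z(2)[OF that] by (simp only: V_def N_def)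
    then have "(y r m)\<^sup>2 \<le> \<delta> r" using V[of r] by (simp add: y_def power_divide field_simps)
    then show ?thesis by (metis real_sqrt_abs real_sqrt_le_iff)
  qed
  have \<rho>: "\<rho> \<longlonglongrightarrow> \<kappa>" unfolding \<rho>_def[abs_def] N_def by (rule \<kappa>(3))
  have n3N: "real (n3 r) / real (N r) = 1 - \<rho> r" for r using n(2)[of r] by (simp add: \<rho>_def N_def field_simps)
  have b2: "(b r)\<^sup>2 = 1 / (\<rho> r * (1 - \<rho> r))" for r
    unfolding n3N[symmetric] by (simp add: b_def \<rho>_def power_divide power2_eq_square[of "real (N r)"])
  have b2lim: "(\<lambda>r. (b r)\<^sup>2) \<longlonglongrightarrow> 1 / (\<kappa> * (1 - \<kappa>))"
    unfolding b2 using \<kappa>(1,2) by (intro tendsto_intros \<rho>) auto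
  then obtain C0 where C0: "\<And>r. norm ((b r)\<^sup>2) \<le> C0" using BseqE[OF convergent_imp_Bseq[OF convergentI]] by metis
  define C where "C = max C0 1"
  have C: "(b r)\<^sup>2 \<le> C" "1 \<le> C" for r using C0[of r] by (auto simp: C_def)
  define M where "M r = measure_pmf (pmf_of_set (resamples (n1 r) (N r)))" for r
  have M: "prob_space (M r)" for r by (simp add: M_def measure_pmf.prob_space_axioms)
  have meas: "f \<in> borel_measurable (M r)" for f :: "_ \<Rightarrow> real" and r by (simp add: M_def)
  have integrable: "integrable (M r) f" for f :: "_ \<Rightarrow> real" and r
    unfolding M_def by (rule integrable_measure_pmf_finite) (simp add: finite_resamples resamples_nonempty)
  have int_avg: "(LINT g|M r. f g) = average (resamples (n1 r) (N r)) f" for f :: "_ \<Rightarrow> real" and r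
    unfolding M_def by (rule integral_pmf_of_set_average[OF finite_resamples resamples_nonempty])
  \<comment> \<open>\<open>U1\<close> and \<open>U2\<close> are the standardised linear parts, \<open>R1\<close> and \<open>R2\<close> the reciprocal studentising factors.\<close>
  define U1 where "U1 r g = (\<Sum>j=1..n1 r. fst g j * c r j)" for r and g :: "(nat \<Rightarrow> real) \<times> (nat \<Rightarrow> nat)"
  define W where "W r g = (\<Sum>m=1..n2 r. y r (snd g m))" for r and g :: "(nat \<Rightarrow> real) \<times> (nat \<Rightarrow> nat)"
  define A where "A r g = (\<Sum>m=1..n2 r. (y r (snd g m))\<^sup>2)" for r and g :: "(nat \<Rightarrow> real) \<times> (nat \<Rightarrow> nat)"
  define U2 where "U2 r g = b r * W r g" for r g
  define R1 where "R1 r g = sqrt ((real (n1 r) - 1) / (real (n1 r) - (U1 r g)\<^sup>2))" for r g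
  define v where "v r g = real (n3 r) / (real (n2 r) - 1) * (A r g - (W r g)\<^sup>2 / real (n2 r))
      + real (n2 r) / (real (n3 r) - 1) * (1 - A r g - (W r g)\<^sup>2 / real (n3 r))" for r g
  define R2 where "R2 r g = 1 / sqrt (v r g)" for r g
  have U1sq: "(LINT g|M r. (U1 r g)\<^sup>2) = 1" for r
    using signs_second_moment[of "n1 r" "c r"] c2[of r]
      average_fst[OF finite_signs finite_Sn Sn_nonempty, of "n1 r" "N r" "\<lambda>e. (\<Sum>j=1..n1 r. e j * c r j)\<^sup>2"]
    by (simp add: int_avg U1_def resamples_def)
  have avg_snd: "average (resamples (n1 r) (N r)) (\<lambda>g. f (snd g)) = average (Sn (n2 r + n3 r)) f" for f :: "_ \<Rightarrow> real" and r
    using average_snd[OF finite_signs finite_Sn signs_nonempty] by (simp add: resamples_def N_def)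
  have Wsq: "(LINT g|M r. (W r g)\<^sup>2) \<le> 1" for r
    using perm_second_moment_le[OF y0 n(2,3), of r] avg_snd[of r "\<lambda>p. (\<Sum>m=1..n2 r. y r (p m))\<^sup>2"]
    by (simp only: int_avg W_def y2)
  have U2sq: "(LINT g|M r. (U2 r g)\<^sup>2) \<le> C" for r
  proof -
    have "(LINT g|M r. (U2 r g)\<^sup>2) = (b r)\<^sup>2 * (LINT g|M r. (W r g)\<^sup>2)" by (simp add: U2_def power_mult_distrib)
    also have "\<dots> \<le> (b r)\<^sup>2 * 1" by (intro mult_left_mono Wsq) auto
    finally show ?thesis using C(1)[of r] by linarith
  qed
  have vanish: "tendsto_in_prob M (\<lambda>r g. (X r g)\<^sup>2 / real (k r)) 0"
    if X: "\<And>r. (LINT g|M r. (X r g)\<^sup>2) \<le> 1" and k: "(\<lambda>r. 1 / real (k r)) \<longlonglongrightarrow> 0" for X :: "nat \<Rightarrow> _ \<Rightarrow> real" and k :: "nat \<Rightarrow> nat"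
  proof (rule tendsto_in_prob_L1[OF M integrable meas])
    have "0 \<le> (LINT g|M r. (X r g)\<^sup>2 / real (k r))" "(LINT g|M r. (X r g)\<^sup>2 / real (k r)) \<le> 1 / real (k r)" for r
      using X[of r] by (auto intro!: divide_right_mono)
    then show "(\<lambda>r. LINT g|M r. \<bar>(X r g)\<^sup>2 / real (k r) - 0\<bar>) \<longlonglongrightarrow> 0"
      by (intro tendsto_sandwich[OF _ _ tendsto_const k]) auto
  qed
  have inv_lim: "(\<lambda>r. 1 - 1 / real (k r)) \<longlonglongrightarrow> 1" if "(\<lambda>r. 1 / real (k r)) \<longlonglongrightarrow> 0" for k :: "nat \<Rightarrow> nat"
    using tendsto_diff[OF tendsto_const that, of 1] by simp
  have R1: "tendsto_in_prob M R1 1"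
  proof -
    have "tendsto_in_prob M (\<lambda>r g. sqrt ((1 - 1 / real (n1 r)) / (1 - (U1 r g)\<^sup>2 / real (n1 r)))) (sqrt (1 / (1 - 0)))"
      by (rule tendsto_in_prob_continuous2[OF M tendsto_in_prob_const[OF inv_lim[OF lim(1)]] vanish[OF _ lim(1)],
            where f="\<lambda>x q. sqrt (x / (1 - q))"])
        (auto intro!: continuous_intros simp: U1sq)
    then show ?thesis
    proof (simp, elim tendsto_in_prob_cong)
      fix r g
      have "(real (n1 r) - 1) / (real (n1 r) - (U1 r g)\<^sup>2) = (1 - 1 / real (n1 r)) / (1 - (U1 r g)\<^sup>2 / real (n1 r))"
        using n(1)[of r] divide_divide_eq_left[of "real (n1 r) - 1" "real (n1 r)"]
        by (simp add: diff_divide_eq_iff)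
      then show "sqrt ((1 - 1 / real (n1 r)) / (1 - (U1 r g)\<^sup>2 / real (n1 r))) = R1 r g" by (simp add: R1_def)
    qed
  qed
  have Alim: "tendsto_in_prob M A \<kappa>"
  proof -
    have "tendsto_in_prob M (\<lambda>r g. A r g - \<rho> r) 0"
    proof (rule tendsto_in_prob_L2[OF M integrable meas])
      have "(LINT g|M r. (A r g - \<rho> r - 0)\<^sup>2) \<le> \<delta> r" for r
        using perm_square_share[OF y2 n(2,3) y\<delta>, of r] \<delta>(1)[of r]
          avg_snd[of r "\<lambda>p. ((\<Sum>m=1..n2 r. (y r (p m))\<^sup>2) - \<rho> r)\<^sup>2"]
        by (simp add: int_avg A_def \<rho>_def N_def)
      then show "(\<lambda>r. LINT g|M r. (A r g - \<rho> r - 0)\<^sup>2) \<longlonglongrightarrow> 0"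
        by (intro tendsto_sandwich[OF _ _ tendsto_const \<delta>(2)]) auto
    qed
    from tendsto_in_prob_add[OF M this tendsto_in_prob_const[OF \<rho>]] show ?thesis by simp
  qed
  have N0: "real (N r) > 0" for r using n(2)[of r] by (simp add: N_def)
  have cancel: "x / M / (w / M * q) = x / (w * q)" if "M > 0" for x w q M :: real
    using that by simp
  have k1: "(\<lambda>r. real (n3 r) / (real (n2 r) - 1)) \<longlonglongrightarrow> (1 - \<kappa>) / \<kappa>"
  proof -
    have "(\<lambda>r. (1 - \<rho> r) / (\<rho> r * (1 - 1 / real (n2 r)))) \<longlonglongrightarrow> (1 - \<kappa>) / (\<kappa> * 1)"
      using \<kappa> by (intro tendsto_intros \<rho> inv_lim lim) auto
    moreover have "(1 - \<rho> r) / (\<rho> r * (1 - 1 / real (n2 r))) = real (n3 r) / (real (n2 r) - 1)" for r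
    proof -
      have "real (n2 r) * (1 - 1 / real (n2 r)) = real (n2 r) - 1" using n(2)[of r] by (simp add: right_diff_distrib)
      then show ?thesis unfolding n3N[symmetric] unfolding \<rho>_def using N0[of r] cancel[OF N0[of r], of "real (n3 r)" "real (n2 r)"] by simp
    qed
    ultimately show ?thesis by simp
  qed
  have k2: "(\<lambda>r. real (n2 r) / (real (n3 r) - 1)) \<longlonglongrightarrow> \<kappa> / (1 - \<kappa>)"
  proof -
    have "(\<lambda>r. \<rho> r / ((1 - \<rho> r) * (1 - 1 / real (n3 r)))) \<longlonglongrightarrow> \<kappa> / ((1 - \<kappa>) * 1)"
      using \<kappa> by (intro tendsto_intros \<rho> inv_lim lim) auto
    moreover have "\<rho> r / ((1 - \<rho> r) * (1 - 1 / real (n3 r))) = real (n2 r) / (real (n3 r) - 1)" for r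
    proof -
      have "real (n3 r) * (1 - 1 / real (n3 r)) = real (n3 r) - 1" using n(3)[of r] by (simp add: right_diff_distrib)
      then show ?thesis unfolding n3N[symmetric] unfolding \<rho>_def using N0[of r] cancel[OF N0[of r], of "real (n2 r)" "real (n3 r)"] by simp
    qed
    ultimately show ?thesis by simp
  qed
  have vlim: "tendsto_in_prob M v ((1 - \<kappa>) / \<kappa> * (\<kappa> - 0) + \<kappa> / (1 - \<kappa>) * (1 - \<kappa> - 0))"
    unfolding v_def
    by (intro tendsto_in_prob_add tendsto_in_prob_mult tendsto_in_prob_diff M Alim vanish Wsq lim tendsto_in_prob_const k1 k2 tendsto_const)
  have R2: "tendsto_in_prob M R2 1"
  proof -
    have "(1 - \<kappa>) / \<kappa> * (\<kappa> - 0) + \<kappa> / (1 - \<kappa>) * (1 - \<kappa> - 0) = 1" using \<kappa> by simp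
    then have "tendsto_in_prob M v 1" using vlim by simp
    from tendsto_in_prob_continuous[OF M this, of "\<lambda>v. 1 / sqrt v"] show ?thesis
      by (simp add: R2_def[abs_def] continuous_intros)
  qed
  have normal: "asymp_normal M (\<lambda>r g. sqrt (a r) * U1 r g + sqrt (1 - a r) * U2 r g)"
    unfolding asymp_normal_def
  proof (intro conjI allI meas)
    fix t
    define s1 where "s1 r = t * sqrt (a r)" for r
    define s2 where "s2 r = t * sqrt (1 - a r) * b r" for r
    define \<phi>1 where "\<phi>1 r = average (signs (n1 r)) (\<lambda>e. iexp (s1 r * (\<Sum>j=1..n1 r. e j * c r j)))" for r
    define \<phi>2 where "\<phi>2 r = average (Sn (N r)) (\<lambda>p. iexp (s2 r * (\<Sum>m=1..n2 r. y r (p m))))" for r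
    define v0 where "v0 r = real (n2 r) * real (n3 r) / (real (N r))\<^sup>2" for r
    have char: "char (distr (M r) borel (\<lambda>g. sqrt (a r) * U1 r g + sqrt (1 - a r) * U2 r g)) t = \<phi>1 r * \<phi>2 r" for r
    proof -
      have "char (distr (M r) borel (\<lambda>g. sqrt (a r) * U1 r g + sqrt (1 - a r) * U2 r g)) t
        = (CLINT g|M r. iexp (t * (sqrt (a r) * U1 r g + sqrt (1 - a r) * U2 r g)))"
        by (rule char_distr_eq[OF meas])
      also have "\<dots> = average (resamples (n1 r) (N r)) (\<lambda>g. iexp (t * (sqrt (a r) * U1 r g + sqrt (1 - a r) * U2 r g)))"
        unfolding M_def by (rule integral_pmf_of_set_average[OF finite_resamples resamples_nonempty])
      also have "\<dots> = average (signs (n1 r) \<times> Sn (N r)) (\<lambda>g. iexp (s1 r * (\<Sum>j=1..n1 r. fst g j * c r j)) * iexp (s2 r * (\<Sum>m=1..n2 r. y r (snd g m))))"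
        unfolding resamples_def by (intro average_cong)
          (simp add: s1_def s2_def U1_def U2_def W_def distrib_left mult.assoc flip: exp_add)
      also have "\<dots> = \<phi>1 r * \<phi>2 r"
        unfolding \<phi>1_def \<phi>2_def by (rule average_Times[OF finite_signs finite_Sn])
      finally show ?thesis .
    qed
    \<comment> \<open>The factor \<open>b\<close> standardises the second part, and the squared weights \<open>a\<close> and \<open>1 - a\<close> add up to 1.\<close>
    have target: "complex_of_real (exp (- (t\<^sup>2) / 2)) = of_real (exp (- ((s1 r)\<^sup>2) / 2)) * of_real (exp (- (v0 r * (s2 r)\<^sup>2) / 2))" for r
    proof -
      have "v0 r * (b r)\<^sup>2 = 1" using n(2)[of r] n(3)[of r] by (simp add: v0_def b_def power_divide N_def)
      then have "v0 r * (s2 r)\<^sup>2 = t\<^sup>2 * (1 - a r)"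
        using a[of r] by (simp add: s2_def power_mult_distrib ac_simps)
      moreover have "(s1 r)\<^sup>2 = t\<^sup>2 * a r" using a[of r] by (simp add: s1_def power_mult_distrib)
      ultimately have "- (t\<^sup>2) / 2 = - ((s1 r)\<^sup>2) / 2 + - (v0 r * (s2 r)\<^sup>2) / 2" by (simp add: algebra_simps)
      then show ?thesis by (simp only: exp_add of_real_mult)
    qed
    define B where "B = \<bar>t\<bar> * sqrt C"
    have s1: "(s1 r) ^ 4 \<le> t ^ 4" for r
    proof -
      have "(s1 r)\<^sup>2 \<le> t\<^sup>2" using a[of r] by (simp add: s1_def power_mult_distrib mult_left_le)
      then have "((s1 r)\<^sup>2)\<^sup>2 \<le> (t\<^sup>2)\<^sup>2" by (rule power_mono) simp
      then show ?thesis by (simp flip: power_mult)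
    qed
    have s2: "\<bar>s2 r\<bar> \<le> B" for r
    proof -
      have b1: "\<bar>b r\<bar> \<le> sqrt C" using C(1)[of r] by (metis real_sqrt_abs real_sqrt_le_iff)
      have "\<bar>s2 r\<bar> = \<bar>t\<bar> * (sqrt (1 - a r) * \<bar>b r\<bar>)" using a[of r] by (simp add: s2_def abs_mult)
      also have "\<dots> \<le> \<bar>t\<bar> * (1 * sqrt C)" using a[of r] b1 by (intro mult_left_mono mult_mono) auto
      finally show ?thesis by (simp add: B_def)
    qed
    let ?e = "\<lambda>r. t ^ 4 * \<delta> r + B * (B * (sqrt (\<delta> r) + 1 / real (n2 r)) + B\<^sup>2 * sqrt (\<delta> r))"
    have le: "norm (\<phi>1 r * \<phi>2 r - of_real (exp (- (t\<^sup>2) / 2))) \<le> ?e r" for r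
    proof -
      have "norm (\<phi>1 r * \<phi>2 r - of_real (exp (- (t\<^sup>2) / 2))) \<le>
         norm (\<phi>1 r - of_real (exp (- ((s1 r)\<^sup>2) / 2))) + norm (\<phi>2 r - of_real (exp (- (v0 r * (s2 r)\<^sup>2) / 2)))"
        unfolding target[of r]
      proof (rule norm_mult_diff_le)
        show "norm (\<phi>1 r) \<le> 1" unfolding \<phi>1_def by (rule norm_average_iexp_le)
        have "0 \<le> v0 r" by (simp add: v0_def)
        then show "norm (complex_of_real (exp (- (v0 r * (s2 r)\<^sup>2) / 2))) \<le> 1" by simp
      qed
      also have "\<dots> \<le> (s1 r) ^ 4 * \<delta> r + \<bar>s2 r\<bar> * (\<bar>s2 r\<bar> * (sqrt (\<delta> r) + 1 / real (N r)) + (s2 r)\<^sup>2 * sqrt (\<delta> r))"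
        unfolding \<phi>1_def \<phi>2_def v0_def N_def
        by (intro add_mono signs_char_approx perm_char_approx c2 c\<delta> y0 y2 y\<delta> n) (auto simp: \<delta>(1))
      also have "\<dots> \<le> ?e r"
      proof (intro add_mono mult_mono)
        show "(s2 r)\<^sup>2 \<le> B\<^sup>2" using s2[of r] by (metis abs_ge_zero power2_abs power_mono)
        show "1 / real (N r) \<le> 1 / real (n2 r)" using n(2)[of r] by (simp add: N_def frac_le)
      qed (use s1[of r] s2[of r] \<delta>(1)[of r] C(2) in \<open>auto simp: B_def less_imp_le\<close>)
      finally show ?thesis .
    qed
    have "?e \<longlonglongrightarrow> t ^ 4 * 0 + B * (B * (sqrt 0 + 0) + B\<^sup>2 * sqrt 0)"
      by (intro tendsto_add tendsto_mult tendsto_const tendsto_real_sqrt \<delta>(2) lim(2))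
    then have e0: "?e \<longlonglongrightarrow> 0" by (simp only: real_sqrt_zero mult_zero_right add_0_left)
    have "(\<lambda>r. \<phi>1 r * \<phi>2 r - of_real (exp (- (t\<^sup>2) / 2))) \<longlonglongrightarrow> 0"
      by (rule Lim_null_comparison[OF always_eventually e0]) (rule allI, rule le)
    then show "(\<lambda>r. char (distr (M r) borel (\<lambda>g. sqrt (a r) * U1 r g + sqrt (1 - a r) * U2 r g)) t) \<longlonglongrightarrow> complex_of_real (exp (- (t\<^sup>2) / 2))"
      unfolding char by (rule LIM_zero_cancel)
  qed
  have "asymp_normal M (\<lambda>r g. sqrt (a r) * (U1 r g * R1 r g) + sqrt (1 - a r) * (U2 r g * R2 r g))"
    by (rule asymp_normal_weighted_ratio[OF M a meas integrable _ meas integrable U2sq R1 R2 normal]) (simp add: U1sq C)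
  note final = asymp_normal_cdf[OF M this]
  have law: "perm_law (a r) (n1 r) (n2 r) (n3 r) (d r) (z r) =
    distr (M r) borel (\<lambda>g. sqrt (a r) * (U1 r g * R1 r g) + sqrt (1 - a r) * (U2 r g * R2 r g))" for r
    unfolding perm_law_def M_def N_def
  proof (rule distr_cong_AE, safe)
    have "perm_T (a r) (n1 r) (n2 r) (n3 r) (d r) (z r) g =
       sqrt (a r) * (U1 r g * R1 r g) + sqrt (1 - a r) * (U2 r g * R2 r g)" if g: "g \<in> resamples (n1 r) (n2 r + n3 r)" for g
    proof -
      have e: "fst g \<in> signs (n1 r)" and p: "snd g \<in> Sn (n2 r + n3 r)" using g by (auto simp: resamples_def)
      have "t_stat (n1 r) (\<lambda>j. fst g j * d r j) = t_stat (n1 r) (\<lambda>j. sqrt (S r) * (fst g j * c r j))"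
        using S[of r] by (simp add: c_def)
      also have "\<dots> = U1 r g * R1 r g"
        unfolding U1_def R1_def using t_stat_signs[OF n(1) c2 e] S[of r] n(1)[of r] by (simp add: t_stat_scale)
      finally have 1: "t_stat (n1 r) (\<lambda>j. fst g j * d r j) = U1 r g * R1 r g" .
      have "T2 (n2 r) (n3 r) (\<lambda>m. z r (snd g m)) =
         T2 (n2 r) (n3 r) (\<lambda>m. sqrt (V r) * y r (snd g m) + sample_mean (N r) (z r))"
        using V[of r] by (simp add: y_def)
      also have "\<dots> = T2 (n2 r) (n3 r) (\<lambda>m. y r (snd g m))"
        by (rule T2_affine) (use n(2)[of r] n(3)[of r] V[of r] in auto)
      also have "\<dots> = U2 r g * R2 r g"
        unfolding T2_perm[OF n(2,3) y0 y2 p] U2_def R2_def v_def W_def A_def b_def N_def by simp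
      finally show ?thesis using 1 by (simp add: perm_T_def reduced_T_def)
    qed
    then show "AE g in measure_pmf (pmf_of_set (resamples (n1 r) (n2 r + n3 r))). perm_T (a r) (n1 r) (n2 r) (n3 r) (d r) (z r) g =
       sqrt (a r) * (U1 r g * R1 r g) + sqrt (1 - a r) * (U2 r g * R2 r g)"
      by (simp add: AE_measure_pmf_iff finite_resamples resamples_nonempty)
  qed simp_all
  show "(\<lambda>r. cdf (perm_law (a r) (n1 r) (n2 r) (n3 r) (d r) (z r)) x) \<longlonglongrightarrow> cdf std_normal_distribution x" for x
    unfolding law by (rule final)
qed

text \<open>The previous theorem made uniform in the data by contradiction: otherwise there would be offending data
  for arbitrarily small \<open>\<delta>\<close> and late \<open>r\<close>, and along them the limit theorem would fail.\<close>

corollary perm_law_uniformly_close: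
  fixes n1 n2 n3 :: "nat \<Rightarrow> nat" and a :: "nat \<Rightarrow> real"
  assumes a: "\<And>r. a r \<in> {0..1}"
    and n: "\<And>r. 2 \<le> n1 r" "\<And>r. 2 \<le> n2 r" "\<And>r. 2 \<le> n3 r"
    and lim: "(\<lambda>r. 1 / real (n1 r)) \<longlonglongrightarrow> 0" "(\<lambda>r. 1 / real (n2 r)) \<longlonglongrightarrow> 0" "(\<lambda>r. 1 / real (n3 r)) \<longlonglongrightarrow> 0"
    and \<kappa>: "0 < \<kappa>" "\<kappa> < 1" "(\<lambda>r. real (n2 r) / real (n2 r + n3 r)) \<longlonglongrightarrow> \<kappa>"
    and \<epsilon>: "\<epsilon> > 0"
  shows "\<exists>\<delta>>0. \<exists>r0. \<forall>r\<ge>r0. \<forall>d z. no_dominant_term \<delta> (n1 r) d \<longrightarrow>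
    no_dominant_term \<delta> (n2 r + n3 r) (\<lambda>m. z m - sample_mean (n2 r + n3 r) z) \<longrightarrow>
    (SUP x. \<bar>cdf (perm_law (a r) (n1 r) (n2 r) (n3 r) d z) x - cdf std_normal_distribution x\<bar>) \<le> \<epsilon>"
    (is "\<exists>\<delta>>0. \<exists>r0. \<forall>r\<ge>r0. \<forall>d z. ?A \<delta> r d \<longrightarrow> ?B \<delta> r z \<longrightarrow> ?sup r d z \<le> \<epsilon>")
proof -
  define bad where "bad \<delta> r d z \<longleftrightarrow> ?A \<delta> r d \<and> ?B \<delta> r z \<and> \<epsilon> < ?sup r d z" for \<delta> r d z
  have "\<exists>\<delta>>0. \<exists>r0. \<forall>r\<ge>r0. \<forall>d z. \<not> bad \<delta> r d z"
  proof (rule ccontr)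
    assume neg: "\<not> ?thesis"
    have "\<exists>r d z. r \<ge> k \<and> bad (1 / real (Suc k)) r d z" for k
    proof -
      have "(0::real) < 1 / real (Suc k)" by simp
      then show ?thesis using neg by blast
    qed
    then obtain R d z where ex0: "\<And>k. R k \<ge> k \<and> bad (1 / real (Suc k)) (R k) (d k) (z k)"
      by metis
    note ex = ex0[unfolded bad_def]
    have R: "filterlim R sequentially sequentially"
      using ex by (intro filterlim_at_top_mono[OF filterlim_ident]) (auto simp: eventually_sequentially)
    have "(\<lambda>k. ?sup (R k) (d k) (z k)) \<longlonglongrightarrow> 0"
    proof (rule perm_law_uniform_limit[where \<delta>="\<lambda>k. 1 / real (Suc k)" and \<kappa>=\<kappa>])
      show "(\<lambda>k. 1 / real (Suc k)) \<longlonglongrightarrow> 0" using LIMSEQ_inverse_real_of_nat by (simp add: inverse_eq_divide)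
      show "(\<lambda>k. 1 / real (n1 (R k))) \<longlonglongrightarrow> 0" "(\<lambda>k. 1 / real (n2 (R k))) \<longlonglongrightarrow> 0" "(\<lambda>k. 1 / real (n3 (R k))) \<longlonglongrightarrow> 0"
        "(\<lambda>k. real (n2 (R k)) / real (n2 (R k) + n3 (R k))) \<longlonglongrightarrow> \<kappa>"
        using filterlim_compose[OF lim(1) R] filterlim_compose[OF lim(2) R] filterlim_compose[OF lim(3) R]
          filterlim_compose[OF \<kappa>(3) R] by auto
    qed (use a n \<kappa>(1,2) ex in auto)
    then have "\<forall>\<^sub>F k in sequentially. ?sup (R k) (d k) (z k) < \<epsilon>" using \<epsilon> by (rule order_tendstoD)
    then obtain k where "?sup (R k) (d k) (z k) < \<epsilon>" using eventually_happens'[OF sequentially_bot] by blast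
    then show False using ex[of k] by linarith
  qed
  then obtain \<delta> r0 where \<delta>: "\<delta> > 0" "\<And>r d z. r \<ge> r0 \<Longrightarrow> \<not> bad \<delta> r d z" by blast
  show ?thesis
  proof (intro exI[of _ \<delta>] exI[of _ r0] conjI \<delta>(1) allI impI)
    fix r d z assume "r \<ge> r0" "?A \<delta> r d" "?B \<delta> r z"
    then show "?sup r d z \<le> \<epsilon>" using \<delta>(2)[of r d z] unfolding bad_def by (meson not_le)
  qed
qed

section \<open>Laws of large numbers along varying probability spaces\<close>

lemma (in prob_space) indep_sets_reindex:
  assumes "indep_sets F (f ` I)" and inj: "inj_on f I"
  shows "indep_sets (\<lambda>i. F (f i)) I"
proof (rule indep_setsI)
  show "F (f i) \<subseteq> events" if "i \<in> I" for i using assms(1) that by (auto simp: indep_sets_def)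
  fix A J assume J: "J \<noteq> {}" "J \<subseteq> I" "finite J" "\<forall>j\<in>J. A j \<in> F (f j)"
  let ?A = "\<lambda>k. A (inv_into I f k)"
  have inv: "inv_into I f (f j) = j" if "j \<in> J" for j using that J inj by (auto intro: inv_into_f_f)
  have "prob (\<Inter>k\<in>f ` J. ?A k) = (\<Prod>k\<in>f ` J. prob (?A k))"
    by (rule indep_setsD[OF assms(1)]) (use J inv in auto)
  moreover have "(\<Inter>k\<in>f ` J. ?A k) = (\<Inter>j\<in>J. A j)" using inv by auto
  moreover have "(\<Prod>k\<in>f ` J. prob (?A k)) = (\<Prod>j\<in>J. prob (A j))"
    using inv inj_on_subset[OF inj J(2)] by (subst prod.reindex) auto
  ultimately show "prob (\<Inter>j\<in>J. A j) = (\<Prod>j\<in>J. prob (A j))" by simp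
qed

lemma (in prob_space) indep_vars_reindex:
  assumes "indep_vars N X (f ` I)" "inj_on f I"
  shows "indep_vars (\<lambda>i. N (f i)) (\<lambda>i. X (f i)) I"
  using assms indep_sets_reindex[of "\<lambda>i. { X i -` A \<inter> space M | A. A \<in> sets (N i)}" f I]
  by (auto simp: indep_vars_def2)

lemma (in prob_space) indep_centered_sum_square:
  fixes X :: "'i \<Rightarrow> 'a \<Rightarrow> real"
  assumes I: "finite I" and ind: "indep_vars (\<lambda>_. borel) X I"
    and sq: "\<And>i. i \<in> I \<Longrightarrow> integrable M (\<lambda>\<omega>. (X i \<omega>)\<^sup>2)"
    and mean: "\<And>i. i \<in> I \<Longrightarrow> expectation (X i) = 0"
  shows "integrable M (\<lambda>\<omega>. (\<Sum>i\<in>I. X i \<omega>)\<^sup>2)"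
    and "expectation (\<lambda>\<omega>. (\<Sum>i\<in>I. X i \<omega>)\<^sup>2) = (\<Sum>i\<in>I. expectation (\<lambda>\<omega>. (X i \<omega>)\<^sup>2))"
proof -
  have meas: "X i \<in> borel_measurable M" if "i \<in> I" for i using ind that by (simp add: indep_vars_def2)
  have int: "integrable M (X i)" if "i \<in> I" for i
    by (rule square_integrable_imp_integrable[OF meas[OF that] sq[OF that]])
  have prod: "integrable M (\<lambda>\<omega>. X i \<omega> * X j \<omega>) \<and>
      expectation (\<lambda>\<omega>. X i \<omega> * X j \<omega>) = (if j = i then expectation (\<lambda>\<omega>. (X i \<omega>)\<^sup>2) else 0)"
    if ij: "i \<in> I" "j \<in> I" for i j
  proof (cases "i = j")
    case True then show ?thesis using sq[OF ij(1)] by (simp add: power2_eq_square)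
  next
    case False
    have ind2: "indep_vars (\<lambda>_. borel) X {i, j}" by (rule indep_vars_subset[OF ind]) (use ij in auto)
    have "integrable M (\<lambda>\<omega>. \<Prod>k\<in>{i,j}. X k \<omega>)" "expectation (\<lambda>\<omega>. \<Prod>k\<in>{i,j}. X k \<omega>) = (\<Prod>k\<in>{i,j}. expectation (X k))"
      using ij int by (auto intro!: indep_vars_integrable[OF _ ind2] indep_vars_lebesgue_integral[OF _ ind2])
    then show ?thesis using False mean ij by simp
  qed
  have eq: "(\<Sum>i\<in>I. X i \<omega>)\<^sup>2 = (\<Sum>i\<in>I. \<Sum>j\<in>I. X i \<omega> * X j \<omega>)" for \<omega>
    by (simp add: power2_eq_square sum_product)
  show "integrable M (\<lambda>\<omega>. (\<Sum>i\<in>I. X i \<omega>)\<^sup>2)" unfolding eq using prod by auto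
  have "expectation (\<lambda>\<omega>. (\<Sum>i\<in>I. X i \<omega>)\<^sup>2) = (\<Sum>i\<in>I. \<Sum>j\<in>I. expectation (\<lambda>\<omega>. X i \<omega> * X j \<omega>))"
  proof -
    have "integrable M (\<lambda>\<omega>. \<Sum>j\<in>I. X i \<omega> * X j \<omega>)" if "i \<in> I" for i
      by (rule Bochner_Integration.integrable_sum) (use prod that in blast)
    moreover have "expectation (\<lambda>\<omega>. \<Sum>j\<in>I. X i \<omega> * X j \<omega>) = (\<Sum>j\<in>I. expectation (\<lambda>\<omega>. X i \<omega> * X j \<omega>))"
      if "i \<in> I" for i
      by (rule Bochner_Integration.integral_sum) (use prod that in blast)
    ultimately show ?thesis unfolding eq by (subst Bochner_Integration.integral_sum) auto
  qed
  also have "\<dots> = (\<Sum>i\<in>I. \<Sum>j\<in>I. if j = i then expectation (\<lambda>\<omega>. (X i \<omega>)\<^sup>2) else 0)"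
    using prod by (intro sum.cong) auto
  also have "\<dots> = (\<Sum>i\<in>I. expectation (\<lambda>\<omega>. (X i \<omega>)\<^sup>2))" using I by simp
  finally show "expectation (\<lambda>\<omega>. (\<Sum>i\<in>I. X i \<omega>)\<^sup>2) = (\<Sum>i\<in>I. expectation (\<lambda>\<omega>. (X i \<omega>)\<^sup>2))" .
qed

text \<open>One row of a triangular array; the law is a parameter because it is the same in all rows.\<close>

definition iid_row :: "'a measure \<Rightarrow> real measure \<Rightarrow> nat \<Rightarrow> (nat \<Rightarrow> 'a \<Rightarrow> real) \<Rightarrow> bool" where
  "iid_row M \<nu> N X \<longleftrightarrow> prob_space M \<and> N > 0 \<and> prob_space.indep_vars M (\<lambda>_. borel) X {1..N} \<and>
     (\<forall>k\<in>{1..N}. X k \<in> borel_measurable M \<and> distr M borel (X k) = \<nu>)"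

lemma iid_rowD:
  assumes "iid_row M \<nu> N X"
  shows "prob_space M" "N > 0" "prob_space.indep_vars M (\<lambda>_. borel) X {1..N}"
    "\<And>k. k \<in> {1..N} \<Longrightarrow> X k \<in> borel_measurable M" "\<And>k. k \<in> {1..N} \<Longrightarrow> distr M borel (X k) = \<nu>"
  using assms by (auto simp: iid_row_def)

lemma iid_row_integral:
  fixes f :: "real \<Rightarrow> real"
  assumes X: "iid_row M \<nu> N X" and k: "k \<in> {1..N}" and f: "f \<in> borel_measurable borel"
  shows "(LINT \<omega>|M. f (X k \<omega>)) = (LINT x|\<nu>. f x)" "integrable M (\<lambda>\<omega>. f (X k \<omega>)) \<longleftrightarrow> integrable \<nu> f"
  unfolding iid_rowD(5)[OF X k, symmetric] using iid_rowD(4)[OF X k] f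
  by (simp_all add: integral_distr integrable_distr_eq)

lemma iid_row_compose:
  assumes X: "iid_row M \<nu> N X" and f: "f \<in> borel_measurable borel"
  shows "iid_row M (distr \<nu> borel f) N (\<lambda>k \<omega>. f (X k \<omega>))"
proof -
  interpret prob_space M using X by (rule iid_rowD)
  have "indep_vars (\<lambda>_. borel) (\<lambda>k \<omega>. f (X k \<omega>)) {1..N}"
    by (rule indep_vars_compose2[OF iid_rowD(3)[OF X]]) (use f in auto)
  moreover have "distr M borel (\<lambda>\<omega>. f (X k \<omega>)) = distr \<nu> borel f" if "k \<in> {1..N}" for k
    using iid_rowD(4,5)[OF X that] f by (simp add: distr_distr o_def flip: iid_rowD(5)[OF X that])
  ultimately show ?thesis using iid_rowD(1,2,4)[OF X] f by (auto simp: iid_row_def intro: measurable_compose)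
qed

lemma
  assumes X: "iid_row M \<nu> N X"
  shows iid_row_prob_space: "prob_space \<nu>" and iid_row_sets: "sets \<nu> = sets borel"
proof -
  have k: "1 \<in> {1..N}" using iid_rowD(2)[OF X] by simp
  show "prob_space \<nu>" unfolding iid_rowD(5)[OF X k, symmetric]
    by (rule prob_space.prob_space_distr[OF iid_rowD(1)[OF X] iid_rowD(4)[OF X k]])
  show "sets \<nu> = sets borel" unfolding iid_rowD(5)[OF X k, symmetric] by simp
qed

lemma iid_row_sum_square:
  fixes f :: "real \<Rightarrow> real"
  assumes X: "iid_row M \<nu> N X" and f: "f \<in> borel_measurable borel"
    and sq: "integrable \<nu> (\<lambda>x. (f x)\<^sup>2)" and mean: "(LINT x|\<nu>. f x) = 0"
  shows "integrable M (\<lambda>\<omega>. (\<Sum>k=1..N. f (X k \<omega>))\<^sup>2)"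
    and "(LINT \<omega>|M. (\<Sum>k=1..N. f (X k \<omega>))\<^sup>2) = real N * (LINT x|\<nu>. (f x)\<^sup>2)"
proof -
  interpret prob_space M using X by (rule iid_rowD)
  have f2: "(\<lambda>x. (f x)\<^sup>2) \<in> borel_measurable borel" using f by measurable
  have ind: "indep_vars (\<lambda>_. borel) (\<lambda>k \<omega>. f (X k \<omega>)) {1..N}" by (rule iid_rowD(3)[OF iid_row_compose[OF X f]])
  note I = iid_row_integral[OF X _ f] iid_row_integral[OF X _ f2]
  show "integrable M (\<lambda>\<omega>. (\<Sum>k=1..N. f (X k \<omega>))\<^sup>2)"
    by (rule indep_centered_sum_square(1)[OF _ ind]) (use I sq mean in auto)
  have "(LINT \<omega>|M. (\<Sum>k=1..N. f (X k \<omega>))\<^sup>2) = (\<Sum>k=1..N. (LINT \<omega>|M. (f (X k \<omega>))\<^sup>2))"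
    by (rule indep_centered_sum_square(2)[OF _ ind]) (use I sq mean in auto)
  also have "\<dots> = (\<Sum>k=1..N. (LINT x|\<nu>. (f x)\<^sup>2))" by (intro sum.cong refl I(3))
  finally show "(LINT \<omega>|M. (\<Sum>k=1..N. f (X k \<omega>))\<^sup>2) = real N * (LINT x|\<nu>. (f x)\<^sup>2)" by simp
qed

text \<open>The weak law under a first moment: truncation at \<open>B\<close> costs little in \<open>L\<^sup>1\<close>, and the
  truncated variables have variance at most \<open>B\<^sup>2\<close>.\<close>

lemma tail_integral_small:
  fixes f :: "real \<Rightarrow> real"
  assumes f: "integrable \<nu> f" and h: "h > 0"
  shows "\<exists>B>0. (LINT x|\<nu>. \<bar>f x - (if \<bar>f x\<bar> \<le> B then f x else 0)\<bar>) < h"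
proof -
  have "(\<lambda>n. LINT x|\<nu>. \<bar>f x - (if \<bar>f x\<bar> \<le> real n then f x else 0)\<bar>) \<longlonglongrightarrow> (LINT x|\<nu>. 0)"
  proof (rule integral_dominated_convergence[where w="\<lambda>x. \<bar>f x\<bar>"])
    note [measurable] = borel_measurable_integrable[OF f]
    show "(\<lambda>x. \<bar>f x - (if \<bar>f x\<bar> \<le> real n then f x else 0)\<bar>) \<in> borel_measurable \<nu>" for n by measurable
    show "integrable \<nu> (\<lambda>x. \<bar>f x\<bar>)" using f by simp
    show "AE x in \<nu>. (\<lambda>n. \<bar>f x - (if \<bar>f x\<bar> \<le> real n then f x else 0)\<bar>) \<longlonglongrightarrow> 0"
    proof (rule AE_I2)
      fix x
      obtain n0 where n0: "\<bar>f x\<bar> \<le> real n0" using real_arch_simple by blast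
      have "\<forall>\<^sub>F n in sequentially. 0 = \<bar>f x - (if \<bar>f x\<bar> \<le> real n then f x else 0)\<bar>"
        using eventually_ge_at_top[of n0] by eventually_elim (use n0 in auto)
      then show "(\<lambda>n. \<bar>f x - (if \<bar>f x\<bar> \<le> real n then f x else 0)\<bar>) \<longlonglongrightarrow> 0"
        by (rule Lim_transform_eventually[OF tendsto_const])
    qed
  qed auto
  then have "\<forall>\<^sub>F n in sequentially. (LINT x|\<nu>. \<bar>f x - (if \<bar>f x\<bar> \<le> real n then f x else 0)\<bar>) < h"
    using h by (intro order_tendstoD(2)) auto
  then have "\<forall>\<^sub>F n in sequentially. (LINT x|\<nu>. \<bar>f x - (if \<bar>f x\<bar> \<le> real n then f x else 0)\<bar>) < h \<and> 0 < n"
    using eventually_gt_at_top[of 0] by (rule eventually_conj)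
  then obtain n where "(LINT x|\<nu>. \<bar>f x - (if \<bar>f x\<bar> \<le> real n then f x else 0)\<bar>) < h" "0 < n"
    using eventually_happens'[OF sequentially_bot] by blast
  then show ?thesis by (intro exI[of _ "real n"]) auto
qed

text \<open>The error of the sample mean consists of the truncation error, the mean of the centred truncated
  variables and the bias of truncation. The middle part is controlled in \<open>L\<^sup>2\<close> and passed to \<open>L\<^sup>1\<close> by
  \<open>\<bar>q\<bar> \<le> q\<^sup>2 / (2 h) + h / 2\<close>.\<close>

lemma iid_row_mean_L1_bound:
  fixes f :: "real \<Rightarrow> real"
  assumes X: "iid_row M \<nu> N X" and fm: "f \<in> borel_measurable borel" and f: "integrable \<nu> f"
    and h: "h > 0" and B: "B > 0" "(LINT x|\<nu>. \<bar>f x - (if \<bar>f x\<bar> \<le> B then f x else 0)\<bar>) < h"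
  shows "(LINT \<omega>|M. \<bar>(\<Sum>k=1..N. f (X k \<omega>)) / real N - (LINT x|\<nu>. f x)\<bar>) \<le> 3 * h + 4 * B\<^sup>2 / (2 * real N * h)"
proof -
  interpret prob_space M using X by (rule iid_rowD)
  interpret \<nu>: prob_space \<nu> using X by (rule iid_row_prob_space)
  have sets: "sets \<nu> = sets borel" using X by (rule iid_row_sets)
  note [measurable] = fm iid_rowD(4)[OF X]
  have N: "N > 0" using X by (rule iid_rowD)
  define g where "g x = (if \<bar>f x\<bar> \<le> B then f x else 0)" for x
  have gm [measurable]: "g \<in> borel_measurable borel" unfolding g_def by measurable
  have gm\<nu>: "g \<in> borel_measurable \<nu>" using gm sets by (simp cong: measurable_cong_sets)
  have gB: "\<bar>g x\<bar> \<le> B" for x using B(1) by (simp add: g_def)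
  have gi: "integrable \<nu> g" by (rule \<nu>.integrable_const_bound[of _ B]) (use gB gm\<nu> in auto)
  define m where "m = (LINT x|\<nu>. g x)"
  have mB: "\<bar>m\<bar> \<le> B"
  proof -
    have "\<bar>m\<bar> \<le> (LINT x|\<nu>. \<bar>g x\<bar>)" unfolding m_def by (rule integral_abs_bound)
    also have "\<dots> \<le> (LINT x|\<nu>. B)" by (rule integral_mono) (use gi gB in auto)
    finally show ?thesis by (simp add: \<nu>.prob_space)
  qed
  define c where "c x = g x - m" for x
  have cm [measurable]: "c \<in> borel_measurable borel" unfolding c_def by measurable
  have c2B: "(c x)\<^sup>2 \<le> 4 * B\<^sup>2" for x
  proof -
    have "\<bar>c x\<bar> \<le> 2 * B" using gB[of x] mB by (simp add: c_def)
    then have "\<bar>c x\<bar>\<^sup>2 \<le> (2 * B)\<^sup>2" by (rule power_mono) simp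
    then show ?thesis by (simp add: power_mult_distrib)
  qed
  have ci: "integrable \<nu> (\<lambda>x. (c x)\<^sup>2)"
    by (rule \<nu>.integrable_const_bound[of _ "4 * B\<^sup>2"]) (use c2B cm sets in \<open>auto cong: measurable_cong_sets\<close>)
  have c0: "(LINT x|\<nu>. c x) = 0" unfolding c_def using gi by (simp add: m_def \<nu>.prob_space)
  note S = iid_row_sum_square[OF X cm ci c0]
  define Q where "Q \<omega> = (\<Sum>k=1..N. c (X k \<omega>)) / real N" for \<omega>
  have Q2: "integrable M (\<lambda>\<omega>. (Q \<omega>)\<^sup>2)" "(LINT \<omega>|M. (Q \<omega>)\<^sup>2) \<le> 4 * B\<^sup>2 / real N"
  proof -
    show "integrable M (\<lambda>\<omega>. (Q \<omega>)\<^sup>2)" using S(1) by (simp add: Q_def power_divide)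
    have "(LINT x|\<nu>. (c x)\<^sup>2) \<le> (LINT x|\<nu>. 4 * B\<^sup>2)" by (rule integral_mono) (use ci c2B in auto)
    then have "(LINT x|\<nu>. (c x)\<^sup>2) \<le> 4 * B\<^sup>2" by (simp add: \<nu>.prob_space)
    then show "(LINT \<omega>|M. (Q \<omega>)\<^sup>2) \<le> 4 * B\<^sup>2 / real N"
      using N S(2) by (simp add: Q_def power_divide power2_eq_square[of "real N"] divide_right_mono)
  qed
  have fk: "integrable M (\<lambda>\<omega>. f (X k \<omega>))" "integrable M (\<lambda>\<omega>. g (X k \<omega>))"
    "(LINT \<omega>|M. \<bar>f (X k \<omega>) - g (X k \<omega>)\<bar>) = (LINT x|\<nu>. \<bar>f x - g x\<bar>)" if "k \<in> {1..N}" for k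
    using iid_row_integral[OF X that fm] iid_row_integral[OF X that gm] f gi
      iid_row_integral(1)[OF X that, of "\<lambda>x. \<bar>f x - g x\<bar>"] by auto
  define R where "R \<omega> = (\<Sum>k=1..N. \<bar>f (X k \<omega>) - g (X k \<omega>)\<bar>) / real N" for \<omega>
  have Ri: "integrable M R" unfolding R_def by (intro integrable_divide Bochner_Integration.integrable_sum integrable_abs Bochner_Integration.integrable_diff fk)
  have R: "(LINT \<omega>|M. R \<omega>) = (LINT x|\<nu>. \<bar>f x - g x\<bar>)"
  proof -
    have "(LINT \<omega>|M. R \<omega>) = (\<Sum>k=1..N. LINT \<omega>|M. \<bar>f (X k \<omega>) - g (X k \<omega>)\<bar>) / real N"
      unfolding R_def using fk by (subst integral_divide_zero, subst Bochner_Integration.integral_sum) auto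
    also have "\<dots> = (\<Sum>k=1..N. LINT x|\<nu>. \<bar>f x - g x\<bar>) / real N" using fk(3) by (intro arg_cong2[where f="(/)"] sum.cong) auto
    finally show ?thesis using N by simp
  qed
  have small: "(LINT x|\<nu>. \<bar>f x - g x\<bar>) < h" using B(2) by (simp add: g_def)
  have mdiff: "\<bar>m - (LINT x|\<nu>. f x)\<bar> < h"
  proof -
    have "\<bar>m - (LINT x|\<nu>. f x)\<bar> = \<bar>LINT x|\<nu>. f x - g x\<bar>" using f gi by (simp add: m_def abs_minus_commute)
    also have "\<dots> \<le> (LINT x|\<nu>. \<bar>f x - g x\<bar>)" by (rule integral_abs_bound)
    finally show ?thesis using small by simp
  qed
  have "(LINT \<omega>|M. \<bar>(\<Sum>k=1..N. f (X k \<omega>)) / real N - (LINT x|\<nu>. f x)\<bar>)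
    \<le> (LINT \<omega>|M. R \<omega> + ((Q \<omega>)\<^sup>2 / (2 * h) + h / 2) + h)"
  proof (rule integral_mono)
    show "integrable M (\<lambda>\<omega>. \<bar>(\<Sum>k=1..N. f (X k \<omega>)) / real N - (LINT x|\<nu>. f x)\<bar>)"
      using fk by (intro integrable_abs Bochner_Integration.integrable_diff integrable_divide Bochner_Integration.integrable_sum) auto
    show "integrable M (\<lambda>\<omega>. R \<omega> + ((Q \<omega>)\<^sup>2 / (2 * h) + h / 2) + h)"
      using Ri Q2(1) by auto
    fix \<omega>
    have "(\<Sum>k=1..N. f (X k \<omega>)) / real N = (\<Sum>k=1..N. f (X k \<omega>) - g (X k \<omega>)) / real N + Q \<omega> + m"
      using N by (simp add: Q_def c_def sum_subtractf add_divide_distrib diff_divide_distrib)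
    moreover have "\<bar>(\<Sum>k=1..N. f (X k \<omega>) - g (X k \<omega>)) / real N\<bar> \<le> R \<omega>"
      unfolding R_def abs_divide using N by (intro divide_mono sum_abs) auto
    moreover have "\<bar>Q \<omega>\<bar> \<le> (Q \<omega>)\<^sup>2 / (2 * h) + h / 2"
    proof -
      have "0 \<le> (\<bar>Q \<omega>\<bar> - h)\<^sup>2" by simp
      then have "2 * \<bar>Q \<omega>\<bar> * h \<le> (Q \<omega>)\<^sup>2 + h\<^sup>2" by (simp add: power2_diff)
      then show ?thesis using h by (simp add: field_simps power2_eq_square)
    qed
    ultimately show "\<bar>(\<Sum>k=1..N. f (X k \<omega>)) / real N - (LINT x|\<nu>. f x)\<bar> \<le> R \<omega> + ((Q \<omega>)\<^sup>2 / (2 * h) + h / 2) + h"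
      using mdiff by linarith
  qed
  also have "\<dots> = (LINT \<omega>|M. R \<omega>) + (LINT \<omega>|M. (Q \<omega>)\<^sup>2) / (2 * h) + h / 2 + h"
    using Ri Q2(1) by (simp add: prob_space)
  also have "\<dots> \<le> h + 4 * B\<^sup>2 / real N / (2 * h) + h / 2 + h"
    using R small Q2(2) h by (intro add_mono divide_right_mono) auto
  also have "\<dots> \<le> 3 * h + 4 * B\<^sup>2 / (2 * real N * h)" using h by (simp add: ac_simps)
  finally show ?thesis .
qed

lemma iid_row_measurable_sum:
  assumes X: "iid_row M \<nu> N X" and f: "f \<in> borel_measurable borel"
  shows "(\<lambda>\<omega>. \<Sum>k=1..N. f (X k \<omega>) :: real) \<in> borel_measurable M"
  using iid_rowD(4)[OF X] f by (intro borel_measurable_sum) (auto intro: measurable_compose)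

theorem weak_law_of_large_numbers:
  fixes f :: "real \<Rightarrow> real"
  assumes X: "\<And>r. iid_row (M r) \<nu> (N r) (X r)" and fm: "f \<in> borel_measurable borel" and f: "integrable \<nu> f"
    and N: "(\<lambda>r. 1 / real (N r)) \<longlonglongrightarrow> 0"
  shows "tendsto_in_prob M (\<lambda>r \<omega>. (\<Sum>k=1..N r. f (X r k \<omega>)) / real (N r)) (LINT x|\<nu>. f x)"
proof (rule tendsto_in_prob_L1)
  show "prob_space (M r)" for r using X by (rule iid_rowD)
  show meas: "(\<lambda>\<omega>. (\<Sum>k=1..N r. f (X r k \<omega>)) / real (N r)) \<in> borel_measurable (M r)" for r
    using iid_row_measurable_sum[OF X fm] by measurable
  show "integrable (M r) (\<lambda>\<omega>. (\<Sum>k=1..N r. f (X r k \<omega>)) / real (N r) - (LINT x|\<nu>. f x))" for r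
  proof -
    interpret prob_space "M r" using X by (rule iid_rowD)
    show ?thesis using iid_row_integral(2)[OF X _ fm] f
      by (intro Bochner_Integration.integrable_diff integrable_divide Bochner_Integration.integrable_sum) auto
  qed
  show "(\<lambda>r. LINT \<omega>|M r. \<bar>(\<Sum>k=1..N r. f (X r k \<omega>)) / real (N r) - (LINT x|\<nu>. f x)\<bar>) \<longlonglongrightarrow> 0"
  proof (rule LIMSEQ_I)
    fix e :: real assume e: "e > 0"
    define h where "h = e / 4"
    have h: "h > 0" using e by (simp add: h_def)
    obtain B where B: "B > 0" "(LINT x|\<nu>. \<bar>f x - (if \<bar>f x\<bar> \<le> B then f x else 0)\<bar>) < h"
      using tail_integral_small[OF f h] by blast
    have "(\<lambda>r. 4 * B\<^sup>2 / (2 * h) * (1 / real (N r))) \<longlonglongrightarrow> 4 * B\<^sup>2 / (2 * h) * 0"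
      by (intro tendsto_mult tendsto_const N)
    then have "\<forall>\<^sub>F r in sequentially. 4 * B\<^sup>2 / (2 * h) * (1 / real (N r)) < h"
      using h by (intro order_tendstoD(2)) auto
    then obtain r0 where r0: "\<And>r. r \<ge> r0 \<Longrightarrow> 4 * B\<^sup>2 / (2 * h) * (1 / real (N r)) < h"
      by (auto simp: eventually_sequentially)
    have "norm ((LINT \<omega>|M r. \<bar>(\<Sum>k=1..N r. f (X r k \<omega>)) / real (N r) - (LINT x|\<nu>. f x)\<bar>) - 0) < e" if "r \<ge> r0" for r
    proof -
      have "(LINT \<omega>|M r. \<bar>(\<Sum>k=1..N r. f (X r k \<omega>)) / real (N r) - (LINT x|\<nu>. f x)\<bar>) \<le> 3 * h + 4 * B\<^sup>2 / (2 * real (N r) * h)"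
        by (rule iid_row_mean_L1_bound[OF X fm f h B])
      also have "4 * B\<^sup>2 / (2 * real (N r) * h) = 4 * B\<^sup>2 / (2 * h) * (1 / real (N r))" by simp
      also have "3 * h + \<dots> < e" using r0[OF that] by (simp add: h_def)
      finally show ?thesis by simp
    qed
    then show "\<exists>no. \<forall>r\<ge>no. norm ((LINT \<omega>|M r. \<bar>(\<Sum>k=1..N r. f (X r k \<omega>)) / real (N r) - (LINT x|\<nu>. f x)\<bar>) - 0) < e"
      by blast
  qed
qed

text \<open>A single observation with finite second moment is negligible on the scale \<open>\<surd>N\<close>, uniformly over
  the sample: \<open>N P (X\<^sup>2 > \<delta> N) \<le> E (X\<^sup>2; X\<^sup>2 > \<delta> N) / \<delta>\<close>.\<close>

lemma iid_row_max_negligible: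
  assumes X: "\<And>r. iid_row (M r) \<nu> (N r) (X r)" and sq: "integrable \<nu> (\<lambda>x. x\<^sup>2)"
    and N: "(\<lambda>r. 1 / real (N r)) \<longlonglongrightarrow> 0" and \<delta>: "\<delta> > 0"
  shows "(\<lambda>r. measure (M r) {\<omega>\<in>space (M r). \<exists>k\<in>{1..N r}. (X r k \<omega>)\<^sup>2 > \<delta> * real (N r)}) \<longlonglongrightarrow> 0"
proof -
  let ?I = "\<lambda>r x. x\<^sup>2 * indicator {x. x\<^sup>2 > \<delta> * real (N r)} x"
  have sets: "sets \<nu> = sets borel" using X[of 0] by (rule iid_row_sets)
  have im: "?I r \<in> borel_measurable borel" for r by measurable
  have lim: "(\<lambda>r. LINT x|\<nu>. ?I r x) \<longlonglongrightarrow> (LINT x|\<nu>. 0)"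
  proof (rule integral_dominated_convergence[OF _ _ sq])
    show "?I r \<in> borel_measurable \<nu>" for r using im sets by (simp cong: measurable_cong_sets)
    show "AE x in \<nu>. norm (?I r x) \<le> x\<^sup>2" for r by (auto simp: indicator_def)
    show "AE x in \<nu>. (\<lambda>r. ?I r x) \<longlonglongrightarrow> 0"
    proof (rule AE_I2)
      fix x
      have "\<forall>\<^sub>F r in sequentially. 1 / real (N r) < \<delta> / (x\<^sup>2 + 1)"
        using N \<delta> by (intro order_tendstoD(2)) (auto intro!: divide_pos_pos add_nonneg_pos)
      then have "\<forall>\<^sub>F r in sequentially. 0 = ?I r x"
      proof eventually_elim
        case (elim r)
        have "0 < real (N r)" using iid_rowD(2)[OF X] by simp
        moreover have "0 < x\<^sup>2 + 1" by (simp add: add_nonneg_pos)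
        ultimately have "x\<^sup>2 + 1 < \<delta> * real (N r)" using elim by (simp add: field_simps)
        then show ?case by (simp add: indicator_def)
      qed
      then show "(\<lambda>r. ?I r x) \<longlonglongrightarrow> 0" by (rule Lim_transform_eventually[OF tendsto_const])
    qed
  qed simp
  have bound: "measure (M r) {\<omega>\<in>space (M r). \<exists>k\<in>{1..N r}. (X r k \<omega>)\<^sup>2 > \<delta> * real (N r)} \<le> (LINT x|\<nu>. ?I r x) / \<delta>" for r
  proof -
    interpret prob_space "M r" using X by (rule iid_rowD)
    have N0: "real (N r) > 0" using iid_rowD(2)[OF X] by simp
    have "prob {\<omega>\<in>space (M r). \<exists>k\<in>{1..N r}. (X r k \<omega>)\<^sup>2 > \<delta> * real (N r)} =
       prob (\<Union>k\<in>{1..N r}. {\<omega>\<in>space (M r). (X r k \<omega>)\<^sup>2 > \<delta> * real (N r)})" by (intro arg_cong[where f=prob]) auto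
    also have "\<dots> \<le> (\<Sum>k\<in>{1..N r}. prob {\<omega>\<in>space (M r). (X r k \<omega>)\<^sup>2 > \<delta> * real (N r)})"
      by (rule measure_UNION_le) (use iid_rowD(4)[OF X] in \<open>auto intro!: measurable_sets_Collect\<close>)
    also have "\<dots> \<le> (\<Sum>k\<in>{1..N r}. (LINT x|\<nu>. ?I r x) / (\<delta> * real (N r)))"
    proof (rule sum_mono)
      fix k assume k: "k \<in> {1..N r}"
      note [measurable] = iid_rowD(4)[OF X k]
      have int: "integrable (M r) (\<lambda>\<omega>. ?I r (X r k \<omega>))"
      proof -
        have "integrable \<nu> (?I r)"
          by (rule Bochner_Integration.integrable_bound[OF sq]) (use im sets in \<open>auto simp: indicator_def cong: measurable_cong_sets\<close>)
        then show ?thesis using iid_row_integral(2)[OF X k im] by simp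
      qed
      have "{\<omega>\<in>space (M r). (X r k \<omega>)\<^sup>2 > \<delta> * real (N r)} \<subseteq> {\<omega>\<in>space (M r). ?I r (X r k \<omega>) \<ge> \<delta> * real (N r)}"
        by (auto simp: indicator_def)
      then have "prob {\<omega>\<in>space (M r). (X r k \<omega>)\<^sup>2 > \<delta> * real (N r)} \<le> prob {\<omega>\<in>space (M r). ?I r (X r k \<omega>) \<ge> \<delta> * real (N r)}"
        by (intro finite_measure_mono) measurable
      also have "\<dots> \<le> (LINT \<omega>|M r. ?I r (X r k \<omega>)) / (\<delta> * real (N r))"
        by (rule integral_Markov_inequality_measure[where A="{}"]) (use int \<delta> N0 in auto)
      also have "(LINT \<omega>|M r. ?I r (X r k \<omega>)) = (LINT x|\<nu>. ?I r x)" by (rule iid_row_integral(1)[OF X k im])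
      finally show "prob {\<omega>\<in>space (M r). (X r k \<omega>)\<^sup>2 > \<delta> * real (N r)} \<le> (LINT x|\<nu>. ?I r x) / (\<delta> * real (N r))" .
    qed
    also have "\<dots> = (LINT x|\<nu>. ?I r x) / \<delta>" using N0 by simp
    finally show ?thesis .
  qed
  show ?thesis
    by (rule tendsto_sandwich[OF _ _ tendsto_const tendsto_divide_zero[of "\<lambda>r. LINT x|\<nu>. ?I r x" _ \<delta>]])
      (use bound lim in auto)
qed

lemma iid_row_sample_mean:
  assumes X: "\<And>r. iid_row (M r) \<nu> (N r) (X r)" and sq: "integrable \<nu> (\<lambda>x. x\<^sup>2)"
    and N: "(\<lambda>r. 1 / real (N r)) \<longlonglongrightarrow> 0"
  shows "tendsto_in_prob M (\<lambda>r \<omega>. sample_mean (N r) (\<lambda>k. X r k \<omega>)) (LINT x|\<nu>. x)"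
proof -
  interpret \<nu>: prob_space \<nu> using X[of 0] by (rule iid_row_prob_space)
  have "(\<lambda>x. x) \<in> borel_measurable \<nu>" using iid_row_sets[OF X[of 0]] by (simp cong: measurable_cong_sets)
  then have "integrable \<nu> (\<lambda>x. x)" using sq by (rule \<nu>.square_integrable_imp_integrable)
  from weak_law_of_large_numbers[OF X _ this N] show ?thesis by (simp add: sample_mean_def)
qed

lemma iid_row_sample_var:
  assumes X: "\<And>r. iid_row (M r) \<nu> (N r) (X r)" and sq: "integrable \<nu> (\<lambda>x. x\<^sup>2)"
    and N: "(\<lambda>r. 1 / real (N r)) \<longlonglongrightarrow> 0" "\<And>r. N r \<ge> 2"
  shows "tendsto_in_prob M (\<lambda>r \<omega>. sample_var (N r) (\<lambda>k. X r k \<omega>)) (prob_space.variance \<nu> (\<lambda>x. x))"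
proof -
  interpret \<nu>: prob_space \<nu> using X[of 0] by (rule iid_row_prob_space)
  have "(\<lambda>x. x) \<in> borel_measurable \<nu>" using iid_row_sets[OF X[of 0]] by (simp cong: measurable_cong_sets)
  then have i1: "integrable \<nu> (\<lambda>x. x)" using sq by (rule \<nu>.square_integrable_imp_integrable)
  have M: "\<And>r. prob_space (M r)" using X by (rule iid_rowD)
  have mean: "tendsto_in_prob M (\<lambda>r \<omega>. sample_mean (N r) (\<lambda>k. X r k \<omega>)) (LINT x|\<nu>. x)"
    by (rule iid_row_sample_mean[OF X sq N(1)])
  have square: "tendsto_in_prob M (\<lambda>r \<omega>. (\<Sum>k=1..N r. (X r k \<omega>)\<^sup>2) / real (N r)) (LINT x|\<nu>. x\<^sup>2)"
    by (rule weak_law_of_large_numbers[OF X _ sq N(1)]) simp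
  have "(\<lambda>r. 1 / (1 - 1 / real (N r))) \<longlonglongrightarrow> 1 / (1 - 0)" by (intro tendsto_intros N) simp
  then have corr: "tendsto_in_prob M (\<lambda>r \<omega>. 1 / (1 - 1 / real (N r))) 1" by (intro tendsto_in_prob_const) simp
  have "tendsto_in_prob M (\<lambda>r \<omega>. 1 / (1 - 1 / real (N r)) * ((\<Sum>k=1..N r. (X r k \<omega>)\<^sup>2) / real (N r)
      - sample_mean (N r) (\<lambda>k. X r k \<omega>) * sample_mean (N r) (\<lambda>k. X r k \<omega>)))
     (1 * ((LINT x|\<nu>. x\<^sup>2) - (LINT x|\<nu>. x) * (LINT x|\<nu>. x)))"
    by (intro tendsto_in_prob_mult tendsto_in_prob_diff M mean square corr)
  moreover have "1 * ((LINT x|\<nu>. x\<^sup>2) - (LINT x|\<nu>. x) * (LINT x|\<nu>. x)) = \<nu>.variance (\<lambda>x. x)"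
    using \<nu>.variance_eq[OF i1 sq] by (simp add: power2_eq_square)
  ultimately show ?thesis
  proof (simp only:, elim tendsto_in_prob_cong)
    fix r \<omega>
    have "1 / (1 - 1 / n) * (s / n - t / n * (t / n)) = (s - t\<^sup>2 / n) / (n - 1)" if "n \<ge> 2" for s t n :: real
      using that by (simp add: field_simps power2_eq_square)
    then show "1 / (1 - 1 / real (N r)) * ((\<Sum>k=1..N r. (X r k \<omega>)\<^sup>2) / real (N r)
      - sample_mean (N r) (\<lambda>k. X r k \<omega>) * sample_mean (N r) (\<lambda>k. X r k \<omega>)) = sample_var (N r) (\<lambda>k. X r k \<omega>)"
      using N(2)[of r] sample_var_eq[of "N r" "\<lambda>k. X r k \<omega>"] by (simp add: sample_mean_def)
  qed
qed

section \<open>The central limit theorem with bounded coefficients\<close>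

text \<open>The second-order expansion of the characteristic function at 0 is uniform for bounded \<open>s\<close>. This
  uniformity lets the weights of the three samples in the statistic oscillate.\<close>

lemma iid_char_power_limit:
  fixes s :: "nat \<Rightarrow> real"
  assumes \<nu>: "real_distribution \<nu>" and sq: "integrable \<nu> (\<lambda>x. x\<^sup>2)" and mean: "(LINT x|\<nu>. x) = 0"
    and var: "(LINT x|\<nu>. x\<^sup>2) = \<sigma>\<^sup>2" "\<sigma> > 0"
    and s: "\<And>r. \<bar>s r\<bar> \<le> S" and N: "(\<lambda>r. 1 / real (N r)) \<longlonglongrightarrow> 0" "\<And>r. N r > 0"
  shows "(\<lambda>r. char \<nu> (s r / (\<sigma> * sqrt (real (N r)))) ^ N r - of_real (exp (- ((s r)\<^sup>2) / 2))) \<longlonglongrightarrow> 0"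
proof -
  interpret real_distribution \<nu> by fact
  have i1: "integrable \<nu> (\<lambda>x. x)" using sq by (rule square_integrable_imp_integrable[rotated]) simp
  have S0: "0 \<le> S" using s[of 0] by linarith
  define u where "u r = S / (\<sigma> * sqrt (real (N r)))" for r
  define g where "g r = (LINT x|\<nu>. min (6 * x\<^sup>2) (u r * \<bar>x\<bar> ^ 3))" for r
  have u: "u \<longlonglongrightarrow> 0"
  proof -
    have "(\<lambda>r. S / \<sigma> * sqrt (1 / real (N r))) \<longlonglongrightarrow> S / \<sigma> * sqrt 0" by (intro tendsto_intros N)
    moreover have "S / \<sigma> * sqrt (1 / real (N r)) = u r" for r by (simp add: u_def real_sqrt_divide)
    ultimately show ?thesis by simp
  qed
  have u0: "0 \<le> u r" for r using S0 var(2) by (simp add: u_def)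
  have int: "integrable \<nu> (\<lambda>x. min (6 * x\<^sup>2) (c * \<bar>x\<bar> ^ 3))" if "c \<ge> 0" for c
    by (rule Bochner_Integration.integrable_bound[of _ "\<lambda>x. 6 * x\<^sup>2"]) (use sq that in auto)
  have g: "g \<longlonglongrightarrow> 0"
  proof -
    have "g \<longlonglongrightarrow> (LINT x|\<nu>. 0)" unfolding g_def
    proof (rule integral_dominated_convergence[where w="\<lambda>x. 6 * x\<^sup>2"])
      show "AE x in \<nu>. (\<lambda>r. min (6 * x\<^sup>2) (u r * \<bar>x\<bar> ^ 3)) \<longlonglongrightarrow> 0"
      proof (rule AE_I2)
        fix x
        have "(\<lambda>r. min (6 * x\<^sup>2) (u r * \<bar>x\<bar> ^ 3)) \<longlonglongrightarrow> min (6 * x\<^sup>2) (0 * \<bar>x\<bar> ^ 3)" by (intro tendsto_intros u)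
        then show "(\<lambda>r. min (6 * x\<^sup>2) (u r * \<bar>x\<bar> ^ 3)) \<longlonglongrightarrow> 0" by simp
      qed
      show "AE x in \<nu>. norm (min (6 * x\<^sup>2) (u r * \<bar>x\<bar> ^ 3)) \<le> 6 * x\<^sup>2" for r using u0[of r] by auto
    qed (use sq in auto)
    then show ?thesis by simp
  qed
  let ?b = "\<lambda>r. S\<^sup>2 / (6 * \<sigma>\<^sup>2) * g r + S ^ 4 / 8 * (1 / real (N r))"
  have bound: "norm (char \<nu> (s r / (\<sigma> * sqrt (real (N r)))) ^ N r - of_real (exp (- ((s r)\<^sup>2) / 2))) \<le> ?b r" for r
  proof -
    define n where "n = real (N r)"
    have n: "n > 0" using N(2)[of r] by (simp add: n_def)
    define t where "t = s r / (\<sigma> * sqrt n)"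
    have t2: "t\<^sup>2 * \<sigma>\<^sup>2 = (s r)\<^sup>2 / n" using n var(2) by (simp add: t_def power_divide power_mult_distrib)
    have s2: "(s r)\<^sup>2 \<le> S\<^sup>2" using s[of r] S0 by (simp add: abs_le_square_iff[symmetric])
    have s4: "(s r) ^ 4 \<le> S ^ 4"
    proof -
      have "((s r)\<^sup>2)\<^sup>2 \<le> (S\<^sup>2)\<^sup>2" using s2 by (rule power_mono) simp
      then show ?thesis by (simp flip: power_mult)
    qed
    have 1: "norm (char \<nu> t - (1 - (s r)\<^sup>2 / n / 2)) \<le> t\<^sup>2 / 6 * g r"
    proof -
      have "norm (char \<nu> t - (1 - t\<^sup>2 * \<sigma>\<^sup>2 / 2)) \<le> t\<^sup>2 / 6 * (LINT x|\<nu>. min (6 * x\<^sup>2) (\<bar>t\<bar> * \<bar>x\<bar> ^ 3))"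
        using char_approx3[OF i1 mean sq, of "\<sigma>\<^sup>2" t] mean var(1) by simp
      also have "\<dots> \<le> t\<^sup>2 / 6 * g r" unfolding g_def
      proof (intro mult_left_mono integral_mono int u0)
        have "\<bar>t\<bar> \<le> u r" using s[of r] n var(2) by (simp add: t_def u_def n_def abs_divide abs_mult divide_right_mono)
        then show "min (6 * x\<^sup>2) (\<bar>t\<bar> * \<bar>x\<bar> ^ 3) \<le> min (6 * x\<^sup>2) (u r * \<bar>x\<bar> ^ 3)" for x
          by (intro min.mono mult_right_mono) auto
      qed auto
      finally show ?thesis using t2 by simp
    qed
    have 2: "norm (complex_of_real (1 - (s r)\<^sup>2 / n / 2) - of_real (exp (- ((s r)\<^sup>2 / n / 2)))) \<le> ((s r)\<^sup>2 / n / 2)\<^sup>2 / 2"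
      using exp_minus_bound[of "(s r)\<^sup>2 / n / 2"] n by (simp only: norm_of_real flip: of_real_diff) (simp add: abs_minus_commute)
    have e: "complex_of_real (exp (- ((s r)\<^sup>2) / 2)) = of_real (exp (- ((s r)\<^sup>2 / n / 2))) ^ N r"
    proof -
      have "- ((s r)\<^sup>2) / 2 = real (N r) * (- ((s r)\<^sup>2 / n / 2))" using n by (simp add: n_def)
      then have "exp (- ((s r)\<^sup>2) / 2) = exp (- ((s r)\<^sup>2 / n / 2)) ^ N r" by (simp only: exp_of_nat_mult)
      then show ?thesis by (simp only: of_real_power)
    qed
    have "norm (char \<nu> t ^ N r - of_real (exp (- ((s r)\<^sup>2) / 2))) \<le> real (N r) * norm (char \<nu> t - of_real (exp (- ((s r)\<^sup>2 / n / 2))))"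
      unfolding e by (rule norm_power_diff) (use n in \<open>auto simp: cmod_char_le_1\<close>)
    also have "\<dots> \<le> n * (t\<^sup>2 / 6 * g r + ((s r)\<^sup>2 / n / 2)\<^sup>2 / 2)"
    proof -
      have "norm (char \<nu> t - of_real (exp (- ((s r)\<^sup>2 / n / 2)))) \<le> t\<^sup>2 / 6 * g r + ((s r)\<^sup>2 / n / 2)\<^sup>2 / 2"
        using norm_triangle_le[OF add_mono[OF 1 2]] by simp
      then show ?thesis unfolding n_def[symmetric] using n by (intro mult_left_mono) auto
    qed
    also have "\<dots> = (s r)\<^sup>2 / (6 * \<sigma>\<^sup>2) * g r + (s r) ^ 4 / 8 * (1 / n)"
    proof -
      have "n * t\<^sup>2 = (s r)\<^sup>2 / \<sigma>\<^sup>2" using t2 n var(2) by (simp add: field_simps)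
      moreover have "n * (((s r)\<^sup>2 / n / 2)\<^sup>2 / 2) = (s r) ^ 4 / 8 * (1 / n)"
        using n by (simp add: power_divide power2_eq_square[of n] flip: power_mult)
      moreover have "n * (t\<^sup>2 / 6 * g r + q) = (n * t\<^sup>2) * g r / 6 + n * q" for q by (simp add: distrib_left)
      ultimately show ?thesis by (simp only:) simp
    qed
    also have "\<dots> \<le> ?b r"
    proof -
      have "0 \<le> g r" unfolding g_def using u0[of r] by (intro Bochner_Integration.integral_nonneg) auto
      then show ?thesis unfolding n_def[symmetric] using s2 s4 n by (intro add_mono mult_right_mono divide_right_mono) auto
    qed
    finally show ?thesis by (simp add: t_def n_def)
  qed
  have "?b \<longlonglongrightarrow> S\<^sup>2 / (6 * \<sigma>\<^sup>2) * 0 + S ^ 4 / 8 * 0" by (intro tendsto_add tendsto_mult tendsto_const g N)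
  then have "?b \<longlonglongrightarrow> 0" by simp
  then show ?thesis by (rule Lim_null_comparison[OF always_eventually, rotated]) (rule allI, rule bound)
qed

lemma centered_law:
  assumes \<nu>: "real_distribution \<nu>" and sq: "integrable \<nu> (\<lambda>x. x\<^sup>2)" and m: "(LINT x|\<nu>. x) = m"
  defines "\<nu>' \<equiv> distr \<nu> borel (\<lambda>x. x - m)"
  shows "real_distribution \<nu>'" "integrable \<nu>' (\<lambda>x. x\<^sup>2)" "(LINT x|\<nu>'. x) = 0"
    "(LINT x|\<nu>'. x\<^sup>2) = prob_space.variance \<nu> (\<lambda>x. x)"
proof -
  interpret real_distribution \<nu> by fact
  have i1: "integrable \<nu> (\<lambda>x. x)" by (rule square_integrable_imp_integrable[OF _ sq]) simp
  show "real_distribution \<nu>'" unfolding \<nu>'_def by (rule real_distribution_distr) simp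
  have "integrable \<nu> (\<lambda>x. x\<^sup>2 + m\<^sup>2 - 2 * x * m)" using sq i1 by auto
  then have "integrable \<nu> (\<lambda>x. (x - m)\<^sup>2)" by (simp only: power2_diff)
  then show "integrable \<nu>' (\<lambda>x. x\<^sup>2)" unfolding \<nu>'_def by (subst integrable_distr_eq) simp_all
  have "(LINT x|\<nu>'. x) = (LINT x|\<nu>. x - m)" unfolding \<nu>'_def by (rule integral_distr) simp_all
  also have "\<dots> = (LINT x|\<nu>. x) - (LINT x|\<nu>. m)" by (rule Bochner_Integration.integral_diff[OF i1]) simp
  also have "(LINT x|\<nu>. m) = m" using prob_space by simp
  finally show "(LINT x|\<nu>'. x) = 0" unfolding m by simp
  have "(LINT x|\<nu>'. x\<^sup>2) = (LINT x|\<nu>. (x - m)\<^sup>2)" unfolding \<nu>'_def by (rule integral_distr) simp_all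
  then show "(LINT x|\<nu>'. x\<^sup>2) = prob_space.variance \<nu> (\<lambda>x. x)" unfolding m .
qed

lemma char_affine:
  assumes "V \<in> borel_measurable M" "distr M borel V = \<nu>"
  shows "char (distr M borel (\<lambda>\<omega>. c * (V \<omega> - m))) t = char (distr \<nu> borel (\<lambda>x. x - m)) (t * c)"
proof -
  have "distr \<nu> borel (\<lambda>x. x - m) = distr M borel (\<lambda>\<omega>. V \<omega> - m)"
    unfolding assms(2)[symmetric] using assms(1) by (subst distr_distr) (auto simp: o_def)
  then show ?thesis using assms(1) by (simp add: char_distr_eq mult.assoc)
qed

section \<open>Asymptotics of the data\<close>

text \<open>The part of the model that the statistics see: differences \<open>D\<close> of the complete pairs and the
  pooled incomplete sample \<open>Z\<close>, with laws that do not depend on the sample sizes.\<close>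

locale paired_arrays =
  fixes M :: "nat \<Rightarrow> 'a measure" and n1 n2 n3 :: "nat \<Rightarrow> nat"
    and D Z :: "nat \<Rightarrow> nat \<Rightarrow> 'a \<Rightarrow> real" and \<nu>D \<nu>1 \<nu>2 :: "real measure"
    and a :: "nat \<Rightarrow> real" and \<kappa> :: real
  assumes M: "\<And>r. prob_space (M r)"
    and a: "\<And>r. a r \<in> {0..1}"
    and n: "\<And>r. 2 \<le> n1 r" "\<And>r. 2 \<le> n2 r" "\<And>r. 2 \<le> n3 r"
    and lim: "(\<lambda>r. 1 / real (n1 r)) \<longlonglongrightarrow> 0" "(\<lambda>r. 1 / real (n2 r)) \<longlonglongrightarrow> 0" "(\<lambda>r. 1 / real (n3 r)) \<longlonglongrightarrow> 0"
    and \<kappa>: "0 < \<kappa>" "\<kappa> < 1" "(\<lambda>r. real (n2 r) / real (n2 r + n3 r)) \<longlonglongrightarrow> \<kappa>"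
    and indep: "\<And>r. prob_space.indep_vars (M r) (\<lambda>_. borel) (case_sum (D r) (Z r)) ({1..n1 r} <+> {1..n2 r + n3 r})"
    and law_D: "\<And>r j. j \<in> {1..n1 r} \<Longrightarrow> distr (M r) borel (D r j) = \<nu>D"
    and law_1: "\<And>r m. m \<in> {1..n2 r} \<Longrightarrow> distr (M r) borel (Z r m) = \<nu>1"
    and law_2: "\<And>r m. m \<in> {n2 r + 1..n2 r + n3 r} \<Longrightarrow> distr (M r) borel (Z r m) = \<nu>2"
    and square: "integrable \<nu>D (\<lambda>x. x\<^sup>2)" "integrable \<nu>1 (\<lambda>x. x\<^sup>2)" "integrable \<nu>2 (\<lambda>x. x\<^sup>2)"
    and variance: "prob_space.variance \<nu>D (\<lambda>x. x) > 0" "prob_space.variance \<nu>1 (\<lambda>x. x) > 0"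
      "prob_space.variance \<nu>2 (\<lambda>x. x) > 0"
begin

lemma obs_measurable: "i \<in> {1..n1 r} <+> {1..n2 r + n3 r} \<Longrightarrow> case_sum (D r) (Z r) i \<in> borel_measurable (M r)"
  using conjunct1[OF indep[of r, unfolded prob_space.indep_vars_def2[OF M]]] by blast

lemma D_measurable [measurable]: "j \<in> {1..n1 r} \<Longrightarrow> D r j \<in> borel_measurable (M r)"
  using obs_measurable[OF InlI] by simp

lemma Z_measurable [measurable]: "m \<in> {1..n2 r + n3 r} \<Longrightarrow> Z r m \<in> borel_measurable (M r)"
  using obs_measurable[OF InrI] by simp

lemma indep_D: "prob_space.indep_vars (M r) (\<lambda>_. borel) (D r) {1..n1 r}"
proof -
  interpret prob_space "M r" by (rule M)
  have "indep_vars (\<lambda>_. borel) (case_sum (D r) (Z r)) (Inl ` {1..n1 r})"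
    by (rule indep_vars_subset[OF indep]) auto
  from indep_vars_reindex[OF this] show ?thesis by (simp add: inj_on_def)
qed

lemma indep_Z: "prob_space.indep_vars (M r) (\<lambda>_. borel) (Z r) {1..n2 r + n3 r}"
proof -
  interpret prob_space "M r" by (rule M)
  have "indep_vars (\<lambda>_. borel) (case_sum (D r) (Z r)) (Inr ` {1..n2 r + n3 r})"
    by (rule indep_vars_subset[OF indep]) auto
  from indep_vars_reindex[OF this] show ?thesis by (simp add: inj_on_def)
qed

lemma row_D: "iid_row (M r) \<nu>D (n1 r) (D r)"
  unfolding iid_row_def using M indep_D D_measurable law_D n(1)[of r] by auto

lemma row_1: "iid_row (M r) \<nu>1 (n2 r) (Z r)"
proof -
  interpret prob_space "M r" by (rule M)
  have "indep_vars (\<lambda>_. borel) (Z r) {1..n2 r}" by (rule indep_vars_subset[OF indep_Z]) auto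
  then show ?thesis unfolding iid_row_def using M Z_measurable law_1 n(2)[of r] by auto
qed

lemma row_2: "iid_row (M r) \<nu>2 (n3 r) (\<lambda>l. Z r (n2 r + l))"
proof -
  interpret prob_space "M r" by (rule M)
  have "indep_vars (\<lambda>_. borel) (Z r) ((\<lambda>l. n2 r + l) ` {1..n3 r})" by (rule indep_vars_subset[OF indep_Z]) auto
  from indep_vars_reindex[OF this]
  have "indep_vars (\<lambda>_. borel) (\<lambda>l. Z r (n2 r + l)) {1..n3 r}" by (simp add: inj_on_def)
  moreover have "distr (M r) borel (Z r (n2 r + l)) = \<nu>2" if "l \<in> {1..n3 r}" for l
    using that by (intro law_2) auto
  ultimately show ?thesis unfolding iid_row_def using M Z_measurable n(3)[of r] by auto
qed

sublocale \<nu>D: prob_space \<nu>D by (rule iid_row_prob_space[OF row_D[of 0]])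
sublocale \<nu>1: prob_space \<nu>1 by (rule iid_row_prob_space[OF row_1[of 0]])
sublocale \<nu>2: prob_space \<nu>2 by (rule iid_row_prob_space[OF row_2[of 0]])

lemma real_distribution_laws: "real_distribution \<nu>D" "real_distribution \<nu>1" "real_distribution \<nu>2"
  using iid_row_sets[OF row_D[of 0]] iid_row_sets[OF row_1[of 0]] iid_row_sets[OF row_2[of 0]]
    \<nu>D.prob_space_axioms \<nu>1.prob_space_axioms \<nu>2.prob_space_axioms
  by (auto simp: real_distribution_def real_distribution_axioms_def dest: sets_eq_imp_space_eq)

lemma first_moments: "integrable \<nu>D (\<lambda>x. x)" "integrable \<nu>1 (\<lambda>x. x)" "integrable \<nu>2 (\<lambda>x. x)"
  by (auto intro!: \<nu>D.square_integrable_imp_integrable[OF _ square(1)] \<nu>1.square_integrable_imp_integrable[OF _ square(2)]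
      \<nu>2.square_integrable_imp_integrable[OF _ square(3)] measurable_ident_sets
      iid_row_sets[OF row_D[of 0]] iid_row_sets[OF row_1[of 0]] iid_row_sets[OF row_2[of 0]])

definition "\<sigma>D = sqrt (\<nu>D.variance (\<lambda>x. x))"
definition "\<sigma>1 = sqrt (\<nu>1.variance (\<lambda>x. x))"
definition "\<sigma>2 = sqrt (\<nu>2.variance (\<lambda>x. x))"

lemma \<sigma>_pos: "\<sigma>D > 0" "\<sigma>1 > 0" "\<sigma>2 > 0"
  using variance by (auto simp: \<sigma>D_def \<sigma>1_def \<sigma>2_def)

lemma \<sigma>_square: "\<sigma>D\<^sup>2 = \<nu>D.variance (\<lambda>x. x)" "\<sigma>1\<^sup>2 = \<nu>1.variance (\<lambda>x. x)" "\<sigma>2\<^sup>2 = \<nu>2.variance (\<lambda>x. x)"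
  using variance by (auto simp: \<sigma>D_def \<sigma>1_def \<sigma>2_def)

lemma sample_var_limits:
  "tendsto_in_prob M (\<lambda>r \<omega>. sample_var (n1 r) (\<lambda>j. D r j \<omega>)) (\<sigma>D\<^sup>2)"
  "tendsto_in_prob M (\<lambda>r \<omega>. sample_var (n2 r) (\<lambda>m. Z r m \<omega>)) (\<sigma>1\<^sup>2)"
  "tendsto_in_prob M (\<lambda>r \<omega>. sample_var (n3 r) (\<lambda>l. Z r (n2 r + l) \<omega>)) (\<sigma>2\<^sup>2)"
  unfolding \<sigma>_square
  using iid_row_sample_var[OF row_D square(1) lim(1) n(1)] iid_row_sample_var[OF row_1 square(2) lim(2) n(2)]
    iid_row_sample_var[OF row_2 square(3) lim(3) n(3)] by auto

lemma prob_tendsto_0_union: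
  assumes "(\<lambda>r. measure (M r) {\<omega>\<in>space (M r). A r \<omega>}) \<longlonglongrightarrow> 0" "(\<lambda>r. measure (M r) {\<omega>\<in>space (M r). B r \<omega>}) \<longlonglongrightarrow> 0"
    and [measurable]: "\<And>r. Measurable.pred (M r) (A r)" "\<And>r. Measurable.pred (M r) (B r)"
  shows "(\<lambda>r. measure (M r) {\<omega>\<in>space (M r). A r \<omega> \<or> B r \<omega>}) \<longlonglongrightarrow> 0"
proof -
  have "measure (M r) {\<omega>\<in>space (M r). A r \<omega> \<or> B r \<omega>} \<le>
    measure (M r) {\<omega>\<in>space (M r). A r \<omega>} + measure (M r) {\<omega>\<in>space (M r). B r \<omega>}" for r
  proof -
    interpret prob_space "M r" by (rule M)
    have "{\<omega>\<in>space (M r). A r \<omega> \<or> B r \<omega>} = {\<omega>\<in>space (M r). A r \<omega>} \<union> {\<omega>\<in>space (M r). B r \<omega>}" by auto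
    then show ?thesis by (simp add: measure_Un_le)
  qed
  then show ?thesis
    by (intro tendsto_sandwich[OF _ _ tendsto_const tendsto_add_zero[OF assms(1,2)]]) auto
qed

lemma prob_tendsto_0_subset:
  assumes "(\<lambda>r. measure (M r) {\<omega>\<in>space (M r). A r \<omega>}) \<longlonglongrightarrow> 0" "\<And>r. Measurable.pred (M r) (A r)"
    and "\<forall>\<^sub>F r in sequentially. \<forall>\<omega>\<in>space (M r). B r \<omega> \<longrightarrow> A r \<omega>"
  shows "(\<lambda>r. measure (M r) {\<omega>\<in>space (M r). B r \<omega>}) \<longlonglongrightarrow> 0"
proof (rule tendsto_sandwich[OF _ _ tendsto_const assms(1)])
  show "\<forall>\<^sub>F r in sequentially. measure (M r) {\<omega>\<in>space (M r). B r \<omega>} \<le> measure (M r) {\<omega>\<in>space (M r). A r \<omega>}"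
    using assms(3)
  proof eventually_elim
    case (elim r)
    interpret prob_space "M r" by (rule M)
    show ?case using elim assms(2)[of r] by (intro finite_measure_mono) auto
  qed
qed simp

text \<open>The sum of squares grows linearly by the law of large numbers, and the largest square is \<open>o(n)\<close> in
  probability.\<close>

lemma no_dominant_D:
  assumes \<delta>: "\<delta> > 0"
  shows "(\<lambda>r. measure (M r) {\<omega>\<in>space (M r). \<not> no_dominant_term \<delta> (n1 r) (\<lambda>j. D r j \<omega>)}) \<longlonglongrightarrow> 0"
proof -
  define q where "q = (LINT x|\<nu>D. x\<^sup>2)"
  have "\<nu>D.variance (\<lambda>x. x) = q - (LINT x|\<nu>D. x)\<^sup>2"
    unfolding q_def by (rule \<nu>D.variance_eq[OF first_moments(1) square(1)])
  moreover have "0 \<le> (LINT x|\<nu>D. x)\<^sup>2" by simp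
  ultimately have q: "q > 0" using variance(1) by linarith
  define \<eta> where "\<eta> = \<delta> * q / 2"
  have \<eta>: "\<eta> > 0" using \<delta> q by (simp add: \<eta>_def)
  let ?s = "\<lambda>r \<omega>. (\<Sum>k=1..n1 r. (D r k \<omega>)\<^sup>2)"
  have 1: "(\<lambda>r. measure (M r) {\<omega>\<in>space (M r). \<bar>?s r \<omega> / real (n1 r) - q\<bar> > q / 2}) \<longlonglongrightarrow> 0"
    unfolding q_def using weak_law_of_large_numbers[OF row_D _ square(1) lim(1)] q
    by (intro tendsto_in_probD) (auto simp: q_def)
  have 2: "(\<lambda>r. measure (M r) {\<omega>\<in>space (M r). \<exists>k\<in>{1..n1 r}. (D r k \<omega>)\<^sup>2 > \<eta> * real (n1 r)}) \<longlonglongrightarrow> 0"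
    by (rule iid_row_max_negligible[OF row_D square(1) lim(1) \<eta>])
  show ?thesis
  proof (rule prob_tendsto_0_subset[OF prob_tendsto_0_union[OF 1 2]])
    show "\<forall>\<^sub>F r in sequentially. \<forall>\<omega>\<in>space (M r). \<not> no_dominant_term \<delta> (n1 r) (\<lambda>j. D r j \<omega>) \<longrightarrow>
       q / 2 < \<bar>?s r \<omega> / real (n1 r) - q\<bar> \<or> (\<exists>k\<in>{1..n1 r}. (D r k \<omega>)\<^sup>2 > \<eta> * real (n1 r))"
    proof (intro always_eventually allI ballI impI, rule ccontr)
      fix r \<omega>
      assume neg: "\<not> no_dominant_term \<delta> (n1 r) (\<lambda>j. D r j \<omega>)"
        "\<not> (q / 2 < \<bar>?s r \<omega> / real (n1 r) - q\<bar> \<or> (\<exists>k\<in>{1..n1 r}. (D r k \<omega>)\<^sup>2 > \<eta> * real (n1 r)))"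
      have N: "real (n1 r) > 0" using n(1)[of r] by simp
      have "\<not> q / 2 < \<bar>?s r \<omega> / real (n1 r) - q\<bar>" using neg(2) by blast
      then have "q / 2 \<le> ?s r \<omega> / real (n1 r)" by linarith
      then have s: "q / 2 * real (n1 r) \<le> ?s r \<omega>" using N by (simp add: pos_le_divide_eq)
      then have "\<delta> * (q / 2 * real (n1 r)) \<le> \<delta> * ?s r \<omega>" using \<delta> by (intro mult_left_mono) auto
      then have "\<eta> * real (n1 r) \<le> \<delta> * ?s r \<omega>" by (simp add: \<eta>_def)
      then have "(D r k \<omega>)\<^sup>2 \<le> \<delta> * ?s r \<omega>" if "k \<in> {1..n1 r}" for k using neg(2) that by force
      moreover have "0 < ?s r \<omega>" using s q N by (intro order.strict_trans2[OF _ s]) auto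
      ultimately show False using neg(1) by (auto simp: no_dominant_term_def)
    qed
  qed measurable
qed

lemma sum_squares_about_sample_mean_le:
  assumes "n > 0"
  shows "(real n - 1) * sample_var n x \<le> (\<Sum>m=1..n. (x m - c)\<^sup>2)"
proof (cases "n = 1")
  case False
  let ?\<mu> = "sample_mean n x"
  have "(\<Sum>m=1..n. (x m - c)\<^sup>2) = (\<Sum>m=1..n. (x m - ?\<mu>)\<^sup>2 + 2 * (?\<mu> - c) * (x m - ?\<mu>) + (?\<mu> - c)\<^sup>2)"
    by (intro sum.cong refl) (simp add: power2_eq_square algebra_simps)
  also have "\<dots> = (\<Sum>m=1..n. (x m - ?\<mu>)\<^sup>2) + 2 * (?\<mu> - c) * (\<Sum>m=1..n. x m - ?\<mu>) + real n * (?\<mu> - c)\<^sup>2"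
    by (simp only: sum.distrib flip: sum_distrib_left) simp
  also have "(\<Sum>m=1..n. x m - ?\<mu>) = 0" using assms by (simp add: sum_subtractf sample_mean_def)
  finally have "(\<Sum>m=1..n. (x m - ?\<mu>)\<^sup>2) \<le> (\<Sum>m=1..n. (x m - c)\<^sup>2)" by simp
  then show ?thesis using assms False by (simp add: sample_var_def)
qed (auto intro!: sum_nonneg)

text \<open>The sum of squares of the pooled sample about its mean is at least the one within the first sample,
  which grows linearly in the pooled sample size as \<open>\<kappa> > 0\<close>. Observations of both samples are \<open>o(\<surd>N)\<close>, and
  with them their mean.\<close>

lemma no_dominant_Z:
  assumes \<delta>: "\<delta> > 0"
  shows "(\<lambda>r. measure (M r) {\<omega>\<in>space (M r).
    \<not> no_dominant_term \<delta> (n2 r + n3 r) (\<lambda>m. Z r m \<omega> - sample_mean (n2 r + n3 r) (\<lambda>m. Z r m \<omega>))}) \<longlonglongrightarrow> 0"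
proof -
  \<comment> \<open>Deviations from the mean are at most \<open>2 \<surd>(\<eta> N)\<close>, the sum of squares is at least \<open>\<sigma>1\<^sup>2 / 4 \<cdot> \<kappa> / 2 \<cdot> N\<close>; the constant makes \<open>4 \<eta> N\<close> equal to \<open>\<delta>\<close> times that bound.\<close>
  define \<eta> where "\<eta> = \<delta> * \<sigma>1\<^sup>2 * \<kappa> / 32"
  have \<eta>: "\<eta> > 0" using \<delta> \<sigma>_pos \<kappa> by (simp add: \<eta>_def)
  let ?A = "\<lambda>r \<omega>. \<sigma>1\<^sup>2 / 2 < \<bar>sample_var (n2 r) (\<lambda>m. Z r m \<omega>) - \<sigma>1\<^sup>2\<bar>"
  let ?B = "\<lambda>r \<omega>. \<exists>m\<in>{1..n2 r}. (Z r m \<omega>)\<^sup>2 > \<eta> * real (n2 r)"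
  let ?C = "\<lambda>r \<omega>. \<exists>l\<in>{1..n3 r}. (Z r (n2 r + l) \<omega>)\<^sup>2 > \<eta> * real (n3 r)"
  have A: "(\<lambda>r. measure (M r) {\<omega>\<in>space (M r). ?A r \<omega>}) \<longlonglongrightarrow> 0"
    by (rule tendsto_in_probD[OF sample_var_limits(2)]) (use \<sigma>_pos in simp)
  have B: "(\<lambda>r. measure (M r) {\<omega>\<in>space (M r). ?B r \<omega>}) \<longlonglongrightarrow> 0"
    by (rule iid_row_max_negligible[OF row_1 square(2) lim(2) \<eta>])
  have C: "(\<lambda>r. measure (M r) {\<omega>\<in>space (M r). ?C r \<omega>}) \<longlonglongrightarrow> 0"
    by (rule iid_row_max_negligible[OF row_2 square(3) lim(3) \<eta>])
  note [measurable] = tendsto_in_prob_measurable[OF sample_var_limits(2)]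
  have \<kappa>2: "\<forall>\<^sub>F r in sequentially. \<kappa> / 2 < real (n2 r) / real (n2 r + n3 r)"
    using \<kappa> by (intro order_tendstoD(1)[OF \<kappa>(3)]) auto
  show ?thesis
  proof (rule prob_tendsto_0_subset[OF prob_tendsto_0_union[OF prob_tendsto_0_union[OF A B] C]])
    show "\<forall>\<^sub>F r in sequentially. \<forall>\<omega>\<in>space (M r).
      \<not> no_dominant_term \<delta> (n2 r + n3 r) (\<lambda>m. Z r m \<omega> - sample_mean (n2 r + n3 r) (\<lambda>m. Z r m \<omega>)) \<longrightarrow>
      (?A r \<omega> \<or> ?B r \<omega>) \<or> ?C r \<omega>"
    proof (rule eventually_mono[OF \<kappa>2], intro ballI impI, rule ccontr)
      fix r \<omega>
      assume neg: "\<not> no_dominant_term \<delta> (n2 r + n3 r) (\<lambda>m. Z r m \<omega> - sample_mean (n2 r + n3 r) (\<lambda>m. Z r m \<omega>))"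
        "\<not> ((?A r \<omega> \<or> ?B r \<omega>) \<or> ?C r \<omega>)"
        and k: "\<kappa> / 2 < real (n2 r) / real (n2 r + n3 r)"
      define N where "N = n2 r + n3 r"
      define zb where "zb = sample_mean N (\<lambda>m. Z r m \<omega>)"
      define V where "V = (\<Sum>m=1..N. (Z r m \<omega> - zb)\<^sup>2)"
      have N0: "real N > 0" using n(2)[of r] by (simp add: N_def)
      have n2: "\<kappa> / 2 * real N < real (n2 r)" using k N0 by (simp add: N_def pos_less_divide_eq)
      have V: "\<sigma>1\<^sup>2 / 4 * real (n2 r) \<le> V"
      proof -
        have "\<not> ?A r \<omega>" using neg(2) by blast
        then have "\<sigma>1\<^sup>2 / 2 \<le> sample_var (n2 r) (\<lambda>m. Z r m \<omega>)" by linarith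
        moreover have "real (n2 r) / 2 \<le> real (n2 r) - 1" using n(2)[of r] by simp
        ultimately have "real (n2 r) / 2 * (\<sigma>1\<^sup>2 / 2) \<le> (real (n2 r) - 1) * sample_var (n2 r) (\<lambda>m. Z r m \<omega>)"
          by (intro mult_mono) auto
        also have "\<dots> \<le> (\<Sum>m=1..n2 r. (Z r m \<omega> - zb)\<^sup>2)"
          using n(2)[of r] by (intro sum_squares_about_sample_mean_le) auto
        also have "\<dots> \<le> V" unfolding V_def N_def by (intro sum_mono2) auto
        finally show ?thesis by (simp add: mult.commute)
      qed
      then have V0: "V > 0" using \<sigma>_pos n(2)[of r] by (intro order.strict_trans2[OF _ V]) auto
      define c where "c = sqrt (\<eta> * real N)"
      have c0: "c \<ge> 0" "c\<^sup>2 = \<eta> * real N" using \<eta> by (auto simp: c_def)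
      have zc: "\<bar>Z r m \<omega>\<bar> \<le> c" if m: "m \<in> {1..N}" for m
      proof -
        have "(Z r m \<omega>)\<^sup>2 \<le> \<eta> * real N"
        proof (cases "m \<le> n2 r")
          case True
          then have "(Z r m \<omega>)\<^sup>2 \<le> \<eta> * real (n2 r)" using neg(2) m by force
          also have "\<dots> \<le> \<eta> * real N" using \<eta> by (simp add: N_def)
          finally show ?thesis .
        next
          case False
          then have "n2 r + (m - n2 r) = m" "m - n2 r \<in> {1..n3 r}" using m by (auto simp: N_def)
          then have "(Z r m \<omega>)\<^sup>2 \<le> \<eta> * real (n3 r)" using neg(2) by force
          also have "\<dots> \<le> \<eta> * real N" using \<eta> by (simp add: N_def)
          finally show ?thesis .
        qed
        then show ?thesis unfolding c_def by (metis real_sqrt_abs real_sqrt_le_iff)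
      qed
      have zbc: "\<bar>zb\<bar> \<le> c"
      proof -
        have "\<bar>\<Sum>m=1..N. Z r m \<omega>\<bar> \<le> (\<Sum>m=1..N. c)" by (rule order.trans[OF sum_abs]) (intro sum_mono zc)
        then show ?thesis using N0 by (simp add: zb_def sample_mean_def abs_divide pos_divide_le_eq mult.commute)
      qed
      have "(Z r m \<omega> - zb)\<^sup>2 \<le> \<delta> * V" if m: "m \<in> {1..N}" for m
      proof -
        have "\<bar>Z r m \<omega> - zb\<bar> \<le> 2 * c" using zc[OF m] zbc by linarith
        then have "\<bar>Z r m \<omega> - zb\<bar>\<^sup>2 \<le> (2 * c)\<^sup>2" by (rule power_mono) simp
        then have "(Z r m \<omega> - zb)\<^sup>2 \<le> 4 * \<eta> * real N" using c0 by (simp add: power_mult_distrib)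
        also have "\<dots> = \<delta> * (\<sigma>1\<^sup>2 / 4 * (\<kappa> / 2 * real N))" by (simp add: \<eta>_def)
        also have "\<dots> \<le> \<delta> * (\<sigma>1\<^sup>2 / 4 * real (n2 r))" using n2 \<delta> by (intro mult_left_mono) auto
        also have "\<dots> \<le> \<delta> * V" using V \<delta> by (intro mult_left_mono) auto
        finally show ?thesis .
      qed
      then show False using neg(1) V0 unfolding no_dominant_term_def V_def zb_def N_def by blast
    qed
  qed measurable
qed

abbreviation T_stat :: "nat \<Rightarrow> 'a \<Rightarrow> real" where
  "T_stat r \<omega> \<equiv> reduced_T (a r) (n1 r) (n2 r) (n3 r) (\<lambda>j. D r j \<omega>) (\<lambda>m. Z r m \<omega>)"

lemma Z2_measurable [measurable]: "l \<in> {1..n3 r} \<Longrightarrow> Z r (n2 r + l) \<in> borel_measurable (M r)"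
  by (rule Z_measurable) auto

lemma Z1_measurable [measurable]: "m \<in> {1..n2 r} \<Longrightarrow> Z r m \<in> borel_measurable (M r)"
  by (rule Z_measurable) auto

lemma sample_mean_measurable:
  "(\<lambda>\<omega>. sample_mean (n1 r) (\<lambda>j. D r j \<omega>)) \<in> borel_measurable (M r)"
  "(\<lambda>\<omega>. sample_mean (n2 r) (\<lambda>m. Z r m \<omega>)) \<in> borel_measurable (M r)"
  "(\<lambda>\<omega>. sample_mean (n3 r) (\<lambda>l. Z r (n2 r + l) \<omega>)) \<in> borel_measurable (M r)"
  unfolding sample_mean_def by measurable

lemma T_stat_measurable: "T_stat r \<in> borel_measurable (M r)"
  using sample_mean_measurable[of r] sample_var_limits[THEN tendsto_in_prob_measurable, of r]
  unfolding reduced_T_def t_stat_def T2_def Let_def by measurable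

text \<open>The standard error of the difference of the two means of the incomplete observations.\<close>

definition se :: "nat \<Rightarrow> real" where "se r = sqrt (\<sigma>1\<^sup>2 / real (n2 r) + \<sigma>2\<^sup>2 / real (n3 r))"

lemma se_pos: "se r > 0"
  unfolding se_def using \<sigma>_pos n(2)[of r] n(3)[of r] by (intro real_sqrt_gt_zero add_pos_pos divide_pos_pos) auto

lemma se_square: "(se r)\<^sup>2 = \<sigma>1\<^sup>2 / real (n2 r) + \<sigma>2\<^sup>2 / real (n3 r)"
  unfolding se_def by (rule real_sqrt_pow2) auto

lemma paired_ratio_limit: "tendsto_in_prob M (\<lambda>r \<omega>. \<sigma>D / sqrt (sample_var (n1 r) (\<lambda>j. D r j \<omega>))) 1"
proof -
  have "isCont (\<lambda>x. \<sigma>D / sqrt x) (\<sigma>D\<^sup>2)" using \<sigma>_pos(1) by (intro continuous_intros) auto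
  then have "tendsto_in_prob M (\<lambda>r \<omega>. \<sigma>D / sqrt (sample_var (n1 r) (\<lambda>j. D r j \<omega>))) (\<sigma>D / sqrt (\<sigma>D\<^sup>2))"
    by (intro tendsto_in_prob_continuous[OF M sample_var_limits(1)]) measurable
  then show ?thesis using \<sigma>_pos(1) by simp
qed

text \<open>The estimated variance of the difference of means, relative to the true one, is a convex combination of
  the relative variance estimates of the two samples. Hence its relative error is at most the sum of
  theirs.\<close>

lemma two_sample_ratio_limit:
  "tendsto_in_prob M (\<lambda>r \<omega>. se r / sqrt (sample_var (n2 r) (\<lambda>m. Z r m \<omega>) / real (n2 r)
      + sample_var (n3 r) (\<lambda>l. Z r (n2 r + l) \<omega>) / real (n3 r))) 1"
proof -
  let ?v1 = "\<lambda>r \<omega>. sample_var (n2 r) (\<lambda>m. Z r m \<omega>)" and ?v2 = "\<lambda>r \<omega>. sample_var (n3 r) (\<lambda>l. Z r (n2 r + l) \<omega>)"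
  note [measurable] = sample_var_limits[THEN tendsto_in_prob_measurable]
  have rel: "tendsto_in_prob M (\<lambda>r \<omega>. \<bar>v r \<omega> - s\<^sup>2\<bar> / s\<^sup>2) 0" if "tendsto_in_prob M v (s\<^sup>2)" "s > 0" for v s
  proof -
    have "tendsto_in_prob M (\<lambda>r \<omega>. \<bar>v r \<omega> - s\<^sup>2\<bar> / s\<^sup>2) (\<bar>s\<^sup>2 - s\<^sup>2\<bar> / s\<^sup>2)"
      using that(2) by (intro tendsto_in_prob_continuous[OF M that(1), where f="\<lambda>x. \<bar>x - s\<^sup>2\<bar> / s\<^sup>2"])
        (auto intro!: continuous_intros)
    then show ?thesis by simp
  qed
  have lim: "tendsto_in_prob M (\<lambda>r \<omega>. \<bar>?v1 r \<omega> - \<sigma>1\<^sup>2\<bar> / \<sigma>1\<^sup>2 + \<bar>?v2 r \<omega> - \<sigma>2\<^sup>2\<bar> / \<sigma>2\<^sup>2) (0 + 0)"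
    by (intro tendsto_in_prob_add M rel sample_var_limits \<sigma>_pos)
  have "tendsto_in_prob M (\<lambda>r \<omega>. (?v1 r \<omega> / real (n2 r) + ?v2 r \<omega> / real (n3 r)) / (se r)\<^sup>2) 1"
  proof (rule tendsto_in_prob_dominated[OF M lim[simplified add_0_left]])
    fix r \<omega>
    define x where "x = \<sigma>1\<^sup>2 / real (n2 r)"
    define y where "y = \<sigma>2\<^sup>2 / real (n3 r)"
    have xy: "x > 0" "y > 0" using \<sigma>_pos n(2)[of r] n(3)[of r] by (auto simp: x_def y_def)
    have t: "(se r)\<^sup>2 = x + y" by (simp add: se_square x_def y_def)
    define e1 where "e1 = ?v1 r \<omega> - \<sigma>1\<^sup>2"
    define e2 where "e2 = ?v2 r \<omega> - \<sigma>2\<^sup>2"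
    have "(?v1 r \<omega> / real (n2 r) + ?v2 r \<omega> / real (n3 r)) / (se r)\<^sup>2 - 1 = (e1 / \<sigma>1\<^sup>2 * x + e2 / \<sigma>2\<^sup>2 * y) / (x + y)"
    proof -
      have "?v1 r \<omega> / real (n2 r) + ?v2 r \<omega> / real (n3 r) = (x + y) + (e1 / \<sigma>1\<^sup>2 * x + e2 / \<sigma>2\<^sup>2 * y)"
      proof -
        have part: "v / k = s / k + (v - s) / s * (s / k)" if "s > 0" for v s k :: real
        proof -
          have "(v - s) / s * (s / k) = (v - s) / k" using that by simp
          then show ?thesis using that by (simp flip: add_divide_distrib)
        qed
        have pos: "\<sigma>1\<^sup>2 > 0" "\<sigma>2\<^sup>2 > 0" using \<sigma>_pos by auto
        show ?thesis
          using part[OF pos(1), of "?v1 r \<omega>" "real (n2 r)"] part[OF pos(2), of "?v2 r \<omega>" "real (n3 r)"]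
          unfolding e1_def e2_def x_def y_def by linarith
      qed
      then show ?thesis unfolding t using xy by (simp add: add_divide_distrib)
    qed
    also have "\<bar>\<dots>\<bar> = \<bar>e1 / \<sigma>1\<^sup>2 * x + e2 / \<sigma>2\<^sup>2 * y\<bar> / (x + y)" using xy by (simp add: abs_divide)
    also have "\<dots> \<le> (\<bar>e1\<bar> / \<sigma>1\<^sup>2 + \<bar>e2\<bar> / \<sigma>2\<^sup>2) * (x + y) / (x + y)"
    proof (rule divide_right_mono)
      have "\<bar>e1 / \<sigma>1\<^sup>2 * x + e2 / \<sigma>2\<^sup>2 * y\<bar> \<le> \<bar>e1\<bar> / \<sigma>1\<^sup>2 * x + \<bar>e2\<bar> / \<sigma>2\<^sup>2 * y"
        by (rule order.trans[OF abs_triangle_ineq]) (use xy in \<open>simp add: abs_mult abs_divide\<close>)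
      also have "\<dots> \<le> \<bar>e1\<bar> / \<sigma>1\<^sup>2 * (x + y) + \<bar>e2\<bar> / \<sigma>2\<^sup>2 * (x + y)"
        using xy by (intro add_mono mult_left_mono) auto
      finally show "\<bar>e1 / \<sigma>1\<^sup>2 * x + e2 / \<sigma>2\<^sup>2 * y\<bar> \<le> (\<bar>e1\<bar> / \<sigma>1\<^sup>2 + \<bar>e2\<bar> / \<sigma>2\<^sup>2) * (x + y)"
        by (simp only: distrib_right)
    qed (use xy in simp)
    also have "\<dots> = \<bar>e1\<bar> / \<sigma>1\<^sup>2 + \<bar>e2\<bar> / \<sigma>2\<^sup>2" using xy by simp
    finally show "\<bar>(?v1 r \<omega> / real (n2 r) + ?v2 r \<omega> / real (n3 r)) / (se r)\<^sup>2 - 1\<bar>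
       \<le> \<bar>?v1 r \<omega> - \<sigma>1\<^sup>2\<bar> / \<sigma>1\<^sup>2 + \<bar>?v2 r \<omega> - \<sigma>2\<^sup>2\<bar> / \<sigma>2\<^sup>2" by (simp only: e1_def e2_def)
  qed measurable
  from tendsto_in_prob_continuous[OF M this, of "\<lambda>x. 1 / sqrt x"]
  have "tendsto_in_prob M (\<lambda>r \<omega>. 1 / sqrt ((?v1 r \<omega> / real (n2 r) + ?v2 r \<omega> / real (n3 r)) / (se r)\<^sup>2)) 1"
    by (simp add: continuous_intros)
  then show ?thesis
    by (rule tendsto_in_prob_cong) (use se_pos in \<open>simp add: real_sqrt_divide less_imp_le\<close>)
qed

lemma paired_second_moment:
  assumes mean: "(LINT x|\<nu>D. x) = 0"
  shows "integrable (M r) (\<lambda>\<omega>. ((\<Sum>j=1..n1 r. D r j \<omega>) / (\<sigma>D * sqrt (real (n1 r))))\<^sup>2)"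
    "(LINT \<omega>|M r. ((\<Sum>j=1..n1 r. D r j \<omega>) / (\<sigma>D * sqrt (real (n1 r))))\<^sup>2) = 1"
proof -
  have v: "(LINT x|\<nu>D. x\<^sup>2) = \<sigma>D\<^sup>2" by (simp add: \<sigma>_square mean)
  note S = iid_row_sum_square[OF row_D _ square(1) mean, of r]
  show "integrable (M r) (\<lambda>\<omega>. ((\<Sum>j=1..n1 r. D r j \<omega>) / (\<sigma>D * sqrt (real (n1 r))))\<^sup>2)"
    unfolding power_divide using S(1) by simp
  show "(LINT \<omega>|M r. ((\<Sum>j=1..n1 r. D r j \<omega>) / (\<sigma>D * sqrt (real (n1 r))))\<^sup>2) = 1"
    unfolding power_divide using S(2) v \<sigma>_pos(1) n(1)[of r] by (simp add: power_mult_distrib)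
qed

text \<open>The weight with which an observation enters the difference of the two standardised means.\<close>

definition wt :: "nat \<Rightarrow> nat \<Rightarrow> real" where
  "wt r m = (if m \<le> n2 r then 1 / (real (n2 r) * se r) else - 1 / (real (n3 r) * se r))"

text \<open>Any constant may be subtracted from the observations, because the weights sum to 0; it will be the
  common mean.\<close>

lemma two_sample_linear:
  "(sample_mean (n2 r) x - sample_mean (n3 r) (\<lambda>l. x (n2 r + l))) / se r = (\<Sum>m=1..n2 r + n3 r. wt r m * (x m - c))"
proof -
  have 1: "(\<Sum>m=1..n2 r. wt r m * (x m - c)) = (sample_mean (n2 r) x - c) / se r"
  proof -
    have "(\<Sum>m=1..n2 r. wt r m * (x m - c)) = (\<Sum>m=1..n2 r. x m - c) / (real (n2 r) * se r)"
      by (simp add: wt_def sum_divide_distrib)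
    then show ?thesis using n(2)[of r] by (simp add: sample_mean_def sum_subtractf diff_divide_distrib)
  qed
  have 2: "(\<Sum>l=1..n3 r. wt r (n2 r + l) * (x (n2 r + l) - c)) = - ((sample_mean (n3 r) (\<lambda>l. x (n2 r + l)) - c) / se r)"
  proof -
    have "(\<Sum>l=1..n3 r. wt r (n2 r + l) * (x (n2 r + l) - c)) = (\<Sum>l=1..n3 r. - ((x (n2 r + l) - c) / (real (n3 r) * se r)))"
      by (intro sum.cong) (auto simp: wt_def)
    also have "\<dots> = - ((\<Sum>l=1..n3 r. x (n2 r + l) - c) / (real (n3 r) * se r))"
      by (simp only: sum_negf sum_divide_distrib)
    finally show ?thesis using n(3)[of r] by (simp add: sample_mean_def sum_subtractf diff_divide_distrib)
  qed
  show ?thesis unfolding sum_split_blocks 1 2 by (simp add: diff_divide_distrib)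
qed

lemma two_sample_second_moment:
  assumes mean: "(LINT x|\<nu>1. x) = (LINT x|\<nu>2. x)"
  shows "integrable (M r) (\<lambda>\<omega>. ((sample_mean (n2 r) (\<lambda>m. Z r m \<omega>) - sample_mean (n3 r) (\<lambda>l. Z r (n2 r + l) \<omega>)) / se r)\<^sup>2)"
    "(LINT \<omega>|M r. ((sample_mean (n2 r) (\<lambda>m. Z r m \<omega>) - sample_mean (n3 r) (\<lambda>l. Z r (n2 r + l) \<omega>)) / se r)\<^sup>2) = 1"
proof -
  interpret prob_space "M r" by (rule M)
  define \<mu> where "\<mu> = (LINT x|\<nu>1. x)"
  define X where "X m \<omega> = wt r m * (Z r m \<omega> - \<mu>)" for m \<omega>
  have ind: "indep_vars (\<lambda>_. borel) X {1..n2 r + n3 r}"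
    unfolding X_def[abs_def] by (rule indep_vars_compose2[OF indep_Z]) measurable
  have first: "integrable (M r) (X m) \<and> expectation (X m) = 0 \<and> integrable (M r) (\<lambda>\<omega>. (X m \<omega>)\<^sup>2) \<and>
      expectation (\<lambda>\<omega>. (X m \<omega>)\<^sup>2) = \<sigma>1\<^sup>2 / (real (n2 r) * se r)\<^sup>2" if m: "m \<in> {1..n2 r}" for m
  proof -
    have w: "wt r m = 1 / (real (n2 r) * se r)" using m by (simp add: wt_def)
    have sq: "integrable \<nu>1 (\<lambda>x. (x - \<mu>)\<^sup>2)" unfolding power2_diff using square(2) first_moments(2) by auto
    have e: "(LINT x|\<nu>1. x - \<mu>) = 0" using first_moments(2) by (simp add: \<mu>_def \<nu>1.prob_space)
    note I = iid_row_integral[OF row_1 m]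
    have m1: "(\<lambda>x::real. x - \<mu>) \<in> borel_measurable borel" "(\<lambda>x::real. (x - \<mu>)\<^sup>2) \<in> borel_measurable borel" by measurable
    have "integrable \<nu>1 (\<lambda>x. x - \<mu>)" using first_moments(2) by simp
    then have "integrable (M r) (\<lambda>\<omega>. Z r m \<omega> - \<mu>)" by (rule I(2)[OF m1(1), THEN iffD2])
    moreover have "(LINT \<omega>|M r. Z r m \<omega> - \<mu>) = 0" unfolding I(1)[OF m1(1)] by (rule e)
    moreover have "integrable (M r) (\<lambda>\<omega>. (Z r m \<omega> - \<mu>)\<^sup>2)" using sq by (rule I(2)[OF m1(2), THEN iffD2])
    moreover have "(LINT \<omega>|M r. (Z r m \<omega> - \<mu>)\<^sup>2) = \<sigma>1\<^sup>2" unfolding I(1)[OF m1(2)] unfolding \<sigma>_square \<mu>_def ..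
    ultimately show ?thesis unfolding X_def[abs_def] w by (simp add: power_mult_distrib power_divide)
  qed
  have second: "integrable (M r) (X (n2 r + l)) \<and> expectation (X (n2 r + l)) = 0 \<and> integrable (M r) (\<lambda>\<omega>. (X (n2 r + l) \<omega>)\<^sup>2) \<and>
      expectation (\<lambda>\<omega>. (X (n2 r + l) \<omega>)\<^sup>2) = \<sigma>2\<^sup>2 / (real (n3 r) * se r)\<^sup>2" if m: "l \<in> {1..n3 r}" for l
  proof -
    have w: "wt r (n2 r + l) = - 1 / (real (n3 r) * se r)" using m by (simp add: wt_def)
    have sq: "integrable \<nu>2 (\<lambda>x. (x - \<mu>)\<^sup>2)" unfolding power2_diff using square(3) first_moments(3) by auto
    have e: "(LINT x|\<nu>2. x - \<mu>) = 0" using first_moments(3) by (simp add: \<mu>_def mean \<nu>2.prob_space)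
    note I = iid_row_integral[OF row_2 m]
    have m1: "(\<lambda>x::real. x - \<mu>) \<in> borel_measurable borel" "(\<lambda>x::real. (x - \<mu>)\<^sup>2) \<in> borel_measurable borel" by measurable
    have "integrable \<nu>2 (\<lambda>x. x - \<mu>)" using first_moments(3) by simp
    then have "integrable (M r) (\<lambda>\<omega>. Z r (n2 r + l) \<omega> - \<mu>)" by (rule I(2)[OF m1(1), THEN iffD2])
    moreover have "(LINT \<omega>|M r. Z r (n2 r + l) \<omega> - \<mu>) = 0" unfolding I(1)[OF m1(1)] by (rule e)
    moreover have "integrable (M r) (\<lambda>\<omega>. (Z r (n2 r + l) \<omega> - \<mu>)\<^sup>2)" using sq by (rule I(2)[OF m1(2), THEN iffD2])
    moreover have "(LINT \<omega>|M r. (Z r (n2 r + l) \<omega> - \<mu>)\<^sup>2) = \<sigma>2\<^sup>2" unfolding I(1)[OF m1(2)] unfolding \<sigma>_square by (simp only: \<mu>_def mean)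
    ultimately show ?thesis unfolding X_def[abs_def] w by (simp add: power_mult_distrib power_divide)
  qed
  have all: "integrable (M r) (\<lambda>\<omega>. (X m \<omega>)\<^sup>2)" "expectation (X m) = 0" if "m \<in> {1..n2 r + n3 r}" for m
  proof -
    have "integrable (M r) (\<lambda>\<omega>. (X m \<omega>)\<^sup>2) \<and> expectation (X m) = 0"
    proof (cases "m \<le> n2 r")
      case True then show ?thesis using first[of m] that by auto
    next
      case False
      then have "m - n2 r \<in> {1..n3 r}" "n2 r + (m - n2 r) = m" using that by auto
      then show ?thesis using second[of "m - n2 r"] by simp
    qed
    then show "integrable (M r) (\<lambda>\<omega>. (X m \<omega>)\<^sup>2)" "expectation (X m) = 0" by auto
  qed
  have eq: "(sample_mean (n2 r) (\<lambda>m. Z r m \<omega>) - sample_mean (n3 r) (\<lambda>l. Z r (n2 r + l) \<omega>)) / se r = (\<Sum>m=1..n2 r + n3 r. X m \<omega>)" for \<omega>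
    unfolding X_def by (rule two_sample_linear)
  show "integrable (M r) (\<lambda>\<omega>. ((sample_mean (n2 r) (\<lambda>m. Z r m \<omega>) - sample_mean (n3 r) (\<lambda>l. Z r (n2 r + l) \<omega>)) / se r)\<^sup>2)"
    unfolding eq by (rule indep_centered_sum_square(1)[OF _ ind all]) auto
  have "expectation (\<lambda>\<omega>. (\<Sum>m=1..n2 r + n3 r. X m \<omega>)\<^sup>2) = (\<Sum>m=1..n2 r + n3 r. expectation (\<lambda>\<omega>. (X m \<omega>)\<^sup>2))"
    by (rule indep_centered_sum_square(2)[OF _ ind all]) auto
  also have "\<dots> = (\<Sum>m=1..n2 r. \<sigma>1\<^sup>2 / (real (n2 r) * se r)\<^sup>2) + (\<Sum>l=1..n3 r. \<sigma>2\<^sup>2 / (real (n3 r) * se r)\<^sup>2)"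
    unfolding sum_split_blocks using first second by (intro arg_cong2[where f="(+)"] sum.cong) auto
  also have "\<dots> = (\<sigma>1\<^sup>2 / real (n2 r) + \<sigma>2\<^sup>2 / real (n3 r)) / (se r)\<^sup>2"
    using n(2)[of r] n(3)[of r] by (simp add: power_mult_distrib power2_eq_square add_divide_distrib ac_simps)
  also have "\<dots> = 1" unfolding se_square[symmetric] using se_pos[of r] by simp
  finally show "(LINT \<omega>|M r. ((sample_mean (n2 r) (\<lambda>m. Z r m \<omega>) - sample_mean (n3 r) (\<lambda>l. Z r (n2 r + l) \<omega>)) / se r)\<^sup>2) = 1"
    unfolding eq .
qed

text \<open>By independence the characteristic function of the standardised statistic is a product of
  three powers; the weights of the three samples are square-summable to 1.\<close>

lemma linear_part_asymp_normal:
  assumes mD: "(LINT x|\<nu>D. x) = 0" and m12: "(LINT x|\<nu>1. x) = (LINT x|\<nu>2. x)"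
  shows "asymp_normal M (\<lambda>r \<omega>. sqrt (a r) * ((\<Sum>j=1..n1 r. D r j \<omega>) / (\<sigma>D * sqrt (real (n1 r)))) +
    sqrt (1 - a r) * ((sample_mean (n2 r) (\<lambda>m. Z r m \<omega>) - sample_mean (n3 r) (\<lambda>l. Z r (n2 r + l) \<omega>)) / se r))"
  unfolding asymp_normal_def
proof (intro conjI allI)
  note [measurable] = sample_mean_measurable
  show "(\<lambda>\<omega>. sqrt (a r) * ((\<Sum>j=1..n1 r. D r j \<omega>) / (\<sigma>D * sqrt (real (n1 r)))) +
    sqrt (1 - a r) * ((sample_mean (n2 r) (\<lambda>m. Z r m \<omega>) - sample_mean (n3 r) (\<lambda>l. Z r (n2 r + l) \<omega>)) / se r)) \<in> borel_measurable (M r)" for r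
    by measurable
  fix t :: real
  define \<mu> where "\<mu> = (LINT x|\<nu>1. x)"
  define \<nu>D' where "\<nu>D' = distr \<nu>D borel (\<lambda>x. x - 0)"
  define \<nu>1' where "\<nu>1' = distr \<nu>1 borel (\<lambda>x. x - \<mu>)"
  define \<nu>2' where "\<nu>2' = distr \<nu>2 borel (\<lambda>x. x - \<mu>)"
  have m2: "(LINT x|\<nu>2. x) = \<mu>" and m1: "(LINT x|\<nu>1. x) = \<mu>" using m12 by (simp_all add: \<mu>_def)
  note cD = centered_law[OF real_distribution_laws(1) square(1) mD, folded \<nu>D'_def, folded \<sigma>_square]
  note c1 = centered_law[OF real_distribution_laws(2) square(2) m1, folded \<nu>1'_def, folded \<sigma>_square]
  note c2 = centered_law[OF real_distribution_laws(3) square(3) m2, folded \<nu>2'_def, folded \<sigma>_square]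
  define s0 where "s0 r = t * sqrt (a r)" for r
  define s1 where "s1 r = t * sqrt (1 - a r) * (\<sigma>1 / (sqrt (real (n2 r)) * se r))" for r
  define s2 where "s2 r = - t * sqrt (1 - a r) * (\<sigma>2 / (sqrt (real (n3 r)) * se r))" for r
  have sum_sq: "(s0 r)\<^sup>2 + (s1 r)\<^sup>2 + (s2 r)\<^sup>2 = t\<^sup>2" for r
  proof -
    have "(s1 r)\<^sup>2 + (s2 r)\<^sup>2 = t\<^sup>2 * (1 - a r) * ((\<sigma>1\<^sup>2 / real (n2 r) + \<sigma>2\<^sup>2 / real (n3 r)) / (se r)\<^sup>2)"
      using a[of r] by (simp add: s1_def s2_def power_mult_distrib power_divide add_divide_distrib distrib_left)
    also have "\<dots> = t\<^sup>2 * (1 - a r)" unfolding se_square[symmetric] using se_pos[of r] by simp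
    finally have "(s1 r)\<^sup>2 + (s2 r)\<^sup>2 = t\<^sup>2 * (1 - a r)" .
    moreover have "(s0 r)\<^sup>2 = t\<^sup>2 * a r" using a[of r] by (simp add: s0_def power_mult_distrib)
    ultimately show ?thesis by (simp add: algebra_simps)
  qed
  have le: "\<bar>s0 r\<bar> \<le> \<bar>t\<bar>" "\<bar>s1 r\<bar> \<le> \<bar>t\<bar>" "\<bar>s2 r\<bar> \<le> \<bar>t\<bar>" for r
    using sum_sq[of r] zero_le_power2[of "s0 r"] zero_le_power2[of "s1 r"] zero_le_power2[of "s2 r"]
    unfolding abs_le_square_iff by linarith+
  define x where "x r = char \<nu>D' (s0 r / (\<sigma>D * sqrt (real (n1 r)))) ^ n1 r" for r
  define y where "y r = char \<nu>1' (s1 r / (\<sigma>1 * sqrt (real (n2 r)))) ^ n2 r" for r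
  define z where "z r = char \<nu>2' (s2 r / (\<sigma>2 * sqrt (real (n3 r)))) ^ n3 r" for r
  have char: "char (distr (M r) borel (\<lambda>\<omega>. sqrt (a r) * ((\<Sum>j=1..n1 r. D r j \<omega>) / (\<sigma>D * sqrt (real (n1 r)))) +
    sqrt (1 - a r) * ((sample_mean (n2 r) (\<lambda>m. Z r m \<omega>) - sample_mean (n3 r) (\<lambda>l. Z r (n2 r + l) \<omega>)) / se r))) t
    = x r * (y r * z r)" for r
  proof -
    interpret prob_space "M r" by (rule M)
    let ?I = "{1..n1 r} <+> {1..n2 r + n3 r}"
    define co where "co = case_sum (\<lambda>j::nat. sqrt (a r) / (\<sigma>D * sqrt (real (n1 r)))) (\<lambda>m::nat. sqrt (1 - a r) * wt r m)"
    define me where "me = case_sum (\<lambda>j::nat. 0::real) (\<lambda>m::nat. \<mu>)"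
    define X where "X i \<omega> = co i * (case_sum (D r) (Z r) i \<omega> - me i)" for i \<omega>
    have ind: "indep_vars (\<lambda>_. borel) X ?I"
      unfolding X_def[abs_def] by (rule indep_vars_compose2[OF indep]) measurable
    have "sqrt (a r) * ((\<Sum>j=1..n1 r. D r j \<omega>) / (\<sigma>D * sqrt (real (n1 r)))) +
      sqrt (1 - a r) * ((sample_mean (n2 r) (\<lambda>m. Z r m \<omega>) - sample_mean (n3 r) (\<lambda>l. Z r (n2 r + l) \<omega>)) / se r) = (\<Sum>i\<in>?I. X i \<omega>)" for \<omega>
      unfolding two_sample_linear[where c=\<mu> and x="\<lambda>m. Z r m \<omega>"]
      by (simp add: sum.Plus X_def co_def me_def sum_distrib_left sum_divide_distrib mult.assoc)
    then have "char (distr (M r) borel (\<lambda>\<omega>. sqrt (a r) * ((\<Sum>j=1..n1 r. D r j \<omega>) / (\<sigma>D * sqrt (real (n1 r)))) +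
      sqrt (1 - a r) * ((sample_mean (n2 r) (\<lambda>m. Z r m \<omega>) - sample_mean (n3 r) (\<lambda>l. Z r (n2 r + l) \<omega>)) / se r))) t
      = (\<Prod>i\<in>?I. char (distr (M r) borel (X i)) t)"
      using char_distr_sum[OF ind] by simp
    also have "\<dots> = (\<Prod>j=1..n1 r. char (distr (M r) borel (X (Inl j))) t) *
       ((\<Prod>m=1..n2 r. char (distr (M r) borel (X (Inr m))) t) * (\<Prod>l=1..n3 r. char (distr (M r) borel (X (Inr (n2 r + l)))) t))"
      by (simp only: prod.Plus finite_atLeastAtMost prod_split_blocks o_def)
    also have "(\<Prod>j=1..n1 r. char (distr (M r) borel (X (Inl j))) t) = x r"
    proof -
      have "char (distr (M r) borel (X (Inl j))) t = char \<nu>D' (s0 r / (\<sigma>D * sqrt (real (n1 r))))" if "j \<in> {1..n1 r}" for j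
        using char_affine[OF D_measurable[OF that] law_D[OF that], of "sqrt (a r) / (\<sigma>D * sqrt (real (n1 r)))" 0 t] by (simp add: X_def[abs_def] co_def me_def \<nu>D'_def s0_def)
      then show ?thesis by (simp add: x_def)
    qed
    also have "(\<Prod>m=1..n2 r. char (distr (M r) borel (X (Inr m))) t) = y r"
    proof -
      have "char (distr (M r) borel (X (Inr m))) t = char \<nu>1' (s1 r / (\<sigma>1 * sqrt (real (n2 r))))" if m: "m \<in> {1..n2 r}" for m
      proof -
        have "t * (sqrt (1 - a r) * wt r m) = s1 r / (\<sigma>1 * sqrt (real (n2 r)))"
          using m \<sigma>_pos(2) by (simp add: wt_def s1_def)
        then show ?thesis
          using char_affine[OF Z1_measurable[OF m] law_1[OF m], of "sqrt (1 - a r) * wt r m" \<mu> t]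
          by (simp add: X_def[abs_def] co_def me_def \<nu>1'_def)
      qed
      then show ?thesis by (simp add: y_def)
    qed
    also have "(\<Prod>l=1..n3 r. char (distr (M r) borel (X (Inr (n2 r + l)))) t) = z r"
    proof -
      have "char (distr (M r) borel (X (Inr (n2 r + l)))) t = char \<nu>2' (s2 r / (\<sigma>2 * sqrt (real (n3 r))))" if l: "l \<in> {1..n3 r}" for l
      proof -
        have "t * (sqrt (1 - a r) * wt r (n2 r + l)) = s2 r / (\<sigma>2 * sqrt (real (n3 r)))"
          using l \<sigma>_pos(3) by (simp add: wt_def s2_def)
        moreover have mem: "n2 r + l \<in> {n2 r + 1..n2 r + n3 r}" using l by auto
        ultimately show ?thesis
          using char_affine[OF Z2_measurable[OF l] law_2[OF mem], of "sqrt (1 - a r) * wt r (n2 r + l)" \<mu> t]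
          by (simp add: X_def[abs_def] co_def me_def \<nu>2'_def)
      qed
      then show ?thesis by (simp add: z_def)
    qed
    finally show ?thesis .
  qed
  let ?g = "\<lambda>s::real. complex_of_real (exp (- (s\<^sup>2) / 2))"
  have target: "?g t = ?g (s0 r) * (?g (s1 r) * ?g (s2 r))" for r
  proof -
    have "- (t\<^sup>2) / 2 = - ((s0 r)\<^sup>2) / 2 + (- ((s1 r)\<^sup>2) / 2 + - ((s2 r)\<^sup>2) / 2)" using sum_sq[of r] by (simp add: field_simps)
    then show ?thesis by (simp only: exp_add of_real_mult)
  qed
  have n0: "n1 r > 0" "n2 r > 0" "n3 r > 0" for r using n(1)[of r] n(2)[of r] n(3)[of r] by auto
  have x0: "(\<lambda>r. norm (x r - ?g (s0 r))) \<longlonglongrightarrow> 0"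
    unfolding x_def by (rule tendsto_norm_zero[OF iid_char_power_limit[OF cD \<sigma>_pos(1) le(1) lim(1) n0(1)]])
  have y0: "(\<lambda>r. norm (y r - ?g (s1 r))) \<longlonglongrightarrow> 0"
    unfolding y_def by (rule tendsto_norm_zero[OF iid_char_power_limit[OF c1 \<sigma>_pos(2) le(2) lim(2) n0(2)]])
  have z0: "(\<lambda>r. norm (z r - ?g (s2 r))) \<longlonglongrightarrow> 0"
    unfolding z_def by (rule tendsto_norm_zero[OF iid_char_power_limit[OF c2 \<sigma>_pos(3) le(3) lim(3) n0(3)]])
  have g1: "norm (?g s) \<le> 1" for s by simp
  have x1: "norm (x r) \<le> 1" and y1: "norm (y r) \<le> 1" for r
    using real_distribution.cmod_char_le_1[OF cD(1)] real_distribution.cmod_char_le_1[OF c1(1)]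
    by (auto simp: x_def y_def norm_power power_le_one)
  have bound: "norm (x r * (y r * z r) - ?g t) \<le> norm (x r - ?g (s0 r)) + (norm (y r - ?g (s1 r)) + norm (z r - ?g (s2 r)))" for r
  proof -
    have "norm (?g (s1 r) * ?g (s2 r)) \<le> 1" unfolding norm_mult using g1 by (intro mult_le_one) auto
    from norm_mult_diff_le[OF x1 this] have "norm (x r * (y r * z r) - ?g t) \<le>
       norm (x r - ?g (s0 r)) + norm (y r * z r - ?g (s1 r) * ?g (s2 r))" unfolding target[of r] .
    moreover have "norm (y r * z r - ?g (s1 r) * ?g (s2 r)) \<le> norm (y r - ?g (s1 r)) + norm (z r - ?g (s2 r))"
      by (rule norm_mult_diff_le[OF y1 g1])
    ultimately show ?thesis by linarith
  qed
  have null: "(\<lambda>r. norm (x r - ?g (s0 r)) + (norm (y r - ?g (s1 r)) + norm (z r - ?g (s2 r)))) \<longlonglongrightarrow> 0"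
    by (intro tendsto_add_zero x0 y0 z0)
  have "(\<lambda>r. x r * (y r * z r) - ?g t) \<longlonglongrightarrow> 0"
    by (rule Lim_null_comparison[OF always_eventually null]) (rule allI, rule bound)
  then show "(\<lambda>r. char (distr (M r) borel (\<lambda>\<omega>. sqrt (a r) * ((\<Sum>j=1..n1 r. D r j \<omega>) / (\<sigma>D * sqrt (real (n1 r)))) +
    sqrt (1 - a r) * ((sample_mean (n2 r) (\<lambda>m. Z r m \<omega>) - sample_mean (n3 r) (\<lambda>l. Z r (n2 r + l) \<omega>)) / se r))) t)
     \<longlonglongrightarrow> ?g t"
    unfolding char by (rule LIM_zero_cancel)
qed

lemma t_stat_ratio:
  "t_stat (n1 r) d = ((\<Sum>j=1..n1 r. d j) / (\<sigma>D * sqrt (real (n1 r)))) * (\<sigma>D / sqrt (sample_var (n1 r) d))"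
proof -
  have "t_stat (n1 r) d = (\<Sum>j=1..n1 r. d j) * (sqrt (real (n1 r)) / real (n1 r)) / sqrt (sample_var (n1 r) d)"
    by (simp add: t_stat_def sample_mean_def real_sqrt_divide)
  also have "sqrt (real (n1 r)) / real (n1 r) = 1 / sqrt (real (n1 r))"
    using n(1)[of r] by (simp add: real_div_sqrt field_simps)
  finally show ?thesis using \<sigma>_pos(1) by simp
qed

lemma T2_ratio:
  "T2 (n2 r) (n3 r) z = ((sample_mean (n2 r) z - sample_mean (n3 r) (\<lambda>l. z (n2 r + l))) / se r) *
    (se r / sqrt (sample_var (n2 r) z / real (n2 r) + sample_var (n3 r) (\<lambda>l. z (n2 r + l)) / real (n3 r)))"
  using se_pos[of r] by (simp add: T2_def Let_def)

text \<open>The statistic is the standardised one with each part multiplied by a ratio of standard deviations.\<close>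

theorem T_stat_asymp_normal:
  assumes mD: "(LINT x|\<nu>D. x) = 0" and m12: "(LINT x|\<nu>1. x) = (LINT x|\<nu>2. x)"
  shows "asymp_normal M T_stat"
proof -
  note [measurable] = sample_mean_measurable
  have meas1: "(\<lambda>\<omega>. (\<Sum>j=1..n1 r. D r j \<omega>) / (\<sigma>D * sqrt (real (n1 r)))) \<in> borel_measurable (M r)" for r
    by measurable
  have meas2: "(\<lambda>\<omega>. (sample_mean (n2 r) (\<lambda>m. Z r m \<omega>) - sample_mean (n3 r) (\<lambda>l. Z r (n2 r + l) \<omega>)) / se r)
     \<in> borel_measurable (M r)" for r
    by measurable
  note result = asymp_normal_weighted_ratio[OF M a meas1 paired_second_moment(1)[OF mD]
      eq_refl[OF paired_second_moment(2)[OF mD]] meas2 two_sample_second_moment(1)[OF m12]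
      eq_refl[OF two_sample_second_moment(2)[OF m12]]
      paired_ratio_limit two_sample_ratio_limit linear_part_asymp_normal[OF mD m12]]
  show ?thesis unfolding reduced_T_def t_stat_ratio T2_ratio by (rule result)
qed

lemma sample_mean_limits:
  "tendsto_in_prob M (\<lambda>r \<omega>. sample_mean (n1 r) (\<lambda>j. D r j \<omega>)) (LINT x|\<nu>D. x)"
  "tendsto_in_prob M (\<lambda>r \<omega>. sample_mean (n2 r) (\<lambda>m. Z r m \<omega>)) (LINT x|\<nu>1. x)"
  "tendsto_in_prob M (\<lambda>r \<omega>. sample_mean (n3 r) (\<lambda>l. Z r (n2 r + l) \<omega>)) (LINT x|\<nu>2. x)"
  by (rule iid_row_sample_mean[OF row_D square(1) lim(1)] iid_row_sample_mean[OF row_1 square(2) lim(2)]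
      iid_row_sample_mean[OF row_2 square(3) lim(3)])+

text \<open>If both means are ordered then each studentised part exceeds a positive multiple of the root of
  the smallest sample size, and so does the weighted sum because \<open>\<surd>a + \<surd>(1 - a) \<ge> 1\<close>.\<close>

theorem T_stat_diverges:
  assumes mD: "(LINT x|\<nu>D. x) > 0" and m12: "(LINT x|\<nu>1. x) > (LINT x|\<nu>2. x)"
  shows "(\<lambda>r. measure (M r) {\<omega>\<in>space (M r). T_stat r \<omega> \<le> u}) \<longlonglongrightarrow> 0"
proof -
  let ?m = "\<lambda>r \<omega>. sample_mean (n1 r) (\<lambda>j. D r j \<omega>)" and ?v = "\<lambda>r \<omega>. sample_var (n1 r) (\<lambda>j. D r j \<omega>)"
  let ?m1 = "\<lambda>r \<omega>. sample_mean (n2 r) (\<lambda>m. Z r m \<omega>)" and ?v1 = "\<lambda>r \<omega>. sample_var (n2 r) (\<lambda>m. Z r m \<omega>)"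
  let ?m2 = "\<lambda>r \<omega>. sample_mean (n3 r) (\<lambda>l. Z r (n2 r + l) \<omega>)" and ?v2 = "\<lambda>r \<omega>. sample_var (n3 r) (\<lambda>l. Z r (n2 r + l) \<omega>)"
  define p where "p = (LINT x|\<nu>D. x) / \<sigma>D"
  define q where "q = ((LINT x|\<nu>1. x) - (LINT x|\<nu>2. x)) / sqrt (\<sigma>1\<^sup>2 + \<sigma>2\<^sup>2)"
  \<comment> \<open>A level that both standardised mean differences exceed with probability tending to 1.\<close>
  define h where "h = min p q / 2"
  have s12: "\<sigma>1\<^sup>2 + \<sigma>2\<^sup>2 > 0" using \<sigma>_pos by (simp add: add_pos_pos)
  have pq: "p > 0" "q > 0" using mD m12 \<sigma>_pos(1) s12 by (auto simp: p_def q_def)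
  have h: "h > 0" "h < p" "h < q" using pq by (auto simp: h_def min_def)
  have P: "tendsto_in_prob M (\<lambda>r \<omega>. ?m r \<omega> / sqrt (?v r \<omega>)) p"
  proof -
    have "tendsto_in_prob M (\<lambda>r \<omega>. ?m r \<omega> / sqrt (?v r \<omega>)) ((LINT x|\<nu>D. x) / sqrt (\<sigma>D\<^sup>2))"
      by (rule tendsto_in_prob_continuous2[OF M sample_mean_limits(1) sample_var_limits(1), where f="\<lambda>x y. x / sqrt y"])
        (use \<sigma>_pos(1) in \<open>auto intro!: continuous_intros\<close>)
    then show ?thesis using \<sigma>_pos(1) by (simp add: p_def)
  qed
  have Q: "tendsto_in_prob M (\<lambda>r \<omega>. (?m1 r \<omega> - ?m2 r \<omega>) / sqrt (?v1 r \<omega> + ?v2 r \<omega>)) q"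
    unfolding q_def
    by (rule tendsto_in_prob_continuous2[OF M tendsto_in_prob_diff[OF M sample_mean_limits(2,3)]
          tendsto_in_prob_add[OF M sample_var_limits(2,3)], where f="\<lambda>x y. x / sqrt y"])
      (use s12 in \<open>auto intro!: continuous_intros\<close>)
  note [measurable] = tendsto_in_prob_measurable[OF P] tendsto_in_prob_measurable[OF Q]
  let ?A = "\<lambda>r \<omega>. p - h < \<bar>?m r \<omega> / sqrt (?v r \<omega>) - p\<bar>"
  let ?B = "\<lambda>r \<omega>. q - h < \<bar>(?m1 r \<omega> - ?m2 r \<omega>) / sqrt (?v1 r \<omega> + ?v2 r \<omega>) - q\<bar>"
  have A: "(\<lambda>r. measure (M r) {\<omega>\<in>space (M r). ?A r \<omega>}) \<longlonglongrightarrow> 0"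
    by (rule tendsto_in_probD[OF P]) (use h in simp)
  have B: "(\<lambda>r. measure (M r) {\<omega>\<in>space (M r). ?B r \<omega>}) \<longlonglongrightarrow> 0"
    by (rule tendsto_in_probD[OF Q]) (use h in simp)
  \<comment> \<open>Sample sizes above \<open>k\<^sup>2\<close> push both studentised parts up to at least \<open>h k > u\<close>.\<close>
  define k where "k = \<bar>u\<bar> / h + 1"
  have k: "k > 0" using h by (simp add: k_def add_nonneg_pos)
  have large: "\<forall>\<^sub>F r in sequentially. k\<^sup>2 < real (n r)" if "(\<lambda>r. 1 / real (n r)) \<longlonglongrightarrow> 0" "\<And>r. 2 \<le> n r" for n :: "nat \<Rightarrow> nat"
  proof -
    have "\<forall>\<^sub>F r in sequentially. 1 / real (n r) < 1 / k\<^sup>2" using k by (intro order_tendstoD(2)[OF that(1)]) simp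
    then show ?thesis
    proof eventually_elim
      case (elim r)
      have "0 < real (n r)" using that(2)[of r] by simp
      then show ?case using elim k by (simp add: field_simps)
    qed
  qed
  have ev: "\<forall>\<^sub>F r in sequentially. k\<^sup>2 < real (n1 r) \<and> k\<^sup>2 < real (n2 r) \<and> k\<^sup>2 < real (n3 r)"
    by (intro eventually_conj large lim n)
  show ?thesis
  proof (rule prob_tendsto_0_subset[OF prob_tendsto_0_union[OF A B]])
    show "\<forall>\<^sub>F r in sequentially. \<forall>\<omega>\<in>space (M r). T_stat r \<omega> \<le> u \<longrightarrow> ?A r \<omega> \<or> ?B r \<omega>"
    proof (rule eventually_mono[OF ev], intro ballI impI, rule ccontr)
      fix r \<omega>
      assume big: "k\<^sup>2 < real (n1 r) \<and> k\<^sup>2 < real (n2 r) \<and> k\<^sup>2 < real (n3 r)"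
        and T: "T_stat r \<omega> \<le> u" and neg: "\<not> (?A r \<omega> \<or> ?B r \<omega>)"
      have hk: "u < h * k" using h by (simp add: k_def distrib_left)
      have "\<not> ?A r \<omega>" using neg by blast
      then have "h \<le> ?m r \<omega> / sqrt (?v r \<omega>)" by linarith
      moreover have "k \<le> sqrt (real (n1 r))" using big k by (intro real_le_rsqrt) auto
      ultimately have "h * k \<le> ?m r \<omega> / sqrt (?v r \<omega>) * sqrt (real (n1 r))"
        using h k by (intro mult_mono) auto
      then have t1: "h * k \<le> t_stat (n1 r) (\<lambda>j. D r j \<omega>)" by (simp add: t_stat_def real_sqrt_divide)
      have "\<not> ?B r \<omega>" using neg by blast
      then have hB: "h \<le> (?m1 r \<omega> - ?m2 r \<omega>) / sqrt (?v1 r \<omega> + ?v2 r \<omega>)" by linarith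
      have v0: "?v1 r \<omega> \<ge> 0" "?v2 r \<omega> \<ge> 0" using n(2)[of r] n(3)[of r] by (auto intro!: sample_var_nonneg)
      have vpos: "?v1 r \<omega> + ?v2 r \<omega> > 0"
        using hB h(1) v0 by (cases "?v1 r \<omega> + ?v2 r \<omega> = 0") auto
      define w where "w = ?v1 r \<omega> / real (n2 r) + ?v2 r \<omega> / real (n3 r)"
      have wpos: "w > 0" using vpos v0 n(2)[of r] n(3)[of r]
        by (cases "?v1 r \<omega> = 0") (auto simp: w_def intro!: add_pos_nonneg)
      have "w \<le> ?v1 r \<omega> / k\<^sup>2 + ?v2 r \<omega> / k\<^sup>2"
        unfolding w_def using v0 big k n(2)[of r] n(3)[of r] by (intro add_mono divide_left_mono) (auto intro!: mult_pos_pos)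
      then have "sqrt w \<le> sqrt ((?v1 r \<omega> + ?v2 r \<omega>) / k\<^sup>2)" by (simp add: add_divide_distrib)
      also have "\<dots> = sqrt (?v1 r \<omega> + ?v2 r \<omega>) / k" using k by (simp add: real_sqrt_divide)
      finally have wle: "sqrt w \<le> sqrt (?v1 r \<omega> + ?v2 r \<omega>) / k" .
      have mpos: "?m1 r \<omega> - ?m2 r \<omega> > 0"
      proof (rule ccontr)
        assume "\<not> ?m1 r \<omega> - ?m2 r \<omega> > 0"
        then have "(?m1 r \<omega> - ?m2 r \<omega>) / sqrt (?v1 r \<omega> + ?v2 r \<omega>) \<le> 0" using vpos by (simp add: divide_nonpos_pos)
        then show False using hB h(1) by linarith
      qed
      have "h * k \<le> (?m1 r \<omega> - ?m2 r \<omega>) / sqrt (?v1 r \<omega> + ?v2 r \<omega>) * k" using hB k by (intro mult_right_mono) auto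
      also have "\<dots> = (?m1 r \<omega> - ?m2 r \<omega>) / (sqrt (?v1 r \<omega> + ?v2 r \<omega>) / k)" by simp
      also have "\<dots> \<le> (?m1 r \<omega> - ?m2 r \<omega>) / sqrt w"
        using wle wpos mpos vpos k by (intro divide_left_mono) auto
      finally have t2: "h * k \<le> T2 (n2 r) (n3 r) (\<lambda>m. Z r m \<omega>)" by (simp add: T2_def Let_def w_def)
      have "sqrt (a r) \<ge> a r" "sqrt (1 - a r) \<ge> 1 - a r" "0 \<le> sqrt (a r)" "0 \<le> sqrt (1 - a r)"
        using a[of r] by (auto intro!: real_le_rsqrt simp: power2_eq_square mult_left_le)
      then have "h * k * 1 \<le> h * k * (sqrt (a r) + sqrt (1 - a r))" using h k by (intro mult_left_mono) auto
      also have "\<dots> = sqrt (a r) * (h * k) + sqrt (1 - a r) * (h * k)" by (simp add: algebra_simps)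
      also have "\<dots> \<le> T_stat r \<omega>"
        unfolding reduced_T_def using t1 t2 a[of r] by (intro add_mono mult_left_mono) auto
      finally show False using T hk by linarith
    qed
  qed measurable
qed

end

section \<open>The conditional law of the permutation statistic\<close>

definition diff :: "'a pairs_experiment \<Rightarrow> nat \<Rightarrow> 'a \<Rightarrow> real" where
  "diff E j \<omega> = XC E j \<omega> $ 1 - XC E j \<omega> $ 2"

definition pooled :: "'a pairs_experiment \<Rightarrow> nat \<Rightarrow> 'a \<Rightarrow> real" where
  "pooled E m \<omega> = (if m \<le> n\<^sub>2 E then XI E 1 m \<omega> else XI E 2 (m - n\<^sub>2 E) \<omega>)"

definition swap_sign :: "(2 \<Rightarrow> 2) \<Rightarrow> real" where
  "swap_sign s = (if s 1 = 1 then 1 else - 1)"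

definition resample :: "'a pairs_experiment \<Rightarrow> 'a \<Rightarrow> (nat \<Rightarrow> real) \<times> (nat \<Rightarrow> nat)" where
  "resample E \<omega> = ((\<lambda>j\<in>{1..n\<^sub>1 E}. swap_sign (\<tau> E j \<omega>)), \<pi> E \<omega>)"

lemma S2_eq: "S2 = {id, Transposition.transpose 1 2}"
proof -
  have "s = id \<or> s = Transposition.transpose 1 2" if "s \<in> S2" for s
  proof -
    have "inj s" using that by (auto simp: S2_def permutes_inj)
    then have "s 1 \<noteq> s 2" by (simp add: inj_eq)
    then have "s 1 = 1 \<and> s 2 = 2 \<or> s 1 = 2 \<and> s 2 = 1" using exhaust_2[of "s 1"] exhaust_2[of "s 2"] by auto
    then show ?thesis
    proof
      assume "s 1 = 1 \<and> s 2 = 2"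
      then have "s k = id k" for k using exhaust_2[of k] by auto
      then show ?thesis by auto
    next
      assume "s 1 = 2 \<and> s 2 = 1"
      then have "s k = Transposition.transpose 1 2 k" for k using exhaust_2[of k] by auto
      then show ?thesis by auto
    qed
  qed
  moreover have "id \<in> S2" "Transposition.transpose 1 2 \<in> S2"
    by (auto simp: S2_def permutes_id intro: permutes_swap_id)
  ultimately show ?thesis by auto
qed

lemma swap_sign_diff:
  fixes x :: "real^2"
  assumes "s \<in> S2"
  shows "x $ s 1 - x $ s 2 = swap_sign s * (x $ 1 - x $ 2)"
  using assms by (auto simp: S2_eq swap_sign_def)

lemma swap_sign_in: "swap_sign s \<in> {- 1, 1}"
  by (simp add: swap_sign_def)

lemma card_swap_sign: "e \<in> {- 1, 1} \<Longrightarrow> card {s \<in> S2. swap_sign s = e} = 1" and card_S2: "card S2 = 2" and finite_S2: "finite S2"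
proof -
  have neq: "id \<noteq> (Transposition.transpose 1 2 :: 2 \<Rightarrow> 2)"
  proof
    assume "id = (Transposition.transpose 1 2 :: 2 \<Rightarrow> 2)"
    then have "id (1::2) = Transposition.transpose 1 2 1" by simp
    then show False by simp
  qed
  show "card S2 = 2" "finite S2" using neq by (auto simp: S2_eq)
  have "{s \<in> S2. swap_sign s = 1} = {id}" "{s \<in> S2. swap_sign s = - 1} = {Transposition.transpose 1 2}"
    by (auto simp: S2_eq swap_sign_def)
  then show "e \<in> {- 1, 1} \<Longrightarrow> card {s \<in> S2. swap_sign s = e} = 1" by auto
qed

lemma borel_measurable_component [measurable (raw)]:
  fixes f :: "'a \<Rightarrow> real^2"
  assumes "f \<in> borel_measurable M"
  shows "(\<lambda>x. f x $ i) \<in> borel_measurable M"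
  by (rule measurable_compose[OF assms borel_measurable_continuous_onI]) (intro continuous_intros)

lemma real_distribution_eqI_rational:
  assumes F: "real_distribution F" and G: "real_distribution G"
    and eq: "\<And>q::rat. cdf F (of_rat q) = cdf G (of_rat q)"
  shows "F = G"
proof (rule cdf_unique[OF F G])
  interpret F: real_distribution F by fact
  interpret G: real_distribution G by fact
  show "cdf F = cdf G"
  proof
    fix x :: real
    have "\<forall>n. \<exists>q::rat. x < of_rat q \<and> of_rat q < x + inverse (real (Suc n))"
      by (intro allI of_rat_dense) simp
    then obtain q :: "nat \<Rightarrow> rat" where q: "\<And>n. x < of_rat (q n)" "\<And>n. of_rat (q n) < x + inverse (real (Suc n))" by metis
    have "(\<lambda>n. of_rat (q n) :: real) \<longlonglongrightarrow> x"
      by (rule tendsto_sandwich[OF _ _ tendsto_const LIMSEQ_inverse_real_of_nat_add[of x]])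
        (intro always_eventually allI less_imp_le q)+
    then have fl: "filterlim (\<lambda>n. of_rat (q n) :: real) (at_right x) sequentially"
      using q(1) by (auto simp: filterlim_at less_imp_neq[THEN not_sym] intro!: always_eventually)
    have "(\<lambda>n. cdf F (of_rat (q n))) \<longlonglongrightarrow> cdf F x" "(\<lambda>n. cdf G (of_rat (q n))) \<longlonglongrightarrow> cdf G x"
      using F.cdf_is_right_cont[of x] G.cdf_is_right_cont[of x] unfolding continuous_within
      by (auto intro: filterlim_compose[OF _ fl])
    then show "cdf F x = cdf G x" unfolding eq by (rule LIMSEQ_unique)
  qed
qed

lemma perm_law_measure:
  assumes "B \<in> sets borel"
  shows "measure (perm_law a n1 n2 n3 d z) B = average (resamples n1 (n2 + n3)) (\<lambda>g. indicator B (perm_T a n1 n2 n3 d z g))"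
proof -
  let ?R = "resamples n1 (n2 + n3)" and ?T = "perm_T a n1 n2 n3 d z"
  have "measure (perm_law a n1 n2 n3 d z) B = measure (measure_pmf (pmf_of_set ?R)) (?T -` B)"
    unfolding perm_law_def using assms by (subst measure_distr) auto
  also have "\<dots> = (LINT g|measure_pmf (pmf_of_set ?R). indicator (?T -` B) g)" by simp
  also have "\<dots> = average ?R (indicator (?T -` B))"
    by (rule integral_pmf_of_set_average[OF finite_resamples resamples_nonempty])
  finally show ?thesis by (simp add: average_def indicator_vimage[symmetric] o_def comp_def cong: sum.cong)
qed

lemma cdf_perm_law:
  "cdf (perm_law a n1 n2 n3 d z) x = average (resamples n1 (n2 + n3)) (\<lambda>g. indicator {..x} (perm_T a n1 n2 n3 d z g))"
  unfolding cdf_def by (rule perm_law_measure) simp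

locale pairs_model =
  fixes P :: "(real^2) measure" and E :: "'a pairs_experiment"
  assumes model: "incomplete_pairs_model P E"
begin

abbreviation "M \<equiv> pspace E"
abbreviation "N \<equiv> n\<^sub>2 E + n\<^sub>3 E"

lemma modelD:
  shows "prob_space M"
    and sizes: "2 \<le> n\<^sub>1 E" "2 \<le> n\<^sub>2 E" "2 \<le> n\<^sub>3 E"
    and XC: "\<And>j. j \<in> {1..n\<^sub>1 E} \<Longrightarrow> XC E j \<in> borel_measurable M" "\<And>j. j \<in> {1..n\<^sub>1 E} \<Longrightarrow> distr M borel (XC E j) = P"
    and XI1: "\<And>k. k \<in> {1..n\<^sub>2 E} \<Longrightarrow> XI E 1 k \<in> borel_measurable M"
      "\<And>k. k \<in> {1..n\<^sub>2 E} \<Longrightarrow> distr M borel (XI E 1 k) = distr P borel (\<lambda>x. x $ 1)"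
    and XI2: "\<And>l. l \<in> {1..n\<^sub>3 E} \<Longrightarrow> XI E 2 l \<in> borel_measurable M"
      "\<And>l. l \<in> {1..n\<^sub>3 E} \<Longrightarrow> distr M borel (XI E 2 l) = distr P borel (\<lambda>x. x $ 2)"
    and swap: "\<And>j. j \<in> {1..n\<^sub>1 E} \<Longrightarrow> \<tau> E j \<in> M \<rightarrow>\<^sub>M count_space S2"
      "\<And>j. j \<in> {1..n\<^sub>1 E} \<Longrightarrow> distr M (count_space S2) (\<tau> E j) = uniform_count_measure S2"
    and perm: "\<pi> E \<in> M \<rightarrow>\<^sub>M count_space (Sn N)" "distr M (count_space (Sn N)) (\<pi> E) = uniform_count_measure (Sn N)"
  using model unfolding incomplete_pairs_model_def by auto

sublocale prob_space M by (rule modelD)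

lemma indep_sources: "indep_sets (source_events E) (sources E)"
  using model by (simp add: incomplete_pairs_model_def)

lemma source_eventsI:
  "A \<in> sets borel \<Longrightarrow> XC E j -` A \<inter> space M \<in> source_events E (Pair_src j)"
  "B \<in> sets borel \<Longrightarrow> XI E i k -` B \<inter> space M \<in> source_events E (Inc_src i k)"
  "C \<subseteq> S2 \<Longrightarrow> \<tau> E j -` C \<inter> space M \<in> source_events E (Swap_src j)"
  "G \<subseteq> Sn N \<Longrightarrow> \<pi> E -` G \<inter> space M \<in> source_events E Perm_src"
  by (auto simp: source_events_def intro: in_vimage_algebra)

lemma Int_stable_source_events: "Int_stable (source_events E src)"
  unfolding source_events_def Int_stable_def by (cases src) auto

definition obs_source :: "nat + nat \<Rightarrow> source" where
  "obs_source = case_sum Pair_src (\<lambda>m. if m \<le> n\<^sub>2 E then Inc_src 1 m else Inc_src 2 (m - n\<^sub>2 E))"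

lemma diff_measurable [measurable]: "j \<in> {1..n\<^sub>1 E} \<Longrightarrow> diff E j \<in> borel_measurable M"
  unfolding diff_def[abs_def] using XC(1)[of j] by measurable

lemma pooled_index: "m \<in> {1..N} \<Longrightarrow> m \<in> {1..n\<^sub>2 E} \<or> \<not> m \<le> n\<^sub>2 E \<and> m - n\<^sub>2 E \<in> {1..n\<^sub>3 E}"
  by auto

lemma pooled_measurable [measurable]: "m \<in> {1..N} \<Longrightarrow> pooled E m \<in> borel_measurable M"
  using XI1(1)[of m] XI2(1)[of "m - n\<^sub>2 E"] pooled_index[of m] by (auto simp: pooled_def[abs_def])

text \<open>Every difference and every pooled observation is a function of one source of randomness, and different
  ones belong to different sources.\<close>

lemma indep_obs: "indep_vars (\<lambda>_. borel) (case_sum (diff E) (pooled E)) ({1..n\<^sub>1 E} <+> {1..N})"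
  (is "indep_vars _ ?V ?I")
  unfolding indep_vars_def2
proof
  show "\<forall>i\<in>?I. ?V i \<in> borel_measurable M" by auto
  have inj: "inj_on obs_source ?I"
  proof (rule inj_onI)
    fix x y assume "x \<in> ?I" "y \<in> ?I" "obs_source x = obs_source y"
    then show "x = y" by (cases x; cases y) (auto simp: obs_source_def split: if_splits)
  qed
  have "obs_source ` ?I \<subseteq> sources E"
  proof (rule image_subsetI)
    fix x assume "x \<in> ?I"
    then show "obs_source x \<in> sources E"
    proof
      fix m assume "m \<in> {1..N}" "x = Inr m"
      then show ?thesis using pooled_index[of m] by (auto simp: obs_source_def sources_def)
    qed (auto simp: obs_source_def sources_def)
  qed
  then have "indep_sets (source_events E) (obs_source ` ?I)" using indep_sources by (rule indep_sets_mono_index)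
  then have "indep_sets (\<lambda>i. source_events E (obs_source i)) ?I" using inj by (rule indep_sets_reindex)
  then show "indep_sets (\<lambda>i. {?V i -` A \<inter> space M |A. A \<in> sets borel}) ?I"
  proof (rule indep_sets_mono_sets)
    fix i assume "i \<in> ?I"
    show "{?V i -` A \<inter> space M |A. A \<in> sets borel} \<subseteq> source_events E (obs_source i)"
    proof (cases i)
      case (Inl j)
      have "diff E j -` A \<inter> space M = XC E j -` ((\<lambda>x. x $ 1 - x $ 2) -` A) \<inter> space M" for A
        by (auto simp: diff_def)
      moreover have "(\<lambda>x::real^2. x $ 1 - x $ 2) -` A \<in> sets borel" if "A \<in> sets borel" for A
        using measurable_sets[of "\<lambda>x::real^2. x $ 1 - x $ 2" borel borel A] that by simp
      ultimately show ?thesis using Inl source_eventsI(1) by (auto simp: obs_source_def)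
    next
      case (Inr m)
      then show ?thesis
        using source_eventsI(2)[of _ 1 m] source_eventsI(2)[of _ 2 "m - n\<^sub>2 E"]
        by (auto simp: obs_source_def pooled_def[abs_def])
    qed
  qed
qed

definition data_sources :: "source set" where
  "data_sources = Pair_src ` {1..n\<^sub>1 E} \<union> Inc_src 1 ` {1..n\<^sub>2 E} \<union> Inc_src 2 ` {1..n\<^sub>3 E}"

definition perm_sources :: "source set" where
  "perm_sources = Swap_src ` {1..n\<^sub>1 E} \<union> {Perm_src}"

lemma source_events_subset: "src \<in> sources E \<Longrightarrow> source_events E src \<subseteq> events"
  using indep_sources by (auto simp: indep_sets_def)

lemma sources_subset: "data_sources \<subseteq> sources E" "perm_sources \<subseteq> sources E"
  by (auto simp: data_sources_def perm_sources_def sources_def)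

lemma source_events_Pow: "src \<in> sources E \<Longrightarrow> source_events E src \<subseteq> Pow (space M)"
  by (rule order.trans[OF source_events_subset sets.space_closed])

lemma data_in_space: "data E \<in> space M \<rightarrow> space ((\<Pi>\<^sub>M j\<in>{1..n\<^sub>1 E}. borel) \<Otimes>\<^sub>M (\<Pi>\<^sub>M m\<in>{1..N}. borel))"
  by (auto simp: data_def space_pair_measure space_PiM)

text \<open>The data are functions of their sources. Independence of the resampling pattern is available for the
  \<open>\<sigma>\<close>-algebra generated by these sources and thus passes to the one generated by the data.\<close>

lemma data_algebra_subset: "sets (data_algebra E) \<subseteq> sigma_sets (space M) (\<Union>src\<in>data_sources. source_events E src)"
proof -
  define G where "G = sigma (space M) (\<Union>src\<in>data_sources. source_events E src)"
  have sub: "(\<Union>src\<in>data_sources. source_events E src) \<subseteq> Pow (space M)"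
    by (intro UN_least source_events_Pow subsetD[OF sources_subset(1)])
  have G: "sets G = sigma_sets (space M) (\<Union>src\<in>data_sources. source_events E src)" "space G = space M"
    unfolding G_def using sub by (simp_all add: sets_measure_of space_measure_of)
  have gen: "A \<in> sets G" if "A \<in> source_events E src" "src \<in> data_sources" for A src
    unfolding G(1) using that by (intro sigma_sets.Basic) auto
  have [measurable]: "XC E j \<in> borel_measurable G" if "j \<in> {1..n\<^sub>1 E}" for j
    using that by (intro measurableI) (auto simp: G(2) data_sources_def intro!: gen[OF source_eventsI(1)])
  have I1: "XI E 1 k \<in> borel_measurable G" if "k \<in> {1..n\<^sub>2 E}" for k
    using that by (intro measurableI) (auto simp: G(2) data_sources_def intro!: gen[OF source_eventsI(2)])
  have I2: "XI E 2 k \<in> borel_measurable G" if "k \<in> {1..n\<^sub>3 E}" for k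
    using that by (intro measurableI) (auto simp: G(2) data_sources_def intro!: gen[OF source_eventsI(2)])
  have "(\<lambda>\<omega>. if m \<le> n\<^sub>2 E then XI E 1 m \<omega> else XI E 2 (m - n\<^sub>2 E) \<omega>) \<in> borel_measurable G" if "m \<in> {1..N}" for m
    using I1[of m] I2[of "m - n\<^sub>2 E"] pooled_index[OF that] by auto
  then have "data E \<in> G \<rightarrow>\<^sub>M (\<Pi>\<^sub>M j\<in>{1..n\<^sub>1 E}. borel) \<Otimes>\<^sub>M (\<Pi>\<^sub>M m\<in>{1..N}. borel)"
    unfolding data_def[abs_def] by (intro measurable_Pair measurable_restrict) auto
  from sets_image_in_sets[OF _ this] show ?thesis unfolding data_algebra_def G by simp
qed

lemma subalgebra_data: "subalgebra M (data_algebra E)"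
proof -
  have "sigma_sets (space M) (\<Union>src\<in>data_sources. source_events E src) \<subseteq> events"
    by (intro sets.sigma_sets_subset UN_least source_events_subset subsetD[OF sources_subset(1)])
  then show ?thesis using data_algebra_subset by (auto simp: subalgebra_def data_algebra_def)
qed

sublocale F: finite_measure_subalgebra M "data_algebra E"
  by unfold_locales (rule subalgebra_data)

lemma obs_data_measurable:
  "j \<in> {1..n\<^sub>1 E} \<Longrightarrow> diff E j \<in> borel_measurable (data_algebra E)"
  "m \<in> {1..N} \<Longrightarrow> pooled E m \<in> borel_measurable (data_algebra E)"
proof -
  have d: "data E \<in> data_algebra E \<rightarrow>\<^sub>M (\<Pi>\<^sub>M j\<in>{1..n\<^sub>1 E}. borel) \<Otimes>\<^sub>M (\<Pi>\<^sub>M m\<in>{1..N}. borel)"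
    unfolding data_algebra_def by (rule measurable_vimage_algebra1[OF data_in_space])
  show "diff E j \<in> borel_measurable (data_algebra E)" if j: "j \<in> {1..n\<^sub>1 E}" for j
  proof -
    have "(\<lambda>\<omega>. fst (data E \<omega>) j) \<in> borel_measurable (data_algebra E)"
      using measurable_compose[OF measurable_compose[OF d measurable_fst] measurable_component_singleton[OF j]] .
    then have "XC E j \<in> borel_measurable (data_algebra E)" using j by (simp add: data_def)
    then show ?thesis unfolding diff_def[abs_def] by measurable
  qed
  show "pooled E m \<in> borel_measurable (data_algebra E)" if m: "m \<in> {1..N}" for m
  proof -
    have "(\<lambda>\<omega>. snd (data E \<omega>) m) \<in> borel_measurable (data_algebra E)"
      using measurable_compose[OF measurable_compose[OF d measurable_snd] measurable_component_singleton[OF m]] .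
    then show ?thesis using m by (simp add: data_def pooled_def[abs_def])
  qed
qed

lemma resample_in: "\<omega> \<in> space M \<Longrightarrow> resample E \<omega> \<in> resamples (n\<^sub>1 E) N"
  using measurable_space[OF perm(1)] swap_sign_in by (auto simp: resample_def resamples_def signs_def)

text \<open>A uniform swap yields a fair sign. The swaps and the permutation are independent of each other and of
  the data, so every pattern has conditional probability \<open>2\<^sup>-\<^sup>n\<^sup>1 / N!\<close>.\<close>

lemma resample_independent:
  assumes A: "A \<in> sets (data_algebra E)" and g: "g \<in> resamples (n\<^sub>1 E) N"
  shows "prob (A \<inter> {\<omega>\<in>space M. resample E \<omega> = g}) = prob A / real (card (resamples (n\<^sub>1 E) N))"
    and "{\<omega>\<in>space M. resample E \<omega> = g} \<in> events"
proof -
  obtain e p where ep: "g = (e, p)" "e \<in> signs (n\<^sub>1 E)" "p \<in> Sn N" using g by (auto simp: resamples_def)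
  define Ev where "Ev src = (case src of Swap_src j \<Rightarrow> \<tau> E j -` {s\<in>S2. swap_sign s = e j} \<inter> space M
     | _ \<Rightarrow> \<pi> E -` {p} \<inter> space M)" for src
  have ev: "Ev src \<in> source_events E src" if "src \<in> perm_sources" for src
    using that ep source_eventsI(3)[of "{s\<in>S2. swap_sign s = e j}" j for j] source_eventsI(4)[of "{p}"]
    by (auto simp: perm_sources_def Ev_def)
  have fin: "finite perm_sources" "perm_sources \<noteq> {}" by (auto simp: perm_sources_def)
  have eq: "{\<omega>\<in>space M. resample E \<omega> = g} = (\<Inter>src\<in>perm_sources. Ev src)"
  proof -
    have ext: "(\<lambda>j\<in>{1..n\<^sub>1 E}. swap_sign (\<tau> E j \<omega>)) = e \<longleftrightarrow> (\<forall>j\<in>{1..n\<^sub>1 E}. swap_sign (\<tau> E j \<omega>) = e j)" for \<omega>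
    proof
      assume "\<forall>j\<in>{1..n\<^sub>1 E}. swap_sign (\<tau> E j \<omega>) = e j"
      then show "(\<lambda>j\<in>{1..n\<^sub>1 E}. swap_sign (\<tau> E j \<omega>)) = e"
        using ep(2) by (intro ext) (auto simp: signs_def PiE_iff extensional_def)
    qed auto
    have \<tau>: "\<tau> E j \<omega> \<in> S2" if "j \<in> {1..n\<^sub>1 E}" "\<omega> \<in> space M" for j \<omega>
      using measurable_space[OF swap(1)[OF that(1)] that(2)] by simp
    have 1: "\<omega> \<in> Ev (Swap_src j) \<longleftrightarrow> swap_sign (\<tau> E j \<omega>) = e j" if "j \<in> {1..n\<^sub>1 E}" "\<omega> \<in> space M" for j \<omega>
      using \<tau>[OF that] that(2) by (simp add: Ev_def)
    have 2: "\<omega> \<in> Ev Perm_src \<longleftrightarrow> \<omega> \<in> space M \<and> \<pi> E \<omega> = p" for \<omega>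
      by (auto simp: Ev_def)
    have 3: "(\<Inter>src\<in>perm_sources. Ev src) = Ev Perm_src \<inter> (\<Inter>j\<in>{1..n\<^sub>1 E}. Ev (Swap_src j))"
      by (auto simp: perm_sources_def)
    have "resample E \<omega> = g \<longleftrightarrow> (\<forall>j\<in>{1..n\<^sub>1 E}. swap_sign (\<tau> E j \<omega>) = e j) \<and> \<pi> E \<omega> = p" for \<omega>
      by (simp only: resample_def ep(1) prod.inject ext)
    then show ?thesis unfolding 3 using 1 2 by blast
  qed
  note sub = sources_subset(2)
  have prob_g: "prob (\<Inter>src\<in>perm_sources. Ev src) = 1 / real (card (resamples (n\<^sub>1 E) N))"
  proof -
    have half: "prob (Ev (Swap_src j)) = 1 / 2" if j: "j \<in> {1..n\<^sub>1 E}" for j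
    proof -
      have ej: "e j \<in> {- 1, 1}" using PiE_mem[OF ep(2)[unfolded signs_def] j] .
      have "prob (Ev (Swap_src j)) = measure (distr M (count_space S2) (\<tau> E j)) {s\<in>S2. swap_sign s = e j}"
        using swap(1)[OF j] by (subst measure_distr) (auto simp: Ev_def)
      also have "\<dots> = 1 / 2"
        unfolding swap(2)[OF j] using card_swap_sign[OF ej] card_S2 finite_S2 by (subst measure_uniform_count_measure) auto
      finally show ?thesis .
    qed
    have perm_prob: "prob (Ev Perm_src) = 1 / real (card (Sn N))"
    proof -
      have "prob (Ev Perm_src) = measure (distr M (count_space (Sn N)) (\<pi> E)) {p}"
        using perm(1) ep(3) by (subst measure_distr) (auto simp: Ev_def)
      also have "\<dots> = 1 / real (card (Sn N))"
        unfolding perm(2) using finite_Sn ep(3) by (subst measure_uniform_count_measure) auto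
      finally show ?thesis .
    qed
    have "prob (\<Inter>src\<in>perm_sources. Ev src) = (\<Prod>src\<in>perm_sources. prob (Ev src))"
      by (rule indep_setsD[OF indep_sources sub fin(2,1)]) (use ev in auto)
    also have "\<dots> = (\<Prod>src\<in>Swap_src ` {1..n\<^sub>1 E}. prob (Ev src)) * prob (Ev Perm_src)"
      unfolding perm_sources_def by (subst prod.union_disjoint) auto
    also have "(\<Prod>src\<in>Swap_src ` {1..n\<^sub>1 E}. prob (Ev src)) = (1 / 2) ^ n\<^sub>1 E"
      by (subst prod.reindex) (auto simp: inj_on_def half)
    finally show ?thesis unfolding perm_prob resamples_def
      by (simp add: card_cartesian_product card_signs power_one_over)
  qed
  have union: "data_sources \<union> perm_sources = sources E"
    by (auto simp: data_sources_def perm_sources_def sources_def)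
  let ?I = "\<lambda>b. if b then data_sources else perm_sources"
  have "indep_sets (source_events E) (\<Union>b\<in>UNIV. ?I b)" using indep_sources union by (simp add: UNIV_bool Un_commute)
  then have ind: "indep_sets (\<lambda>b. sigma_sets (space M) (\<Union>src\<in>?I b. source_events E src)) UNIV"
    by (rule indep_sets_collect_sigma) (auto simp: Int_stable_source_events disjoint_family_on_def data_sources_def perm_sources_def)
  have sets_ev: "(\<Inter>src\<in>perm_sources. Ev src) \<in> sigma_sets (space M) (\<Union>src\<in>perm_sources. source_events E src)"
  proof -
    have "(\<Union>src\<in>perm_sources. source_events E src) \<subseteq> Pow (space M)"
      by (intro UN_least source_events_Pow subsetD[OF sub])
    then interpret S: sigma_algebra "space M" "sigma_sets (space M) (\<Union>src\<in>perm_sources. source_events E src)"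
      by (rule sigma_algebra_sigma_sets)
    show ?thesis using ev fin by (intro S.finite_INT) auto
  qed
  have "(\<Inter>b\<in>UNIV. if b then A else (\<Inter>src\<in>perm_sources. Ev src)) = A \<inter> (\<Inter>src\<in>perm_sources. Ev src)"
    by (auto split: if_splits)
  moreover have "prob (\<Inter>b\<in>UNIV. if b then A else (\<Inter>src\<in>perm_sources. Ev src)) =
     (\<Prod>b\<in>UNIV. prob (if b then A else (\<Inter>src\<in>perm_sources. Ev src)))"
    by (rule indep_setsD[OF ind]) (use A data_algebra_subset sets_ev in auto)
  ultimately show "prob (A \<inter> {\<omega>\<in>space M. resample E \<omega> = g}) = prob A / real (card (resamples (n\<^sub>1 E) N))"
    unfolding eq using prob_g by (simp add: UNIV_bool)
  show "{\<omega>\<in>space M. resample E \<omega> = g} \<in> events"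
    unfolding eq
  proof (rule sets.finite_INT[OF fin])
    fix src assume "src \<in> perm_sources"
    then show "Ev src \<in> events" using ev source_events_subset[of src] sub by blast
  qed
qed

end

lemma sample_mean_measurable:
  assumes "\<And>j. j \<in> {1..n} \<Longrightarrow> (\<lambda>\<omega>. x \<omega> j) \<in> borel_measurable M"
  shows "(\<lambda>\<omega>. sample_mean n (x \<omega>)) \<in> borel_measurable M"
  unfolding sample_mean_def by (intro borel_measurable_divide borel_measurable_sum assms) auto

lemma sample_var_measurable:
  assumes "\<And>j. j \<in> {1..n} \<Longrightarrow> (\<lambda>\<omega>. x \<omega> j) \<in> borel_measurable M"
  shows "(\<lambda>\<omega>. sample_var n (x \<omega>)) \<in> borel_measurable M"
  unfolding sample_var_def
  by (intro borel_measurable_divide borel_measurable_sum borel_measurable_power borel_measurable_diff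
      sample_mean_measurable assms) auto

lemma reduced_T_measurable:
  assumes d: "\<And>j. j \<in> {1..n1} \<Longrightarrow> (\<lambda>\<omega>. d \<omega> j) \<in> borel_measurable M"
    and z: "\<And>m. m \<in> {1..n2+n3} \<Longrightarrow> (\<lambda>\<omega>. z \<omega> m) \<in> borel_measurable M"
  shows "(\<lambda>\<omega>. reduced_T a n1 n2 n3 (d \<omega>) (z \<omega>)) \<in> borel_measurable M"
proof -
  have z1: "\<And>m. m \<in> {1..n2} \<Longrightarrow> (\<lambda>\<omega>. z \<omega> m) \<in> borel_measurable M"
    and z2: "\<And>l. l \<in> {1..n3} \<Longrightarrow> (\<lambda>\<omega>. z \<omega> (n2 + l)) \<in> borel_measurable M"
    using z by auto
  note [measurable] = sample_mean_measurable[OF d] sample_var_measurable[OF d] sample_mean_measurable[OF z1]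
    sample_var_measurable[OF z1] sample_mean_measurable[of n3 "\<lambda>\<omega> l. z \<omega> (n2 + l)", OF z2]
    sample_var_measurable[of n3 "\<lambda>\<omega> l. z \<omega> (n2 + l)", OF z2]
  show ?thesis unfolding reduced_T_def t_stat_def T2_def Let_def by measurable
qed

lemma perm_T_measurable:
  assumes d: "\<And>j. j \<in> {1..n1} \<Longrightarrow> (\<lambda>\<omega>. d \<omega> j) \<in> borel_measurable M"
    and z: "\<And>m. m \<in> {1..n2+n3} \<Longrightarrow> (\<lambda>\<omega>. z \<omega> m) \<in> borel_measurable M"
    and g: "g \<in> resamples n1 (n2 + n3)"
  shows "(\<lambda>\<omega>. perm_T a n1 n2 n3 (d \<omega>) (z \<omega>) g) \<in> borel_measurable M"
  unfolding perm_T_def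
proof (rule reduced_T_measurable)
  show "(\<lambda>\<omega>. fst g j * d \<omega> j) \<in> borel_measurable M" if "j \<in> {1..n1}" for j using d[OF that] by measurable
  have "snd g \<in> Sn (n2 + n3)" using g by (auto simp: resamples_def)
  then show "(\<lambda>\<omega>. z \<omega> (snd g m)) \<in> borel_measurable M" if "m \<in> {1..n2+n3}" for m
    by (rule z[OF Sn_in[OF _ that]])
qed

lemma T1_eq_t_stat: "T1 n xc = t_stat n (\<lambda>j. xc j $ 1 - xc j $ 2)"
  by (simp add: T1_def t_stat_def Let_def)

lemma average_measurable:
  fixes f :: "'g \<Rightarrow> 'a \<Rightarrow> real"
  assumes "\<And>g. g \<in> G \<Longrightarrow> f g \<in> borel_measurable M"
  shows "(\<lambda>\<omega>. average G (\<lambda>g. f g \<omega>)) \<in> borel_measurable M"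
  unfolding average_def by (intro borel_measurable_divide borel_measurable_sum assms) auto

context pairs_model
begin

lemma T_obs_eq:
  "T_obs a E \<omega> = reduced_T (a (n\<^sub>1 E) (n\<^sub>2 E) (n\<^sub>3 E)) (n\<^sub>1 E) (n\<^sub>2 E) (n\<^sub>3 E) (\<lambda>j. diff E j \<omega>) (\<lambda>m. pooled E m \<omega>)"
proof -
  have "t_stat (n\<^sub>1 E) (\<lambda>j. fst (data E \<omega>) j $ 1 - fst (data E \<omega>) j $ 2) = t_stat (n\<^sub>1 E) (\<lambda>j. diff E j \<omega>)"
    by (rule t_stat_cong) (simp add: data_def diff_def)
  moreover have "T2 (n\<^sub>2 E) (n\<^sub>3 E) (snd (data E \<omega>)) = T2 (n\<^sub>2 E) (n\<^sub>3 E) (\<lambda>m. pooled E m \<omega>)"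
    by (rule T2_cong) (simp add: data_def pooled_def)
  ultimately show ?thesis
    by (simp add: T_obs_def weighted_T_def reduced_T_def case_prod_beta T1_eq_t_stat)
qed

lemma T_perm_eq:
  assumes \<omega>: "\<omega> \<in> space M"
  shows "T_perm a E \<omega> = perm_T (a (n\<^sub>1 E) (n\<^sub>2 E) (n\<^sub>3 E)) (n\<^sub>1 E) (n\<^sub>2 E) (n\<^sub>3 E) (\<lambda>j. diff E j \<omega>) (\<lambda>m. pooled E m \<omega>) (resample E \<omega>)"
proof -
  have S: "\<tau> E j \<omega> \<in> S2" if "j \<in> {1..n\<^sub>1 E}" for j using measurable_space[OF swap(1)[OF that] \<omega>] by simp
  have p: "\<pi> E \<omega> \<in> Sn N" using measurable_space[OF perm(1) \<omega>] by simp
  have "t_stat (n\<^sub>1 E) (\<lambda>j. fst (data E \<omega>) j $ \<tau> E j \<omega> 1 - fst (data E \<omega>) j $ \<tau> E j \<omega> 2)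
     = t_stat (n\<^sub>1 E) (\<lambda>j. fst (resample E \<omega>) j * diff E j \<omega>)"
    by (rule t_stat_cong) (simp add: data_def diff_def resample_def swap_sign_diff[OF S])
  moreover have "T2 (n\<^sub>2 E) (n\<^sub>3 E) (\<lambda>m. snd (data E \<omega>) (\<pi> E \<omega> m)) = T2 (n\<^sub>2 E) (n\<^sub>3 E) (\<lambda>m. pooled E (snd (resample E \<omega>) m) \<omega>)"
  proof (rule T2_cong)
    fix m assume "m \<in> {1..N}"
    then have "\<pi> E \<omega> m \<in> {1..N}" by (rule Sn_in[OF p])
    then show "snd (data E \<omega>) (\<pi> E \<omega> m) = pooled E (snd (resample E \<omega>) m) \<omega>"
      by (simp add: data_def pooled_def resample_def)
  qed
  ultimately show ?thesis
    by (simp add: T_perm_def weighted_T_def perm_T_def reduced_T_def permute_data_def case_prod_beta T1_eq_t_stat)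
qed

abbreviation stat :: "(nat \<Rightarrow> nat \<Rightarrow> nat \<Rightarrow> real) \<Rightarrow> 'a \<Rightarrow> (nat \<Rightarrow> real) \<times> (nat \<Rightarrow> nat) \<Rightarrow> real" where
  "stat a \<omega> \<equiv> perm_T (a (n\<^sub>1 E) (n\<^sub>2 E) (n\<^sub>3 E)) (n\<^sub>1 E) (n\<^sub>2 E) (n\<^sub>3 E) (\<lambda>j. diff E j \<omega>) (\<lambda>m. pooled E m \<omega>)"

abbreviation plaw :: "(nat \<Rightarrow> nat \<Rightarrow> nat \<Rightarrow> real) \<Rightarrow> 'a \<Rightarrow> real measure" where
  "plaw a \<omega> \<equiv> perm_law (a (n\<^sub>1 E) (n\<^sub>2 E) (n\<^sub>3 E)) (n\<^sub>1 E) (n\<^sub>2 E) (n\<^sub>3 E) (\<lambda>j. diff E j \<omega>) (\<lambda>m. pooled E m \<omega>)"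

lemma stat_measurable: "g \<in> resamples (n\<^sub>1 E) N \<Longrightarrow> (\<lambda>\<omega>. stat a \<omega> g) \<in> borel_measurable (data_algebra E)"
  by (intro perm_T_measurable) (auto intro: obs_data_measurable)

lemma space_data_algebra: "space (data_algebra E) = space M"
  by (simp add: data_algebra_def)

text \<open>Given the data all resampling patterns are equally likely, so averaging over them is a version of the
  conditional probability. The defining equation is checked by splitting according to the pattern.\<close>

lemma cond_prob_T_perm:
  assumes B: "B \<in> sets borel"
  shows "AE \<omega> in M. real_cond_exp M (data_algebra E) (indicator (T_perm a E -` B \<inter> space M)) \<omega>
    = average (resamples (n\<^sub>1 E) N) (\<lambda>g. indicator B (stat a \<omega> g))"
proof (rule F.real_cond_exp_charact)
  let ?R = "resamples (n\<^sub>1 E) N" and ?Y = "T_perm a E -` B \<inter> space M"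
  let ?H = "\<lambda>g. {\<omega>\<in>space M. stat a \<omega> g \<in> B}" and ?C = "\<lambda>g. {\<omega>\<in>space M. resample E \<omega> = g}"
  have HF: "?H g \<in> sets (data_algebra E)" if "g \<in> ?R" for g
    using measurable_sets_Collect[OF stat_measurable[OF that], of "\<lambda>x. x \<in> B" a] B by (simp add: space_data_algebra)
  have sub: "sets (data_algebra E) \<subseteq> events" using subalgebra_data by (simp add: subalgebra_def)
  have Yeq: "?Y = (\<Union>g\<in>?R. ?H g \<inter> ?C g)"
    using T_perm_eq[of _ a] resample_in by auto
  have Yev: "?Y \<in> events"
    unfolding Yeq using HF sub resample_independent(2) by (intro sets.finite_UN finite_resamples sets.Int) blast+
  show avgF: "(\<lambda>\<omega>. average ?R (\<lambda>g. indicator B (stat a \<omega> g) :: real)) \<in> borel_measurable (data_algebra E)"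
  proof (rule average_measurable)
    fix g assume "g \<in> ?R"
    note [measurable] = stat_measurable[OF this, of a] B
    show "(\<lambda>\<omega>. indicator B (stat a \<omega> g) :: real) \<in> borel_measurable (data_algebra E)" by measurable
  qed
  show "integrable M (indicator ?Y :: 'a \<Rightarrow> real)" using Yev by (simp add: emeasure_eq_measure)
  show avgM: "integrable M (\<lambda>\<omega>. average ?R (\<lambda>g. indicator B (stat a \<omega> g) :: real))"
  proof (rule integrable_const_bound[of _ 1])
    show "AE \<omega> in M. norm (average ?R (\<lambda>g. indicator B (stat a \<omega> g) :: real)) \<le> 1"
    proof (rule AE_I2)
      fix \<omega>
      have "norm (average ?R (\<lambda>g. indicator B (stat a \<omega> g) :: real)) \<le> average ?R (\<lambda>g. norm (indicator B (stat a \<omega> g) :: real))"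
        by (rule norm_average_le)
      also have "\<dots> \<le> average ?R (\<lambda>g. 1)" by (rule average_mono) (simp add: indicator_def)
      finally show "norm (average ?R (\<lambda>g. indicator B (stat a \<omega> g) :: real)) \<le> 1"
        by (simp add: average_const finite_resamples resamples_nonempty)
    qed
    show "(\<lambda>\<omega>. average ?R (\<lambda>g. indicator B (stat a \<omega> g) :: real) :: real) \<in> borel_measurable M"
      using measurable_from_subalg[OF subalgebra_data avgF] .
  qed
  fix A assume A: "A \<in> sets (data_algebra E)"
  then have AM: "A \<in> events" using sub by auto
  have left: "(LINT \<omega>:A|M. indicator ?Y \<omega> :: real) = prob (A \<inter> ?Y)"
  proof -
    have "(LINT \<omega>:A|M. indicator ?Y \<omega> :: real) = (LINT \<omega>|M. indicator (A \<inter> ?Y) \<omega>)"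
      unfolding set_lebesgue_integral_def by (intro Bochner_Integration.integral_cong) (auto simp: indicator_def)
    then show ?thesis using AM Yev by simp
  qed
  have "A \<inter> ?Y = (\<Union>g\<in>?R. (A \<inter> ?H g) \<inter> ?C g)" unfolding Yeq by auto
  then have "prob (A \<inter> ?Y) = (\<Sum>g\<in>?R. prob ((A \<inter> ?H g) \<inter> ?C g))"
  proof (simp only:, intro finite_measure_finite_Union finite_resamples)
    show "(\<lambda>g. A \<inter> ?H g \<inter> ?C g) ` ?R \<subseteq> events" using AM HF sub resample_independent(2) by blast
    show "disjoint_family_on (\<lambda>g. A \<inter> ?H g \<inter> ?C g) ?R" by (auto simp: disjoint_family_on_def)
  qed
  also have "\<dots> = (\<Sum>g\<in>?R. prob (A \<inter> ?H g) / real (card ?R))"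
    using A HF by (intro sum.cong refl resample_independent(1) sets.Int)
  finally have right1: "prob (A \<inter> ?Y) = (\<Sum>g\<in>?R. prob (A \<inter> ?H g)) / real (card ?R)" by (simp add: sum_divide_distrib)
  have "(LINT \<omega>:A|M. average ?R (\<lambda>g. indicator B (stat a \<omega> g) :: real) :: real)
     = (LINT \<omega>|M. (\<Sum>g\<in>?R. indicator (A \<inter> ?H g) \<omega>) / real (card ?R))"
    unfolding set_lebesgue_integral_def average_def
    by (intro Bochner_Integration.integral_cong refl) (auto simp: indicator_def)
  also have "\<dots> = (\<Sum>g\<in>?R. prob (A \<inter> ?H g)) / real (card ?R)"
  proof -
    have ev: "A \<inter> ?H g \<in> events" if "g \<in> ?R" for g using AM HF[OF that] sub by auto
    have "(LINT \<omega>|M. (\<Sum>g\<in>?R. indicator (A \<inter> ?H g) \<omega> :: real)) = (\<Sum>g\<in>?R. LINT \<omega>|M. indicator (A \<inter> ?H g) \<omega>)"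
      by (rule Bochner_Integration.integral_sum) (use ev in \<open>auto simp: emeasure_eq_measure\<close>)
    also have "\<dots> = (\<Sum>g\<in>?R. prob (A \<inter> ?H g))" by (intro sum.cong refl) (use ev in simp)
    finally show ?thesis by simp
  qed
  finally show "(LINT \<omega>:A|M. indicator ?Y \<omega>) = (LINT \<omega>:A|M. average ?R (\<lambda>g. indicator B (stat a \<omega> g) :: real))"
    unfolding left right1 by simp
qed

lemma kernel_real_distribution:
  assumes K: "cond_law_T_perm a E K" and \<omega>: "\<omega> \<in> space M"
  shows "real_distribution (K \<omega>)"
proof -
  have "K \<in> data_algebra E \<rightarrow>\<^sub>M prob_algebra borel" using K by (simp add: cond_law_T_perm_def regular_cond_distr_def)
  from measurable_space[OF this, of \<omega>] have "K \<omega> \<in> space (prob_algebra borel)" using \<omega> by (simp add: space_data_algebra)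
  then show ?thesis
    by (auto simp: space_prob_algebra real_distribution_def real_distribution_axioms_def dest: sets_eq_imp_space_eq)
qed

text \<open>A law on the reals is determined by its distribution function at rational points, where countably many
  null sets can be united.\<close>

theorem cond_law_eq_perm_law:
  assumes K: "cond_law_T_perm a E K"
  shows "AE \<omega> in M. K \<omega> = plaw a \<omega>"
proof -
  have "AE \<omega> in M. cdf (K \<omega>) (of_rat q) = cdf (plaw a \<omega>) (of_rat q)" for q :: rat
  proof -
    have B: "{..of_rat q :: real} \<in> sets borel" by simp
    have "AE \<omega> in M. measure (K \<omega>) {..of_rat q} = real_cond_exp M (data_algebra E) (indicator (T_perm a E -` {..of_rat q} \<inter> space M)) \<omega>"
      using K B unfolding cond_law_T_perm_def regular_cond_distr_def by blast
    with cond_prob_T_perm[OF B, of a] show ?thesis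
      unfolding cdf_perm_law by eventually_elim (simp add: cdf_def2)
  qed
  then have "AE \<omega> in M. \<forall>q::rat. cdf (K \<omega>) (of_rat q) = cdf (plaw a \<omega>) (of_rat q)" by (simp add: AE_all_countable)
  then show ?thesis using AE_space
  proof eventually_elim
    case (elim \<omega>)
    show ?case
      by (rule real_distribution_eqI_rational[OF kernel_real_distribution[OF K elim(2)] real_distribution_perm_law]) (use elim(1) in blast)
  qed
qed

end

section \<open>Quantiles and the test function\<close>

text \<open>The Galois connection between quantile function and distribution function turns statements about
  critical values into statements about the distribution function.\<close>

lemma quantile_le_iff:
  assumes L: "real_distribution L" and p: "0 < p" "p < 1"
  shows "quantile L p \<le> x \<longleftrightarrow> p \<le> cdf L x"
proof -
  interpret L: cdf_distribution L using L by (simp add: cdf_distribution_def)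
  show ?thesis using L.pseudoinverse[OF p, of x] by (simp add: quantile_def)
qed

context pairs_model
begin

lemma kernel_cdf_measurable:
  assumes K: "cond_law_T_perm a E K"
  shows "(\<lambda>\<omega>. cdf (K \<omega>) x) \<in> borel_measurable (data_algebra E)"
proof -
  have [measurable]: "K \<in> data_algebra E \<rightarrow>\<^sub>M prob_algebra borel" using K by (simp add: cond_law_T_perm_def regular_cond_distr_def)
  have "(\<lambda>\<omega>. measure (K \<omega>) {..x}) \<in> borel_measurable (data_algebra E)" by measurable
  then show ?thesis by (simp add: cdf_def)
qed

lemma quantile_measurable:
  assumes K: "cond_law_T_perm a E K" and p: "0 < p" "p < 1"
  shows "(\<lambda>\<omega>. quantile (K \<omega>) p) \<in> borel_measurable (data_algebra E)"
  unfolding borel_measurable_iff_le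
proof
  fix x
  have "{\<omega>\<in>space (data_algebra E). quantile (K \<omega>) p \<le> x} = {\<omega>\<in>space (data_algebra E). p \<le> cdf (K \<omega>) x}"
    using quantile_le_iff[OF kernel_real_distribution[OF K] p] by (auto simp: space_data_algebra)
  also have "\<dots> \<in> sets (data_algebra E)"
    using kernel_cdf_measurable[OF K, of x] by measurable
  finally show "{\<omega>\<in>space (data_algebra E). quantile (K \<omega>) p \<le> x} \<in> sets (data_algebra E)" .
qed

lemma T_obs_measurable: "T_obs a E \<in> borel_measurable (data_algebra E)"
  unfolding T_obs_eq[abs_def] by (rule reduced_T_measurable) (auto intro: obs_data_measurable)

lemma perm_test_measurable:
  assumes K: "cond_law_T_perm a E K" and \<gamma>: "randomization_constant \<alpha> E K \<gamma>" and \<alpha>: "0 < \<alpha>" "\<alpha> < 1"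
  shows "perm_test \<alpha> a E K \<gamma> \<in> borel_measurable M"
proof -
  have [measurable]: "\<gamma> \<in> borel_measurable (data_algebra E)" using \<gamma> by (simp add: randomization_constant_def)
  have [measurable]: "(\<lambda>\<omega>. quantile (K \<omega>) (1 - \<alpha>)) \<in> borel_measurable (data_algebra E)"
    by (rule quantile_measurable[OF K]) (use \<alpha> in auto)
  have [measurable]: "(\<lambda>\<omega>. T_obs a E \<omega>) \<in> borel_measurable (data_algebra E)" by (rule T_obs_measurable)
  have "perm_test \<alpha> a E K \<gamma> \<in> borel_measurable (data_algebra E)"
    unfolding perm_test_def[abs_def] Let_def of_bool_def by measurable
  then show ?thesis by (rule measurable_from_subalg[OF subalgebra_data])
qed

lemma perm_test_bounds:
  assumes \<gamma>: "randomization_constant \<alpha> E K \<gamma>" and \<omega>: "\<omega> \<in> space M"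
  shows "0 \<le> perm_test \<alpha> a E K \<gamma> \<omega>" "perm_test \<alpha> a E K \<gamma> \<omega> \<le> 1"
proof -
  have "\<gamma> \<omega> \<in> {0..1}" using \<gamma> \<omega> by (simp add: randomization_constant_def)
  then show "0 \<le> perm_test \<alpha> a E K \<gamma> \<omega>" "perm_test \<alpha> a E K \<gamma> \<omega> \<le> 1" by (auto simp: perm_test_def Let_def of_bool_def)
qed

end

section \<open>Exactness under symmetry\<close>

text \<open>The group structure of the patterns: resampling with \<open>h\<close> the data that were resampled with \<open>g\<close> amounts
  to resampling the original data with the product.\<close>

definition act :: "nat \<Rightarrow> (nat \<Rightarrow> real) \<times> (nat \<Rightarrow> nat) \<Rightarrow> (nat \<Rightarrow> real) \<times> (nat \<Rightarrow> nat) \<Rightarrow> (nat \<Rightarrow> real) \<times> (nat \<Rightarrow> nat)" where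
  "act n g h = ((\<lambda>j\<in>{1..n}. fst g j * fst h j), snd g \<circ> snd h)"

lemma reduced_T_cong:
  assumes "\<And>j. j \<in> {1..n1} \<Longrightarrow> d j = d' j" "\<And>m. m \<in> {1..n2+n3} \<Longrightarrow> z m = z' m"
  shows "reduced_T a n1 n2 n3 d z = reduced_T a n1 n2 n3 d' z'"
  using t_stat_cong[of n1 d d'] T2_cong[of n2 n3 z z'] assms by (simp add: reduced_T_def)

lemma perm_T_cong:
  assumes "\<And>j. j \<in> {1..n1} \<Longrightarrow> d j = d' j" "\<And>m. m \<in> {1..n2+n3} \<Longrightarrow> z m = z' m"
    and g: "g \<in> resamples n1 (n2 + n3)"
  shows "perm_T a n1 n2 n3 d z g = perm_T a n1 n2 n3 d' z' g"
  unfolding perm_T_def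
proof (rule reduced_T_cong)
  have "snd g \<in> Sn (n2 + n3)" using g by (auto simp: resamples_def)
  then show "z (snd g m) = z' (snd g m)" if "m \<in> {1..n2+n3}" for m by (rule assms(2)[OF Sn_in[OF _ that]])
qed (simp add: assms(1))

lemma perm_T_act:
  assumes g: "g \<in> resamples n1 (n2 + n3)" and h: "h \<in> resamples n1 (n2 + n3)"
  shows "perm_T a n1 n2 n3 (\<lambda>j. fst g j * d j) (\<lambda>m. z (snd g m)) h = perm_T a n1 n2 n3 d z (act n1 g h)"
  unfolding perm_T_def by (rule reduced_T_cong) (auto simp: act_def)

lemma act_in:
  assumes "g \<in> resamples n1 N" "h \<in> resamples n1 N"
  shows "act n1 g h \<in> resamples n1 N"
proof -
  have "fst g j * fst h j \<in> {-1, 1}" if "j \<in> {1..n1}" for j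
  proof -
    have "fst g j \<in> {-1, 1}" "fst h j \<in> {-1, 1}"
      using assms that unfolding resamples_def signs_def by (auto dest!: PiE_mem)
    then show ?thesis by auto
  qed
  moreover have "snd g \<circ> snd h \<in> Sn N" using assms by (auto simp: resamples_def Sn_def intro: permutes_compose)
  ultimately show ?thesis by (auto simp: act_def resamples_def signs_def)
qed

text \<open>Multiplication by a group element permutes the patterns.\<close>

lemma average_act:
  assumes g: "g \<in> resamples n1 N"
  shows "average (resamples n1 N) (\<lambda>h. f (act n1 g h)) = average (resamples n1 N) f"
proof -
  let ?R = "resamples n1 N"
  have "inj_on (act n1 g) ?R"
  proof (rule inj_onI)
    fix h h' assume h: "h \<in> ?R" "h' \<in> ?R" and eq: "act n1 g h = act n1 g h'"
    have "fst h j = fst h' j" for j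
    proof (cases "j \<in> {1..n1}")
      case True
      have "fst g j \<noteq> 0" using g True unfolding resamples_def signs_def by (auto dest!: PiE_mem)
      moreover have "fst g j * fst h j = fst g j * fst h' j"
        using arg_cong[OF eq, of "\<lambda>x. fst x j"] True by (simp add: act_def)
      ultimately show ?thesis by simp
    next
      case False
      then show ?thesis using h by (auto simp: resamples_def signs_def PiE_iff extensional_def)
    qed
    moreover have "snd h = snd h'"
    proof -
      have "inj (snd g)" using g by (auto simp: resamples_def Sn_def intro: permutes_inj)
      moreover have "snd g \<circ> snd h = snd g \<circ> snd h'" using arg_cong[OF eq, of snd] by (simp add: act_def)
      ultimately show ?thesis by (simp add: fun_eq_iff inj_eq)
    qed
    ultimately show "h = h'" by (intro prod_eqI) auto
  qed
  moreover have "act n1 g ` ?R \<subseteq> ?R" using act_in[OF g] by auto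
  ultimately have "bij_betw (act n1 g) ?R ?R"
    by (intro bij_betw_imageI endo_inj_surj finite_resamples)
  then show ?thesis unfolding average_def by (subst sum.reindex_bij_betw[symmetric]) auto
qed

text \<open>The critical value and the test as functions of differences and pooled sample; the
  randomisation constant is the only solution of its defining equation, because a quantile of a law
  with finite support is an atom of it.\<close>

definition crit :: "real \<Rightarrow> real \<Rightarrow> nat \<Rightarrow> nat \<Rightarrow> nat \<Rightarrow> (nat \<Rightarrow> real) \<Rightarrow> (nat \<Rightarrow> real) \<Rightarrow> real" where
  "crit \<alpha> a n1 n2 n3 d z = quantile (perm_law a n1 n2 n3 d z) (1 - \<alpha>)"

definition share :: "(real \<Rightarrow> real \<Rightarrow> bool) \<Rightarrow> real \<Rightarrow> real \<Rightarrow> nat \<Rightarrow> nat \<Rightarrow> nat \<Rightarrow> (nat \<Rightarrow> real) \<Rightarrow> (nat \<Rightarrow> real) \<Rightarrow> real" where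
  "share rel \<alpha> a n1 n2 n3 d z =
     average (resamples n1 (n2 + n3)) (\<lambda>g. of_bool (rel (perm_T a n1 n2 n3 d z g) (crit \<alpha> a n1 n2 n3 d z)))"

definition test_fun :: "real \<Rightarrow> real \<Rightarrow> nat \<Rightarrow> nat \<Rightarrow> nat \<Rightarrow> (nat \<Rightarrow> real) \<Rightarrow> (nat \<Rightarrow> real) \<Rightarrow> real" where
  "test_fun \<alpha> a n1 n2 n3 d z =
     of_bool (reduced_T a n1 n2 n3 d z > crit \<alpha> a n1 n2 n3 d z) +
     (\<alpha> - share (>) \<alpha> a n1 n2 n3 d z) / share (=) \<alpha> a n1 n2 n3 d z * of_bool (reduced_T a n1 n2 n3 d z = crit \<alpha> a n1 n2 n3 d z)"

lemma perm_law_act: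
  assumes g: "g \<in> resamples n1 (n2 + n3)"
  shows "perm_law a n1 n2 n3 (\<lambda>j. fst g j * d j) (\<lambda>m. z (snd g m)) = perm_law a n1 n2 n3 d z"
proof (rule real_distribution_eqI_rational[OF real_distribution_perm_law real_distribution_perm_law])
  fix q
  let ?R = "resamples n1 (n2 + n3)"
  have "average ?R (\<lambda>h. indicator {..of_rat q} (perm_T a n1 n2 n3 (\<lambda>j. fst g j * d j) (\<lambda>m. z (snd g m)) h))
     = average ?R (\<lambda>h. indicator {..of_rat q} (perm_T a n1 n2 n3 d z (act n1 g h)) :: real)"
    by (intro average_cong) (simp add: perm_T_act[OF g])
  also have "\<dots> = average ?R (\<lambda>h. indicator {..of_rat q} (perm_T a n1 n2 n3 d z h))" by (rule average_act[OF g])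
  finally show "cdf (perm_law a n1 n2 n3 (\<lambda>j. fst g j * d j) (\<lambda>m. z (snd g m))) (of_rat q) = cdf (perm_law a n1 n2 n3 d z) (of_rat q)"
    unfolding cdf_perm_law .
qed

lemma share_act:
  assumes g: "g \<in> resamples n1 (n2 + n3)"
  shows "share rel \<alpha> a n1 n2 n3 (\<lambda>j. fst g j * d j) (\<lambda>m. z (snd g m)) = share rel \<alpha> a n1 n2 n3 d z"
proof -
  let ?R = "resamples n1 (n2 + n3)" and ?c = "crit \<alpha> a n1 n2 n3 d z"
  have "share rel \<alpha> a n1 n2 n3 (\<lambda>j. fst g j * d j) (\<lambda>m. z (snd g m)) =
     average ?R (\<lambda>h. of_bool (rel (perm_T a n1 n2 n3 d z (act n1 g h)) ?c))"
    unfolding share_def crit_def perm_law_act[OF g] by (intro average_cong) (simp add: perm_T_act[OF g])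
  also have "\<dots> = share rel \<alpha> a n1 n2 n3 d z" unfolding share_def by (rule average_act[OF g])
  finally show ?thesis .
qed

text \<open>Otherwise the distribution function would be constant from a point left of the quantile up to the
  quantile, which contradicts the minimality of the latter.\<close>

lemma crit_atom:
  assumes \<alpha>: "0 < \<alpha>" "\<alpha> < 1"
  shows "share (=) \<alpha> a n1 n2 n3 d z \<ge> 1 / real (card (resamples n1 (n2 + n3)))"
proof -
  let ?R = "resamples n1 (n2 + n3)" and ?T = "perm_T a n1 n2 n3 d z"
  define c where "c = crit \<alpha> a n1 n2 n3 d z"
  have L: "real_distribution (perm_law a n1 n2 n3 d z)" by (rule real_distribution_perm_law)
  have q: "c \<le> x \<longleftrightarrow> 1 - \<alpha> \<le> cdf (perm_law a n1 n2 n3 d z) x" for x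
    unfolding c_def crit_def by (rule quantile_le_iff[OF L]) (use \<alpha> in auto)
  have "\<exists>g\<in>?R. ?T g = c"
  proof (rule ccontr)
    assume neg: "\<not> (\<exists>g\<in>?R. ?T g = c)"
    \<comment> \<open>The values left of \<open>c\<close>; the extra point keeps the set nonempty.\<close>
    define S where "S = insert (c - 1) (?T ` {g\<in>?R. ?T g < c})"
    have S: "finite S" "S \<noteq> {}" unfolding S_def using finite_resamples by auto
    define x where "x = Max S"
    have "x \<in> S" unfolding x_def by (rule Max_in[OF S])
    then have "x < c" by (auto simp: S_def)
    moreover have "?T g \<le> c \<longleftrightarrow> ?T g \<le> x" if "g \<in> ?R" for g
    proof
      assume "?T g \<le> c"
      then have "?T g < c" using neg that by force
      then have "?T g \<in> S" using that by (auto simp: S_def)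
      then show "?T g \<le> x" unfolding x_def by (intro Max_ge S)
    qed (use \<open>x < c\<close> in auto)
    then have "cdf (perm_law a n1 n2 n3 d z) x = cdf (perm_law a n1 n2 n3 d z) c"
      unfolding cdf_perm_law by (intro average_cong) (auto simp: indicator_def)
    ultimately show False using q[of x] q[of c] by auto
  qed
  then obtain g where g: "g \<in> ?R" "?T g = c" by blast
  have "of_bool (?T g = c) \<le> (\<Sum>g\<in>?R. of_bool (?T g = c) :: real)"
    by (rule member_le_sum[OF g(1)]) (auto simp: finite_resamples)
  then have "1 \<le> (\<Sum>g\<in>?R. of_bool (?T g = c) :: real)" using g(2) by simp
  then show ?thesis unfolding share_def average_def c_def[symmetric] by (intro divide_right_mono) auto
qed

lemma card_resamples_pos: "0 < real (card (resamples n N))"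
  using finite_resamples resamples_nonempty by (simp add: card_gt_0_iff)

lemma crit_atom_pos:
  assumes "0 < \<alpha>" "\<alpha> < 1"
  shows "share (=) \<alpha> a n1 n2 n3 d z > 0"
proof -
  have "0 < 1 / real (card (resamples n1 (n2 + n3)))" using card_resamples_pos by simp
  also have "\<dots> \<le> share (=) \<alpha> a n1 n2 n3 d z" by (rule crit_atom[OF assms])
  finally show ?thesis .
qed

text \<open>The bound is crude but makes the test integrable for arbitrary data.\<close>

lemma test_fun_bounded:
  assumes \<alpha>: "0 < \<alpha>" "\<alpha> < 1"
  shows "\<bar>test_fun \<alpha> a n1 n2 n3 d z\<bar> \<le> 1 + real (card (resamples n1 (n2 + n3)))"
proof -
  let ?R = "resamples n1 (n2 + n3)" and ?gt = "share (>) \<alpha> a n1 n2 n3 d z" and ?eq = "share (=) \<alpha> a n1 n2 n3 d z"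
  have "average ?R (\<lambda>g. 0) \<le> ?gt" "?gt \<le> average ?R (\<lambda>g. 1)"
    unfolding share_def by (rule average_mono, simp)+
  then have "\<bar>\<alpha> - ?gt\<bar> \<le> 1" using \<alpha> by (simp add: average_const finite_resamples resamples_nonempty)
  then have "\<bar>\<alpha> - ?gt\<bar> / ?eq \<le> 1 / (1 / real (card ?R))"
    using crit_atom[OF \<alpha>, of n1 n2 n3 a d z] crit_atom_pos[OF \<alpha>] card_resamples_pos by (intro frac_le) auto
  then have "\<bar>(\<alpha> - ?gt) / ?eq\<bar> \<le> real (card ?R)" using crit_atom_pos[OF \<alpha>, of a n1 n2 n3 d z] by (simp add: abs_divide)
  then show ?thesis unfolding test_fun_def by (auto simp: of_bool_def)
qed

text \<open>Critical value and randomisation are constant on the orbit of a data set, while the statistic runs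
  through all of its resampled values. So the mean over the orbit is the probability of exceeding the
  critical value plus the randomised share of the atom.\<close>

lemma test_fun_orbit_average:
  assumes \<alpha>: "0 < \<alpha>" "\<alpha> < 1"
  shows "average (resamples n1 (n2 + n3)) (\<lambda>g. test_fun \<alpha> a n1 n2 n3 (\<lambda>j. fst g j * d j) (\<lambda>m. z (snd g m))) = \<alpha>"
proof -
  let ?R = "resamples n1 (n2 + n3)" and ?c = "crit \<alpha> a n1 n2 n3 d z" and ?T = "perm_T a n1 n2 n3 d z"
  let ?gt = "share (>) \<alpha> a n1 n2 n3 d z" and ?eq = "share (=) \<alpha> a n1 n2 n3 d z"
  have "average ?R (\<lambda>g. test_fun \<alpha> a n1 n2 n3 (\<lambda>j. fst g j * d j) (\<lambda>m. z (snd g m))) =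
    average ?R (\<lambda>g. of_bool (?T g > ?c) + (\<alpha> - ?gt) / ?eq * of_bool (?T g = ?c))"
    by (intro average_cong) (simp add: test_fun_def share_act crit_def perm_law_act flip: perm_T_def)
  also have "\<dots> = ?gt + (\<alpha> - ?gt) / ?eq * ?eq" by (simp only: average_add average_cmult share_def)
  also have "\<dots> = \<alpha>" using crit_atom_pos[OF \<alpha>, of a n1 n2 n3 d z] by simp
  finally show ?thesis .
qed

lemma crit_cong:
  assumes "\<And>j. j \<in> {1..n1} \<Longrightarrow> d j = d' j" "\<And>m. m \<in> {1..n2+n3} \<Longrightarrow> z m = z' m"
  shows "crit \<alpha> a n1 n2 n3 d z = crit \<alpha> a n1 n2 n3 d' z'"
proof -
  have "perm_law a n1 n2 n3 d z = perm_law a n1 n2 n3 d' z'"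
  proof (rule real_distribution_eqI_rational[OF real_distribution_perm_law real_distribution_perm_law])
    have eq: "perm_T a n1 n2 n3 d z g = perm_T a n1 n2 n3 d' z' g" if "g \<in> resamples n1 (n2 + n3)" for g
      by (rule perm_T_cong[OF assms that])
    show "cdf (perm_law a n1 n2 n3 d z) (of_rat q) = cdf (perm_law a n1 n2 n3 d' z') (of_rat q)" for q
      unfolding cdf_perm_law by (rule average_cong) (simp only: eq)
  qed
  then show ?thesis by (simp add: crit_def)
qed

lemma test_fun_cong:
  assumes "\<And>j. j \<in> {1..n1} \<Longrightarrow> d j = d' j" "\<And>m. m \<in> {1..n2+n3} \<Longrightarrow> z m = z' m"
  shows "test_fun \<alpha> a n1 n2 n3 d z = test_fun \<alpha> a n1 n2 n3 d' z'"
proof -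
  have crit: "crit \<alpha> a n1 n2 n3 d z = crit \<alpha> a n1 n2 n3 d' z'" by (rule crit_cong[OF assms])
  have "share rel \<alpha> a n1 n2 n3 d z = share rel \<alpha> a n1 n2 n3 d' z'" for rel
  proof -
    have eq: "perm_T a n1 n2 n3 d z g = perm_T a n1 n2 n3 d' z' g" if "g \<in> resamples n1 (n2 + n3)" for g
      by (rule perm_T_cong[OF assms that])
    show ?thesis unfolding share_def by (rule average_cong) (simp only: eq crit)
  qed
  moreover have "reduced_T a n1 n2 n3 d z = reduced_T a n1 n2 n3 d' z'" by (rule reduced_T_cong[OF assms])
  ultimately show ?thesis unfolding test_fun_def by (simp only: crit)
qed

lemma test_fun_measurable:
  assumes \<alpha>: "0 < \<alpha>" "\<alpha> < 1"
    and d: "\<And>j. j \<in> {1..n1} \<Longrightarrow> (\<lambda>\<omega>. d \<omega> j) \<in> borel_measurable M"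
    and z: "\<And>m. m \<in> {1..n2+n3} \<Longrightarrow> (\<lambda>\<omega>. z \<omega> m) \<in> borel_measurable M"
  shows "(\<lambda>\<omega>. test_fun \<alpha> a n1 n2 n3 (d \<omega>) (z \<omega>)) \<in> borel_measurable M"
proof -
  let ?R = "resamples n1 (n2 + n3)"
  note T = perm_T_measurable[of n1 d M n2 n3 z, OF d z]
  have crit: "(\<lambda>\<omega>. crit \<alpha> a n1 n2 n3 (d \<omega>) (z \<omega>)) \<in> borel_measurable M"
    unfolding borel_measurable_iff_le
  proof
    fix x
    have "(\<lambda>\<omega>. cdf (perm_law a n1 n2 n3 (d \<omega>) (z \<omega>)) x) \<in> borel_measurable M"
      unfolding cdf_perm_law
    proof (rule average_measurable)
      fix g assume "g \<in> ?R"
      note [measurable] = T[OF _ _ this]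
      show "(\<lambda>\<omega>. indicator {..x} (perm_T a n1 n2 n3 (d \<omega>) (z \<omega>) g) :: real) \<in> borel_measurable M" by measurable
    qed
    then have "{\<omega>\<in>space M. 1 - \<alpha> \<le> cdf (perm_law a n1 n2 n3 (d \<omega>) (z \<omega>)) x} \<in> sets M" by measurable
    then show "{\<omega>\<in>space M. crit \<alpha> a n1 n2 n3 (d \<omega>) (z \<omega>) \<le> x} \<in> sets M"
      using quantile_le_iff[OF real_distribution_perm_law, of "1 - \<alpha>"] \<alpha> by (simp add: crit_def)
  qed
  have share: "(\<lambda>\<omega>. share rel \<alpha> a n1 n2 n3 (d \<omega>) (z \<omega>)) \<in> borel_measurable M"
    if rel: "rel = (=) \<or> rel = (>)" for rel
    unfolding share_def
  proof (rule average_measurable)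
    fix g assume "g \<in> ?R"
    note [measurable] = T[OF _ _ this] crit
    show "(\<lambda>\<omega>. of_bool (rel (perm_T a n1 n2 n3 (d \<omega>) (z \<omega>) g) (crit \<alpha> a n1 n2 n3 (d \<omega>) (z \<omega>))) :: real) \<in> borel_measurable M"
      using rel unfolding of_bool_def by (elim disjE) (simp_all only:, measurable)
  qed
  note [measurable] = crit share[of "(=)", simplified] share[of "(>)", simplified] reduced_T_measurable[of n1 d M n2 n3 z, OF d z]
  show ?thesis unfolding test_fun_def of_bool_def by measurable
qed

context pairs_model
begin

abbreviation data_test :: "real \<Rightarrow> (nat \<Rightarrow> nat \<Rightarrow> nat \<Rightarrow> real) \<Rightarrow> (nat \<Rightarrow> real) \<Rightarrow> (nat \<Rightarrow> real) \<Rightarrow> real" where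
  "data_test \<alpha> a \<equiv> test_fun \<alpha> (a (n\<^sub>1 E) (n\<^sub>2 E) (n\<^sub>3 E)) (n\<^sub>1 E) (n\<^sub>2 E) (n\<^sub>3 E)"

lemma perm_test_eq_test_fun:
  assumes K: "cond_law_T_perm a E K" and \<gamma>: "randomization_constant \<alpha> E K \<gamma>" and \<alpha>: "0 < \<alpha>" "\<alpha> < 1"
  shows "AE \<omega> in M. perm_test \<alpha> a E K \<gamma> \<omega> = data_test \<alpha> a (\<lambda>j. diff E j \<omega>) (\<lambda>m. pooled E m \<omega>)"
  using cond_law_eq_perm_law[OF K] AE_space
proof eventually_elim
  case (elim \<omega>)
  let ?c = "quantile (K \<omega>) (1 - \<alpha>)"
  let ?share = "\<lambda>rel. share rel \<alpha> (a (n\<^sub>1 E) (n\<^sub>2 E) (n\<^sub>3 E)) (n\<^sub>1 E) (n\<^sub>2 E) (n\<^sub>3 E) (\<lambda>j. diff E j \<omega>) (\<lambda>m. pooled E m \<omega>)"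
  have c: "?c = crit \<alpha> (a (n\<^sub>1 E) (n\<^sub>2 E) (n\<^sub>3 E)) (n\<^sub>1 E) (n\<^sub>2 E) (n\<^sub>3 E) (\<lambda>j. diff E j \<omega>) (\<lambda>m. pooled E m \<omega>)"
    using elim(1) by (simp add: crit_def)
  have gt: "measure (K \<omega>) {?c<..} = ?share (>)"
    unfolding elim(1) perm_law_measure[of "{_<..}", simplified] share_def crit_def
    by (intro average_cong) (simp add: indicator_def)
  have eq: "measure (K \<omega>) {?c} = ?share (=)"
    unfolding elim(1) perm_law_measure[of "{_}", simplified] share_def crit_def
    by (intro average_cong) (simp add: indicator_def)
  have "measure (K \<omega>) {?c<..} + \<gamma> \<omega> * measure (K \<omega>) {?c} = \<alpha>"
    using \<gamma> elim(2) by (simp add: randomization_constant_def Let_def)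
  then have "\<gamma> \<omega> = (\<alpha> - ?share (>)) / ?share (=)"
    unfolding gt eq using crit_atom_pos[OF \<alpha>] by (simp add: field_simps less_imp_neq[THEN not_sym])
  then show ?case unfolding perm_test_def Let_def T_obs_eq c test_fun_def by simp
qed

lemma diff_law: "j \<in> {1..n\<^sub>1 E} \<Longrightarrow> distr M borel (diff E j) = distr P borel (\<lambda>x. x $ 1 - x $ 2)"
proof -
  assume j: "j \<in> {1..n\<^sub>1 E}"
  have "distr P borel (\<lambda>x. x $ 1 - x $ 2) = distr (distr M borel (XC E j)) borel (\<lambda>x. x $ 1 - x $ 2)" by (simp add: XC(2)[OF j])
  also have "\<dots> = distr M borel (diff E j)" using XC(1)[OF j] by (subst distr_distr) (auto simp: o_def diff_def[abs_def])
  finally show ?thesis by simp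
qed

lemma pooled_law:
  "m \<in> {1..n\<^sub>2 E} \<Longrightarrow> distr M borel (pooled E m) = distr P borel (\<lambda>x. x $ 1)"
  "m \<in> {n\<^sub>2 E + 1..N} \<Longrightarrow> distr M borel (pooled E m) = distr P borel (\<lambda>x. x $ 2)"
proof -
  show "m \<in> {1..n\<^sub>2 E} \<Longrightarrow> distr M borel (pooled E m) = distr P borel (\<lambda>x. x $ 1)"
    using XI1(2)[of m] by (simp add: pooled_def[abs_def])
  assume m: "m \<in> {n\<^sub>2 E + 1..N}"
  then have "m - n\<^sub>2 E \<in> {1..n\<^sub>3 E}" by auto
  from XI2(2)[OF this] show "distr M borel (pooled E m) = distr P borel (\<lambda>x. x $ 2)"
    using m by (simp add: pooled_def[abs_def])
qed

text \<open>Under the symmetry assumptions every resampling pattern preserves the joint law of differences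
  and pooled sample: it permutes identically distributed independent variables and flips signs of
  symmetric ones.\<close>

lemma expectation_invariant:
  assumes sym: "distr M borel (diff E 1) = distr M borel (\<lambda>\<omega>. - diff E 1 \<omega>)"
    and same: "distr P borel (\<lambda>x. x $ 1) = distr P borel (\<lambda>x. x $ 2)"
    and g: "g \<in> resamples (n\<^sub>1 E) N" and \<alpha>: "0 < \<alpha>" "\<alpha> < 1"
  shows "(LINT \<omega>|M. data_test \<alpha> a (\<lambda>j. fst g j * diff E j \<omega>) (\<lambda>m. pooled E (snd g m) \<omega>)) =
    (LINT \<omega>|M. data_test \<alpha> a (\<lambda>j. diff E j \<omega>) (\<lambda>m. pooled E m \<omega>))"
proof -
  let ?I = "{1..n\<^sub>1 E} <+> {1..N}" and ?V = "case_sum (diff E) (pooled E)"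
  define f where "f = case_sum Inl (\<lambda>m::nat. Inr (snd g m) :: nat + nat)"
  define s where "s = case_sum (fst g) (\<lambda>m::nat. 1::real)"
  define V' where "V' i \<omega> = s i * ?V (f i) \<omega>" for i \<omega>
  have p: "snd g \<in> Sn N" and e: "fst g \<in> signs (n\<^sub>1 E)" using g by (auto simp: resamples_def)
  have pi: "snd g ` {1..N} = {1..N}" "inj (snd g)" using p by (auto simp: Sn_def permutes_image permutes_inj simp del: image_subset_iff)
  have fI: "f ` ?I = ?I"
  proof -
    have "f ` ?I = Inl ` {1..n\<^sub>1 E} \<union> Inr ` (snd g ` {1..N})" by (simp add: f_def Plus_def image_Un image_image)
    then show ?thesis by (simp only: pi Plus_def)
  qed
  have finj: "inj_on f ?I"
  proof (rule inj_onI)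
    fix x y assume "f x = f y"
    then show "x = y" by (cases x; cases y) (simp_all add: f_def inj_eq[OF pi(2)])
  qed
  have I0: "?I \<noteq> {}" using sizes(1) by auto
  have ind1: "indep_vars (\<lambda>_. borel) ?V ?I" by (rule indep_obs)
  have "indep_vars (\<lambda>_. borel) ?V (f ` ?I)" unfolding fI by (rule ind1)
  from indep_vars_reindex[OF this finj] have ind2: "indep_vars (\<lambda>_. borel) V' ?I"
    unfolding V'_def[abs_def] by (rule indep_vars_compose2) measurable
  have mV: "?V i \<in> borel_measurable M" if "i \<in> ?I" for i using ind1 that by (simp add: indep_vars_def2)
  have mV': "V' i \<in> borel_measurable M" if "i \<in> ?I" for i using ind2 that by (simp add: indep_vars_def2)
  have law: "distr M borel (V' i) = distr M borel (?V i)" if i: "i \<in> ?I" for i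
  proof (cases i)
    case (Inl j)
    then have j: "j \<in> {1..n\<^sub>1 E}" using i by auto
    have "fst g j \<in> {-1, 1}" using PiE_mem[OF e[unfolded signs_def] j] .
    moreover have "distr M borel (\<lambda>\<omega>. - diff E j \<omega>) = distr M borel (diff E j)"
    proof -
      have one: "1 \<in> {1..n\<^sub>1 E}" using sizes(1) by simp
      have "distr M borel (\<lambda>\<omega>. - diff E k \<omega>) = distr (distr P borel (\<lambda>x. x $ 1 - x $ 2)) borel uminus" if k: "k \<in> {1..n\<^sub>1 E}" for k
        unfolding diff_law[OF k, symmetric] using diff_measurable[OF k] by (subst distr_distr) (auto simp: o_def)
      then have "distr M borel (\<lambda>\<omega>. - diff E j \<omega>) = distr M borel (\<lambda>\<omega>. - diff E 1 \<omega>)" using one j by simp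
      also have "\<dots> = distr M borel (diff E j)" using sym diff_law[OF one] diff_law[OF j] by simp
      finally show ?thesis .
    qed
    ultimately show ?thesis using Inl by (auto simp: V'_def[abs_def] s_def f_def)
  next
    case (Inr m)
    then have m: "m \<in> {1..N}" using i by auto
    have all: "distr M borel (pooled E k) = distr P borel (\<lambda>x. x $ 1)" if "k \<in> {1..N}" for k
      using pooled_law[of k] same that by (cases "k \<le> n\<^sub>2 E") auto
    show ?thesis using Inr all[OF m] all[OF Sn_in[OF p m]] by (simp add: V'_def[abs_def] s_def f_def)
  qed
  have joint: "distr M (\<Pi>\<^sub>M i\<in>?I. borel) (\<lambda>\<omega>. \<lambda>i\<in>?I. V' i \<omega>) = distr M (\<Pi>\<^sub>M i\<in>?I. borel) (\<lambda>\<omega>. \<lambda>i\<in>?I. ?V i \<omega>)"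
  proof -
    have "distr M (\<Pi>\<^sub>M i\<in>?I. borel) (\<lambda>\<omega>. \<lambda>i\<in>?I. V' i \<omega>) = (\<Pi>\<^sub>M i\<in>?I. distr M borel (V' i))"
      using ind2 indep_vars_iff_distr_eq_PiM'[OF I0, where M'="\<lambda>_. borel" and X=V'] mV' by blast
    also have "\<dots> = (\<Pi>\<^sub>M i\<in>?I. distr M borel (?V i))" by (rule PiM_cong[OF refl law])
    also have "\<dots> = distr M (\<Pi>\<^sub>M i\<in>?I. borel) (\<lambda>\<omega>. \<lambda>i\<in>?I. ?V i \<omega>)"
      using ind1 indep_vars_iff_distr_eq_PiM'[OF I0, where M'="\<lambda>_. borel" and X="?V"] mV by metis
    finally show ?thesis .
  qed
  define F where "F v = data_test \<alpha> a (\<lambda>j. v (Inl j)) (\<lambda>m. v (Inr m))" for v :: "nat + nat \<Rightarrow> real"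
  have Fm: "F \<in> borel_measurable (\<Pi>\<^sub>M i\<in>?I. borel)"
    unfolding F_def[abs_def] by (rule test_fun_measurable[OF \<alpha>]) (auto intro!: measurable_component_singleton)
  have m1: "(\<lambda>\<omega>. \<lambda>i\<in>?I. V' i \<omega>) \<in> M \<rightarrow>\<^sub>M (\<Pi>\<^sub>M i\<in>?I. borel)" by (rule measurable_restrict) (rule mV')
  have m2: "(\<lambda>\<omega>. \<lambda>i\<in>?I. ?V i \<omega>) \<in> M \<rightarrow>\<^sub>M (\<Pi>\<^sub>M i\<in>?I. borel)" by (rule measurable_restrict) (rule mV)
  have "(LINT \<omega>|M. F (\<lambda>i\<in>?I. V' i \<omega>)) = (LINT \<omega>|M. F (\<lambda>i\<in>?I. ?V i \<omega>))"
    using integral_distr[OF m1 Fm] integral_distr[OF m2 Fm] joint by simp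
  moreover have "F (\<lambda>i\<in>?I. V' i \<omega>) = data_test \<alpha> a (\<lambda>j. fst g j * diff E j \<omega>) (\<lambda>m. pooled E (snd g m) \<omega>)" for \<omega>
    unfolding F_def by (rule test_fun_cong) (auto simp: V'_def s_def f_def)
  moreover have "F (\<lambda>i\<in>?I. ?V i \<omega>) = data_test \<alpha> a (\<lambda>j. diff E j \<omega>) (\<lambda>m. pooled E m \<omega>)" for \<omega>
    unfolding F_def by (rule test_fun_cong) auto
  ultimately show ?thesis by simp
qed

text \<open>All resampled data have the law of the original ones, so the expectation of the test is that of its
  average over the orbit.\<close>

theorem perm_test_exact:
  assumes K: "cond_law_T_perm a E K" and \<gamma>: "randomization_constant \<alpha> E K \<gamma>" and \<alpha>: "0 < \<alpha>" "\<alpha> < 1"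
    and sym: "distr M borel (diff E 1) = distr M borel (\<lambda>\<omega>. - diff E 1 \<omega>)"
    and same: "distr M borel (XI E 1 1) = distr M borel (XI E 2 1)"
  shows "(LINT \<omega>|M. perm_test \<alpha> a E K \<gamma> \<omega>) = \<alpha>"
proof -
  let ?R = "resamples (n\<^sub>1 E) N"
  have same': "distr P borel (\<lambda>x. x $ 1) = distr P borel (\<lambda>x. x $ 2)"
    using same XI1(2)[of 1] XI2(2)[of 1] sizes by simp
  let ?\<psi> = "\<lambda>g \<omega>. data_test \<alpha> a (\<lambda>j. fst g j * diff E j \<omega>) (\<lambda>m. pooled E (snd g m) \<omega>)"
  have tm: "(\<lambda>\<omega>. data_test \<alpha> a (\<lambda>j. diff E j \<omega>) (\<lambda>m. pooled E m \<omega>)) \<in> borel_measurable M"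
    by (rule test_fun_measurable[OF \<alpha>]) auto
  define c where "c = (LINT \<omega>|M. data_test \<alpha> a (\<lambda>j. diff E j \<omega>) (\<lambda>m. pooled E m \<omega>))"
  have E\<psi>: "(LINT \<omega>|M. ?\<psi> g \<omega>) = c" if "g \<in> ?R" for g
    unfolding c_def by (rule expectation_invariant[OF sym same' that \<alpha>])
  have int: "integrable M (?\<psi> g)" if g: "g \<in> ?R" for g
  proof (rule integrable_const_bound)
    show "AE \<omega> in M. norm (?\<psi> g \<omega>) \<le> 1 + real (card ?R)" using test_fun_bounded[OF \<alpha>] by simp
    have "snd g \<in> Sn N" using g by (auto simp: resamples_def)
    then show "?\<psi> g \<in> borel_measurable M"
      by (intro test_fun_measurable[OF \<alpha>] borel_measurable_times borel_measurable_const diff_measurable pooled_measurable)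
        (auto dest: Sn_in)
  qed
  have "\<alpha> = (LINT \<omega>|M. average ?R (\<lambda>g. ?\<psi> g \<omega>))"
    by (simp add: prob_space test_fun_orbit_average[OF \<alpha>, where z="\<lambda>m. pooled E m _"])
  also have "\<dots> = average ?R (\<lambda>g. LINT \<omega>|M. ?\<psi> g \<omega>)"
    unfolding average_def using int by (subst integral_divide_zero, subst Bochner_Integration.integral_sum) auto
  also have "\<dots> = average ?R (\<lambda>g. c)" by (rule average_cong) (rule E\<psi>)
  also have "\<dots> = c" by (rule average_const[OF finite_resamples resamples_nonempty])
  finally have main: "c = \<alpha>" by simp
  have "(LINT \<omega>|M. perm_test \<alpha> a E K \<gamma> \<omega>) = c"
    unfolding c_def by (rule integral_cong_AE[OF perm_test_measurable[OF K \<gamma> \<alpha>] tm perm_test_eq_test_fun[OF K \<gamma> \<alpha>]])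
  then show ?thesis using main by simp
qed

end

section \<open>Moments of linear contrasts of a pair\<close>

lemma integrable_mult_squares:
  fixes f g :: "'a \<Rightarrow> real"
  assumes [measurable]: "f \<in> borel_measurable M" "g \<in> borel_measurable M"
    and "integrable M (\<lambda>x. (f x)\<^sup>2)" "integrable M (\<lambda>x. (g x)\<^sup>2)"
  shows "integrable M (\<lambda>x. f x * g x)"
proof (rule Bochner_Integration.integrable_bound[OF Bochner_Integration.integrable_add[OF assms(3,4)]])
  show "AE x in M. norm (f x * g x) \<le> norm ((f x)\<^sup>2 + (g x)\<^sup>2)"
  proof (rule AE_I2)
    fix x
    have "2 * (\<bar>f x\<bar> * \<bar>g x\<bar>) \<le> (f x)\<^sup>2 + (g x)\<^sup>2"
      using sum_squares_bound[of "\<bar>f x\<bar>" "\<bar>g x\<bar>"] by simp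
    moreover have "0 \<le> \<bar>f x\<bar> * \<bar>g x\<bar>" by simp
    ultimately show "norm (f x * g x) \<le> norm ((f x)\<^sup>2 + (g x)\<^sup>2)" unfolding real_norm_def abs_mult by linarith
  qed
qed measurable

text \<open>The variance of \<open>v \<bullet> x\<close> is the quadratic form of the covariance matrix at \<open>v\<close>.\<close>

lemma contrast_law:
  fixes v :: "real^2"
  assumes law: "pair_law P \<mu> \<Sigma>" and v: "v \<noteq> 0"
  defines "\<nu> \<equiv> distr P borel (\<lambda>x. v \<bullet> x)"
  shows "integrable \<nu> (\<lambda>x. x\<^sup>2)" "(LINT x|\<nu>. x) = v \<bullet> \<mu>" "prob_space.variance \<nu> (\<lambda>x. x) > 0"
proof -
  interpret prob_space P using law by (simp add: pair_law_def)
  have [measurable_cong]: "sets P = sets borel" using law by (simp add: pair_law_def)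
  have sq: "integrable P (\<lambda>x. (x $ i)\<^sup>2)" for i using law by (simp add: pair_law_def)
  have i1: "integrable P (\<lambda>x. x $ i)" for i by (rule square_integrable_imp_integrable[OF _ sq]) measurable
  have mu: "\<mu> $ i = (LINT x|P. x $ i)" and cov: "\<Sigma> $ i $ j = (LINT x|P. (x $ i - \<mu> $ i) * (x $ j - \<mu> $ j))" for i j
    using law by (auto simp: pair_law_def)
  have pos: "0 < v \<bullet> (\<Sigma> *v v)" using law v by (simp add: pair_law_def)
  have expand: "v \<bullet> x = (\<Sum>i\<in>UNIV. v $ i * x $ i)" for x :: "real^2" by (simp add: inner_vec_def)
  have vx: "integrable P (\<lambda>x. v \<bullet> x)" unfolding expand using i1 by simp
  have mean: "(LINT x|P. v \<bullet> x) = v \<bullet> \<mu>" unfolding expand using i1 by (simp add: mu)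
  then show m: "(LINT x|\<nu>. x) = v \<bullet> \<mu>" unfolding \<nu>_def by (subst integral_distr) auto
  have csq: "integrable P (\<lambda>x. (x $ i - \<mu> $ i)\<^sup>2)" for i
    using sq[of i] i1[of i] by (simp add: power2_diff)
  have prod: "integrable P (\<lambda>x. (x $ i - \<mu> $ i) * (x $ j - \<mu> $ j))" for i j
    by (rule integrable_mult_squares[OF _ _ csq csq]) measurable
  have square: "(v \<bullet> x - v \<bullet> \<mu>)\<^sup>2 = (\<Sum>i\<in>UNIV. \<Sum>j\<in>UNIV. v $ i * v $ j * ((x $ i - \<mu> $ i) * (x $ j - \<mu> $ j)))" for x
  proof -
    have "(v \<bullet> x - v \<bullet> \<mu>)\<^sup>2 = (\<Sum>i\<in>UNIV. v $ i * (x $ i - \<mu> $ i))\<^sup>2"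
      unfolding expand by (simp add: right_diff_distrib sum_subtractf)
    also have "\<dots> = (\<Sum>i\<in>UNIV. \<Sum>j\<in>UNIV. v $ i * v $ j * ((x $ i - \<mu> $ i) * (x $ j - \<mu> $ j)))"
      unfolding power2_eq_square sum_product by (intro sum.cong refl) (simp add: mult_ac)
    finally show ?thesis .
  qed
  have "integrable P (\<lambda>x. (v \<bullet> x - v \<bullet> \<mu>)\<^sup>2)" unfolding square using prod by simp
  then have "integrable P (\<lambda>x. (v \<bullet> x - v \<bullet> \<mu>)\<^sup>2 + 2 * (v \<bullet> \<mu>) * (v \<bullet> x) - (v \<bullet> \<mu>)\<^sup>2)" using vx by simp
  moreover have "(\<lambda>x. (v \<bullet> x - v \<bullet> \<mu>)\<^sup>2 + 2 * (v \<bullet> \<mu>) * (v \<bullet> x) - (v \<bullet> \<mu>)\<^sup>2) = (\<lambda>x. (v \<bullet> x)\<^sup>2)"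
    by (simp add: fun_eq_iff power2_eq_square algebra_simps)
  ultimately show "integrable \<nu> (\<lambda>x. x\<^sup>2)" unfolding \<nu>_def by (subst integrable_distr_eq) auto
  have "prob_space.variance \<nu> (\<lambda>x. x) = (LINT x|P. (v \<bullet> x - v \<bullet> \<mu>)\<^sup>2)"
    unfolding m unfolding \<nu>_def by (subst integral_distr) auto
  also have "\<dots> = (\<Sum>i\<in>UNIV. \<Sum>j\<in>UNIV. v $ i * v $ j * \<Sigma> $ i $ j)" unfolding square using prod by (simp add: cov)
  also have "\<dots> = v \<bullet> (\<Sigma> *v v)"
    by (simp add: inner_vec_def matrix_vector_mult_def sum_distrib_left mult_ac)
  finally show "prob_space.variance \<nu> (\<lambda>x. x) > 0" using pos by simp
qed

lemma component_laws:
  assumes law: "pair_law P \<mu> \<Sigma>"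
  defines "\<nu>D \<equiv> distr P borel (\<lambda>x. x $ 1 - x $ 2)" and "\<nu>1 \<equiv> distr P borel (\<lambda>x. x $ 1)" and "\<nu>2 \<equiv> distr P borel (\<lambda>x. x $ 2)"
  shows "integrable \<nu>D (\<lambda>x. x\<^sup>2)" "integrable \<nu>1 (\<lambda>x. x\<^sup>2)" "integrable \<nu>2 (\<lambda>x. x\<^sup>2)"
    and "(LINT x|\<nu>D. x) = \<mu> $ 1 - \<mu> $ 2" "(LINT x|\<nu>1. x) = \<mu> $ 1" "(LINT x|\<nu>2. x) = \<mu> $ 2"
    and "prob_space.variance \<nu>D (\<lambda>x. x) > 0" "prob_space.variance \<nu>1 (\<lambda>x. x) > 0" "prob_space.variance \<nu>2 (\<lambda>x. x) > 0"
proof -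
  \<comment> \<open>The three laws belong to the contrasts \<open>e\<^sub>1 - e\<^sub>2\<close>, \<open>e\<^sub>1\<close> and \<open>e\<^sub>2\<close>.\<close>
  let ?w = "axis 1 1 - axis 2 1 :: real^2"
  have nz: "?w $ 1 \<noteq> 0" by (simp add: axis_def)
  then have w: "?w \<noteq> 0" by (metis zero_index)
  have ax: "(axis i 1 :: real^2) \<noteq> 0" for i by (simp add: axis_eq_0_iff)
  have eqs: "?w \<bullet> x = x $ 1 - x $ 2" "axis i 1 \<bullet> x = x $ i" for x :: "real^2" and i
    by (simp_all add: inner_diff_left inner_axis' )
  note D = contrast_law[OF law w, unfolded eqs] and C = contrast_law[OF law ax, unfolded eqs]
  show "integrable \<nu>D (\<lambda>x. x\<^sup>2)" "integrable \<nu>1 (\<lambda>x. x\<^sup>2)" "integrable \<nu>2 (\<lambda>x. x\<^sup>2)"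
    "(LINT x|\<nu>D. x) = \<mu> $ 1 - \<mu> $ 2" "(LINT x|\<nu>1. x) = \<mu> $ 1" "(LINT x|\<nu>2. x) = \<mu> $ 2"
    "prob_space.variance \<nu>D (\<lambda>x. x) > 0" "prob_space.variance \<nu>1 (\<lambda>x. x) > 0" "prob_space.variance \<nu>2 (\<lambda>x. x) > 0"
    unfolding \<nu>D_def \<nu>1_def \<nu>2_def by (rule D C)+
qed

section \<open>The permutation test along a sequence of experiments\<close>

lemma no_dominant_term_pred:
  assumes "\<And>j. j \<in> {1..n} \<Longrightarrow> (\<lambda>\<omega>. x \<omega> j) \<in> borel_measurable M"
  shows "Measurable.pred M (\<lambda>\<omega>. no_dominant_term \<delta> n (x \<omega>))"
proof -
  note [measurable] = assms
  show ?thesis unfolding no_dominant_term_def by measurable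
qed

text \<open>By right continuity a supremum over the rationals suffices.\<close>

lemma sup_cdf_diff_gt_iff:
  assumes F: "real_distribution F" and G: "real_distribution G"
  shows "u < (SUP x. \<bar>cdf F x - cdf G x\<bar>) \<longleftrightarrow> (\<exists>q::rat. u < \<bar>cdf F (of_rat q) - cdf G (of_rat q)\<bar>)"
proof -
  interpret F: real_distribution F by fact
  interpret G: real_distribution G by fact
  have "\<exists>q::rat. u < \<bar>cdf F (of_rat q) - cdf G (of_rat q)\<bar>" if x: "u < \<bar>cdf F x - cdf G x\<bar>" for x
  proof -
    have "((\<lambda>y. \<bar>cdf F y - cdf G y\<bar>) \<longlongrightarrow> \<bar>cdf F x - cdf G x\<bar>) (at_right x)"
      using F.cdf_is_right_cont[of x] G.cdf_is_right_cont[of x] unfolding continuous_within by (intro tendsto_intros)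
    then have "\<forall>\<^sub>F y in at_right x. u < \<bar>cdf F y - cdf G y\<bar>" using x by (rule order_tendstoD)
    then obtain b where b: "x < b" "\<And>y. x < y \<Longrightarrow> y < b \<Longrightarrow> u < \<bar>cdf F y - cdf G y\<bar>"
      unfolding eventually_at_right_field by blast
    from of_rat_dense[OF b(1)] b(2) show ?thesis by blast
  qed
  then show ?thesis unfolding less_cSUP_iff[OF UNIV_not_empty bdd_above_cdf_diff[OF F G]] by blast
qed

locale pairs_sequence =
  fixes P :: "(real^2) measure" and \<mu> :: "real^2" and \<Sigma> :: "real^2^2" and a :: "nat \<Rightarrow> nat \<Rightarrow> nat \<Rightarrow> real"
    and E :: "nat \<Rightarrow> 'a pairs_experiment" and K :: "nat \<Rightarrow> 'a \<Rightarrow> real measure" and \<kappa> :: real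
  assumes law: "pair_law P \<mu> \<Sigma>"
    and weight: "\<And>k l m. 2 \<le> k \<Longrightarrow> 2 \<le> l \<Longrightarrow> 2 \<le> m \<Longrightarrow> a k l m \<in> {0..1}"
    and models: "\<And>r. incomplete_pairs_model P (E r)"
    and kernel: "\<And>r. cond_law_T_perm a (E r) (K r)"
    and \<kappa>: "0 < \<kappa>" "\<kappa> < 1"
    and regime: "asymptotic_regime E \<kappa>"
begin

abbreviation "M r \<equiv> pspace (E r)"

lemma pairs_model: "pairs_model P (E r)"
  by (simp add: pairs_model_def models)

lemmas sizes = pairs_model.sizes[OF pairs_model]

lemma prob_space_M: "prob_space (M r)" by (rule pairs_model.modelD[OF pairs_model])

sublocale paired_arrays M "\<lambda>r. n\<^sub>1 (E r)" "\<lambda>r. n\<^sub>2 (E r)" "\<lambda>r. n\<^sub>3 (E r)" "\<lambda>r. diff (E r)" "\<lambda>r. pooled (E r)"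
  "distr P borel (\<lambda>x. x $ 1 - x $ 2)" "distr P borel (\<lambda>x. x $ 1)" "distr P borel (\<lambda>x. x $ 2)"
  "\<lambda>r. a (n\<^sub>1 (E r)) (n\<^sub>2 (E r)) (n\<^sub>3 (E r))" \<kappa>
proof (rule paired_arrays.intro)
  let ?min = "\<lambda>r. min (n\<^sub>1 (E r)) (min (n\<^sub>2 (E r)) (n\<^sub>3 (E r)))"
  have m: "filterlim ?min at_top sequentially" using regime by (simp add: asymptotic_regime_def)
  have recip: "(\<lambda>r. 1 / real (n r)) \<longlonglongrightarrow> 0" if "\<And>r. ?min r \<le> n r" for n
  proof -
    have "filterlim n at_top sequentially" by (rule filterlim_at_top_mono[OF m]) (simp add: that)
    then have "filterlim (\<lambda>r. real (n r)) at_top sequentially"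
      by (rule filterlim_compose[OF filterlim_real_sequentially])
    then show ?thesis by (intro tendsto_divide_0[OF tendsto_const]) (rule filterlim_at_top_imp_at_infinity)
  qed
  show "(\<lambda>r. 1 / real (n\<^sub>1 (E r))) \<longlonglongrightarrow> 0" "(\<lambda>r. 1 / real (n\<^sub>2 (E r))) \<longlonglongrightarrow> 0" "(\<lambda>r. 1 / real (n\<^sub>3 (E r))) \<longlonglongrightarrow> 0"
    by (rule recip, simp)+
  show "(\<lambda>r. real (n\<^sub>2 (E r)) / real (n\<^sub>2 (E r) + n\<^sub>3 (E r))) \<longlonglongrightarrow> \<kappa>"
    using regime by (simp add: asymptotic_regime_def)
  show "prob_space.indep_vars (M r) (\<lambda>_. borel) (case_sum (diff (E r)) (pooled (E r)))
      ({1..n\<^sub>1 (E r)} <+> {1..n\<^sub>2 (E r) + n\<^sub>3 (E r)})" for r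
    by (rule pairs_model.indep_obs[OF pairs_model])
  show "distr (M r) borel (diff (E r) j) = distr P borel (\<lambda>x. x $ 1 - x $ 2)" if "j \<in> {1..n\<^sub>1 (E r)}" for r j
    using that by (rule pairs_model.diff_law[OF pairs_model])
  show "distr (M r) borel (pooled (E r) m) = distr P borel (\<lambda>x. x $ 1)" if "m \<in> {1..n\<^sub>2 (E r)}" for r m
    using that by (rule pairs_model.pooled_law(1)[OF pairs_model])
  show "distr (M r) borel (pooled (E r) m) = distr P borel (\<lambda>x. x $ 2)"
    if "m \<in> {n\<^sub>2 (E r) + 1..n\<^sub>2 (E r) + n\<^sub>3 (E r)}" for r m
    using that by (rule pairs_model.pooled_law(2)[OF pairs_model])
qed (rule prob_space_M weight sizes \<kappa> component_laws[OF law])+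

lemma T_obs_eq_T_stat: "T_obs a (E r) = T_stat r"
  by (rule ext) (simp add: pairs_model.T_obs_eq[OF pairs_model])

abbreviation discrepancy :: "nat \<Rightarrow> 'a \<Rightarrow> real" where
  "discrepancy r \<omega> \<equiv> (SUP x. \<bar>cdf (K r \<omega>) x - cdf std_normal_distribution x\<bar>)"

lemma real_distribution_K: "\<omega> \<in> space (M r) \<Longrightarrow> real_distribution (K r \<omega>)"
  by (rule pairs_model.kernel_real_distribution[OF pairs_model kernel])

lemma cdf_K_measurable: "(\<lambda>\<omega>. cdf (K r \<omega>) x) \<in> borel_measurable (M r)"
  by (rule measurable_from_subalg[OF pairs_model.subalgebra_data[OF pairs_model] pairs_model.kernel_cdf_measurable[OF pairs_model kernel]])

lemma discrepancy_measurable [measurable]: "discrepancy r \<in> borel_measurable (M r)"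
proof (rule borel_measurableI_greater)
  fix u
  note [measurable] = cdf_K_measurable
  have "{\<omega>\<in>space (M r). u < discrepancy r \<omega>} =
      {\<omega>\<in>space (M r). \<exists>q::rat. u < \<bar>cdf (K r \<omega>) (of_rat q) - cdf std_normal_distribution (of_rat q)\<bar>}"
    using sup_cdf_diff_gt_iff[OF real_distribution_K real_dist_normal_dist] by blast
  also have "\<dots> \<in> sets (M r)" by measurable
  finally show "{\<omega>\<in>space (M r). u < discrepancy r \<omega>} \<in> sets (M r)" .
qed

lemma cdf_diff_le_discrepancy:
  assumes "\<omega> \<in> space (M r)"
  shows "\<bar>cdf (K r \<omega>) x - cdf std_normal_distribution x\<bar> \<le> discrepancy r \<omega>"
  by (rule cSUP_upper[OF UNIV_I bdd_above_cdf_diff[OF real_distribution_K[OF assms] real_dist_normal_dist]])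

text \<open>Outside the event that some observation dominates, the conditional law is uniformly close to the normal
  one, and this event has vanishing probability.\<close>

theorem discrepancy_tendsto_0: "tendsto_in_prob M discrepancy 0"
  unfolding tendsto_in_prob_def
proof (intro conjI allI impI)
  show "discrepancy r \<in> borel_measurable (M r)" for r by measurable
  fix \<epsilon> :: real assume \<epsilon>: "\<epsilon> > 0"
  let ?A = "\<lambda>\<delta> r \<omega>. \<not> no_dominant_term \<delta> (n\<^sub>1 (E r)) (\<lambda>j. diff (E r) j \<omega>)"
  let ?B = "\<lambda>\<delta> r \<omega>. \<not> no_dominant_term \<delta> (n\<^sub>2 (E r) + n\<^sub>3 (E r))
    (\<lambda>m. pooled (E r) m \<omega> - sample_mean (n\<^sub>2 (E r) + n\<^sub>3 (E r)) (\<lambda>m. pooled (E r) m \<omega>))"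
  from perm_law_uniformly_close[where a="\<lambda>r. a (n\<^sub>1 (E r)) (n\<^sub>2 (E r)) (n\<^sub>3 (E r))", OF a n lim \<kappa>(1,2) paired_arrays.\<kappa>(3)[OF paired_arrays_axioms] \<epsilon>]
  obtain \<delta> r0 where \<delta>: "\<delta> > 0" and
    close: "\<forall>r\<ge>r0. \<forall>d z. no_dominant_term \<delta> (n\<^sub>1 (E r)) d \<longrightarrow>
      no_dominant_term \<delta> (n\<^sub>2 (E r) + n\<^sub>3 (E r)) (\<lambda>m. z m - sample_mean (n\<^sub>2 (E r) + n\<^sub>3 (E r)) z) \<longrightarrow>
      (SUP x. \<bar>cdf (perm_law (a (n\<^sub>1 (E r)) (n\<^sub>2 (E r)) (n\<^sub>3 (E r))) (n\<^sub>1 (E r)) (n\<^sub>2 (E r)) (n\<^sub>3 (E r)) d z) x - cdf std_normal_distribution x\<bar>) \<le> \<epsilon>"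
    by (elim exE conjE)
  have A: "Measurable.pred (M r) (?A \<delta> r)" for r
    by (intro pred_intros_logic no_dominant_term_pred D_measurable)
  have B: "Measurable.pred (M r) (?B \<delta> r)" for r
    by (intro pred_intros_logic no_dominant_term_pred borel_measurable_diff Z_measurable Submission.sample_mean_measurable)
  have lim0: "(\<lambda>r. measure (M r) {\<omega>\<in>space (M r). ?A \<delta> r \<omega> \<or> ?B \<delta> r \<omega>}) \<longlonglongrightarrow> 0"
    by (rule prob_tendsto_0_union[OF no_dominant_D[OF \<delta>] no_dominant_Z[OF \<delta>] A B])
  have bound: "measure (M r) {\<omega>\<in>space (M r). \<bar>discrepancy r \<omega> - 0\<bar> > \<epsilon>} \<le>
      measure (M r) {\<omega>\<in>space (M r). ?A \<delta> r \<omega> \<or> ?B \<delta> r \<omega>}" if r: "r \<ge> r0" for r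
  proof -
    interpret prob_space "M r" by (rule prob_space_M)
    show ?thesis
    proof (rule finite_measure_mono_AE)
      show "{\<omega>\<in>space (M r). ?A \<delta> r \<omega> \<or> ?B \<delta> r \<omega>} \<in> events" using A[of r] B[of r] by measurable
      show "AE \<omega> in M r. \<omega> \<in> {\<omega>\<in>space (M r). \<bar>discrepancy r \<omega> - 0\<bar> > \<epsilon>} \<longrightarrow>
          \<omega> \<in> {\<omega>\<in>space (M r). ?A \<delta> r \<omega> \<or> ?B \<delta> r \<omega>}"
        using pairs_model.cond_law_eq_perm_law[OF pairs_model kernel]
      proof eventually_elim
        case (elim \<omega>)
        show ?case
        proof
          assume *: "\<omega> \<in> {\<omega>\<in>space (M r). \<bar>discrepancy r \<omega> - 0\<bar> > \<epsilon>}"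
          then have \<omega>: "\<omega> \<in> space (M r)" by simp
          have "0 \<le> discrepancy r \<omega>" using cdf_diff_le_discrepancy[OF \<omega>, of 0] by linarith
          then have "\<epsilon> < discrepancy r \<omega>" using * by simp
          then have "?A \<delta> r \<omega> \<or> ?B \<delta> r \<omega>" unfolding elim using close[rule_format, OF r, of "\<lambda>j. diff (E r) j \<omega>" "\<lambda>m. pooled (E r) m \<omega>"] by linarith
          then show "\<omega> \<in> {\<omega>\<in>space (M r). ?A \<delta> r \<omega> \<or> ?B \<delta> r \<omega>}" using \<omega> by simp
        qed
      qed
    qed
  qed
  show "(\<lambda>r. measure (M r) {\<omega>\<in>space (M r). \<bar>discrepancy r \<omega> - 0\<bar> > \<epsilon>}) \<longlonglongrightarrow> 0"
  proof (rule tendsto_sandwich[OF _ _ tendsto_const lim0])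
    show "\<forall>\<^sub>F r in sequentially. measure (M r) {\<omega>\<in>space (M r). \<bar>discrepancy r \<omega> - 0\<bar> > \<epsilon>} \<le>
        measure (M r) {\<omega>\<in>space (M r). ?A \<delta> r \<omega> \<or> ?B \<delta> r \<omega>}"
      using eventually_ge_at_top[of r0] by (rule eventually_mono) (rule bound)
  qed simp
qed

text \<open>If the distribution function is within \<open>e / 2\<close> of the normal one then it lies below \<open>p\<close> where the normal
  one equals \<open>p - e\<close>, and above \<open>p\<close> where the normal one equals \<open>p + e\<close>.\<close>

lemma quantile_between:
  assumes \<omega>: "\<omega> \<in> space (M r)" and p: "0 < p" "p < 1" and close: "discrepancy r \<omega> \<le> e / 2" and e: "e > 0"
  shows "cdf std_normal_distribution l = p - e \<Longrightarrow> l < quantile (K r \<omega>) p"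
    and "cdf std_normal_distribution u = p + e \<Longrightarrow> quantile (K r \<omega>) p \<le> u"
proof -
  have near: "\<bar>cdf (K r \<omega>) x - cdf std_normal_distribution x\<bar> \<le> e / 2" for x
    using cdf_diff_le_discrepancy[OF \<omega>, of x] close by linarith
  show "l < quantile (K r \<omega>) p" if "cdf std_normal_distribution l = p - e"
  proof -
    have "\<not> p \<le> cdf (K r \<omega>) l" using near[of l] e unfolding that by linarith
    then show ?thesis using quantile_le_iff[OF real_distribution_K[OF \<omega>] p, of l] by linarith
  qed
  show "quantile (K r \<omega>) p \<le> u" if "cdf std_normal_distribution u = p + e"
    unfolding quantile_le_iff[OF real_distribution_K[OF \<omega>] p] using near[of u] e unfolding that by linarith
qed

context
  fixes \<alpha> :: real and \<gamma> :: "nat \<Rightarrow> 'a \<Rightarrow> real"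
  assumes \<alpha>: "0 < \<alpha>" "\<alpha> < 1" and \<gamma>: "\<And>r. randomization_constant \<alpha> (E r) (K r) (\<gamma> r)"
begin

abbreviation \<phi> :: "nat \<Rightarrow> 'a \<Rightarrow> real" where
  "\<phi> r \<equiv> perm_test \<alpha> a (E r) (K r) (\<gamma> r)"

lemma \<phi>_bounds: "\<omega> \<in> space (M r) \<Longrightarrow> 0 \<le> \<phi> r \<omega>" "\<omega> \<in> space (M r) \<Longrightarrow> \<phi> r \<omega> \<le> 1"
  by (rule pairs_model.perm_test_bounds[OF pairs_model \<gamma>], assumption)+

lemma \<phi>_integrable: "integrable (M r) (\<phi> r)"
proof -
  interpret prob_space "M r" by (rule prob_space_M)
  show ?thesis
  proof (rule integrable_const_bound[of _ 1])
    show "AE \<omega> in M r. norm (\<phi> r \<omega>) \<le> 1" using \<phi>_bounds[of _ r] by (intro AE_I2) simp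
  qed (rule pairs_model.perm_test_measurable[OF pairs_model kernel \<gamma> \<alpha>])
qed

lemma expectation_le_one: "(LINT \<omega>|M r. \<phi> r \<omega>) \<le> 1"
proof -
  interpret prob_space "M r" by (rule prob_space_M)
  have "(LINT \<omega>|M r. \<phi> r \<omega>) \<le> (LINT \<omega>|M r. 1)" using \<phi>_integrable \<phi>_bounds(2) by (intro integral_mono) auto
  then show ?thesis by (simp add: prob_space)
qed

abbreviation "far e r \<equiv> measure (M r) {\<omega>\<in>space (M r). \<bar>discrepancy r \<omega> - 0\<bar> > e / 2}"

text \<open>Where the discrepancy is at most \<open>e / 2\<close> the critical value lies between \<open>l\<close> and \<open>u\<close>: the test vanishes below \<open>l\<close> and
  rejects above \<open>u\<close>.\<close>

lemma
  assumes e: "e > 0"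
  shows rejection_upper: "cdf std_normal_distribution l = 1 - \<alpha> - e \<Longrightarrow>
      (LINT \<omega>|M r. \<phi> r \<omega>) \<le> measure (M r) {\<omega>\<in>space (M r). T_stat r \<omega> > l} + far e r"
    and rejection_lower: "cdf std_normal_distribution u = 1 - \<alpha> + e \<Longrightarrow>
      measure (M r) {\<omega>\<in>space (M r). T_stat r \<omega> > u} - far e r \<le> (LINT \<omega>|M r. \<phi> r \<omega>)"
proof -
  interpret prob_space "M r" by (rule prob_space_M)
  note [measurable] = T_stat_measurable
  let ?B = "{\<omega>\<in>space (M r). \<bar>discrepancy r \<omega> - 0\<bar> > e / 2}"
  let ?G = "\<lambda>x. {\<omega>\<in>space (M r). T_stat r \<omega> > x}"
  have ev: "?B \<in> events" "?G x \<in> events" for x by measurable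
  have int: "integrable (M r) (indicator ?B :: 'a \<Rightarrow> real)" "integrable (M r) (indicator (?G x) :: 'a \<Rightarrow> real)" for x
    using ev by (auto simp: emeasure_eq_measure)
  have p: "0 < 1 - \<alpha>" "1 - \<alpha> < 1" using \<alpha> by auto
  have \<phi>: "\<phi> r \<omega> = (let c = quantile (K r \<omega>) (1 - \<alpha>) in of_bool (T_stat r \<omega> > c) + \<gamma> r \<omega> * of_bool (T_stat r \<omega> = c))" for \<omega>
    unfolding perm_test_def T_obs_eq_T_stat ..
  show "(LINT \<omega>|M r. \<phi> r \<omega>) \<le> prob (?G l) + prob ?B" if l: "cdf std_normal_distribution l = 1 - \<alpha> - e"
  proof -
    have "\<phi> r \<omega> \<le> indicator (?G l) \<omega> + indicator ?B \<omega>" if \<omega>: "\<omega> \<in> space (M r)" for \<omega>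
    proof (cases "\<omega> \<in> ?B \<or> \<omega> \<in> ?G l")
      case True
      then have "1 \<le> indicator (?G l) \<omega> + (indicator ?B \<omega> :: real)" by (auto simp: indicator_def)
      then show ?thesis using \<phi>_bounds(2)[OF \<omega>] by linarith
    next
      case False
      then have T: "T_stat r \<omega> \<le> l" and d: "discrepancy r \<omega> \<le> e / 2" using \<omega> by auto
      from T quantile_between(1)[OF \<omega> p d e l] have "T_stat r \<omega> < quantile (K r \<omega>) (1 - \<alpha>)" by linarith
      then have "\<phi> r \<omega> = 0" unfolding \<phi> Let_def by simp
      then show ?thesis by simp
    qed
    then have "(LINT \<omega>|M r. \<phi> r \<omega>) \<le> (LINT \<omega>|M r. indicator (?G l) \<omega> + indicator ?B \<omega>)"
      using \<phi>_integrable int by (intro integral_mono Bochner_Integration.integrable_add)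
    also have "\<dots> = prob (?G l) + prob ?B" using int ev by simp
    finally show ?thesis .
  qed
  show "prob (?G u) - prob ?B \<le> (LINT \<omega>|M r. \<phi> r \<omega>)" if u: "cdf std_normal_distribution u = 1 - \<alpha> + e"
  proof -
    have "indicator (?G u) \<omega> - indicator ?B \<omega> \<le> \<phi> r \<omega>" if \<omega>: "\<omega> \<in> space (M r)" for \<omega>
    proof (cases "\<omega> \<in> ?G u \<and> \<omega> \<notin> ?B")
      case True
      then have T: "u < T_stat r \<omega>" and d: "discrepancy r \<omega> \<le> e / 2" using \<omega> by auto
      from T quantile_between(2)[OF \<omega> p d e u] have "quantile (K r \<omega>) (1 - \<alpha>) < T_stat r \<omega>" by linarith
      then have "\<phi> r \<omega> = 1" unfolding \<phi> Let_def by simp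
      then show ?thesis by (simp add: indicator_def)
    next
      case False
      then have "indicator (?G u) \<omega> - indicator ?B \<omega> \<le> (0::real)" by (auto simp: indicator_def)
      then show ?thesis using \<phi>_bounds(1)[OF \<omega>] by linarith
    qed
    then have "(LINT \<omega>|M r. indicator (?G u) \<omega> - indicator ?B \<omega>) \<le> (LINT \<omega>|M r. \<phi> r \<omega>)"
      using \<phi>_integrable int by (intro integral_mono Bochner_Integration.integrable_diff)
    moreover have "(LINT \<omega>|M r. indicator (?G u) \<omega> - indicator ?B \<omega>) = prob (?G u) - prob ?B" using int ev by simp
    ultimately show ?thesis by simp
  qed
qed

lemma far_tendsto_0: "e > 0 \<Longrightarrow> far e \<longlonglongrightarrow> 0"
  by (rule tendsto_in_probD[OF discrepancy_tendsto_0]) simp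

lemma prob_T_stat_gt: "measure (M r) {\<omega>\<in>space (M r). T_stat r \<omega> > x} = 1 - measure (M r) {\<omega>\<in>space (M r). T_stat r \<omega> \<le> x}"
proof -
  interpret prob_space "M r" by (rule prob_space_M)
  note [measurable] = T_stat_measurable
  have "{\<omega>\<in>space (M r). T_stat r \<omega> > x} = space (M r) - {\<omega>\<in>space (M r). T_stat r \<omega> \<le> x}" by auto
  then show ?thesis by (simp add: prob_compl)
qed

text \<open>By the central limit theorem the rejection bounds converge to \<open>\<alpha> + e\<close> and \<open>\<alpha> - e\<close>, and \<open>e\<close> is
  arbitrary.\<close>

theorem perm_test_asymptotic_level:
  assumes eq: "\<mu> $ 1 = \<mu> $ 2"
  shows "(\<lambda>r. LINT \<omega>|M r. \<phi> r \<omega>) \<longlonglongrightarrow> \<alpha>"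
proof (rule tendstoI)
  fix \<epsilon> :: real assume \<epsilon>: "\<epsilon> > 0"
  \<comment> \<open>The last two bounds keep \<open>1 - \<alpha> \<plusminus> e\<close> in the open unit interval, so that it has normal quantiles.\<close>
  define e where "e = min (\<epsilon> / 2) (min (\<alpha> / 2) ((1 - \<alpha>) / 2))"
  have e: "e > 0" "e \<le> \<epsilon> / 2" "e < \<alpha>" "e < 1 - \<alpha>" using \<epsilon> \<alpha> by (auto simp: e_def min_def)
  obtain l where l: "cdf std_normal_distribution l = 1 - \<alpha> - e"
    using cdf_std_normal_attains[of "1 - \<alpha> - e"] e \<alpha> by auto
  obtain u where u: "cdf std_normal_distribution u = 1 - \<alpha> + e"
    using cdf_std_normal_attains[of "1 - \<alpha> + e"] e \<alpha> by auto
  have "asymp_normal M T_stat"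
    by (rule T_stat_asymp_normal) (simp_all add: component_laws[OF law] eq)
  note clt = asymp_normal_cdf[OF prob_space_M this]
  have tail: "(\<lambda>r. measure (M r) {\<omega>\<in>space (M r). T_stat r \<omega> > x}) \<longlonglongrightarrow> 1 - cdf std_normal_distribution x" for x
  proof -
    have "measure (M r) {\<omega>\<in>space (M r). T_stat r \<omega> \<le> x} = cdf (distr (M r) borel (T_stat r)) x" for r
      unfolding cdf_def using T_stat_measurable[of r] by (subst measure_distr) (auto intro!: arg_cong[where f="measure (M r)"])
    then show ?thesis unfolding prob_T_stat_gt by (simp only:) (intro tendsto_diff tendsto_const clt)
  qed
  have upper: "(\<lambda>r. measure (M r) {\<omega>\<in>space (M r). T_stat r \<omega> > l} + far e r) \<longlonglongrightarrow> \<alpha> + e"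
    using tendsto_add[OF tail[of l] far_tendsto_0[OF e(1)]] unfolding l by (simp add: algebra_simps)
  have lower: "(\<lambda>r. measure (M r) {\<omega>\<in>space (M r). T_stat r \<omega> > u} - far e r) \<longlonglongrightarrow> \<alpha> - e"
    using tendsto_diff[OF tail[of u] far_tendsto_0[OF e(1)]] unfolding u by (simp add: algebra_simps)
  have "\<alpha> + e < \<alpha> + \<epsilon>" "\<alpha> - \<epsilon> < \<alpha> - e" using e \<epsilon> by linarith+
  then have "\<forall>\<^sub>F r in sequentially. measure (M r) {\<omega>\<in>space (M r). T_stat r \<omega> > l} + far e r < \<alpha> + \<epsilon>"
    "\<forall>\<^sub>F r in sequentially. \<alpha> - \<epsilon> < measure (M r) {\<omega>\<in>space (M r). T_stat r \<omega> > u} - far e r"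
    using order_tendstoD(2)[OF upper] order_tendstoD(1)[OF lower] by blast+
  then show "\<forall>\<^sub>F r in sequentially. dist (LINT \<omega>|M r. \<phi> r \<omega>) \<alpha> < \<epsilon>"
  proof eventually_elim
    case (elim r)
    from elim rejection_upper[OF e(1) l, of r] rejection_lower[OF e(1) u, of r]
    have "(LINT \<omega>|M r. \<phi> r \<omega>) < \<alpha> + \<epsilon>" "\<alpha> - \<epsilon> < (LINT \<omega>|M r. \<phi> r \<omega>)" by linarith+
    then show ?case unfolding dist_real_def by linarith
  qed
qed

text \<open>The critical value stays below a fixed \<open>u\<close> with probability tending to 1, and the statistic exceeds every
  bound.\<close>

theorem perm_test_consistent:
  assumes gt: "\<mu> $ 1 > \<mu> $ 2"
  shows "(\<lambda>r. LINT \<omega>|M r. \<phi> r \<omega>) \<longlonglongrightarrow> 1"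
proof -
  have e: "\<alpha> / 2 > 0" using \<alpha> by simp
  obtain u where u: "cdf std_normal_distribution u = 1 - \<alpha> + \<alpha> / 2"
    using cdf_std_normal_attains[of "1 - \<alpha> + \<alpha> / 2"] \<alpha> by auto
  have "(\<lambda>r. measure (M r) {\<omega>\<in>space (M r). T_stat r \<omega> \<le> u}) \<longlonglongrightarrow> 0"
    by (rule T_stat_diverges) (simp_all add: component_laws[OF law] gt)
  from tendsto_diff[OF tendsto_diff[OF tendsto_const this] far_tendsto_0[OF e], of 1]
  have "(\<lambda>r. measure (M r) {\<omega>\<in>space (M r). T_stat r \<omega> > u} - far (\<alpha> / 2) r) \<longlonglongrightarrow> 1"
    unfolding prob_T_stat_gt by simp
  then show ?thesis
    by (rule tendsto_sandwich[OF always_eventually always_eventually _ tendsto_const, rotated 2])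
      (intro allI rejection_lower[OF e u] expectation_le_one)+
qed

end

end

theorem theorem3p1:
  fixes \<alpha> :: real
    and P :: "(real^2) measure" and \<mu> :: "real^2" and \<Sigma> :: "real^2^2"
    and a :: "nat \<Rightarrow> nat \<Rightarrow> nat \<Rightarrow> real"
  assumes alpha: "0 < \<alpha>" "\<alpha> < 1"
    and law: "pair_law P \<mu> \<Sigma>"
    and weight: "\<forall>k\<ge>2. \<forall>l\<ge>2. \<forall>m\<ge>2. a k l m \<in> {0..1}"
  shows
    "(\<forall>(E :: nat \<Rightarrow> 'a pairs_experiment) K \<kappa>.
        (\<forall>r. incomplete_pairs_model P (E r) \<and> cond_law_T_perm a (E r) (K r)) \<and>
        0 < \<kappa> \<and> \<kappa> < 1 \<and> asymptotic_regime E \<kappa> \<longrightarrow>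
        tendsto_in_prob (\<lambda>r. pspace (E r))
          (\<lambda>r \<omega>. SUP x. \<bar>cdf (K r \<omega>) x - cdf std_normal_distribution x\<bar>) 0)
     \<and>
     (\<forall>(E :: nat \<Rightarrow> 'a pairs_experiment) K \<gamma> \<kappa>.
        (\<forall>r. incomplete_pairs_model P (E r) \<and> cond_law_T_perm a (E r) (K r) \<and>
             randomization_constant \<alpha> (E r) (K r) (\<gamma> r)) \<and>
        0 < \<kappa> \<and> \<kappa> < 1 \<and> asymptotic_regime E \<kappa> \<longrightarrow>
        (\<mu> $ 1 = \<mu> $ 2 \<longrightarrow>
           (\<lambda>r. LINT \<omega>|pspace (E r). perm_test \<alpha> a (E r) (K r) (\<gamma> r) \<omega>) \<longlonglongrightarrow> \<alpha>) \<and>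
        (\<mu> $ 1 > \<mu> $ 2 \<longrightarrow>
           (\<lambda>r. LINT \<omega>|pspace (E r). perm_test \<alpha> a (E r) (K r) (\<gamma> r) \<omega>) \<longlonglongrightarrow> 1))
     \<and>
     (\<forall>(E :: 'a pairs_experiment) K \<gamma>.
        incomplete_pairs_model P E \<and> cond_law_T_perm a E K \<and> randomization_constant \<alpha> E K \<gamma> \<and>
        distr (pspace E) borel (\<lambda>\<omega>. XC E 1 \<omega> $ 1 - XC E 1 \<omega> $ 2) =
          distr (pspace E) borel (\<lambda>\<omega>. - (XC E 1 \<omega> $ 1 - XC E 1 \<omega> $ 2)) \<and>
        distr (pspace E) borel (XI E 1 1) = distr (pspace E) borel (XI E 2 1) \<longrightarrow>
        (LINT \<omega>|pspace E. perm_test \<alpha> a E K \<gamma> \<omega>) = \<alpha>)"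
proof (intro conjI allI impI)
  have w: "\<And>k l m. 2 \<le> k \<Longrightarrow> 2 \<le> l \<Longrightarrow> 2 \<le> m \<Longrightarrow> a k l m \<in> {0..1}" using weight by blast
  fix E :: "nat \<Rightarrow> 'a pairs_experiment" and K and \<kappa> :: real
  assume "(\<forall>r. incomplete_pairs_model P (E r) \<and> cond_law_T_perm a (E r) (K r)) \<and>
    0 < \<kappa> \<and> \<kappa> < 1 \<and> asymptotic_regime E \<kappa>"
  then have "pairs_sequence P \<mu> \<Sigma> a E K \<kappa>" using law w by (simp add: pairs_sequence_def)
  then show "tendsto_in_prob (\<lambda>r. pspace (E r))
      (\<lambda>r \<omega>. SUP x. \<bar>cdf (K r \<omega>) x - cdf std_normal_distribution x\<bar>) 0"
    by (rule pairs_sequence.discrepancy_tendsto_0)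
next
  have w: "\<And>k l m. 2 \<le> k \<Longrightarrow> 2 \<le> l \<Longrightarrow> 2 \<le> m \<Longrightarrow> a k l m \<in> {0..1}" using weight by blast
  fix E :: "nat \<Rightarrow> 'a pairs_experiment" and K \<gamma> and \<kappa> :: real
  assume A: "(\<forall>r. incomplete_pairs_model P (E r) \<and> cond_law_T_perm a (E r) (K r) \<and>
      randomization_constant \<alpha> (E r) (K r) (\<gamma> r)) \<and> 0 < \<kappa> \<and> \<kappa> < 1 \<and> asymptotic_regime E \<kappa>"
  then have seq: "pairs_sequence P \<mu> \<Sigma> a E K \<kappa>" using law w by (simp add: pairs_sequence_def)
  have \<gamma>: "\<And>r. randomization_constant \<alpha> (E r) (K r) (\<gamma> r)" using A by blast
  show "(\<lambda>r. LINT \<omega>|pspace (E r). perm_test \<alpha> a (E r) (K r) (\<gamma> r) \<omega>) \<longlonglongrightarrow> \<alpha>" if "\<mu> $ 1 = \<mu> $ 2"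
    by (rule pairs_sequence.perm_test_asymptotic_level[OF seq alpha \<gamma> that])
  show "(\<lambda>r. LINT \<omega>|pspace (E r). perm_test \<alpha> a (E r) (K r) (\<gamma> r) \<omega>) \<longlonglongrightarrow> 1" if "\<mu> $ 1 > \<mu> $ 2"
    by (rule pairs_sequence.perm_test_consistent[OF seq alpha \<gamma> that])
next
  fix E :: "'a pairs_experiment" and K \<gamma>
  assume A: "incomplete_pairs_model P E \<and> cond_law_T_perm a E K \<and> randomization_constant \<alpha> E K \<gamma> \<and>
    distr (pspace E) borel (\<lambda>\<omega>. XC E 1 \<omega> $ 1 - XC E 1 \<omega> $ 2) =
      distr (pspace E) borel (\<lambda>\<omega>. - (XC E 1 \<omega> $ 1 - XC E 1 \<omega> $ 2)) \<and>
    distr (pspace E) borel (XI E 1 1) = distr (pspace E) borel (XI E 2 1)"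
  then have "pairs_model P E" by (simp add: pairs_model_def)
  then show "(LINT \<omega>|pspace E. perm_test \<alpha> a E K \<gamma> \<omega>) = \<alpha>"
    by (rule pairs_model.perm_test_exact) (use A alpha in \<open>auto simp: diff_def[abs_def]\<close>)
qed

end
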